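(* Let $p$ be a prime and $k$ a perfect field of characteristic $p$. The functors $W_n$ ($n\le\infty$) and $CW^u$ from $\mathrm{Alg}_k$ to the category $\mathrm{Dmod}^u_k$ of unipotent graded Dieudonné modules over $k$ factor naturally through $\mathrm{pol}_p\colon\mathrm{Alg}_k\to\mathrm{Pol}_p(k)$, and the functor $CW^c\colon\mathrm{alg}_k\to\mathbb D\mathrm{mod}^c_k$ to connected Dieudonné modules factors naturally through $\mathrm{pol}_p\colon\mathrm{alg}_k\to\mathrm{pol}_p(k)$.
   Context: **Polar algebras.** All graded objects are nonnegatively graded. $\mathrm{Alg}_k$: graded-commutative $k$-algebras; $\mathrm{alg}_k$: those of finite length over $k$. $M_k$: graded $k$-modules $A$ with graded symmetric (up to Koszul sign) $k$-multilinear maps $\mu\colon (A_j)^{\otimes_k p}\to A_{jp}$, all $j$, with $\mu$-preserving graded linear maps as morphisms. $\mathrm{pol}_p\colon\mathrm{Alg}_k\to M_k$ remembers only $p$-fold multiplication of elements of equal degree. A graded $p$-polar $k$-algebra is an object of $M_k$ that is a subobject of some $\mathrm{pol}_p(B)$, $B\in\mathrm{Alg}_k$; $\mathrm{Pol}_p(k)\subset M_k$ is the full subcategory of these, and $\mathrm{pol}_p(k)$ the full subcategory of those of finite length. **Dieudonné modules.** $W(k)$ is the ring of $p$-typical Witt vectors of $k$, $\mathrm{frob}$ its Frobenius. For a graded $W(k)$-module $M$ and $i\ge0$, $M(i)_n=M_{p^in}$ with $\lambda\in W(k)$ acting as $\mathrm{frob}^i(\lambda)$. A graded Dieudonné module is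 a graded $W(k)$-module $M$ with $W(k)$-linear maps $F\colon M\to M(1)$, $V\colon M(1)\to M$ satisfying $FV=p$, $VF=p$. It is unipotent if every $x\in M$ satisfies $V^n(x)=0$ for $n\gg0$; $\mathrm{Dmod}_k^u$ is the full subcategory of these. A Dieudonné module $M$ is connected if $M$ is profinite as a $W(k)$-module and has a fundamental system of neighborhoods consisting of (finite length) $W(k)$-modules $N$ such that $F^n(N)=0$ for $n\gg0$; $\mathbb D\mathrm{mod}^c_k$ is the category of connected Dieudonné modules and continuous homomorphisms. **Witt vectors.** For $R\in\mathrm{Alg}_k$ write, if $p$ is odd, $R_{ev}$ for the even-degree subalgebra; if $p=2$ put $R_{ev}=R$. The constructions below are applied to the commutative graded ring $R_{ev}$; write $R$ for it. For $0\le n\le\infty$, $W_n(R)_j=\prod_{i=0}^nR_{jp^i}$, with addition given by the classical $p$-typical Witt addition polynomials $(S_0,S_1,\dots)$ and with the $W(k)$-action given by the Witt multiplication polynomials; $F(a_0,a_1,\dots)=(a_0^p,a_1^p,\dots)$, $V(a_0,a_1,\dots)=(0,a_0,a_1,\dots)$ (truncated to $n+1$ entries). $CW^u(R)_j$ is the set of sequences $(\dots,a_{-1},a_0)$ with $a_{-i}\in R_{j/p^i}$ (zero if $j/p^i\notin\mathbb Z$) and almost all entries zero; for $n$ large, sums are computed by adding $(a_{-n},\dots,a_0)$ and $(b_{-n},\dots,b_0)$ as Witt vectors, and $\lambda\in W(k)$ acts as Witt multiplication of $(a_{-n},\dots,a_0)$ by $\mathrm{frob}^{-n}(\lambda)$.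 (This is $\operatorname{colim}_V W_n(R(-n))$, where $R(-1)_m=R_{m/p}$, zero if $p\nmid m$.) $F$ raises entries to the $p$-th power and $V$ sends $(\dots,a_{-1},a_0)$ to $(\dots,a_{-2},a_{-1})$. For $R\in\mathrm{alg}_k$ with nilradical $\mathrm{nil}(R)$: for $j\ne0$, $CW^c(R)_j\subset CW^u(R)_j$ consists of the covectors all of whose entries lie in $\mathrm{nil}(R)$; $CW^c(R)_0=CW^c(R_0)$ is the classical group of connected co-Witt vectors (Fontaine), i.e. all sequences $(\dots,a_{-1},a_0)$ with entries in $\mathrm{nil}(R_0)$, with the $(-i)$-th entry of a sum the eventually constant value of $S_m(a_{-i-m},\dots,a_{-i};b_{-i-m},\dots,b_{-i})$ for $m\gg0$, $W(k)$-action, $F$, $V$ analogous, and the product topology (of discrete factors).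
   Formalization: For n=∞ the target is all graded Dieudonné modules, since W_∞(k)_0=W(k) is not unipotent; "connected" is read as: small open N with M/N of finite length and F^n(M)⊂N for n≫0, since CW^c(k[x]/x²)_0 has no open N of finite length. *)

theory Defs
  imports
    "HOL-Algebra.Module"
    "HOL-Algebra.AbelCoset"
    "HOL-Analysis.Function_Topology"
    "HOL-Combinatorics.Permutations"
    "HOL-Computational_Algebra.Primes"
    "HOL-Library.Extended_Nat"
    "HOL-Library.Poly_Mapping"
begin

section \<open>Categories and functors\<close>

text \<open>
  Morphisms are functions that are extensional on the carriers, so HOL equality of morphisms is
  equality in the category. Composition takes the source object as first argument.
\<close>

record ('o, 'm) cat =
  Obj :: "'o set"
  Hom :: "'o \<Rightarrow> 'o \<Rightarrow> 'm set"
  Idn :: "'o \<Rightarrow> 'm"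
  Cmp :: "'o \<Rightarrow> 'm \<Rightarrow> 'm \<Rightarrow> 'm"

record ('o, 'm, 'o2, 'm2) ftor =
  fobj :: "'o \<Rightarrow> 'o2"
  fmor :: "'o \<Rightarrow> 'o \<Rightarrow> 'm \<Rightarrow> 'm2"

definition is_functor :: "('o, 'm) cat \<Rightarrow> ('o2, 'm2) cat \<Rightarrow> ('o, 'm, 'o2, 'm2) ftor \<Rightarrow> bool"
  where "is_functor C D F \<longleftrightarrow>
    (\<forall>x\<in>Obj C. fobj F x \<in> Obj D) \<and>
    (\<forall>x\<in>Obj C. \<forall>y\<in>Obj C. \<forall>f\<in>Hom C x y. fmor F x y f \<in> Hom D (fobj F x) (fobj F y)) \<and>
    (\<forall>x\<in>Obj C. fmor F x x (Idn C x) = Idn D (fobj F x)) \<and>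
    (\<forall>x\<in>Obj C. \<forall>y\<in>Obj C. \<forall>z\<in>Obj C. \<forall>f\<in>Hom C x y. \<forall>g\<in>Hom C y z.
      fmor F x z (Cmp C x g f) = Cmp D (fobj F x) (fmor F y z g) (fmor F x y f))"

definition factors_through ::
  "('o, 'm) cat \<Rightarrow> ('o1, 'm1) cat \<Rightarrow> ('o2, 'm2) cat \<Rightarrow>
   ('o, 'm, 'o2, 'm2) ftor \<Rightarrow> ('o, 'm, 'o1, 'm1) ftor \<Rightarrow> bool"
  where "factors_through C D E F P \<longleftrightarrow>
    is_functor C E F \<and> is_functor C D P \<and>
    (\<exists>G. is_functor D E G \<and>
      (\<forall>x\<in>Obj C. fobj F x = fobj G (fobj P x)) \<and>
      (\<forall>x\<in>Obj C. \<forall>y\<in>Obj C. \<forall>f\<in>Hom C x y.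
        fmor F x y f = fmor G (fobj P x) (fobj P y) (fmor P x y f)))"

definition full_subcat :: "('o, 'm) cat \<Rightarrow> ('o \<Rightarrow> bool) \<Rightarrow> ('o, 'm) cat"
  where "full_subcat C Q = C\<lparr>Obj := {x \<in> Obj C. Q x}\<rparr>"


section \<open>Modules\<close>

text \<open>
  The module with the given carrier and operations. The operations are restricted to the carrier
  and the (meaningless) ring multiplication is left undefined, so that two modules obtained in
  this way are equal as soon as they have the same elements and operations.
\<close>

definition mod_on ::
  "('k, 'r) ring_scheme \<Rightarrow> 'a set \<Rightarrow> 'a \<Rightarrow> ('a \<Rightarrow> 'a \<Rightarrow> 'a) \<Rightarrow> ('k \<Rightarrow> 'a \<Rightarrow> 'a) \<Rightarrow> ('k, 'a) module"
  where "mod_on K A z pl sm =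
    \<lparr>carrier = A, monoid.mult = undefined, one = undefined, zero = z,
     add = (\<lambda>x\<in>A. \<lambda>y\<in>A. pl x y), smult = (\<lambda>r\<in>carrier K. \<lambda>x\<in>A. sm r x)\<rparr>"

definition lin_maps ::
  "('k, 'r) ring_scheme \<Rightarrow> ('k, 'a, 'x) module_scheme \<Rightarrow> ('k, 'b, 'y) module_scheme \<Rightarrow> ('a \<Rightarrow> 'b) set"
  where "lin_maps K M N =
    {f \<in> carrier M \<rightarrow> carrier N.
      (\<forall>x\<in>carrier M. \<forall>y\<in>carrier M. f (x \<oplus>\<^bsub>M\<^esub> y) = f x \<oplus>\<^bsub>N\<^esub> f y) \<and>
      (\<forall>r\<in>carrier K. \<forall>x\<in>carrier M. f (r \<odot>\<^bsub>M\<^esub> x) = r \<odot>\<^bsub>N\<^esub> f x)}"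

text \<open>
  \<open>M / N\<close> has finite length: the strict chains of submodules of \<open>M / N\<close>, that is, of submodules of
  \<open>M\<close> containing \<open>N\<close>, have bounded length.
\<close>

definition finite_colength ::
  "('k, 'r) ring_scheme \<Rightarrow> ('k, 'a, 'x) module_scheme \<Rightarrow> 'a set \<Rightarrow> bool"
  where "finite_colength K M N \<longleftrightarrow>
    (\<exists>b::nat. \<forall>C n. (\<forall>i\<le>n. submodule (C i) K M \<and> N \<subseteq> C i) \<and> (\<forall>i<n. C i \<subset> C (Suc i)) \<longrightarrow> n \<le> b)"

definition gr_finite_colength ::
  "('k, 'r) ring_scheme \<Rightarrow> (nat \<Rightarrow> ('k, 'a, 'x) module_scheme) \<Rightarrow> (nat \<Rightarrow> 'a set) \<Rightarrow> bool"
  where "gr_finite_colength K M N \<longleftrightarrow>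
    (\<forall>j. finite_colength K (M j) (N j)) \<and> finite {j. N j \<noteq> carrier (M j)}"

definition gr_finite_length ::
  "('k, 'r) ring_scheme \<Rightarrow> (nat \<Rightarrow> ('k, 'a, 'x) module_scheme) \<Rightarrow> bool"
  where "gr_finite_length K M \<longleftrightarrow> gr_finite_colength K M (\<lambda>j. {\<zero>\<^bsub>M j\<^esub>})"

definition open_fin_submods ::
  "('k, 'r) ring_scheme \<Rightarrow> ('k, 'a, 'x) module_scheme \<Rightarrow> 'a topology \<Rightarrow> 'a set set"
  where "open_fin_submods K M T = {N. submodule N K M \<and> openin T N \<and> finite_colength K M N}"

text \<open>
  \<open>M\<close> with the topology \<open>T\<close> is the limit of its discrete quotients \<open>M / N\<close> of finite length: the
  cosets of the \<open>N\<close> are a base of \<open>T\<close>, and \<open>M \<rightarrow> lim M / N\<close> is injective and surjective.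
\<close>

definition profinite_module ::
  "('k, 'r) ring_scheme \<Rightarrow> ('k, 'a, 'x) module_scheme \<Rightarrow> 'a topology \<Rightarrow> bool"
  where "profinite_module K M T \<longleftrightarrow>
    Module.module K M \<and> topspace T = carrier M \<and>
    (\<forall>U. openin T U \<longleftrightarrow>
      U \<subseteq> carrier M \<and> (\<forall>x\<in>U. \<exists>N\<in>open_fin_submods K M T. N +>\<^bsub>M\<^esub> x \<subseteq> U)) \<and>
    \<Inter>(open_fin_submods K M T) = {\<zero>\<^bsub>M\<^esub>} \<and>
    (\<forall>c. (\<forall>N\<in>open_fin_submods K M T. c N \<in> a_rcosets\<^bsub>M\<^esub> N) \<and>
         (\<forall>N\<in>open_fin_submods K M T. \<forall>N'\<in>open_fin_submods K M T. N \<subseteq> N' \<longrightarrow> c N \<subseteq> c N') \<longrightarrow>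
         (\<exists>x\<in>carrier M. \<forall>N\<in>open_fin_submods K M T. x \<in> c N))"


section \<open>Graded-commutative algebras\<close>

record ('k, 'a) galg = "('k, 'a) module" +
  gr :: "nat \<Rightarrow> 'a set"

definition graded_comm_algebra :: "('k, 'r) ring_scheme \<Rightarrow> ('k, 'a) galg \<Rightarrow> bool"
  where "graded_comm_algebra k R \<longleftrightarrow>
    ring R \<and> Module.module k R \<and>
    (\<forall>r\<in>carrier k. \<forall>x\<in>carrier R. \<forall>y\<in>carrier R.
      (r \<odot>\<^bsub>R\<^esub> x) \<otimes>\<^bsub>R\<^esub> y = r \<odot>\<^bsub>R\<^esub> (x \<otimes>\<^bsub>R\<^esub> y) \<and> x \<otimes>\<^bsub>R\<^esub> (r \<odot>\<^bsub>R\<^esub> y) = r \<odot>\<^bsub>R\<^esub> (x \<otimes>\<^bsub>R\<^esub> y)) \<and>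
    (\<forall>j. submodule (gr R j) k R) \<and>
    (\<forall>x\<in>carrier R. \<exists>!c. (\<forall>j. c j \<in> gr R j) \<and> finite {j. c j \<noteq> \<zero>\<^bsub>R\<^esub>} \<and>
      x = finsum R c {j. c j \<noteq> \<zero>\<^bsub>R\<^esub>}) \<and>
    \<one>\<^bsub>R\<^esub> \<in> gr R 0 \<and>
    (\<forall>i j. \<forall>x\<in>gr R i. \<forall>y\<in>gr R j. x \<otimes>\<^bsub>R\<^esub> y \<in> gr R (i + j)) \<and>
    (\<forall>i j. \<forall>x\<in>gr R i. \<forall>y\<in>gr R j.
      x \<otimes>\<^bsub>R\<^esub> y = [((- 1 :: int) ^ (i * j))] \<cdot>\<^bsub>R\<^esub> (y \<otimes>\<^bsub>R\<^esub> x))"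

definition gr_component :: "('k, 'r) ring_scheme \<Rightarrow> ('k, 'a) galg \<Rightarrow> nat \<Rightarrow> ('k, 'a) module"
  where "gr_component k R j = mod_on k (gr R j) \<zero>\<^bsub>R\<^esub> (add R) (smult R)"

definition Alg :: "('k, 'r) ring_scheme \<Rightarrow> (('k, 'a) galg, 'a \<Rightarrow> 'a) cat"
  where "Alg k =
    \<lparr>Obj = {R. graded_comm_algebra k R},
     Hom = (\<lambda>R S. {f \<in> ring_hom R S \<inter> lin_maps k R S \<inter> extensional (carrier R).
                     \<forall>j. f ` gr R j \<subseteq> gr S j}),
     Idn = (\<lambda>R. \<lambda>x\<in>carrier R. x),
     Cmp = (\<lambda>R g f. compose (carrier R) g f)\<rparr>"

definition alg_fin :: "('k, 'r) ring_scheme \<Rightarrow> (('k, 'a) galg, 'a \<Rightarrow> 'a) cat"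
  where "alg_fin k = full_subcat (Alg k) (\<lambda>R. gr_finite_length k (gr_component k R))"

definition ev_degree :: "nat \<Rightarrow> nat \<Rightarrow> bool"
  where "ev_degree p j \<longleftrightarrow> p = 2 \<or> even j"

definition ev_part :: "nat \<Rightarrow> ('k, 'a) galg \<Rightarrow> ('k, 'a) galg"
  where "ev_part p R = R
    \<lparr>carrier := {x. \<exists>c J. finite J \<and> (\<forall>j\<in>J. ev_degree p j \<and> c j \<in> gr R j) \<and> x = finsum R c J},
     gr := (\<lambda>j. if ev_degree p j then gr R j else {\<zero>\<^bsub>R\<^esub>})\<rparr>"

definition nilradical :: "('a, 'x) ring_scheme \<Rightarrow> 'a set"
  where "nilradical R = {x \<in> carrier R. \<exists>n::nat. x [^]\<^bsub>R\<^esub> n = \<zero>\<^bsub>R\<^esub>}"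


section \<open>Polar algebras\<close>

text \<open>\<open>pmu A j\<close> is the map \<open>A\<^sub>j \<times> \<dots> \<times> A\<^sub>j \<rightarrow> A\<^sub>j\<^sub>p\<close> on lists of length \<open>p\<close>.\<close>

record ('k, 'a) polar =
  pcomp :: "nat \<Rightarrow> ('k, 'a) module"
  pmu :: "nat \<Rightarrow> 'a list \<Rightarrow> 'a"

definition ptuples :: "nat \<Rightarrow> 'a set \<Rightarrow> 'a list set"
  where "ptuples p A = {xs. length xs = p \<and> set xs \<subseteq> A}"

text \<open>
  All arguments of \<open>\<mu>\<close> have the same degree \<open>j\<close>, so the Koszul sign of a permutation \<open>\<sigma>\<close> is
  \<open>sign \<sigma>\<close> to the power \<open>j * j\<close>.
\<close>

definition M_object :: "nat \<Rightarrow> ('k, 'r) ring_scheme \<Rightarrow> ('k, 'a) polar \<Rightarrow> bool"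
  where "M_object p k A \<longleftrightarrow>
    (\<forall>j. Module.module k (pcomp A j) \<and>
      (\<forall>xs\<in>ptuples p (carrier (pcomp A j)).
        pmu A j xs \<in> carrier (pcomp A (j * p)) \<and>
        (\<forall>i<p. \<forall>x\<in>carrier (pcomp A j). \<forall>y\<in>carrier (pcomp A j).
          pmu A j (xs[i := x \<oplus>\<^bsub>pcomp A j\<^esub> y]) =
            pmu A j (xs[i := x]) \<oplus>\<^bsub>pcomp A (j * p)\<^esub> pmu A j (xs[i := y])) \<and>
        (\<forall>i<p. \<forall>r\<in>carrier k. \<forall>x\<in>carrier (pcomp A j).
          pmu A j (xs[i := r \<odot>\<^bsub>pcomp A j\<^esub> x]) = r \<odot>\<^bsub>pcomp A (j * p)\<^esub> pmu A j (xs[i := x])) \<and>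
        (\<forall>\<sigma>. \<sigma> permutes {..<p} \<longrightarrow>
          pmu A j (permute_list \<sigma> xs) = [(sign \<sigma> ^ (j * j))] \<cdot>\<^bsub>pcomp A (j * p)\<^esub> pmu A j xs)))"

definition M_hom ::
  "nat \<Rightarrow> ('k, 'r) ring_scheme \<Rightarrow> ('k, 'a) polar \<Rightarrow> ('k, 'b) polar \<Rightarrow> (nat \<Rightarrow> 'a \<Rightarrow> 'b) set"
  where "M_hom p k A B =
    {f. \<forall>j. f j \<in> lin_maps k (pcomp A j) (pcomp B j) \<inter> extensional (carrier (pcomp A j)) \<and>
      (\<forall>xs\<in>ptuples p (carrier (pcomp A j)). f (j * p) (pmu A j xs) = pmu B j (map (f j) xs))}"

definition pol_obj :: "nat \<Rightarrow> ('k, 'r) ring_scheme \<Rightarrow> ('k, 'a) galg \<Rightarrow> ('k, 'a) polar"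
  where "pol_obj p k R =
    \<lparr>pcomp = gr_component k R,
     pmu = (\<lambda>j. \<lambda>xs\<in>ptuples p (gr R j). foldr (monoid.mult R) xs \<one>\<^bsub>R\<^esub>)\<rparr>"

definition pol_functor ::
  "nat \<Rightarrow> ('k, 'r) ring_scheme \<Rightarrow>
   (('k, 'a) galg, 'a \<Rightarrow> 'a, ('k, 'a) polar, nat \<Rightarrow> 'a \<Rightarrow> 'a) ftor"
  where "pol_functor p k =
    \<lparr>fobj = pol_obj p k, fmor = (\<lambda>R S f j. restrict f (gr R j))\<rparr>"

text \<open>
  The type \<open>'a\<close> plays the role of a universe: \<open>Alg k\<close> and \<open>Pol p k\<close> consist of the objects whose
  elements lie in \<open>'a\<close>, and the algebra \<open>B\<close> ranges over the same universe.
\<close>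

definition is_polar_algebra :: "nat \<Rightarrow> ('k, 'r) ring_scheme \<Rightarrow> ('k, 'a) polar \<Rightarrow> bool"
  where "is_polar_algebra p k A \<longleftrightarrow>
    M_object p k A \<and>
    (\<exists>B :: ('k, 'a) galg. graded_comm_algebra k B \<and>
      (\<exists>f\<in>M_hom p k A (pol_obj p k B). \<forall>j. inj_on (f j) (carrier (pcomp A j))))"

definition Pol :: "nat \<Rightarrow> ('k, 'r) ring_scheme \<Rightarrow> (('k, 'a) polar, nat \<Rightarrow> 'a \<Rightarrow> 'a) cat"
  where "Pol p k =
    \<lparr>Obj = {A. is_polar_algebra p k A},
     Hom = M_hom p k,
     Idn = (\<lambda>A j. \<lambda>x\<in>carrier (pcomp A j). x),
     Cmp = (\<lambda>A g f j. compose (carrier (pcomp A j)) (g j) (f j))\<rparr>"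

definition pol_fin :: "nat \<Rightarrow> ('k, 'r) ring_scheme \<Rightarrow> (('k, 'a) polar, nat \<Rightarrow> 'a \<Rightarrow> 'a) cat"
  where "pol_fin p k = full_subcat (Pol p k) (\<lambda>A. gr_finite_length k (pcomp A))"


section \<open>Witt polynomials and Witt vectors of a commutative ring\<close>

text \<open>Integer polynomials in \<open>X\<^sub>0, Y\<^sub>0, X\<^sub>1, Y\<^sub>1, \<dots>\<close>: \<open>X\<^sub>i\<close> is variable \<open>2 * i\<close>, \<open>Y\<^sub>i\<close> is variable \<open>2 * i + 1\<close>.\<close>

type_synonym zpoly = "(nat \<Rightarrow>\<^sub>0 nat) \<Rightarrow>\<^sub>0 int"

definition pvar :: "nat \<Rightarrow> zpoly"
  where "pvar v = Poly_Mapping.single (Poly_Mapping.single v 1) 1"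

definition ghost :: "nat \<Rightarrow> nat \<Rightarrow> (nat \<Rightarrow> zpoly) \<Rightarrow> zpoly"
  where "ghost p n f = (\<Sum>i\<le>n. of_nat (p ^ i) * f i ^ (p ^ (n - i)))"

definition witt_sum :: "nat \<Rightarrow> nat \<Rightarrow> zpoly"
  where "witt_sum p = (THE S. \<forall>n. ghost p n S =
    ghost p n (\<lambda>i. pvar (2 * i)) + ghost p n (\<lambda>i. pvar (2 * i + 1)))"

definition witt_prod :: "nat \<Rightarrow> nat \<Rightarrow> zpoly"
  where "witt_prod p = (THE P. \<forall>n. ghost p n P =
    ghost p n (\<lambda>i. pvar (2 * i)) * ghost p n (\<lambda>i. pvar (2 * i + 1)))"

definition peval :: "('a, 'x) ring_scheme \<Rightarrow> zpoly \<Rightarrow> (nat \<Rightarrow> 'a) \<Rightarrow> (nat \<Rightarrow> 'a) \<Rightarrow> 'a"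
  where "peval R P x y =
    finsum R (\<lambda>m. [Poly_Mapping.lookup P m] \<cdot>\<^bsub>R\<^esub>
        finprod R (\<lambda>v. (if even v then x (v div 2) else y (v div 2)) [^]\<^bsub>R\<^esub> Poly_Mapping.lookup m v)
          (Poly_Mapping.keys m))
      (Poly_Mapping.keys P)"

definition witt_ring :: "nat \<Rightarrow> ('k, 'r) ring_scheme \<Rightarrow> (nat \<Rightarrow> 'k) ring"
  where "witt_ring p k =
    \<lparr>carrier = {a. \<forall>i. a i \<in> carrier k},
     monoid.mult = (\<lambda>a b i. peval k (witt_prod p i) a b),
     one = (\<lambda>i. if i = 0 then \<one>\<^bsub>k\<^esub> else \<zero>\<^bsub>k\<^esub>),
     zero = (\<lambda>i. \<zero>\<^bsub>k\<^esub>),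
     add = (\<lambda>a b i. peval k (witt_sum p i) a b)\<rparr>"

text \<open>For \<open>k\<close> of characteristic \<open>p\<close>, the Frobenius of \<open>W(k)\<close> raises the entries to the \<open>p\<close>-th power.\<close>

definition wfrob :: "nat \<Rightarrow> ('k, 'r) ring_scheme \<Rightarrow> (nat \<Rightarrow> 'k) \<Rightarrow> (nat \<Rightarrow> 'k)"
  where "wfrob p k l = (\<lambda>i. l i [^]\<^bsub>k\<^esub> p)"

definition wfrob_inv :: "nat \<Rightarrow> ('k, 'r) ring_scheme \<Rightarrow> (nat \<Rightarrow> 'k) \<Rightarrow> (nat \<Rightarrow> 'k)"
  where "wfrob_inv p k = inv_into (carrier (witt_ring p k)) (wfrob p k)"


section \<open>Dieudonne modules\<close>

text \<open>\<open>dF M j\<close> maps \<open>M\<^sub>j\<close> to \<open>M\<^sub>p\<^sub>j = M(1)\<^sub>j\<close>, and \<open>dV M j\<close> maps \<open>M\<^sub>p\<^sub>j = M(1)\<^sub>j\<close> to \<open>M\<^sub>j\<close>.\<close>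

record ('k, 'm) dmod =
  dcomp :: "nat \<Rightarrow> (nat \<Rightarrow> 'k, 'm) module"
  dF :: "nat \<Rightarrow> 'm \<Rightarrow> 'm"
  dV :: "nat \<Rightarrow> 'm \<Rightarrow> 'm"

record ('k, 'm) tdmod = "('k, 'm) dmod" +
  dtop :: "nat \<Rightarrow> 'm topology"

definition twist ::
  "nat \<Rightarrow> ('k, 'r) ring_scheme \<Rightarrow> nat \<Rightarrow> (nat \<Rightarrow> (nat \<Rightarrow> 'k, 'm) module) \<Rightarrow> nat \<Rightarrow> (nat \<Rightarrow> 'k, 'm) module"
  where "twist p k i M n =
    (M (p ^ i * n))\<lparr>smult := (\<lambda>l x. (wfrob p k ^^ i) l \<odot>\<^bsub>M (p ^ i * n)\<^esub> x)\<rparr>"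

definition is_dieudonne :: "nat \<Rightarrow> ('k, 'r) ring_scheme \<Rightarrow> ('k, 'm, 'z) dmod_scheme \<Rightarrow> bool"
  where "is_dieudonne p k M \<longleftrightarrow>
    (\<forall>j. Module.module (witt_ring p k) (dcomp M j) \<and>
      dF M j \<in> lin_maps (witt_ring p k) (dcomp M j) (twist p k 1 (dcomp M) j) \<and>
      dV M j \<in> lin_maps (witt_ring p k) (twist p k 1 (dcomp M) j) (dcomp M j) \<and>
      (\<forall>x\<in>carrier (dcomp M (p * j)). dF M j (dV M j x) = [p] \<cdot>\<^bsub>dcomp M (p * j)\<^esub> x) \<and>
      (\<forall>x\<in>carrier (dcomp M j). dV M j (dF M j x) = [p] \<cdot>\<^bsub>dcomp M j\<^esub> x))"

definition dmod_hom ::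
  "nat \<Rightarrow> ('k, 'r) ring_scheme \<Rightarrow> ('k, 'm, 'z) dmod_scheme \<Rightarrow> ('k, 'm, 'z) dmod_scheme \<Rightarrow>
   (nat \<Rightarrow> 'm \<Rightarrow> 'm) set"
  where "dmod_hom p k M N =
    {f. \<forall>j. f j \<in> lin_maps (witt_ring p k) (dcomp M j) (dcomp N j) \<inter> extensional (carrier (dcomp M j)) \<and>
      (\<forall>x\<in>carrier (dcomp M j). f (p * j) (dF M j x) = dF N j (f j x)) \<and>
      (\<forall>x\<in>carrier (dcomp M (p * j)). f j (dV M j x) = dV N j (f (p * j) x))}"

definition Dmod :: "nat \<Rightarrow> ('k, 'r) ring_scheme \<Rightarrow> (('k, 'm) dmod, nat \<Rightarrow> 'm \<Rightarrow> 'm) cat"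
  where "Dmod p k =
    \<lparr>Obj = {M. is_dieudonne p k M},
     Hom = dmod_hom p k,
     Idn = (\<lambda>M j. \<lambda>x\<in>carrier (dcomp M j). x),
     Cmp = (\<lambda>M g f j. compose (carrier (dcomp M j)) (g j) (f j))\<rparr>"

text \<open>The iterates \<open>F\<^sup>n : M\<^sub>j \<rightarrow> M\<^sub>q\<close> and \<open>V\<^sup>n : M\<^sub>q \<rightarrow> M\<^sub>j\<close>, where \<open>q = p ^ n * j\<close>.\<close>

primrec Fpow :: "nat \<Rightarrow> ('k, 'm, 'z) dmod_scheme \<Rightarrow> nat \<Rightarrow> nat \<Rightarrow> 'm \<Rightarrow> 'm" where
  "Fpow p M 0 j x = x"
| "Fpow p M (Suc n) j x = dF M (p ^ n * j) (Fpow p M n j x)"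

primrec Vpow :: "nat \<Rightarrow> ('k, 'm, 'z) dmod_scheme \<Rightarrow> nat \<Rightarrow> nat \<Rightarrow> 'm \<Rightarrow> 'm" where
  "Vpow p M 0 j x = x"
| "Vpow p M (Suc n) j x = dV M j (Vpow p M n (p * j) x)"

text \<open>
  On \<open>M\<^sub>d\<close> the iterate \<open>V\<^sup>n\<close> is only defined if \<open>p ^ n\<close> divides \<open>d\<close>; hence unipotence is a condition
  on \<open>M\<^sub>0\<close> only.
\<close>

definition unipotent :: "nat \<Rightarrow> ('k, 'm, 'z) dmod_scheme \<Rightarrow> bool"
  where "unipotent p M \<longleftrightarrow>
    (\<forall>d. \<forall>x\<in>carrier (dcomp M d).
      \<exists>n0. \<forall>n\<ge>n0. \<forall>j. d = p ^ n * j \<longrightarrow> Vpow p M n j x = \<zero>\<^bsub>dcomp M j\<^esub>)"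

definition Dmod_u :: "nat \<Rightarrow> ('k, 'r) ring_scheme \<Rightarrow> (('k, 'm) dmod, nat \<Rightarrow> 'm \<Rightarrow> 'm) cat"
  where "Dmod_u p k = full_subcat (Dmod p k) (unipotent p)"

text \<open>
  A profinite Dieudonne module is connected if \<open>0\<close> has a fundamental system of open graded
  submodules \<open>N\<close> such that \<open>M / N\<close> has finite length and \<open>F\<^sup>n\<close> induces zero on it for large \<open>n\<close>.
\<close>

definition connected_dmod :: "nat \<Rightarrow> ('k, 'r) ring_scheme \<Rightarrow> ('k, 'm) tdmod \<Rightarrow> bool"
  where "connected_dmod p k M \<longleftrightarrow>
    is_dieudonne p k M \<and>
    (\<forall>j. profinite_module (witt_ring p k) (dcomp M j) (dtop M j) \<and>
      continuous_map (dtop M j) (dtop M (p * j)) (dF M j) \<and>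
      continuous_map (dtop M (p * j)) (dtop M j) (dV M j)) \<and>
    (\<forall>j U. openin (dtop M j) U \<and> \<zero>\<^bsub>dcomp M j\<^esub> \<in> U \<longrightarrow>
      (\<exists>N. (\<forall>i. submodule (N i) (witt_ring p k) (dcomp M i) \<and> openin (dtop M i) (N i)) \<and>
        gr_finite_colength (witt_ring p k) (dcomp M) N \<and> N j \<subseteq> U \<and>
        (\<exists>n0. \<forall>n\<ge>n0. \<forall>i. Fpow p M n i ` carrier (dcomp M i) \<subseteq> N (p ^ n * i))))"

definition Dmod_c :: "nat \<Rightarrow> ('k, 'r) ring_scheme \<Rightarrow> (('k, 'm) tdmod, nat \<Rightarrow> 'm \<Rightarrow> 'm) cat"
  where "Dmod_c p k =
    \<lparr>Obj = {M. connected_dmod p k M},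
     Hom = (\<lambda>M N. {f \<in> dmod_hom p k M N. \<forall>j. continuous_map (dtop M j) (dtop N j) (f j)}),
     Idn = (\<lambda>M j. \<lambda>x\<in>carrier (dcomp M j). x),
     Cmp = (\<lambda>M g f j. compose (carrier (dcomp M j)) (g j) (f j))\<rparr>"


section \<open>Witt vectors of graded algebras\<close>

text \<open>
  In this and the next section, the functions whose name ends in \<open>0\<close> are to be applied to the
  commutative graded ring \<open>ev_part p R\<close>. The entries of \<open>W\<^sub>n\<close> are indexed by \<open>{i. enat i \<le> n}\<close>.
\<close>

definition W_carrier0 :: "nat \<Rightarrow> enat \<Rightarrow> ('k, 'a) galg \<Rightarrow> nat \<Rightarrow> (nat \<Rightarrow> 'a) set"
  where "W_carrier0 p n R j = (\<Pi>\<^sub>E i\<in>{i. enat i \<le> n}. gr R (j * p ^ i))"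

definition W_obj0 :: "nat \<Rightarrow> ('k, 'r) ring_scheme \<Rightarrow> enat \<Rightarrow> ('k, 'a) galg \<Rightarrow> ('k, nat \<Rightarrow> 'a) dmod"
  where "W_obj0 p k n R =
    \<lparr>dcomp = (\<lambda>j. mod_on (witt_ring p k) (W_carrier0 p n R j)
       (\<lambda>i\<in>{i. enat i \<le> n}. \<zero>\<^bsub>R\<^esub>)
       (\<lambda>a b. \<lambda>i\<in>{i. enat i \<le> n}. peval R (witt_sum p i) a b)
       (\<lambda>l a. \<lambda>i\<in>{i. enat i \<le> n}. peval R (witt_prod p i) (\<lambda>s. l s \<odot>\<^bsub>R\<^esub> \<one>\<^bsub>R\<^esub>) a)),
     dF = (\<lambda>j. \<lambda>a\<in>W_carrier0 p n R j. \<lambda>i\<in>{i. enat i \<le> n}. a i [^]\<^bsub>R\<^esub> p),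
     dV = (\<lambda>j. \<lambda>a\<in>W_carrier0 p n R (p * j). \<lambda>i\<in>{i. enat i \<le> n}.
       (case i of 0 \<Rightarrow> \<zero>\<^bsub>R\<^esub> | Suc m \<Rightarrow> a m))\<rparr>"

definition W_functor ::
  "nat \<Rightarrow> ('k, 'r) ring_scheme \<Rightarrow> enat \<Rightarrow>
   (('k, 'a) galg, 'a \<Rightarrow> 'a, ('k, nat \<Rightarrow> 'a) dmod, nat \<Rightarrow> (nat \<Rightarrow> 'a) \<Rightarrow> (nat \<Rightarrow> 'a)) ftor"
  where "W_functor p k n =
    \<lparr>fobj = (\<lambda>R. W_obj0 p k n (ev_part p R)),
     fmor = (\<lambda>R S f j. \<lambda>a\<in>W_carrier0 p n (ev_part p R) j. \<lambda>i\<in>{i. enat i \<le> n}. f (a i))\<rparr>"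


section \<open>Co-Witt vectors of graded algebras\<close>

text \<open>A covector \<open>(\<dots>, a\<^sub>-\<^sub>1, a\<^sub>0)\<close> is represented by the function taking \<open>i\<close> to \<open>a\<^sub>-\<^sub>i\<close>.\<close>

definition ev_value :: "(nat \<Rightarrow> 'a) \<Rightarrow> 'a"
  where "ev_value f = (THE v. eventually (\<lambda>m. f m = v) sequentially)"

definition CW_entry :: "nat \<Rightarrow> ('k, 'a) galg \<Rightarrow> nat \<Rightarrow> nat \<Rightarrow> 'a set"
  where "CW_entry p R j i = (if p ^ i dvd j then gr R (j div p ^ i) else {\<zero>\<^bsub>R\<^esub>})"

definition CW_add :: "nat \<Rightarrow> ('k, 'a) galg \<Rightarrow> (nat \<Rightarrow> 'a) \<Rightarrow> (nat \<Rightarrow> 'a) \<Rightarrow> (nat \<Rightarrow> 'a)"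
  where "CW_add p R a b = (\<lambda>i. ev_value (\<lambda>m.
    peval R (witt_sum p m) (\<lambda>s. a (i + m - s)) (\<lambda>s. b (i + m - s))))"

text \<open>
  The \<open>-i\<close>-th entry of the Witt product of \<open>(a\<^sub>-\<^sub>n, \<dots>, a\<^sub>0)\<close> with the image of \<open>l\<close> under the \<open>-n\<close>-th
  power of the Frobenius, for large \<open>n = i + m\<close>.
\<close>

definition CW_smult ::
  "nat \<Rightarrow> ('k, 'r) ring_scheme \<Rightarrow> ('k, 'a) galg \<Rightarrow> (nat \<Rightarrow> 'k) \<Rightarrow> (nat \<Rightarrow> 'a) \<Rightarrow> (nat \<Rightarrow> 'a)"
  where "CW_smult p k R l a = (\<lambda>i. ev_value (\<lambda>m.
    peval R (witt_prod p m) (\<lambda>s. (wfrob_inv p k ^^ (i + m)) l s \<odot>\<^bsub>R\<^esub> \<one>\<^bsub>R\<^esub>) (\<lambda>s. a (i + m - s))))"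

definition CW_obj0 ::
  "nat \<Rightarrow> ('k, 'r) ring_scheme \<Rightarrow> (nat \<Rightarrow> (nat \<Rightarrow> 'a) set) \<Rightarrow> ('k, 'a) galg \<Rightarrow> ('k, nat \<Rightarrow> 'a) dmod"
  where "CW_obj0 p k C R =
    \<lparr>dcomp = (\<lambda>j. mod_on (witt_ring p k) (C j) (\<lambda>i. \<zero>\<^bsub>R\<^esub>) (CW_add p R) (CW_smult p k R)),
     dF = (\<lambda>j. \<lambda>a\<in>C j. \<lambda>i. a i [^]\<^bsub>R\<^esub> p),
     dV = (\<lambda>j. \<lambda>a\<in>C (p * j). \<lambda>i. a (Suc i))\<rparr>"

definition CWu_carrier0 :: "nat \<Rightarrow> ('k, 'a) galg \<Rightarrow> nat \<Rightarrow> (nat \<Rightarrow> 'a) set"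
  where "CWu_carrier0 p R j =
    {a. (\<forall>i. a i \<in> CW_entry p R j i) \<and> finite {i. a i \<noteq> \<zero>\<^bsub>R\<^esub>}}"

definition CWu_functor ::
  "nat \<Rightarrow> ('k, 'r) ring_scheme \<Rightarrow>
   (('k, 'a) galg, 'a \<Rightarrow> 'a, ('k, nat \<Rightarrow> 'a) dmod, nat \<Rightarrow> (nat \<Rightarrow> 'a) \<Rightarrow> (nat \<Rightarrow> 'a)) ftor"
  where "CWu_functor p k =
    \<lparr>fobj = (\<lambda>R. CW_obj0 p k (CWu_carrier0 p (ev_part p R)) (ev_part p R)),
     fmor = (\<lambda>R S f j. \<lambda>a\<in>CWu_carrier0 p (ev_part p R) j. \<lambda>i. f (a i))\<rparr>"

definition CWc_carrier0 :: "nat \<Rightarrow> ('k, 'a) galg \<Rightarrow> nat \<Rightarrow> (nat \<Rightarrow> 'a) set"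
  where "CWc_carrier0 p R j =
    (if j = 0 then {a. \<forall>i. a i \<in> gr R 0 \<inter> nilradical R}
     else {a \<in> CWu_carrier0 p R j. \<forall>i. a i \<in> nilradical R})"

definition CWc_top0 :: "nat \<Rightarrow> ('k, 'a) galg \<Rightarrow> nat \<Rightarrow> (nat \<Rightarrow> 'a) topology"
  where "CWc_top0 p R j =
    product_topology (\<lambda>i. discrete_topology (CW_entry p R j i \<inter> nilradical R)) UNIV"

definition CWc_functor ::
  "nat \<Rightarrow> ('k, 'r) ring_scheme \<Rightarrow>
   (('k, 'a) galg, 'a \<Rightarrow> 'a, ('k, nat \<Rightarrow> 'a) tdmod, nat \<Rightarrow> (nat \<Rightarrow> 'a) \<Rightarrow> (nat \<Rightarrow> 'a)) ftor"
  where "CWc_functor p k =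
    \<lparr>fobj = (\<lambda>R. dmod.extend (CW_obj0 p k (CWc_carrier0 p (ev_part p R)) (ev_part p R))
        (tdmod.fields (CWc_top0 p (ev_part p R)))),
     fmor = (\<lambda>R S f j. \<lambda>a\<in>CWc_carrier0 p (ev_part p R) j. \<lambda>i. f (a i))\<rparr>"

end

theory Submission
  imports Defs "HOL-Algebra.Ideal"
begin

text \<open>
  The theorem is a statement about the Witt polynomials. If the variables \<open>X\<^sub>i\<close> and \<open>Y\<^sub>i\<close> have weight
  \<open>p ^ i\<close>, then the \<open>n\<close>-th addition polynomial is isobaric of weight \<open>p ^ n\<close>, and the \<open>n\<close>-th
  multiplication polynomial is so in each of its two groups of variables (\<open>homog_witt_sum\<close>,
  \<open>homog_witt_prod\<close>). A family of powers of \<open>p\<close> with sum \<open>p ^ n\<close> is either a single power or splits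
  into \<open>p\<close> families with sum \<open>p ^ (n - 1)\<close>. So if the entry of index \<open>i\<close> has degree \<open>j * p ^ i\<close>,
  every monomial of such a polynomial is an iterated product of \<open>p\<close> elements of equal degree. The
  operations on Witt vectors can therefore be expressed by what a polar algebra remembers.

  This is made precise without constructing a theory of polar polynomials. A relation between two
  algebras that is closed under addition, scalars and \<open>p\<close>-fold products of elements of equal degree
  also contains the pairs of values of Witt polynomials at related entries (\<open>T_pev\<close>). Let \<open>g\<close> be a
  morphism of polar algebras \<open>A\<close> and \<open>A'\<close>, embedded into algebras \<open>B\<close> and \<open>B'\<close>. The graph of \<open>g\<close> is
  such a relation between \<open>B\<close> and \<open>B'\<close>. For \<open>A = A'\<close>, \<open>B = B'\<close> and \<open>g\<close> the identity, this says that
  Witt vectors of \<open>B\<close> with entries in \<open>A\<close> are closed under the operations. For \<open>A = A'\<close> with two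
  embeddings it says that the result does not depend on the embedding. For arbitrary \<open>g\<close> it gives
  functoriality. Finally, the polar algebra of \<open>B\<close> is embedded in itself by the identity, where one
  recovers the Witt vectors of \<open>B\<close>; this is the factorization.

  The laws of Dieudonne modules come from those of ordinary Witt vectors over rings of characteristic
  \<open>p\<close>, in particular \<open>FV = VF = p\<close>. They are transferred by \<open>dieudonne_wfam\<close> along a relation
  between covectors and families of Witt vectors that approximate them. For covectors one has to know
  that the sums of their cut-offs become constant. This holds when the entries eventually lie in a
  nilpotent ideal: a monomial with a factor of low index must have many factors of low index
  (\<open>many_low_factors\<close>) and thus vanishes. Finite covectors satisfy this with the ideal zero, connected
  covectors in degree zero because in a polar algebra of finite length the nilpotent elements of
  degree zero generate a nilpotent ideal (\<open>nil_ideal\<close>).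

  The number of entries that are involved in an entry of a sum of connected covectors is bounded.
  Cylinders are therefore neighborhoods of zero that contain open submodules. A submodule containing
  a cylinder is determined by the leading entries of its elements, which lie in components of finite
  length; so its quotient has finite length. This makes connected covectors a profinite module
  (\<open>profinite\<close>), and \<open>F\<close> is nilpotent on the quotients since the entries in degree zero are nilpotent.
\<close>

section \<open>Evaluating integer polynomials in a ring\<close>

abbreviation keys :: "('a \<Rightarrow>\<^sub>0 'b::zero) \<Rightarrow> 'a set" where "keys \<equiv> Poly_Mapping.keys"
abbreviation lookup :: "('a \<Rightarrow>\<^sub>0 'b::zero) \<Rightarrow> 'a \<Rightarrow> 'b" where "lookup \<equiv> Poly_Mapping.lookup"

definition lprod :: "('a, 'x) monoid_scheme \<Rightarrow> 'a list \<Rightarrow> 'a"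
  where "lprod R xs = foldr (monoid.mult R) xs \<one>\<^bsub>R\<^esub>"

definition mev :: "('a, 'x) ring_scheme \<Rightarrow> (nat \<Rightarrow> 'a) \<Rightarrow> (nat \<Rightarrow>\<^sub>0 nat) \<Rightarrow> 'a"
  where "mev R v m = finprod R (\<lambda>i. v i [^]\<^bsub>R\<^esub> lookup m i) (keys m)"

definition pev :: "('a, 'x) ring_scheme \<Rightarrow> zpoly \<Rightarrow> (nat \<Rightarrow> 'a) \<Rightarrow> 'a"
  where "pev R P v = finsum R (\<lambda>m. [lookup P m] \<cdot>\<^bsub>R\<^esub> mev R v m) (keys P)"

text \<open>
  Interleaving: the values of the variables
  \<open>X\<^sub>0, Y\<^sub>0, X\<^sub>1, Y\<^sub>1, \<dots>\<close> in the numbering of variables used for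
  the Witt polynomials.
\<close>

definition ilv :: "(nat \<Rightarrow> 'a) \<Rightarrow> (nat \<Rightarrow> 'a) \<Rightarrow> nat \<Rightarrow> 'a"
  where "ilv x y v = (if even v then x (v div 2) else y (v div 2))"

lemma peval_pev: "peval R P x y = pev R P (ilv x y)"
  unfolding peval_def pev_def mev_def ilv_def ..

lemma lprod_simps [simp]: "lprod R [] = \<one>\<^bsub>R\<^esub>" "lprod R (x # xs) = x \<otimes>\<^bsub>R\<^esub> lprod R xs"
  by (auto simp: lprod_def)

lemma pm_eq_sum_single:
  fixes x :: "'a \<Rightarrow>\<^sub>0 'b::comm_monoid_add"
  shows "x = (\<Sum>m\<in>keys x. Poly_Mapping.single m (lookup x m))"
  by (rule poly_mapping_eqI)
     (auto simp: lookup_sum lookup_single when_def in_keys_iff sum.delta' )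

text \<open>
  Polynomials are sums of terms; identities that are additive need to be checked on single terms
  only.
\<close>

lemma pm_single_add_induct [case_names zero single add]:
  fixes x :: "'a \<Rightarrow>\<^sub>0 'b::comm_monoid_add"
  assumes "Q 0" "\<And>m c. Q (Poly_Mapping.single m c)" "\<And>a b. Q a \<Longrightarrow> Q b \<Longrightarrow> Q (a + b)"
  shows "Q x"
proof -
  have "Q (\<Sum>m\<in>S. Poly_Mapping.single m (lookup x m))" if "finite S" for S
    using that by induction (auto intro: assms)
  from this[of "keys x"] show ?thesis using pm_eq_sum_single[of x] by simp
qed

context cring begin

lemma lprod_closed [simp]: "set xs \<subseteq> carrier R \<Longrightarrow> lprod R xs \<in> carrier R"
  by (induction xs) auto

lemma lprod_append:
  "set xs \<subseteq> carrier R \<Longrightarrow> set ys \<subseteq> carrier R \<Longrightarrow> lprod R (xs @ ys) = lprod R xs \<otimes> lprod R ys"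
  by (induction xs) (auto simp: m_assoc)

lemma mev_closed [simp]: "\<forall>i. v i \<in> carrier R \<Longrightarrow> mev R v m \<in> carrier R"
  unfolding mev_def by (auto intro!: finprod_closed)

lemma mev_superset:
  assumes "\<forall>i. v i \<in> carrier R" "finite S" "keys m \<subseteq> S"
  shows "mev R v m = finprod R (\<lambda>i. v i [^] lookup m i) S"
  unfolding mev_def using assms
  by (intro finprod_mono_neutral_cong_left) (auto simp: in_keys_iff)

lemma mev_add:
  assumes v: "\<forall>i. v i \<in> carrier R"
  shows "mev R v (m + m') = mev R v m \<otimes> mev R v m'"
proof -
  let ?S = "keys m \<union> keys m'"
  have "mev R v (m + m') = finprod R (\<lambda>i. v i [^] lookup (m + m') i) ?S"
    using keys_add by (intro mev_superset[OF v]) (auto dest: set_mp[OF keys_add])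
  also have "\<dots> = finprod R (\<lambda>i. v i [^] lookup m i \<otimes> v i [^] lookup m' i) ?S"
    using v by (intro finprod_cong) (auto simp: lookup_add nat_pow_mult simp_implies_def)
  also have "\<dots> = mev R v m \<otimes> mev R v m'"
    using v by (subst finprod_multf) (auto simp: mev_superset[of v ?S])
  finally show ?thesis .
qed

lemma mev_zero [simp]: "mev R v 0 = \<one>"
  by (simp add: mev_def)

lemma mev_single [simp]: "\<forall>i. v i \<in> carrier R \<Longrightarrow> mev R v (Poly_Mapping.single i n) = v i [^] n"
  by (cases "n = 0") (auto simp: mev_def finprod_insert Pi_def)

lemma int_add_pow_closed [simp]: "x \<in> carrier R \<Longrightarrow> [(k::int)] \<cdot> x \<in> carrier R"
  by (rule add.int_pow_closed)

lemma int_add_pow_zero [simp]: "[(0::int)] \<cdot> x = \<zero>"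
  by (simp add: add_pow_def)

lemma finsum_single [simp]: "f a \<in> carrier R \<Longrightarrow> finsum R f {a} = f a"
  by (subst finsum_insert) auto

lemma pev_closed [simp]: "\<forall>i. v i \<in> carrier R \<Longrightarrow> pev R P v \<in> carrier R"
  unfolding pev_def by (auto intro!: finsum_closed)

lemma pev_superset:
  assumes "\<forall>i. v i \<in> carrier R" "finite S" "keys P \<subseteq> S"
  shows "pev R P v = finsum R (\<lambda>m. [lookup P m] \<cdot> mev R v m) S"
  unfolding pev_def using assms
  by (intro add.finprod_mono_neutral_cong_left) (auto simp: in_keys_iff)

lemma pev_add:
  assumes v: "\<forall>i. v i \<in> carrier R"
  shows "pev R (P + Q) v = pev R P v \<oplus> pev R Q v"
proof -
  let ?S = "keys P \<union> keys Q"
  have "pev R (P + Q) v = finsum R (\<lambda>m. [lookup (P + Q) m] \<cdot> mev R v m) ?S"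
    by (intro pev_superset[OF v]) (auto dest: set_mp[OF keys_add])
  also have "\<dots> = finsum R (\<lambda>m. [lookup P m] \<cdot> mev R v m \<oplus> [lookup Q m] \<cdot> mev R v m) ?S"
    using v by (intro finsum_cong) (auto simp: lookup_add add.int_pow_mult simp_implies_def)
  also have "\<dots> = pev R P v \<oplus> pev R Q v"
    using v by (subst finsum_addf) (auto simp: pev_superset[of v ?S])
  finally show ?thesis .
qed

lemma pev_zero [simp]: "pev R 0 v = \<zero>"
  by (simp add: pev_def)

lemma pev_single: "\<forall>i. v i \<in> carrier R \<Longrightarrow> pev R (Poly_Mapping.single m c) v = [c] \<cdot> mev R v m"
  by (cases "c = 0") (auto simp: pev_def)

lemma pev_mult:
  assumes v: "\<forall>i. v i \<in> carrier R"
  shows "pev R (P * Q) v = pev R P v \<otimes> pev R Q v"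
proof (induction P rule: pm_single_add_induct)
  case zero
  show ?case using v by simp
next
  case (add a b)
  then show ?case using v by (simp add: distrib_right pev_add l_distr)
next
  case (single m c)
  show ?case
  proof (induction Q rule: pm_single_add_induct)
    case zero
    show ?case using v by simp
  next
    case (add a b)
    then show ?case using v by (simp add: distrib_left pev_add r_distr)
  next
    case (single m' d)
    show ?case using v
      by (simp add: mult_single pev_single mev_add add_pow_ldistr_int add_pow_rdistr_int
          add.int_pow_pow)
  qed
qed

lemma pev_one [simp]: "\<forall>i. v i \<in> carrier R \<Longrightarrow> pev R 1 v = \<one>"
  using pev_single[of v 0 1] by (simp del: single_one add: single_one[symmetric])

lemma pev_power: "\<forall>i. v i \<in> carrier R \<Longrightarrow> pev R (P ^ n) v = pev R P v [^] n"
  by (induction n) (auto simp: pev_mult m_comm)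

lemma pev_of_nat: "\<forall>i. v i \<in> carrier R \<Longrightarrow> pev R (of_nat n) v = [n] \<cdot> \<one>"
  by (induction n) (auto simp: pev_add a_comm)

lemma pev_sum: "finite S \<Longrightarrow> \<forall>i. v i \<in> carrier R \<Longrightarrow> pev R (sum f S) v = finsum R (\<lambda>i. pev R (f i) v) S"
  by (induction S rule: finite_induct) (auto simp: pev_add Pi_def)

lemma pev_pvar [simp]: "\<forall>i. v i \<in> carrier R \<Longrightarrow> pev R (pvar i) v = v i"
  by (simp add: pvar_def pev_single Pi_def)

lemma mev_cong: "(\<And>i. i \<in> keys m \<Longrightarrow> v i = w i) \<Longrightarrow> \<forall>i. w i \<in> carrier R \<Longrightarrow> mev R v m = mev R w m"
  unfolding mev_def by (intro finprod_cong') auto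

text \<open>
  A monomial is often more useful as a list of its variables with repetitions: the factors of
  such a product can then be regrouped.
\<close>

lemma mev_eq_lprod:
  assumes "\<forall>i. v i \<in> carrier R"
  shows "mev R v (\<Sum>i\<leftarrow>vs. Poly_Mapping.single i 1) = lprod R (map v vs)"
  using assms by (induction vs) (auto simp: mev_add Pi_def)

end

lemma monomial_list:
  obtains vs where "m = (\<Sum>i\<leftarrow>vs. Poly_Mapping.single i (1::nat))"
proof -
  have "\<exists>vs. m = (\<Sum>i\<leftarrow>vs. Poly_Mapping.single i (1::nat))"
  proof (induction m rule: pm_single_add_induct)
    case zero
    show ?case by (rule exI[of _ "[]"]) simp
  next
    case (single m c)
    have "(\<Sum>i\<leftarrow>replicate c m. Poly_Mapping.single i (1::nat)) = Poly_Mapping.single m c"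
      by (induction c) (auto simp: single_add[symmetric])
    then show ?case by metis
  next
    case (add a b)
    then obtain u w where "a = (\<Sum>i\<leftarrow>u. Poly_Mapping.single i (1::nat))"
      "b = (\<Sum>i\<leftarrow>w. Poly_Mapping.single i (1::nat))" by auto
    then show ?case by (intro exI[of _ "u @ w"]) simp
  qed
  then show ?thesis using that by blast
qed

lemma keys_monomial_list: "keys (\<Sum>i\<leftarrow>vs. Poly_Mapping.single i (1::nat)) = set vs"
proof (induction vs)
  case (Cons a vs)
  have "keys (x + y) = keys x \<union> keys y" for x y :: "'a \<Rightarrow>\<^sub>0 nat"
    by (auto simp: in_keys_iff lookup_add)
  then show ?case using Cons by simp
qed simp

lemma (in ring_hom_cring) hom_int_add_pow:
  assumes "x \<in> carrier R" shows "h ([(k::int)] \<cdot> x) = [k] \<cdot>\<^bsub>S\<^esub> h x"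
proof -
  have nat: "h ([(n::nat)] \<cdot> x) = [n] \<cdot>\<^bsub>S\<^esub> h x" for n
    using assms by (induction n) auto
  show ?thesis
    using assms nat[of "nat k"] nat[of "nat (-k)"]
    by (cases "k \<ge> 0") (auto simp: add_pow_int_ge add_pow_int_lt)
qed

lemma (in ring_hom_cring) hom_pow:
  assumes "x \<in> carrier R" shows "h (x [^] (n::nat)) = h x [^]\<^bsub>S\<^esub> n"
  using assms by (induction n) auto

lemma (in ring_hom_cring) hom_pev:
  assumes v: "\<forall>i. v i \<in> carrier R"
  shows "h (pev R P v) = pev S P (h \<circ> v)"
proof -
  have hv: "\<forall>i. (h \<circ> v) i \<in> carrier S" using v by auto
  have m: "h (mev R v m) = mev S (h \<circ> v) m" for m
  proof -
    have "h (mev R v m) = finprod S (h \<circ> (\<lambda>i. v i [^] lookup m i)) (keys m)"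
      unfolding mev_def using v by (subst hom_finprod) auto
    also have "\<dots> = mev S (h \<circ> v) m"
      unfolding mev_def using v by (intro S.finprod_cong') (auto simp: hom_pow Pi_def)
    finally show ?thesis .
  qed
  show ?thesis
  proof (induction P rule: pm_single_add_induct)
    case zero
    show ?case by simp
  next
    case (single a c)
    show ?case using v hv by (simp add: R.pev_single S.pev_single hom_int_add_pow m del: o_apply)
  next
    case (add a b)
    then show ?case using v hv by (simp add: R.pev_add S.pev_add del: o_apply)
  qed
qed

text \<open>
  A type class ring as a ring with carrier. Evaluation of polynomials at polynomials, that is,
  substitution, becomes an instance of evaluation in a ring.
\<close>

definition univ_ring :: "'a::comm_ring_1 ring"
  where "univ_ring = \<lparr>carrier = UNIV, monoid.mult = (*), one = 1, zero = 0, add = (+)\<rparr>"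

lemma univ_ring_simps [simp]:
  "carrier univ_ring = UNIV" "x \<otimes>\<^bsub>univ_ring\<^esub> y = x * y" "\<one>\<^bsub>univ_ring\<^esub> = 1"
  "\<zero>\<^bsub>univ_ring\<^esub> = 0" "x \<oplus>\<^bsub>univ_ring\<^esub> y = x + y"
  by (auto simp: univ_ring_def)

lemma cring_univ_ring: "cring (univ_ring :: 'a::comm_ring_1 ring)"
proof (rule cringI)
  show "abelian_group (univ_ring :: 'a ring)"
    by (rule abelian_groupI) (auto simp: add.assoc add.commute intro: exI[of _ "- _"] left_minus)
  show "comm_monoid (univ_ring :: 'a ring)"
    by (rule comm_monoidI) (auto simp: mult.assoc mult.commute)
qed (auto simp: distrib_right)

interpretation UR: cring "univ_ring :: 'a::comm_ring_1 ring"
  by (rule cring_univ_ring)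

lemma univ_ring_pow [simp]: "x [^]\<^bsub>univ_ring\<^esub> (n::nat) = x ^ n"
  by (induction n) (auto simp: mult.commute)

lemma univ_ring_finsum [simp]: "finite S \<Longrightarrow> finsum univ_ring f S = sum f S"
  by (induction S rule: finite_induct) (auto)

lemma univ_ring_nat_add_pow [simp]: "[(n::nat)] \<cdot>\<^bsub>univ_ring\<^esub> x = of_nat n * x"
  by (induction n) (auto simp: algebra_simps)

definition psub :: "zpoly \<Rightarrow> (nat \<Rightarrow> zpoly) \<Rightarrow> zpoly"
  where "psub P v = pev univ_ring P v"

lemma psub_simps [simp]:
  "psub (P + Q) v = psub P v + psub Q v" "psub (P * Q) v = psub P v * psub Q v"
  "psub 0 v = 0" "psub 1 v = 1" "psub (P ^ n) v = psub P v ^ n" "psub (of_nat n) v = of_nat n"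
  "psub (pvar i) v = v i"
  "psub (P - Q) v = psub P v - psub Q v"
  "finite S \<Longrightarrow> psub (sum f S) v = (\<Sum>i\<in>S. psub (f i) v)"
  unfolding psub_def
  by (simp_all add: UR.pev_add UR.pev_mult UR.pev_power UR.pev_of_nat UR.pev_sum del: of_nat_power)
     (metis UR.pev_add UNIV_I add_diff_cancel diff_add_cancel univ_ring_simps(1,5))

text \<open>
  Every sequence in a commutative ring is the image of the sequence of variables under a ring
  homomorphism. Identities between Witt vectors therefore follow from identities between
  polynomials.
\<close>

lemma (in cring) pev_hom: "\<forall>i. v i \<in> carrier R \<Longrightarrow> ring_hom_cring univ_ring R (\<lambda>P. pev R P v)"
  by (intro ring_hom_cring.intro ring_hom_cring_axioms.intro cring_univ_ring is_cring ring_hom_memI)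
     (auto simp: pev_mult pev_add)

section \<open>Congruences modulo powers of p\<close>

lemma dvd_diff_power:
  fixes a b :: "'a::comm_ring_1"
  assumes "d dvd a - b" shows "d dvd a ^ n - b ^ n"
proof -
  have "a - b dvd a ^ n - b ^ n"
    by (cases n) (auto simp: diff_power_eq_sum simp del: power_Suc)
  then show ?thesis using assms dvd_trans by blast
qed

lemma dvd_diff_mult:
  fixes a b c d :: "'a::comm_ring_1"
  assumes "q dvd a - b" "q dvd c - d" shows "q dvd a * c - b * d"
proof -
  have "a * c - b * d = (a - b) * c + b * (c - d)" by (simp add: algebra_simps)
  then show ?thesis using assms by simp
qed

lemma dvd_diff_trans:
  fixes a b c :: "'a::comm_ring_1"
  assumes "q dvd a - b" "q dvd b - c" shows "q dvd a - c"
  using dvd_add[OF assms] by simp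

lemma dvd_diff_sym:
  fixes a b :: "'a::comm_ring_1"
  assumes "q dvd a - b" shows "q dvd b - a"
  using assms by (metis dvd_minus_iff minus_diff_eq)

text \<open>
  The quotient \<open>(a ^ p - b ^ p) / (a - b)\<close> is a sum of \<open>p\<close> products that are all congruent
  modulo \<open>p\<close>, so it contributes one more factor \<open>p\<close>.
\<close>

lemma pow_p_cong:
  fixes a b :: "'a::comm_ring_1"
  assumes d: "of_nat (p ^ Suc j) dvd a - b"
  shows "of_nat (p ^ Suc (Suc j)) dvd a ^ p - b ^ p"
proof (cases p)
  case 0
  then show ?thesis by simp
next
  case (Suc q)
  have pd: "of_nat p dvd a - b"
    using d by (metis dvd_trans of_nat_mult power_Suc dvd_triv_left)
  have A: "of_nat p dvd (\<Sum>i<Suc q. a ^ i * b ^ (q - i)) - (\<Sum>i<Suc q. b ^ i * b ^ (q - i))"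
    unfolding sum_subtractf[symmetric]
    by (intro dvd_sum dvd_diff_mult dvd_diff_power[OF pd]) auto
  have "(\<Sum>i<Suc q. b ^ i * b ^ (q - i)) = (\<Sum>i<Suc q. b ^ q)"
    by (intro sum.cong) (auto simp: power_add[symmetric])
  then have B: "of_nat p dvd (\<Sum>i<Suc q. b ^ i * b ^ (q - i))"
    using Suc by (simp del: sum.lessThan_Suc)
  from dvd_add[OF A B] have "of_nat p dvd (\<Sum>i<Suc q. a ^ i * b ^ (q - i))"
    by (simp del: sum.lessThan_Suc)
  then have "of_nat (p ^ Suc j) * of_nat p dvd (a - b) * (\<Sum>i<Suc q. a ^ i * b ^ (q - i))"
    by (intro mult_dvd_mono d)
  moreover have "a ^ p - b ^ p = (a - b) * (\<Sum>i<Suc q. a ^ i * b ^ (q - i))"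
    unfolding Suc by (rule diff_power_eq_sum)
  moreover have "of_nat (p ^ Suc (Suc j)) = of_nat (p ^ Suc j) * (of_nat p :: 'a)"
    by (simp only: power_Suc2[of p "Suc j"] of_nat_mult)
  ultimately show ?thesis by (simp only:)
qed

lemma pow_pk_cong:
  fixes a b :: "'a::comm_ring_1"
  assumes "of_nat p dvd a - b"
  shows "of_nat (p ^ Suc k) dvd a ^ (p ^ k) - b ^ (p ^ k)"
proof (induction k)
  case (Suc k)
  have "of_nat (p ^ Suc (Suc k)) dvd (a ^ (p ^ k)) ^ p - (b ^ (p ^ k)) ^ p"
    by (rule pow_p_cong[OF Suc])
  then show ?case by (simp only: power_mult[symmetric] power_Suc2[symmetric])
qed (use assms in simp)

lemma freshman_dvd:
  fixes x y :: "'a::comm_ring_1"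
  assumes "prime p"
  shows "of_nat p dvd (x + y) ^ p - (x ^ p + y ^ p)"
proof -
  obtain q where q: "p = Suc q" using assms prime_gt_0_nat by (metis gr0_implies_Suc)
  have "(x + y) ^ p = (\<Sum>k\<le>p. of_nat (p choose k) * x ^ k * y ^ (p - k))"
    by (rule binomial_ring)
  also have "\<dots> = y ^ p + (\<Sum>k<q. of_nat (p choose Suc k) * x ^ Suc k * y ^ (p - Suc k)) + x ^ p"
    unfolding q sum.atMost_Suc_shift by (simp add: lessThan_Suc_atMost[symmetric] del: binomial_Suc_Suc power_Suc)
  finally have "(x + y) ^ p - (x ^ p + y ^ p) = (\<Sum>k<q. of_nat (p choose Suc k) * x ^ Suc k * y ^ (p - Suc k))"
    by simp
  moreover have "of_nat p dvd (of_nat (p choose Suc k) :: 'a)" if "k < q" for k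
  proof -
    have "p dvd (p choose Suc k)"
      using that q assms by (intro dvd_choose_prime) auto
    then show ?thesis by (metis dvdE dvd_triv_left of_nat_mult)
  qed
  ultimately show ?thesis by (auto intro!: dvd_sum dvd_mult2)
qed

section \<open>The ghost map and the lemma of Dwork\<close>

lemma zpoly_induct [case_names one pvar add minus mult]:
  fixes P :: zpoly
  assumes one: "Q 1" and var: "\<And>i. Q (pvar i)" and add: "\<And>a b. Q a \<Longrightarrow> Q b \<Longrightarrow> Q (a + b)"
    and minus: "\<And>a b. Q a \<Longrightarrow> Q b \<Longrightarrow> Q (a - b)" and mult: "\<And>a b. Q a \<Longrightarrow> Q b \<Longrightarrow> Q (a * b)"
  shows "Q P"
proof -
  have zero: "Q 0" using minus[OF one one] by simp
  have int: "Q (of_int c)" for c :: int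
    by (induction c rule: int_induct[where k = 0]) (use zero one add minus in auto)
  have mon: "Q (Poly_Mapping.single m 1)" for m
  proof -
    obtain vs where vs: "m = (\<Sum>i\<leftarrow>vs. Poly_Mapping.single i (1::nat))" by (rule monomial_list)
    show ?thesis unfolding vs
    proof (induction vs)
      case (Cons v vs)
      then show ?case using mult[OF var[of v] Cons] by (simp add: pvar_def mult_single)
    qed (use one in simp)
  qed
  show ?thesis
  proof (induction P rule: pm_single_add_induct)
    case (single m c)
    have "of_int c * Poly_Mapping.single m 1 = Poly_Mapping.single 0 c * (Poly_Mapping.single m 1 :: zpoly)"
      by (simp add: single_of_int[symmetric])
    then have "Poly_Mapping.single m c = of_int c * (Poly_Mapping.single m 1 :: zpoly)"
      by (simp add: mult_single)
    then show ?case using mult[OF int mon] by simp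
  qed (use zero add in auto)
qed

definition frl :: "nat \<Rightarrow> zpoly \<Rightarrow> zpoly"
  where "frl p P = psub P (\<lambda>i. pvar i ^ p)"

lemma frl_cong:
  assumes p: "prime p"
  shows "of_nat p dvd frl p P - P ^ p"
proof (induction P rule: zpoly_induct)
  case (add a b)
  have "of_nat p dvd (frl p a + frl p b) - (a ^ p + b ^ p)"
    using dvd_add[OF add] by (simp add: algebra_simps)
  then show ?case unfolding frl_def psub_simps
    using dvd_diff_trans[OF _ dvd_diff_sym[OF freshman_dvd[OF p]]] by blast
next
  case (minus a b)
  have "of_nat p dvd ((a - b) + b) ^ p - ((a - b) ^ p + b ^ p)" by (rule freshman_dvd[OF p])
  then have 1: "of_nat p dvd (a ^ p - b ^ p) - (a - b) ^ p" by (simp add: algebra_simps)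
  have "of_nat p dvd (frl p a - frl p b) - (a ^ p - b ^ p)"
    using dvd_diff[OF minus] by (simp add: algebra_simps)
  then show ?case unfolding frl_def psub_simps using dvd_diff_trans[OF _ 1] by blast
next
  case (mult a b)
  then show ?case using dvd_diff_mult[OF mult] by (simp add: frl_def power_mult_distrib)
qed (auto simp: frl_def)

lemma psub_ghost: "psub (ghost p n f) v = ghost p n (\<lambda>i. psub (f i) v)"
  unfolding ghost_def by (simp del: of_nat_power)

lemma of_nat_cancel_zpoly: "p > 0 \<Longrightarrow> of_nat (p ^ n) * a = of_nat (p ^ n) * (b :: zpoly) \<Longrightarrow> a = b"
  by simp

lemma of_nat_dvd_cancel_zpoly:
  "p > 0 \<Longrightarrow> of_nat (p ^ n) * d dvd of_nat (p ^ n) * (b :: zpoly) \<Longrightarrow> d dvd b"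
  by (simp del: of_nat_power)

lemma ghost_split: "ghost p n f = (\<Sum>i<n. of_nat (p ^ i) * f i ^ (p ^ (n - i))) + of_nat (p ^ n) * f n"
  unfolding ghost_def by (simp add: lessThan_Suc_atMost[symmetric])

lemma ghost_cong: "(\<And>i. i \<le> n \<Longrightarrow> f i = g i) \<Longrightarrow> ghost p n f = ghost p n g"
  unfolding ghost_def by (auto intro!: sum.cong)

text \<open>
  Integer polynomials have no torsion, so the ghost components determine the entries one after
  the other.
\<close>

lemma ghost_inj_upto:
  assumes p: "p > 0" and e: "\<And>m. m \<le> n \<Longrightarrow> ghost p m f = ghost p m g"
  shows "i \<le> n \<Longrightarrow> f i = g i"
proof (induction i rule: less_induct)
  case (less i)
  have "(\<Sum>j<i. of_nat (p ^ j) * f j ^ (p ^ (i - j))) = (\<Sum>j<i. of_nat (p ^ j) * g j ^ (p ^ (i - j)))"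
    using less by (auto intro!: sum.cong)
  with e[OF less.prems] have "of_nat (p ^ i) * f i = of_nat (p ^ i) * g i"
    unfolding ghost_split by (simp del: of_nat_power)
  then show ?case by (rule of_nat_cancel_zpoly[OF p])
qed

lemma ghost_inj: "p > 0 \<Longrightarrow> (\<And>m. ghost p m f = ghost p m g) \<Longrightarrow> f = g"
  using ghost_inj_upto[of p] by blast

text \<open>
  The entries are changed modulo \<open>p\<close> by replacing \<open>f i ^ p\<close> with its Frobenius lift; the
  exponents and the factors \<open>p ^ i\<close> turn this into a congruence modulo the full power of \<open>p\<close>.
\<close>

lemma ghost_frl_partial:
  assumes p: "prime p"
  shows "of_nat (p ^ Suc n) dvd (\<Sum>i<Suc n. of_nat (p ^ i) * f i ^ (p ^ (Suc n - i))) - frl p (ghost p n f)"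
proof -
  have "frl p (ghost p n f) = (\<Sum>i<Suc n. of_nat (p ^ i) * frl p (f i) ^ (p ^ (n - i)))"
    unfolding frl_def psub_ghost unfolding ghost_def by (simp add: lessThan_Suc_atMost)
  moreover have "of_nat (p ^ Suc n) dvd of_nat (p ^ i) * f i ^ (p ^ (Suc n - i)) - of_nat (p ^ i) * frl p (f i) ^ (p ^ (n - i))"
    if "i < Suc n" for i
  proof -
    have "of_nat (p ^ Suc (n - i)) dvd (f i ^ p) ^ (p ^ (n - i)) - frl p (f i) ^ (p ^ (n - i))"
      by (rule pow_pk_cong[OF dvd_diff_sym[OF frl_cong[OF p]]])
    moreover have "(f i ^ p) ^ (p ^ (n - i)) = f i ^ (p ^ (Suc n - i))"
      using that by (simp add: power_mult[symmetric] Suc_diff_le)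
    ultimately have "of_nat (p ^ i) * of_nat (p ^ Suc (n - i)) dvd
      of_nat (p ^ i) * (f i ^ (p ^ (Suc n - i)) - frl p (f i) ^ (p ^ (n - i)))"
      by (intro mult_dvd_mono) auto
    moreover have "of_nat (p ^ i) * of_nat (p ^ Suc (n - i)) = (of_nat (p ^ Suc n) :: zpoly)"
    proof -
      have "p ^ i * p ^ Suc (n - i) = p ^ Suc n" using that by (simp flip: power_add)
      then show ?thesis by (metis of_nat_mult)
    qed
    ultimately show ?thesis by (simp only: right_diff_distrib)
  qed
  ultimately show ?thesis
    by (simp only: sum_subtractf[symmetric]) (auto intro!: dvd_sum simp del: power_Suc sum.lessThan_Suc)
qed

lemma ghost_frl:
  assumes p: "prime p"
  shows "of_nat (p ^ Suc n) dvd ghost p (Suc n) f - frl p (ghost p n f)"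
proof -
  have e: "ghost p (Suc n) f - frl p (ghost p n f) =
    ((\<Sum>i<Suc n. of_nat (p ^ i) * f i ^ (p ^ (Suc n - i))) - frl p (ghost p n f)) + of_nat (p ^ Suc n) * f (Suc n)"
    unfolding ghost_split[of p "Suc n"] by (simp add: algebra_simps)
  show ?thesis unfolding e by (rule dvd_add[OF ghost_frl_partial[OF p] dvd_triv_left])
qed

text \<open>
  The lemma of Dwork: the congruences between consecutive ghost components are what is needed to
  divide by \<open>p ^ n\<close> when the \<open>n\<close>-th entry is computed from the previous ones. Existence and
  uniqueness of the Witt polynomials is a special case.
\<close>

lemma dwork:
  assumes p: "prime p" and g: "\<And>n. of_nat (p ^ Suc n) dvd g (Suc n) - frl p (g n)"
  shows "\<exists>!f. \<forall>n. ghost p n f = g n"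
proof -
  have p0: "p > 0" using p by (rule prime_gt_0_nat)
  have ex: "\<exists>f. \<forall>m<n. ghost p m f = g m" for n
  proof (induction n)
    case (Suc n)
    then obtain f where f: "\<forall>m<n. ghost p m f = g m" by blast
    have "of_nat (p ^ n) dvd g n - (\<Sum>i<n. of_nat (p ^ i) * f i ^ (p ^ (n - i)))"
    proof (cases n)
      case (Suc m)
      have "ghost p m f = g m" using f Suc by simp
      then have "of_nat (p ^ Suc m) dvd frl p (g m) - (\<Sum>i<Suc m. of_nat (p ^ i) * f i ^ (p ^ (Suc m - i)))"
        using dvd_diff_sym[OF ghost_frl_partial[OF p, of m f]] by simp
      then show ?thesis unfolding Suc by (rule dvd_diff_trans[OF g])
    qed simp
    then obtain q where q: "g n - (\<Sum>i<n. of_nat (p ^ i) * f i ^ (p ^ (n - i))) = of_nat (p ^ n) * q"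
      by (rule dvdE)
    have "ghost p m (f(n := q)) = g m" if "m < Suc n" for m
    proof (cases "m = n")
      case True
      then show ?thesis using q unfolding ghost_split by (simp add: algebra_simps)
    next
      case False
      then have "ghost p m (f(n := q)) = ghost p m f" using that by (intro ghost_cong) auto
      then show ?thesis using f that False by simp
    qed
    then show ?case by blast
  qed simp
  then obtain F where F: "\<And>n m. m < n \<Longrightarrow> ghost p m (F n) = g m" by metis
  have "ghost p n (\<lambda>i. F (Suc i) i) = g n" for n
  proof -
    have "ghost p n (\<lambda>i. F (Suc i) i) = ghost p n (F (Suc n))"
    proof (rule ghost_cong)
      fix i assume "i \<le> n"
      then show "F (Suc i) i = F (Suc n) i"
        by (intro ghost_inj_upto[OF p0, of i "F (Suc i)" "F (Suc n)" i]) (auto simp: F)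
    qed
    then show ?thesis by (simp add: F)
  qed
  moreover have "f = f'" if "\<forall>n. ghost p n f = g n" "\<forall>n. ghost p n f' = g n" for f f'
    using that by (intro ghost_inj[OF p0]) auto
  ultimately show ?thesis by blast
qed

lemma frl_simps: "frl p (a + b) = frl p a + frl p b" "frl p (a * b) = frl p a * frl p b" "frl p (a - b) = frl p a - frl p b" "frl p 0 = 0"
  by (auto simp: frl_def)

lemma witt_sum_ghost:
  assumes p: "prime p"
  shows "ghost p n (witt_sum p) = ghost p n (\<lambda>i. pvar (2 * i)) + ghost p n (\<lambda>i. pvar (2 * i + 1))"
proof -
  have "\<exists>!S. \<forall>n. ghost p n S = ghost p n (\<lambda>i. pvar (2 * i)) + ghost p n (\<lambda>i. pvar (2 * i + 1))"
  proof (rule dwork[OF p])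
    fix n
    show "of_nat (p ^ Suc n) dvd ghost p (Suc n) (\<lambda>i. pvar (2 * i)) + ghost p (Suc n) (\<lambda>i. pvar (2 * i + 1)) -
          frl p (ghost p n (\<lambda>i. pvar (2 * i)) + ghost p n (\<lambda>i. pvar (2 * i + 1)))"
      unfolding frl_simps add_diff_add by (intro dvd_add ghost_frl[OF p])
  qed
  from theI'[OF this, THEN spec] show ?thesis unfolding witt_sum_def .
qed

lemma witt_prod_ghost:
  assumes p: "prime p"
  shows "ghost p n (witt_prod p) = ghost p n (\<lambda>i. pvar (2 * i)) * ghost p n (\<lambda>i. pvar (2 * i + 1))"
proof -
  have "\<exists>!S. \<forall>n. ghost p n S = ghost p n (\<lambda>i. pvar (2 * i)) * ghost p n (\<lambda>i. pvar (2 * i + 1))"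
  proof (rule dwork[OF p])
    fix n
    show "of_nat (p ^ Suc n) dvd ghost p (Suc n) (\<lambda>i. pvar (2 * i)) * ghost p (Suc n) (\<lambda>i. pvar (2 * i + 1)) -
          frl p (ghost p n (\<lambda>i. pvar (2 * i)) * ghost p n (\<lambda>i. pvar (2 * i + 1)))"
      unfolding frl_simps by (rule dvd_diff_mult[OF ghost_frl[OF p] ghost_frl[OF p]])
  qed
  from theI'[OF this, THEN spec] show ?thesis unfolding witt_prod_def .
qed

text \<open>
  The converse passage, from ghost components to entries, loses one factor \<open>p ^ n\<close>. Identities
  that hold only in characteristic \<open>p\<close> are proved in this way.
\<close>

lemma ghost_cong_imp_cong:
  assumes p: "prime p" and e: "\<And>n. of_nat (p ^ Suc n) dvd ghost p n f - ghost p n g"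
  shows "of_nat p dvd f n - g n"
proof (induction n rule: less_induct)
  case (less n)
  have "of_nat (p ^ Suc n) dvd (\<Sum>i<n. of_nat (p ^ i) * f i ^ (p ^ (n - i))) - (\<Sum>i<n. of_nat (p ^ i) * g i ^ (p ^ (n - i)))"
    unfolding sum_subtractf[symmetric]
  proof (rule dvd_sum)
    fix i assume "i \<in> {..<n}"
    then have i: "i < n" by simp
    have "of_nat (p ^ i) * of_nat (p ^ Suc (n - i)) dvd of_nat (p ^ i) * (f i ^ (p ^ (n - i)) - g i ^ (p ^ (n - i)))"
      by (rule mult_dvd_mono[OF dvd_refl pow_pk_cong[OF less[OF i]]])
    moreover have "of_nat (p ^ i) * of_nat (p ^ Suc (n - i)) = (of_nat (p ^ Suc n) :: zpoly)"
    proof -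
      have "p ^ i * p ^ Suc (n - i) = p ^ Suc n" using i by (simp flip: power_add)
      then show ?thesis by (metis of_nat_mult)
    qed
    ultimately show "of_nat (p ^ Suc n) dvd of_nat (p ^ i) * f i ^ (p ^ (n - i)) - of_nat (p ^ i) * g i ^ (p ^ (n - i))"
      by (simp only: right_diff_distrib)
  qed
  from dvd_diff[OF e[of n] this] have "of_nat (p ^ Suc n) dvd of_nat (p ^ n) * (f n - g n)"
    unfolding ghost_split by (simp add: algebra_simps del: of_nat_power power_Suc)
  then have "of_nat (p ^ n) * of_nat p dvd of_nat (p ^ n) * (f n - g n)"
    by (simp add: mult.commute)
  then show ?case by (rule of_nat_dvd_cancel_zpoly[OF prime_gt_0_nat[OF p]])
qed

section \<open>The Witt polynomials are isobaric\<close>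

definition wt :: "(nat \<Rightarrow> nat) \<Rightarrow> (nat \<Rightarrow>\<^sub>0 nat) \<Rightarrow> nat"
  where "wt w m = (\<Sum>i\<in>keys m. lookup m i * w i)"

definition homog :: "(nat \<Rightarrow> nat) \<Rightarrow> nat \<Rightarrow> zpoly \<Rightarrow> bool"
  where "homog w d P \<longleftrightarrow> (\<forall>m\<in>keys P. wt w m = d)"

lemma wt_superset: "finite S \<Longrightarrow> keys m \<subseteq> S \<Longrightarrow> wt w m = (\<Sum>i\<in>S. lookup m i * w i)"
  unfolding wt_def by (intro sum.mono_neutral_left) (auto simp: in_keys_iff)

lemma wt_add: "wt w (m + m') = wt w m + wt w m'"
proof -
  let ?S = "keys m \<union> keys m'"
  have "wt w (m + m') = (\<Sum>i\<in>?S. lookup (m + m') i * w i)"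
    using keys_add[of m m'] by (intro wt_superset) auto
  then show ?thesis
    by (simp add: wt_superset[of ?S] lookup_add distrib_right sum.distrib)
qed

lemma wt_monomial_list: "wt w (\<Sum>i\<leftarrow>vs. Poly_Mapping.single i 1) = (\<Sum>i\<leftarrow>vs. w i)"
  by (induction vs) (auto simp: wt_add, auto simp: wt_def)

lemma homog_add: "homog w d P \<Longrightarrow> homog w d Q \<Longrightarrow> homog w d (P + Q)"
  unfolding homog_def by (meson Un_iff keys_add subsetD)

lemma homog_minus: "homog w d P \<Longrightarrow> homog w d Q \<Longrightarrow> homog w d (P - Q)"
  using homog_add[of w d P "- Q"] by (simp add: homog_def)

lemma homog_mult: "homog w d P \<Longrightarrow> homog w e Q \<Longrightarrow> homog w (d + e) (P * Q)"
  unfolding homog_def by (auto dest!: set_mp[OF keys_mult] simp: wt_add)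

lemma homog_of_nat: "homog w 0 (of_nat n)"
  unfolding homog_def by (auto simp: single_of_nat[symmetric] wt_def simp del: single_of_nat)

lemma homog_power: "homog w d P \<Longrightarrow> homog w (n * d) (P ^ n)"
proof (induction n)
  case 0
  then show ?case using homog_of_nat[of w 1] by simp
next
  case (Suc n)
  then show ?case using homog_mult[of w d P "n * d" "P ^ n"] by simp
qed

lemma homog_sum: "finite S \<Longrightarrow> (\<And>i. i \<in> S \<Longrightarrow> homog w d (f i)) \<Longrightarrow> homog w d (sum f S)"
  by (induction S rule: finite_induct) (auto intro: homog_add, auto simp: homog_def)

lemma homog_cancel:
  assumes "c > 0" "homog w d (of_nat c * P)" shows "homog w d P"
proof -
  have "of_nat c * P = Poly_Mapping.map ((*) (int c)) P"
    by (simp add: mult_map_scale_conv_mult flip: single_of_nat)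
  then have "lookup (of_nat c * P) m = int c * lookup P m" for m
    by (simp add: map.rep_eq when_def)
  then have "keys (of_nat c * P) = keys P" using assms by (auto simp: in_keys_iff)
  then show ?thesis using assms by (simp add: homog_def)
qed

lemma homog_pvar: "homog w (w i) (pvar i)"
  by (simp add: homog_def pvar_def wt_def)

lemma homog_ghost_term:
  assumes "homog w (p ^ i) P" "i \<le> n"
  shows "homog w (p ^ n) (of_nat (p ^ i) * P ^ (p ^ (n - i)))"
  using homog_mult[OF homog_of_nat[of w "p ^ i"] homog_power[OF assms(1), of "p ^ (n - i)"]] assms(2)
  by (simp add: power_add[symmetric] del: of_nat_power)

lemma homog_ghost:
  assumes "\<And>i. homog w (p ^ i) (f i)" shows "homog w (p ^ n) (ghost p n f)"
  unfolding ghost_def by (intro homog_sum homog_ghost_term assms) auto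

text \<open>
  Weights of the entries are read off from the ghost components because \<open>p ^ n\<close> is not a zero
  divisor.
\<close>

lemma homog_of_ghost:
  assumes p: "p > 0" and "\<And>n. homog w (p ^ n) (ghost p n f)"
  shows "homog w (p ^ n) (f n)"
proof (induction n rule: less_induct)
  case (less n)
  have "homog w (p ^ n) (ghost p n f - (\<Sum>i<n. of_nat (p ^ i) * f i ^ (p ^ (n - i))))"
    using less by (intro homog_minus assms homog_sum homog_ghost_term) auto
  then have "homog w (p ^ n) (of_nat (p ^ n) * f n)" unfolding ghost_split by (simp del: of_nat_power)
  then show ?case by (rule homog_cancel[rotated]) (simp add: p)
qed

lemma homog_witt_sum:
  assumes p: "prime p" shows "homog (\<lambda>i. p ^ (i div 2)) (p ^ n) (witt_sum p n)"
proof (rule homog_of_ghost[OF prime_gt_0_nat[OF p]])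
  fix n
  have "homog (\<lambda>i. p ^ (i div 2)) (p ^ i) (pvar (2 * i))" "homog (\<lambda>i. p ^ (i div 2)) (p ^ i) (pvar (2 * i + 1))" for i
    using homog_pvar[of "\<lambda>i. p ^ (i div 2)" "2 * i"] homog_pvar[of "\<lambda>i. p ^ (i div 2)" "2 * i + 1"] by auto
  then show "homog (\<lambda>i. p ^ (i div 2)) (p ^ n) (ghost p n (witt_sum p))"
    unfolding witt_sum_ghost[OF p] by (intro homog_add homog_ghost) auto
qed

text \<open>
  The multiplication polynomials are isobaric in the \<open>X\<close> variables and in the \<open>Y\<close> variables
  separately. This is why scalars, which have degree zero, may be substituted for the \<open>X\<close>
  variables.
\<close>

lemma homog_witt_prod:
  assumes p: "prime p"
  shows "homog (\<lambda>i. if even i then p ^ (i div 2) else 0) (p ^ n) (witt_prod p n)"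
    and "homog (\<lambda>i. if odd i then p ^ (i div 2) else 0) (p ^ n) (witt_prod p n)"
proof -
  have z: "homog w 0 (ghost p n f)" if "\<And>i. homog w 0 (f i)" for w n f
    unfolding ghost_def
  proof (intro homog_sum)
    fix i
    show "homog w 0 (of_nat (p ^ i) * f i ^ p ^ (n - i))"
      using homog_mult[OF homog_of_nat homog_power[OF that]] by (metis add_0 mult_0_right)
  qed auto
  let ?w = "\<lambda>i. if even i then p ^ (i div 2) else (0::nat)"
  have "homog ?w (p ^ i) (pvar (2 * i))" "homog ?w 0 (pvar (2 * i + 1))" for i
    using homog_pvar[of ?w "2 * i"] homog_pvar[of ?w "2 * i + 1"] by auto
  then have "homog ?w (p ^ n + 0) (ghost p n (witt_prod p))" for n
    unfolding witt_prod_ghost[OF p] by (intro homog_mult homog_ghost z) auto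
  then show "homog ?w (p ^ n) (witt_prod p n)"
    using homog_of_ghost[OF prime_gt_0_nat[OF p], of ?w "witt_prod p"] by simp
  let ?w = "\<lambda>i. if odd i then p ^ (i div 2) else (0::nat)"
  have "homog ?w 0 (pvar (2 * i))" "homog ?w (p ^ i) (pvar (2 * i + 1))" for i
    using homog_pvar[of ?w "2 * i"] homog_pvar[of ?w "2 * i + 1"] by auto
  then have "homog ?w (0 + p ^ n) (ghost p n (witt_prod p))" for n
    unfolding witt_prod_ghost[OF p] by (intro homog_mult homog_ghost z) auto
  then show "homog ?w (p ^ n) (witt_prod p n)"
    using homog_of_ghost[OF prime_gt_0_nat[OF p], of ?w "witt_prod p"] by simp
qed

section \<open>The ring of Witt vectors\<close>

definition wadd :: "nat \<Rightarrow> ('a, 'x) ring_scheme \<Rightarrow> (nat \<Rightarrow> 'a) \<Rightarrow> (nat \<Rightarrow> 'a) \<Rightarrow> nat \<Rightarrow> 'a"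
  where "wadd p R a b = (\<lambda>i. peval R (witt_sum p i) a b)"

definition wmul :: "nat \<Rightarrow> ('a, 'x) ring_scheme \<Rightarrow> (nat \<Rightarrow> 'a) \<Rightarrow> (nat \<Rightarrow> 'a) \<Rightarrow> nat \<Rightarrow> 'a"
  where "wmul p R a b = (\<lambda>i. peval R (witt_prod p i) a b)"

definition vshift :: "'a \<Rightarrow> (nat \<Rightarrow> 'a) \<Rightarrow> nat \<Rightarrow> 'a"
  where "vshift z a = (\<lambda>i. case i of 0 \<Rightarrow> z | Suc m \<Rightarrow> a m)"

definition wfr :: "nat \<Rightarrow> ('a, 'x) ring_scheme \<Rightarrow> (nat \<Rightarrow> 'a) \<Rightarrow> nat \<Rightarrow> 'a"
  where "wfr p R a = (\<lambda>i. a i [^]\<^bsub>R\<^esub> p)"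

lemma wfrob_eq: "wfrob p k = wfr p k"
  by (auto simp: wfrob_def wfr_def)

lemma vshift_simps [simp]: "vshift z a 0 = z" "vshift z a (Suc i) = a i"
  by (auto simp: vshift_def)

lemma ilv_simps [simp]: "ilv a b (2 * i) = a i" "ilv a b (Suc (2 * i)) = b i"
  by (auto simp: ilv_def)

lemma ilv_comp: "h \<circ> ilv a b = ilv (h \<circ> a) (h \<circ> b)"
  by (auto simp: ilv_def)

lemma ilv_carrier: "\<forall>i. a i \<in> A \<Longrightarrow> \<forall>i. b i \<in> A \<Longrightarrow> \<forall>i. ilv a b i \<in> A"
  by (auto simp: ilv_def)

lemma (in ring_hom_cring) hom_peval:
  assumes "\<forall>i. x i \<in> carrier R" "\<forall>i. y i \<in> carrier R"
  shows "h (peval R P x y) = peval S P (h \<circ> x) (h \<circ> y)"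
  unfolding peval_pev using assms by (simp add: hom_pev ilv_carrier ilv_comp)

lemma (in ring_hom_cring) hom_wadd:
  assumes "\<forall>i. x i \<in> carrier R" "\<forall>i. y i \<in> carrier R"
  shows "h \<circ> wadd p R x y = wadd p S (h \<circ> x) (h \<circ> y)"
  using assms by (auto simp: wadd_def hom_peval)

lemma (in ring_hom_cring) hom_wmul:
  assumes "\<forall>i. x i \<in> carrier R" "\<forall>i. y i \<in> carrier R"
  shows "h \<circ> wmul p R x y = wmul p S (h \<circ> x) (h \<circ> y)"
  using assms by (auto simp: wmul_def hom_peval)

lemma (in ring_hom_cring) hom_nat_add_pow:
  assumes "x \<in> carrier R" shows "h ([(n::nat)] \<cdot> x) = [n] \<cdot>\<^bsub>S\<^esub> h x"
  using assms by (induction n) auto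

lemma (in cring) peval_closed [simp]:
  "\<forall>i. x i \<in> carrier R \<Longrightarrow> \<forall>i. y i \<in> carrier R \<Longrightarrow> peval R P x y \<in> carrier R"
  by (simp add: peval_pev ilv_carrier)

lemma (in cring) wadd_closed [simp]:
  "\<forall>i. x i \<in> carrier R \<Longrightarrow> \<forall>i. y i \<in> carrier R \<Longrightarrow> wadd p R x y i \<in> carrier R"
  by (simp add: wadd_def)

lemma (in cring) wmul_closed [simp]:
  "\<forall>i. x i \<in> carrier R \<Longrightarrow> \<forall>i. y i \<in> carrier R \<Longrightarrow> wmul p R x y i \<in> carrier R"
  by (simp add: wmul_def)

lemma peval_univ: "peval univ_ring P x y = psub P (ilv x y)"
  by (simp add: peval_pev psub_def)

context
  fixes p :: nat
  assumes p: "prime p"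
begin

lemma p_pos: "p > 0" using p by (rule prime_gt_0_nat)

lemma ghost_zadd: "ghost p n (wadd p univ_ring X Y) = ghost p n X + ghost p n Y"
proof -
  have "ghost p n (wadd p univ_ring X Y) = psub (ghost p n (witt_sum p)) (ilv X Y)"
    by (simp add: psub_ghost wadd_def peval_univ)
  then show ?thesis by (simp add: witt_sum_ghost[OF p] psub_ghost)
qed

lemma ghost_zmul: "ghost p n (wmul p univ_ring X Y) = ghost p n X * ghost p n Y"
proof -
  have "ghost p n (wmul p univ_ring X Y) = psub (ghost p n (witt_prod p)) (ilv X Y)"
    by (simp add: psub_ghost wmul_def peval_univ)
  then show ?thesis by (simp add: witt_prod_ghost[OF p] psub_ghost)
qed

lemma ghost_0: "ghost p n (\<lambda>i. 0) = 0"
  using p_pos by (auto simp: ghost_def zero_power intro!: sum.neutral)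

lemma ghost_1: "ghost p n (\<lambda>i. if i = 0 then 1 else 0) = 1"
proof -
  have "ghost p n (\<lambda>i. if i = 0 then 1 else 0) = (\<Sum>i\<le>n. if i = 0 then 1 else 0)"
    unfolding ghost_def using p_pos by (intro sum.cong) auto
  then show ?thesis by simp
qed

lemma ghost_vshift_0: "ghost p 0 (vshift 0 X) = 0"
  by (simp add: ghost_def)

lemma ghost_vshift_Suc: "ghost p (Suc n) (vshift 0 X) = of_nat p * ghost p n X"
  unfolding ghost_def sum.atMost_Suc_shift using p_pos
  by (simp add: sum_distrib_left mult.assoc)

lemma ghost_wfr: "ghost p n (wfr p univ_ring X) = ghost p (Suc n) X - of_nat (p ^ Suc n) * X (Suc n)"
proof -
  have "ghost p n (wfr p univ_ring X) = (\<Sum>i<Suc n. of_nat (p ^ i) * X i ^ (p ^ (Suc n - i)))"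
    unfolding ghost_def wfr_def lessThan_Suc_atMost
    by (intro sum.cong) (auto simp: power_mult[symmetric] Suc_diff_le)
  then show ?thesis unfolding ghost_split[of p "Suc n"] by (simp del: of_nat_power)
qed

lemmas zghost = ghost_zadd ghost_zmul ghost_0 ghost_1

lemma zadd_neg_ex: "\<exists>N :: nat \<Rightarrow> zpoly. wadd p univ_ring N X = (\<lambda>i. 0)"
proof -
  have "\<exists>!N. \<forall>n. ghost p n N = 0 - ghost p n X"
  proof (rule dwork[OF p])
    fix n
    have "of_nat (p ^ Suc n) dvd - (ghost p (Suc n) X - frl p (ghost p n X))"
      using ghost_frl[OF p] by (simp only: dvd_minus_iff)
    then show "of_nat (p ^ Suc n) dvd 0 - ghost p (Suc n) X - frl p (0 - ghost p n X)"
      by (simp only: frl_simps) (simp add: algebra_simps)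
  qed
  then obtain N where "\<forall>n. ghost p n N = 0 - ghost p n X" by blast
  then have "wadd p univ_ring N X = (\<lambda>i. 0)"
    by (intro ghost_inj[OF p_pos]) (simp add: zghost)
  then show ?thesis by blast
qed

text \<open>
  Any three Witt vectors over \<open>R\<close> come from Witt vectors over a polynomial ring, where the ghost
  map is injective.
\<close>

lemma witt_generic:
  fixes a b c :: "nat \<Rightarrow> 'a"
  assumes R: "cring R" and a: "\<forall>i. a i \<in> carrier R" and b: "\<forall>i. b i \<in> carrier R" and c: "\<forall>i. c i \<in> carrier R"
  obtains h X Y Z where "ring_hom_cring univ_ring R h" "a = h \<circ> X" "b = h \<circ> Y" "c = h \<circ> (Z :: nat \<Rightarrow> zpoly)"
proof -
  interpret R: cring R by (rule R)
  \<comment> \<open>the three sequences are interleaved to the values of a single sequence of variables\<close>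
  define v where "v i = (if i mod 3 = 0 then a (i div 3) else if i mod 3 = 1 then b (i div 3) else c (i div 3))" for i
  have v: "\<forall>i. v i \<in> carrier R" using a b c by (auto simp: v_def)
  have "v (3 * i) = a i" "v (3 * i + 1) = b i" "v (3 * i + 2) = c i" for i
  proof -
    have "(3 * i + 1) div 3 = i" "(3 * i + 2) div 3 = i" "(3 * i + 1) mod 3 = 1" "(3 * i + 2) mod 3 = 2"
      by presburger+
    then show "v (3 * i) = a i" "v (3 * i + 1) = b i" "v (3 * i + 2) = c i"
      by (simp_all add: v_def del: add_2_eq_Suc' One_nat_def add_Suc_right)
  qed
  then have "a = (\<lambda>P. pev R P v) \<circ> (\<lambda>i. pvar (3 * i))" "b = (\<lambda>P. pev R P v) \<circ> (\<lambda>i. pvar (3 * i + 1))"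
    "c = (\<lambda>P. pev R P v) \<circ> (\<lambda>i. pvar (3 * i + 2))"
    using v by (auto simp: fun_eq_iff simp del: add_2_eq_Suc' One_nat_def add_Suc_right)
  then show ?thesis using that R.pev_hom[OF v] by blast
qed

lemma hom_zadd: "ring_hom_cring univ_ring R h \<Longrightarrow> wadd p R (h \<circ> X) (h \<circ> Y) = h \<circ> wadd p univ_ring X Y"
  by (subst ring_hom_cring.hom_wadd) auto

lemma hom_zmul: "ring_hom_cring univ_ring R h \<Longrightarrow> wmul p R (h \<circ> X) (h \<circ> Y) = h \<circ> wmul p univ_ring X Y"
  by (subst ring_hom_cring.hom_wmul) auto

lemma hom_01:
  assumes "ring_hom_cring univ_ring R h" shows "h 0 = \<zero>\<^bsub>R\<^esub>" "h 1 = \<one>\<^bsub>R\<^esub>"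
  using ring_hom_cring.hom_zero[OF assms] ring_hom_one[OF ring_hom_cring.homh[OF assms]] by simp_all

lemma hom_z0: "ring_hom_cring univ_ring R h \<Longrightarrow> (\<lambda>i. \<zero>\<^bsub>R\<^esub>) = h \<circ> (\<lambda>i. 0)"
  by (simp add: fun_eq_iff hom_01)

lemma hom_z1: "ring_hom_cring univ_ring R h \<Longrightarrow> (\<lambda>i. if i = 0 then \<one>\<^bsub>R\<^esub> else \<zero>\<^bsub>R\<^esub>) = h \<circ> (\<lambda>i. if i = 0 then 1 else 0)"
  by (simp add: fun_eq_iff hom_01)

lemma hom_vshift: "ring_hom_cring univ_ring R h \<Longrightarrow> vshift \<zero>\<^bsub>R\<^esub> (h \<circ> X) = h \<circ> vshift 0 X"
  by (simp add: fun_eq_iff hom_01 vshift_def split: nat.splits)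

lemma hom_wfr: "ring_hom_cring univ_ring R h \<Longrightarrow> wfr p R (h \<circ> X) = h \<circ> wfr p univ_ring X"
  using ring_hom_cring.hom_pow[of univ_ring R h _ p] by (auto simp: wfr_def fun_eq_iff)

lemmas hom_z = hom_zadd hom_zmul hom_z0 hom_z1 hom_vshift hom_wfr

lemma witt_ring_simps [simp]:
  "carrier (witt_ring p R) = {a. \<forall>i. a i \<in> carrier R}"
  "x \<oplus>\<^bsub>witt_ring p R\<^esub> y = wadd p R x y"
  "x \<otimes>\<^bsub>witt_ring p R\<^esub> y = wmul p R x y"
  "\<zero>\<^bsub>witt_ring p R\<^esub> = (\<lambda>i. \<zero>\<^bsub>R\<^esub>)"
  "\<one>\<^bsub>witt_ring p R\<^esub> = (\<lambda>i. if i = 0 then \<one>\<^bsub>R\<^esub> else \<zero>\<^bsub>R\<^esub>)"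
  by (auto simp: witt_ring_def wadd_def wmul_def)

text \<open>
  The ring axioms hold for the ghost components and so over polynomial rings, hence everywhere.
\<close>

lemma cring_witt_ring:
  assumes R: "cring R" shows "cring (witt_ring p R)"
proof -
  interpret R: cring R by (rule R)
  note gen = witt_generic[OF R]
  have assoc: "wadd p R (wadd p R a b) c = wadd p R a (wadd p R b c)"
    "wmul p R (wmul p R a b) c = wmul p R a (wmul p R b c)"
    "wmul p R (wadd p R a b) c = wadd p R (wmul p R a c) (wmul p R b c)"
    "wadd p R a b = wadd p R b a" "wmul p R a b = wmul p R b a"
    "wadd p R (\<lambda>i. \<zero>\<^bsub>R\<^esub>) a = a" "wmul p R (\<lambda>i. if i = 0 then \<one>\<^bsub>R\<^esub> else \<zero>\<^bsub>R\<^esub>) a = a"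
    "\<exists>d\<in>{x. \<forall>i. x i \<in> carrier R}. wadd p R d a = (\<lambda>i. \<zero>\<^bsub>R\<^esub>)"
    if abc: "\<forall>i. a i \<in> carrier R" "\<forall>i. b i \<in> carrier R" "\<forall>i. c i \<in> carrier R" for a b c
  proof -
    obtain h X Y Z where h: "ring_hom_cring univ_ring R h" and e: "a = h \<circ> X" "b = h \<circ> Y" "c = h \<circ> (Z :: nat \<Rightarrow> zpoly)"
      using gen[OF abc] by blast
    show "wadd p R (wadd p R a b) c = wadd p R a (wadd p R b c)"
      unfolding e hom_z[OF h] by (intro arg_cong2[of _ _ _ _ "(\<circ>)"] refl ghost_inj[OF p_pos]) (simp add: zghost algebra_simps)
    show "wmul p R (wmul p R a b) c = wmul p R a (wmul p R b c)"
      unfolding e hom_z[OF h] by (intro arg_cong2[of _ _ _ _ "(\<circ>)"] refl ghost_inj[OF p_pos]) (simp add: zghost algebra_simps)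
    show "wmul p R (wadd p R a b) c = wadd p R (wmul p R a c) (wmul p R b c)"
      unfolding e hom_z[OF h] by (intro arg_cong2[of _ _ _ _ "(\<circ>)"] refl ghost_inj[OF p_pos]) (simp add: zghost algebra_simps)
    show "wadd p R a b = wadd p R b a"
      unfolding e hom_z[OF h] by (intro arg_cong2[of _ _ _ _ "(\<circ>)"] refl ghost_inj[OF p_pos]) (simp add: zghost algebra_simps)
    show "wmul p R a b = wmul p R b a"
      unfolding e hom_z[OF h] by (intro arg_cong2[of _ _ _ _ "(\<circ>)"] refl ghost_inj[OF p_pos]) (simp add: zghost algebra_simps)
    show "wadd p R (\<lambda>i. \<zero>\<^bsub>R\<^esub>) a = a"
      unfolding e hom_z[OF h] by (intro arg_cong2[of _ _ _ _ "(\<circ>)"] refl ghost_inj[OF p_pos]) (simp add: zghost algebra_simps)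
    show "wmul p R (\<lambda>i. if i = 0 then \<one>\<^bsub>R\<^esub> else \<zero>\<^bsub>R\<^esub>) a = a"
      unfolding e hom_z[OF h] by (intro arg_cong2[of _ _ _ _ "(\<circ>)"] refl ghost_inj[OF p_pos]) (simp add: zghost algebra_simps)
    obtain N where N: "wadd p univ_ring N X = (\<lambda>i. 0)" using zadd_neg_ex by blast
    interpret h: ring_hom_cring univ_ring R h by (rule h)
    show "\<exists>d\<in>{x. \<forall>i. x i \<in> carrier R}. wadd p R d a = (\<lambda>i. \<zero>\<^bsub>R\<^esub>)"
      unfolding e by (rule bexI[of _ "h \<circ> N"], unfold hom_z[OF h] N) auto
  qed
  show ?thesis
  proof (rule cringI)
    show "abelian_group (witt_ring p R)"
      by (rule abelian_groupI) (use assoc in auto)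
    show "comm_monoid (witt_ring p R)"
      by (rule comm_monoidI) (use assoc in auto)
  qed (use assoc in auto)
qed

lemma wadd_vshift:
  assumes R: "cring R" and ab: "\<forall>i. a i \<in> carrier R" "\<forall>i. b i \<in> carrier R"
  shows "wadd p R (vshift \<zero>\<^bsub>R\<^esub> a) (vshift \<zero>\<^bsub>R\<^esub> b) = vshift \<zero>\<^bsub>R\<^esub> (wadd p R a b)"
proof -
  obtain h X Y Z where h: "ring_hom_cring univ_ring R h" and e: "a = h \<circ> X" "b = h \<circ> Y" "b = h \<circ> (Z :: nat \<Rightarrow> zpoly)"
    using witt_generic[OF R ab ab(2)] by blast
  have "wadd p univ_ring (vshift 0 X) (vshift 0 Y) = vshift 0 (wadd p univ_ring X Y)"
  proof (rule ghost_inj[OF p_pos])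
    fix m
    show "ghost p m (wadd p univ_ring (vshift 0 X) (vshift 0 Y)) = ghost p m (vshift 0 (wadd p univ_ring X Y))"
      by (cases m) (simp_all add: zghost ghost_vshift_0 ghost_vshift_Suc algebra_simps)
  qed
  then show ?thesis unfolding e(1,2) hom_z[OF h] by simp
qed

context
  fixes R (structure)
  assumes R: "cring R" and char: "[p] \<cdot> \<one> = \<zero>"
begin

interpretation R: cring R by (rule R)

lemma charp_pev_eq:
  assumes v: "\<forall>i. v i \<in> carrier R" and d: "of_nat p dvd P - Q"
  shows "pev R P v = pev R Q v"
proof -
  obtain T where "P - Q = of_nat p * T" using d by (rule dvdE)
  then have "P = of_nat p * T + Q" by (simp add: algebra_simps)
  then show ?thesis using v by (simp add: R.pev_add R.pev_mult R.pev_of_nat char)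
qed

lemma charp_hom_eq:
  assumes h: "ring_hom_cring univ_ring R h" and d: "of_nat p dvd P - (Q :: zpoly)"
  shows "h P = h Q"
proof -
  interpret h: ring_hom_cring univ_ring R h by (rule h)
  obtain T where "P - Q = of_nat p * T" using d by (rule dvdE)
  then have "P = of_nat p * T + Q" by (simp add: algebra_simps)
  then have "h P = h (of_nat p * T) \<oplus> h Q" using h.hom_add[of "of_nat p * T" Q] by simp
  also have "h (of_nat p * T) = h (of_nat p) \<otimes> h T" using h.hom_mult[of "of_nat p" T] by simp
  also have "h (of_nat p) = \<zero>" using h.hom_nat_add_pow[of 1 p] char h.hom_one by simp
  finally show ?thesis by simp
qed

lemma charp_hom_fun:
  assumes h: "ring_hom_cring univ_ring R h" and d: "\<And>n. of_nat p dvd X n - (Y n :: zpoly)"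
  shows "h \<circ> X = h \<circ> Y"
proof
  fix n show "(h \<circ> X) n = (h \<circ> Y) n" using charp_hom_eq[OF h d] by simp
qed

lemma frobenius_add:
  assumes "x \<in> carrier R" "y \<in> carrier R"
  shows "(x \<oplus> y) [^] p = x [^] p \<oplus> y [^] p"
proof -
  define v where "v = (\<lambda>i::nat. if i = 0 then x else y)"
  have v: "\<forall>i. v i \<in> carrier R" "v 0 = x" "v 1 = y" using assms by (auto simp: v_def)
  have "pev R ((pvar 0 + pvar 1) ^ p) v = pev R (pvar 0 ^ p + pvar 1 ^ p) v"
    by (rule charp_pev_eq[OF v(1) freshman_dvd[OF p]])
  then show ?thesis using v by (simp add: R.pev_power R.pev_add)
qed

lemma frobenius_hom: "ring_hom_cring R R (\<lambda>x. x [^] p)"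
  using p_pos by (intro ring_hom_cring.intro ring_hom_cring_axioms.intro R ring_hom_memI)
     (auto simp: frobenius_add R.nat_pow_distrib)

lemma wfr_wadd:
  assumes "\<forall>i. a i \<in> carrier R" "\<forall>i. b i \<in> carrier R"
  shows "wfr p R (wadd p R a b) = wadd p R (wfr p R a) (wfr p R b)"
  using ring_hom_cring.hom_wadd[OF frobenius_hom assms, of p] by (simp add: wfr_def o_def)

lemma wfr_wmul:
  assumes "\<forall>i. a i \<in> carrier R" "\<forall>i. b i \<in> carrier R"
  shows "wfr p R (wmul p R a b) = wmul p R (wfr p R a) (wfr p R b)"
  using ring_hom_cring.hom_wmul[OF frobenius_hom assms, of p] by (simp add: wfr_def o_def)

text \<open>
  The projection formula \<open>a \<cdot> V b = V (F a \<cdot> b)\<close>. Since \<open>F\<close> is computed entrywise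
  here, it is true in characteristic \<open>p\<close> only.
\<close>

lemma wmul_vshift:
  assumes ab: "\<forall>i. a i \<in> carrier R" "\<forall>i. b i \<in> carrier R"
  shows "wmul p R a (vshift \<zero> b) = vshift \<zero> (wmul p R (wfr p R a) b)"
proof -
  obtain h X Y Z where h: "ring_hom_cring univ_ring R h" and e: "a = h \<circ> X" "b = h \<circ> Y" "b = h \<circ> (Z :: nat \<Rightarrow> zpoly)"
    using witt_generic[OF R ab ab(2)] by blast
  have "of_nat p dvd wmul p univ_ring X (vshift 0 Y) n - vshift 0 (wmul p univ_ring (wfr p univ_ring X) Y) n" for n
  proof (rule ghost_cong_imp_cong[OF p])
    fix m
    show "of_nat (p ^ Suc m) dvd ghost p m (wmul p univ_ring X (vshift 0 Y)) - ghost p m (vshift 0 (wmul p univ_ring (wfr p univ_ring X) Y))"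
    proof (cases m)
      case (Suc n)
      have "ghost p m (wmul p univ_ring X (vshift 0 Y)) - ghost p m (vshift 0 (wmul p univ_ring (wfr p univ_ring X) Y))
        = of_nat p * (of_nat (p ^ m) * (X m * ghost p n Y))"
        by (simp add: Suc zghost ghost_vshift_Suc ghost_wfr algebra_simps del: of_nat_power power_Suc)
      also have "\<dots> = of_nat (p ^ Suc m) * (X m * ghost p n Y)" by simp
      finally show ?thesis by (simp only: dvd_triv_left)
    qed (simp add: zghost ghost_vshift_0)
  qed
  then show ?thesis unfolding e(1,2) hom_z[OF h] by (rule charp_hom_fun[OF h])
qed

text \<open>
  Over a ring of characteristic \<open>p\<close>, multiplication by \<open>p\<close> is \<open>VF\<close>.
\<close>

lemma witt_p_mult:
  assumes a: "\<forall>i. a i \<in> carrier R"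
  shows "[p] \<cdot>\<^bsub>witt_ring p R\<^esub> a = vshift \<zero> (wfr p R a)"
proof -
  obtain h X Y Z where h: "ring_hom_cring univ_ring R h" and e: "a = h \<circ> X" "a = h \<circ> Y" "a = h \<circ> (Z :: nat \<Rightarrow> zpoly)"
    using witt_generic[OF R a a a] by blast
  interpret h: ring_hom_cring univ_ring R h by (rule h)
  interpret ZW: cring "witt_ring p (univ_ring :: zpoly ring)" by (rule cring_witt_ring[OF cring_univ_ring])
  interpret RW: cring "witt_ring p R" by (rule cring_witt_ring[OF R])
  have "ring_hom_cring (witt_ring p univ_ring) (witt_ring p R) ((\<circ>) h)"
    by (intro ring_hom_cring.intro ring_hom_cring_axioms.intro ZW.is_cring RW.is_cring ring_hom_memI)
      (auto simp: hom_z[OF h])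
  from ring_hom_cring.hom_nat_add_pow[OF this, of X p]
  have 1: "[p] \<cdot>\<^bsub>witt_ring p R\<^esub> a = h \<circ> ([p] \<cdot>\<^bsub>witt_ring p univ_ring\<^esub> X)" by (simp add: e)
  have g: "ghost p n ([(m::nat)] \<cdot>\<^bsub>witt_ring p univ_ring\<^esub> X) = of_nat m * ghost p n X" for m n
    by (induction m) (auto simp: zghost algebra_simps)
  have "of_nat p dvd ([p] \<cdot>\<^bsub>witt_ring p univ_ring\<^esub> X) n - vshift 0 (wfr p univ_ring X) n" for n
  proof (rule ghost_cong_imp_cong[OF p])
    fix m
    show "of_nat (p ^ Suc m) dvd ghost p m ([p] \<cdot>\<^bsub>witt_ring p univ_ring\<^esub> X) - ghost p m (vshift 0 (wfr p univ_ring X))"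
    proof (cases m)
      case 0
      then show ?thesis by (simp add: g ghost_vshift_0)
    next
      case (Suc n)
      have "ghost p m ([p] \<cdot>\<^bsub>witt_ring p univ_ring\<^esub> X) - ghost p m (vshift 0 (wfr p univ_ring X))
        = of_nat p * (of_nat (p ^ m) * X m)"
        by (simp add: Suc g ghost_vshift_Suc ghost_wfr algebra_simps del: of_nat_power power_Suc)
      also have "\<dots> = of_nat (p ^ Suc m) * X m" by simp
      finally show ?thesis by (simp only: dvd_triv_left)
    qed
  qed
  then have "h \<circ> ([p] \<cdot>\<^bsub>witt_ring p univ_ring\<^esub> X) = h \<circ> vshift 0 (wfr p univ_ring X)"
    by (rule charp_hom_fun[OF h])
  with 1 have "[p] \<cdot>\<^bsub>witt_ring p R\<^esub> a = h \<circ> vshift 0 (wfr p univ_ring X)" by simp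
  also have "\<dots> = vshift \<zero> (wfr p R a)" unfolding e(1) hom_z[OF h] ..
  finally show ?thesis .
qed

lemma wfr_vshift: "wfr p R (vshift \<zero> a) = vshift \<zero> (wfr p R a)"
  using p_pos by (auto simp: wfr_def vshift_def R.nat_pow_zero fun_eq_iff split: nat.splits)

end

end

section \<open>Modules represented by a relation\<close>

lemma mod_on_simps [simp]:
  "carrier (mod_on K A z pl sm) = A" "\<zero>\<^bsub>mod_on K A z pl sm\<^esub> = z"
  "x \<in> A \<Longrightarrow> y \<in> A \<Longrightarrow> x \<oplus>\<^bsub>mod_on K A z pl sm\<^esub> y = pl x y"
  "r \<in> carrier K \<Longrightarrow> x \<in> A \<Longrightarrow> r \<odot>\<^bsub>mod_on K A z pl sm\<^esub> x = sm r x"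
  by (auto simp: mod_on_def)

text \<open>
  The elements of \<open>C\<close> are represented by elements of a module \<open>N\<close>, generally in many ways,
  compatibly with the operations. The set of all representatives need not be a set with a
  convenient description, so no submodule or quotient of \<open>N\<close> is formed; the module axioms are
  nevertheless inherited by \<open>C\<close>.
\<close>

locale represented =
  fixes K :: "('k, 'r) ring_scheme" and N :: "('k, 'n, 'x) module_scheme"
    and \<rho> :: "'n \<Rightarrow> 'a \<Rightarrow> bool" and C :: "'a set"
    and z :: 'a and pl :: "'a \<Rightarrow> 'a \<Rightarrow> 'a" and sm :: "'k \<Rightarrow> 'a \<Rightarrow> 'a"
  assumes N: "Module.module K N"
    and rep_ex: "\<And>a. a \<in> C \<Longrightarrow> \<exists>x. \<rho> x a"
    and rep_in: "\<And>x a. \<rho> x a \<Longrightarrow> x \<in> carrier N \<and> a \<in> C"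
    and rep_fun: "\<And>x a b. \<rho> x a \<Longrightarrow> \<rho> x b \<Longrightarrow> a = b"
    and rep_zero: "\<rho> \<zero>\<^bsub>N\<^esub> z"
    and rep_add: "\<And>x a y b. \<rho> x a \<Longrightarrow> \<rho> y b \<Longrightarrow> \<rho> (x \<oplus>\<^bsub>N\<^esub> y) (pl a b)"
    and rep_smult: "\<And>x a r. r \<in> carrier K \<Longrightarrow> \<rho> x a \<Longrightarrow> \<rho> (r \<odot>\<^bsub>N\<^esub> x) (sm r a)"
begin

interpretation N: Module.module K N by (rule N)

lemma rep_module: "Module.module K (mod_on K C z pl sm)"
proof (rule moduleI)
  have plC: "pl a b \<in> C" if "a \<in> C" "b \<in> C" for a b
    using rep_ex that rep_add rep_in by meson
  have smC: "sm r a \<in> C" if "a \<in> C" "r \<in> carrier K" for a r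
    using rep_ex that rep_smult rep_in by meson
  have zC: "z \<in> C" using rep_in[OF rep_zero] ..
  show "cring K" by (rule N.R.is_cring)
  show "abelian_group (mod_on K C z pl sm)"
  proof (rule abelian_groupI)
    fix a b c assume "a \<in> carrier (mod_on K C z pl sm)" "b \<in> carrier (mod_on K C z pl sm)" "c \<in> carrier (mod_on K C z pl sm)"
    then have abc: "a \<in> C" "b \<in> C" "c \<in> C" by auto
    then obtain x y w where r: "\<rho> x a" "\<rho> y b" "\<rho> w c" using rep_ex by meson
    then have cN: "x \<in> carrier N" "y \<in> carrier N" "w \<in> carrier N" using rep_in by auto
    have "pl (pl a b) c = pl a (pl b c)"
      using rep_fun[OF rep_add[OF rep_add[OF r(1,2)] r(3)]] rep_add[OF r(1) rep_add[OF r(2,3)]] cN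
      by (simp add: N.a_assoc)
    then show "a \<oplus>\<^bsub>mod_on K C z pl sm\<^esub> b \<oplus>\<^bsub>mod_on K C z pl sm\<^esub> c = a \<oplus>\<^bsub>mod_on K C z pl sm\<^esub> (b \<oplus>\<^bsub>mod_on K C z pl sm\<^esub> c)"
      using abc by (simp add: plC)
    have "pl a b = pl b a"
      using rep_fun[OF rep_add[OF r(1,2)]] rep_add[OF r(2,1)] cN by (simp add: N.a_comm)
    then show "a \<oplus>\<^bsub>mod_on K C z pl sm\<^esub> b = b \<oplus>\<^bsub>mod_on K C z pl sm\<^esub> a" using abc by simp
    have "pl z a = a" using rep_fun[OF rep_add[OF rep_zero r(1)]] r(1) cN by simp
    then show "\<zero>\<^bsub>mod_on K C z pl sm\<^esub> \<oplus>\<^bsub>mod_on K C z pl sm\<^esub> a = a" using abc zC by simp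
    \<comment> \<open>negatives are multiples by \<open>-1\<close>, and the relation is compatible with scalars\<close>
    have m: "\<ominus>\<^bsub>K\<^esub> \<one>\<^bsub>K\<^esub> \<in> carrier K" by simp
    have "\<rho> (\<ominus>\<^bsub>K\<^esub> \<one>\<^bsub>K\<^esub> \<odot>\<^bsub>N\<^esub> x \<oplus>\<^bsub>N\<^esub> x) (pl (sm (\<ominus>\<^bsub>K\<^esub> \<one>\<^bsub>K\<^esub>) a) a)"
      using rep_add[OF rep_smult[OF m r(1)] r(1)] .
    then have "pl (sm (\<ominus>\<^bsub>K\<^esub> \<one>\<^bsub>K\<^esub>) a) a = z"
      using cN rep_fun[OF _ rep_zero] by (simp add: N.smult_l_minus N.l_neg)
    then show "\<exists>y\<in>carrier (mod_on K C z pl sm). y \<oplus>\<^bsub>mod_on K C z pl sm\<^esub> a = \<zero>\<^bsub>mod_on K C z pl sm\<^esub>"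
      using smC[OF abc(1) m] abc by (intro bexI[of _ "sm (\<ominus>\<^bsub>K\<^esub> \<one>\<^bsub>K\<^esub>) a"]) auto
  qed (auto simp: plC zC)
  fix a b r s assume *: "a \<in> carrier (mod_on K C z pl sm)" "b \<in> carrier (mod_on K C z pl sm)"
    "r \<in> carrier K" "s \<in> carrier K"
  then have ab: "a \<in> C" "b \<in> C" and K: "r \<in> carrier K" "s \<in> carrier K"
    "r \<oplus>\<^bsub>K\<^esub> s \<in> carrier K" "r \<otimes>\<^bsub>K\<^esub> s \<in> carrier K" by auto
  then obtain x y where r: "\<rho> x a" "\<rho> y b" using rep_ex by meson
  then have c: "x \<in> carrier N" "y \<in> carrier N" using rep_in by auto
  have "sm (r \<oplus>\<^bsub>K\<^esub> s) a = pl (sm r a) (sm s a)"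
    using rep_fun[OF rep_smult[OF K(3) r(1)]] rep_add[OF rep_smult[OF K(1) r(1)] rep_smult[OF K(2) r(1)]] c K
    by (simp add: N.smult_l_distr)
  then show "(r \<oplus>\<^bsub>K\<^esub> s) \<odot>\<^bsub>mod_on K C z pl sm\<^esub> a = r \<odot>\<^bsub>mod_on K C z pl sm\<^esub> a \<oplus>\<^bsub>mod_on K C z pl sm\<^esub> s \<odot>\<^bsub>mod_on K C z pl sm\<^esub> a"
    using ab K by (simp add: smC)
  have "sm (r \<otimes>\<^bsub>K\<^esub> s) a = sm r (sm s a)"
    using rep_fun[OF rep_smult[OF K(4) r(1)]] rep_smult[OF K(1) rep_smult[OF K(2) r(1)]] c K
    by (simp add: N.smult_assoc1)
  then show "(r \<otimes>\<^bsub>K\<^esub> s) \<odot>\<^bsub>mod_on K C z pl sm\<^esub> a = r \<odot>\<^bsub>mod_on K C z pl sm\<^esub> (s \<odot>\<^bsub>mod_on K C z pl sm\<^esub> a)"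
    using ab K by (simp add: smC)
  have "sm r (pl a b) = pl (sm r a) (sm r b)"
    using rep_fun[OF rep_smult[OF K(1) rep_add[OF r]]] rep_add[OF rep_smult[OF K(1) r(1)] rep_smult[OF K(1) r(2)]] c K
    by (simp add: N.smult_r_distr)
  then show "r \<odot>\<^bsub>mod_on K C z pl sm\<^esub> (a \<oplus>\<^bsub>mod_on K C z pl sm\<^esub> b) = r \<odot>\<^bsub>mod_on K C z pl sm\<^esub> a \<oplus>\<^bsub>mod_on K C z pl sm\<^esub> r \<odot>\<^bsub>mod_on K C z pl sm\<^esub> b"
    using ab K by (simp add: smC plC)
  show "r \<odot>\<^bsub>mod_on K C z pl sm\<^esub> a \<in> carrier (mod_on K C z pl sm)"
    using ab K by (simp add: smC)
next
  fix a assume "a \<in> carrier (mod_on K C z pl sm)"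
  then have ab: "a \<in> C" by simp
  then obtain x where r: "\<rho> x a" using rep_ex by meson
  then have "sm \<one>\<^bsub>K\<^esub> a = a"
    using rep_fun[OF rep_smult[OF N.R.one_closed r]] r rep_in[OF r] by simp
  then show "\<one>\<^bsub>K\<^esub> \<odot>\<^bsub>mod_on K C z pl sm\<^esub> a = a" using ab by simp
qed

lemma rep_nat_add_pow:
  assumes "\<rho> x a" shows "\<rho> ([(n::nat)] \<cdot>\<^bsub>N\<^esub> x) ([n] \<cdot>\<^bsub>mod_on K C z pl sm\<^esub> a)"
proof (induction n)
  interpret Q: Module.module K "mod_on K C z pl sm" by (rule rep_module)
  case 0
  show ?case using rep_zero by simp
next
  interpret Q: Module.module K "mod_on K C z pl sm" by (rule rep_module)
  case (Suc n)
  have "[n] \<cdot>\<^bsub>mod_on K C z pl sm\<^esub> a \<in> C" using Suc rep_in by blast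
  then show ?case using rep_add[OF Suc assms] rep_in[OF assms] by simp
qed

end

text \<open>
  The axioms of a Dieudonne module are inherited in the same way, degree by degree, from one
  ungraded module with operators.
\<close>

lemma dieudonne_represented:
  fixes M :: "('k, 'm, 'y) dmod_scheme" and N :: "(nat \<Rightarrow> 'k, 'n, 'x) module_scheme"
  assumes rep: "\<And>j. represented (witt_ring p k) N (\<rho> j) (C j) (z j) (pl j) (sm j)"
    and wf: "\<And>l. l \<in> carrier (witt_ring p k) \<Longrightarrow> wfrob p k l \<in> carrier (witt_ring p k)"
    and FNl: "\<And>x y. x \<in> carrier N \<Longrightarrow> y \<in> carrier N \<Longrightarrow> FN (x \<oplus>\<^bsub>N\<^esub> y) = FN x \<oplus>\<^bsub>N\<^esub> FN y"
    and FNs: "\<And>l x. l \<in> carrier (witt_ring p k) \<Longrightarrow> x \<in> carrier N \<Longrightarrow> FN (l \<odot>\<^bsub>N\<^esub> x) = wfrob p k l \<odot>\<^bsub>N\<^esub> FN x"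
    and VNl: "\<And>x y. x \<in> carrier N \<Longrightarrow> y \<in> carrier N \<Longrightarrow> VN (x \<oplus>\<^bsub>N\<^esub> y) = VN x \<oplus>\<^bsub>N\<^esub> VN y"
    and VNs: "\<And>l x. l \<in> carrier (witt_ring p k) \<Longrightarrow> x \<in> carrier N \<Longrightarrow> VN (wfrob p k l \<odot>\<^bsub>N\<^esub> x) = l \<odot>\<^bsub>N\<^esub> VN x"
    and FVN: "\<And>x. x \<in> carrier N \<Longrightarrow> FN (VN x) = [p] \<cdot>\<^bsub>N\<^esub> x" "\<And>x. x \<in> carrier N \<Longrightarrow> VN (FN x) = [p] \<cdot>\<^bsub>N\<^esub> x"
    and repF: "\<And>j x a. \<rho> j x a \<Longrightarrow> \<rho> (p * j) (FN x) (F j a)"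
    and repV: "\<And>j x a. \<rho> (p * j) x a \<Longrightarrow> \<rho> j (VN x) (V j a)"
    and M: "dcomp M = (\<lambda>j. mod_on (witt_ring p k) (C j) (z j) (pl j) (sm j))"
      "dF M = (\<lambda>j. \<lambda>a\<in>C j. F j a)" "dV M = (\<lambda>j. \<lambda>a\<in>C (p * j). V j a)"
  shows "is_dieudonne p k M"
proof -
  let ?W = "witt_ring p k"
  have ex: "\<exists>x. \<rho> j x a" if "a \<in> C j" for j a using represented.rep_ex[OF rep that] .
  have inn: "x \<in> carrier N" "a \<in> C j" if "\<rho> j x a" for j x a using represented.rep_in[OF rep that] by auto
  note add = represented.rep_add[OF rep] and smul = represented.rep_smult[OF rep]
    and funl = represented.rep_fun[OF rep] and pow = represented.rep_nat_add_pow[OF rep]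
  have FC: "F j a \<in> C (p * j)" if "a \<in> C j" for j a using ex[OF that] repF inn by blast
  have VC: "V j a \<in> C j" if "a \<in> C (p * j)" for j a using ex[OF that] repV inn by blast
  have plC: "pl j a b \<in> C j" if "a \<in> C j" "b \<in> C j" for j a b
    using ex that add inn by meson
  have smC: "sm j r a \<in> C j" if "a \<in> C j" "r \<in> carrier ?W" for j a r
    using ex that smul inn by meson
  have F1: "F j (pl j a b) = pl (p * j) (F j a) (F j b)" if ab: "a \<in> C j" "b \<in> C j" for j a b
  proof -
    obtain x y where r: "\<rho> j x a" "\<rho> j y b" using ex ab by meson
    show ?thesis using funl[OF repF[OF add[OF r]]] add[OF repF[OF r(1)] repF[OF r(2)]] FNl[OF inn(1)[OF r(1)] inn(1)[OF r(2)]]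
      by simp
  qed
  have F2: "F j (sm j l a) = sm (p * j) (wfrob p k l) (F j a)" if a: "a \<in> C j" and l: "l \<in> carrier ?W" for j a l
  proof -
    obtain x where r: "\<rho> j x a" using ex a by meson
    show ?thesis using funl[OF repF[OF smul[OF l r]]] smul[OF wf[OF l] repF[OF r]] FNs[OF l inn(1)[OF r]] by simp
  qed
  have V1: "V j (pl (p * j) a b) = pl j (V j a) (V j b)" if ab: "a \<in> C (p * j)" "b \<in> C (p * j)" for j a b
  proof -
    obtain x y where r: "\<rho> (p * j) x a" "\<rho> (p * j) y b" using ex ab by meson
    show ?thesis using funl[OF repV[OF add[OF r]]] add[OF repV[OF r(1)] repV[OF r(2)]] VNl[OF inn(1)[OF r(1)] inn(1)[OF r(2)]]
      by simp
  qed
  have V2: "V j (sm (p * j) (wfrob p k l) a) = sm j l (V j a)" if a: "a \<in> C (p * j)" and l: "l \<in> carrier ?W" for j a l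
  proof -
    obtain x where r: "\<rho> (p * j) x a" using ex a by meson
    show ?thesis using funl[OF repV[OF smul[OF wf[OF l] r]]] smul[OF l repV[OF r]] VNs[OF l inn(1)[OF r]] by simp
  qed
  have FV: "F j (V j a) = [p] \<cdot>\<^bsub>mod_on ?W (C (p * j)) (z (p * j)) (pl (p * j)) (sm (p * j))\<^esub> a" if a: "a \<in> C (p * j)" for j a
  proof -
    obtain x where r: "\<rho> (p * j) x a" using ex a by meson
    show ?thesis using funl[OF repF[OF repV[OF r]]] pow[OF r, of p] FVN(1)[OF inn(1)[OF r]] by simp
  qed
  have VF: "V j (F j a) = [p] \<cdot>\<^bsub>mod_on ?W (C j) (z j) (pl j) (sm j)\<^esub> a" if a: "a \<in> C j" for j a
  proof -
    obtain x where r: "\<rho> j x a" using ex a by meson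
    show ?thesis using funl[OF repV[OF repF[OF r]]] pow[OF r, of p] FVN(2)[OF inn(1)[OF r]] by simp
  qed
  show ?thesis
    unfolding is_dieudonne_def
  proof (intro allI conjI)
    fix j
    show "Module.module ?W (dcomp M j)" unfolding M by (rule represented.rep_module[OF rep])
    show "dF M j \<in> lin_maps ?W (dcomp M j) (twist p k 1 (dcomp M) j)"
      unfolding lin_maps_def twist_def M by (auto simp: FC F1 F2 plC smC wf)
    show "dV M j \<in> lin_maps ?W (twist p k 1 (dcomp M) j) (dcomp M j)"
      unfolding lin_maps_def twist_def M by (auto simp: VC V1 V2 plC smC wf)
    show "\<forall>x\<in>carrier (dcomp M (p * j)). dF M j (dV M j x) = [p] \<cdot>\<^bsub>dcomp M (p * j)\<^esub> x"
      unfolding M by (auto simp: VC FV)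
    show "\<forall>x\<in>carrier (dcomp M j). dV M j (dF M j x) = [p] \<cdot>\<^bsub>dcomp M j\<^esub> x"
      unfolding M by (auto simp: FC VF)
  qed
qed

section \<open>Families of Witt vectors with twisted action\<close>

locale walg =
  fixes p :: nat and k :: "('k, 'r) ring_scheme" and R :: "('b, 'x) ring_scheme" (structure) and \<iota> :: "'k \<Rightarrow> 'b"
  assumes p: "prime p" and k: "field k" and kchar: "[p] \<cdot>\<^bsub>k\<^esub> \<one>\<^bsub>k\<^esub> = \<zero>\<^bsub>k\<^esub>"
    and perf: "(\<lambda>x. x [^]\<^bsub>k\<^esub> p) ` carrier k = carrier k"
    and R: "cring R" and io: "\<iota> \<in> ring_hom k R"
begin

sublocale R: cring R by (rule R)
sublocale k: field k by (rule k)
sublocale io: ring_hom_cring k R \<iota> by unfold_locales (rule io)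
sublocale Wk: cring "witt_ring p k" by (rule cring_witt_ring[OF p k.is_cring])
sublocale WR: cring "witt_ring p R" by (rule cring_witt_ring[OF p R])

lemma Rchar: "[p] \<cdot> \<one> = \<zero>"
  using io.hom_nat_add_pow[of "\<one>\<^bsub>k\<^esub>" p] kchar io.hom_one io.hom_zero by simp

lemma ppos: "p > 0" using p by (rule prime_gt_0_nat)

lemma frob_inj: "inj_on (\<lambda>x. x [^]\<^bsub>k\<^esub> p) (carrier k)"
proof (rule inj_onI)
  interpret f: ring_hom_cring k k "\<lambda>x. x [^]\<^bsub>k\<^esub> p" by (rule frobenius_hom[OF p k.is_cring kchar])
  have pow0: "x = \<zero>\<^bsub>k\<^esub>" if "x \<in> carrier k" "x [^]\<^bsub>k\<^esub> n = \<zero>\<^bsub>k\<^esub>" for x and n :: nat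
    using that by (induction n) (auto simp: k.integral_iff)
  fix x y assume xy: "x \<in> carrier k" "y \<in> carrier k" "x [^]\<^bsub>k\<^esub> p = y [^]\<^bsub>k\<^esub> p"
  have "(x \<ominus>\<^bsub>k\<^esub> y) [^]\<^bsub>k\<^esub> p = x [^]\<^bsub>k\<^esub> p \<oplus>\<^bsub>k\<^esub> \<ominus>\<^bsub>k\<^esub> (y [^]\<^bsub>k\<^esub> p)"
    using f.hom_add[of x "\<ominus>\<^bsub>k\<^esub> y"] f.hom_a_inv[of y] xy by (simp add: a_minus_def)
  then have "(x \<ominus>\<^bsub>k\<^esub> y) [^]\<^bsub>k\<^esub> p = \<zero>\<^bsub>k\<^esub>" using xy by (simp add: k.r_neg)
  then have "x \<ominus>\<^bsub>k\<^esub> y = \<zero>\<^bsub>k\<^esub>"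
    using pow0[of "x \<ominus>\<^bsub>k\<^esub> y" p] xy by auto
  then have "x \<oplus>\<^bsub>k\<^esub> \<ominus>\<^bsub>k\<^esub> y = \<zero>\<^bsub>k\<^esub>" by (simp add: a_minus_def)
  then have "x = \<ominus>\<^bsub>k\<^esub> (\<ominus>\<^bsub>k\<^esub> y)" using xy by (intro k.sum_zero_eq_neg) auto
  then show "x = y" using xy by simp
qed

lemma wfrob_bij: "bij_betw (wfrob p k) (carrier (witt_ring p k)) (carrier (witt_ring p k))"
proof (rule bij_betw_imageI)
  show "inj_on (wfrob p k) (carrier (witt_ring p k))"
  proof (rule inj_onI)
    fix x y assume xy: "x \<in> carrier (witt_ring p k)" "y \<in> carrier (witt_ring p k)" "wfrob p k x = wfrob p k y"
    then have "x i [^]\<^bsub>k\<^esub> p = y i [^]\<^bsub>k\<^esub> p" for i by (auto simp: wfrob_def fun_eq_iff)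
    then show "x = y" using xy frob_inj by (auto simp: witt_ring_simps[OF p] inj_on_def fun_eq_iff)
  qed
  show "wfrob p k ` carrier (witt_ring p k) = carrier (witt_ring p k)"
  proof (rule subset_antisym; rule subsetI)
    fix y assume "y \<in> carrier (witt_ring p k)"
    then have "\<forall>i. \<exists>x\<in>carrier k. y i = x [^]\<^bsub>k\<^esub> p" using perf by (auto simp: witt_ring_simps[OF p])
    then obtain x where "\<forall>i. x i \<in> carrier k \<and> y i = x i [^]\<^bsub>k\<^esub> p" by metis
    then show "y \<in> wfrob p k ` carrier (witt_ring p k)"
      by (auto simp: witt_ring_simps[OF p] wfrob_def image_iff intro!: exI[of _ x])
  qed (auto simp: witt_ring_simps[OF p] wfrob_def)
qed

lemma wfrob_closed: "l \<in> carrier (witt_ring p k) \<Longrightarrow> wfrob p k l \<in> carrier (witt_ring p k)"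
  using wfrob_bij by (auto simp: bij_betw_def)

lemma wfi_closed: "l \<in> carrier (witt_ring p k) \<Longrightarrow> wfrob_inv p k l \<in> carrier (witt_ring p k)"
  unfolding wfrob_inv_def using wfrob_bij by (metis bij_betw_imp_surj_on inv_into_into)

lemma wfi_left: "l \<in> carrier (witt_ring p k) \<Longrightarrow> wfrob_inv p k (wfrob p k l) = l"
  unfolding wfrob_inv_def using wfrob_bij by (simp add: bij_betw_inv_into_left)

lemma wfi_right: "l \<in> carrier (witt_ring p k) \<Longrightarrow> wfrob p k (wfrob_inv p k l) = l"
  unfolding wfrob_inv_def using wfrob_bij by (simp add: bij_betw_inv_into_right)

lemma wfrob_hom: "wfrob p k \<in> ring_hom (witt_ring p k) (witt_ring p k)"
  by (rule ring_hom_memI)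
    (auto simp: witt_ring_simps[OF p] wfrob_eq wfr_wadd[OF p k.is_cring kchar] wfr_wmul[OF p k.is_cring kchar],
     auto simp: wfr_def fun_eq_iff k.nat_pow_zero ppos)

lemma wfi_hom: "wfrob_inv p k \<in> ring_hom (witt_ring p k) (witt_ring p k)"
proof (rule ring_hom_memI)
  fix x y assume xy: "x \<in> carrier (witt_ring p k)" "y \<in> carrier (witt_ring p k)"
  let ?x = "wfrob_inv p k x" and ?y = "wfrob_inv p k y"
  have c: "?x \<in> carrier (witt_ring p k)" "?y \<in> carrier (witt_ring p k)" using xy wfi_closed by auto
  have "wfrob p k (?x \<otimes>\<^bsub>witt_ring p k\<^esub> ?y) = x \<otimes>\<^bsub>witt_ring p k\<^esub> y"
    using ring_hom_mult[OF wfrob_hom c] wfi_right xy by (simp del: witt_ring_simps)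
  then show "wfrob_inv p k (x \<otimes>\<^bsub>witt_ring p k\<^esub> y) = ?x \<otimes>\<^bsub>witt_ring p k\<^esub> ?y"
    using wfi_left[OF Wk.m_closed[OF c]] by simp
  have "wfrob p k (?x \<oplus>\<^bsub>witt_ring p k\<^esub> ?y) = x \<oplus>\<^bsub>witt_ring p k\<^esub> y"
    using ring_hom_add[OF wfrob_hom c] wfi_right xy by (simp del: witt_ring_simps)
  then show "wfrob_inv p k (x \<oplus>\<^bsub>witt_ring p k\<^esub> y) = ?x \<oplus>\<^bsub>witt_ring p k\<^esub> ?y"
    using wfi_left[OF Wk.a_closed[OF c]] by simp
next
  show "wfrob_inv p k \<one>\<^bsub>witt_ring p k\<^esub> = \<one>\<^bsub>witt_ring p k\<^esub>"
    using wfi_left[OF Wk.one_closed] ring_hom_one[OF wfrob_hom] by simp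
qed (rule wfi_closed)

lemma wfin_hom: "(wfrob_inv p k ^^ M) \<in> ring_hom (witt_ring p k) (witt_ring p k)"
proof (induction M)
  case 0
  show ?case by (rule ring_hom_memI) auto
next
  case (Suc M)
  show ?case unfolding funpow.simps by (rule ring_hom_trans[OF Suc wfi_hom])
qed

lemma wfin_closed: "l \<in> carrier (witt_ring p k) \<Longrightarrow> (wfrob_inv p k ^^ M) l \<in> carrier (witt_ring p k)"
  by (rule ring_hom_closed[OF wfin_hom])

lemma wfin_wfrob: "l \<in> carrier (witt_ring p k) \<Longrightarrow> (wfrob_inv p k ^^ M) (wfrob p k l) = wfrob p k ((wfrob_inv p k ^^ M) l)"
  by (induction M) (auto simp: wfi_left wfi_right wfin_closed)

text \<open>
  The scalar \<open>frob\<^sup>-\<^sup>M l\<close> as a Witt vector over \<open>R\<close>.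
\<close>

definition thw :: "nat \<Rightarrow> (nat \<Rightarrow> 'k) \<Rightarrow> nat \<Rightarrow> 'b"
  where "thw M l = \<iota> \<circ> (wfrob_inv p k ^^ M) l"

lemma thw_hom: "thw M \<in> ring_hom (witt_ring p k) (witt_ring p R)"
proof -
  have "(\<circ>) \<iota> \<in> ring_hom (witt_ring p k) (witt_ring p R)"
    by (rule ring_hom_memI) (auto simp: witt_ring_simps[OF p] io.hom_wadd io.hom_wmul io.hom_one)
  from ring_hom_trans[OF wfin_hom this] show ?thesis by (simp add: thw_def[abs_def] o_def)
qed

lemma thw_closed: "l \<in> carrier (witt_ring p k) \<Longrightarrow> thw M l i \<in> carrier R"
  using ring_hom_closed[OF thw_hom, of l M] by (simp add: witt_ring_simps[OF p])

lemma thw_wfrob: "l \<in> carrier (witt_ring p k) \<Longrightarrow> thw M (wfrob p k l) = wfr p R (thw M l)"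
  unfolding thw_def wfin_wfrob using wfin_closed[of l M]
  by (auto simp: wfrob_def wfr_def witt_ring_simps[OF p] io.hom_pow)

text \<open>
  Families \<open>x\<close> of Witt vectors over \<open>R\<close>, where \<open>W(k)\<close> acts on \<open>x M\<close> through
  \<open>frob\<^sup>-\<^sup>M\<close>. A covector \<open>a\<close> is represented by a family with \<open>x M\<close> close to
  \<open>(a\<^sub>-\<^sub>M, \<dots>, a\<^sub>0)\<close>, and the twist is the one in the definition of the
  action on covectors. A Witt vector is represented by the member of index \<open>0\<close>.
\<close>

definition wfam :: "(nat \<Rightarrow> 'k, nat \<Rightarrow> nat \<Rightarrow> 'b) module"
  where "wfam = \<lparr>carrier = {x. \<forall>M i. x M i \<in> carrier R}, monoid.mult = undefined, one = undefined,
    zero = (\<lambda>M i. \<zero>), add = (\<lambda>x y M. wadd p R (x M) (y M)), smult = (\<lambda>l x M. wmul p R (thw M l) (x M))\<rparr>"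

lemma wfam_simps [simp]:
  "carrier wfam = {x. \<forall>M i. x M i \<in> carrier R}" "\<zero>\<^bsub>wfam\<^esub> = (\<lambda>M i. \<zero>)"
  "x \<oplus>\<^bsub>wfam\<^esub> y = (\<lambda>M. wadd p R (x M) (y M))" "l \<odot>\<^bsub>wfam\<^esub> x = (\<lambda>M. wmul p R (thw M l) (x M))"
  by (auto simp: wfam_def)

lemma wfam_module: "Module.module (witt_ring p k) wfam"
proof -
  note [simp] = witt_ring_simps[OF p]
  have L1: "wadd p R (\<lambda>i. \<zero>) a = a" "wmul p R (\<one>\<^bsub>witt_ring p R\<^esub>) a = a"
    if "\<forall>i. a i \<in> carrier R" for a
    using WR.l_zero[of a] WR.l_one[of a] that by simp_all
  have L2: "wadd p R a b = wadd p R b a" if "\<forall>i. a i \<in> carrier R" "\<forall>i. b i \<in> carrier R" for a b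
    using WR.a_comm[of a b] that by simp
  have L3: "wadd p R (wadd p R a b) c = wadd p R a (wadd p R b c)"
     "wmul p R (wmul p R a b) c = wmul p R a (wmul p R b c)"
     "wmul p R (wadd p R a b) c = wadd p R (wmul p R a c) (wmul p R b c)"
     "wmul p R a (wadd p R b c) = wadd p R (wmul p R a b) (wmul p R a c)"
    if "\<forall>i. a i \<in> carrier R" "\<forall>i. b i \<in> carrier R" "\<forall>i. c i \<in> carrier R" for a b c
    using WR.a_assoc[of a b c] WR.m_assoc[of a b c] WR.l_distr[of a b c] WR.r_distr[of b c a] that by simp_all
  show ?thesis
  proof (rule moduleI)
    show "abelian_group wfam"
    proof (rule abelian_groupI)
      fix x assume x: "x \<in> carrier wfam"
      have "\<exists>y. (\<forall>i. y i \<in> carrier R) \<and> wadd p R y (x M) = (\<lambda>i. \<zero>)" for M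
        using WR.add.l_inv_ex[of "x M"] x by auto
      then obtain y where "\<forall>M. (\<forall>i. y M i \<in> carrier R) \<and> wadd p R (y M) (x M) = (\<lambda>i. \<zero>)" by metis
      then show "\<exists>y\<in>carrier wfam. y \<oplus>\<^bsub>wfam\<^esub> x = \<zero>\<^bsub>wfam\<^esub>" by (intro bexI[of _ y]) auto
    qed (auto simp: L1 L3 intro!: ext L2[THEN fun_cong])
    fix a b x y assume ab: "a \<in> carrier (witt_ring p k)" "b \<in> carrier (witt_ring p k)"
      and xy: "x \<in> carrier wfam" "y \<in> carrier wfam"
    note t = thw_closed[OF ab(1)] thw_closed[OF ab(2)]
    show "a \<odot>\<^bsub>wfam\<^esub> x \<in> carrier wfam" using t xy by simp
    show "(a \<oplus>\<^bsub>witt_ring p k\<^esub> b) \<odot>\<^bsub>wfam\<^esub> x = a \<odot>\<^bsub>wfam\<^esub> x \<oplus>\<^bsub>wfam\<^esub> b \<odot>\<^bsub>wfam\<^esub> x"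
      using ring_hom_add[OF thw_hom ab] t xy by (simp add: L3)
    show "a \<odot>\<^bsub>wfam\<^esub> (x \<oplus>\<^bsub>wfam\<^esub> y) = a \<odot>\<^bsub>wfam\<^esub> x \<oplus>\<^bsub>wfam\<^esub> a \<odot>\<^bsub>wfam\<^esub> y"
      using t xy by (simp add: L3)
    show "(a \<otimes>\<^bsub>witt_ring p k\<^esub> b) \<odot>\<^bsub>wfam\<^esub> x = a \<odot>\<^bsub>wfam\<^esub> (b \<odot>\<^bsub>wfam\<^esub> x)"
      using ring_hom_mult[OF thw_hom ab] t xy by (simp add: L3)
  next
    fix x assume xy: "x \<in> carrier wfam"
    show "\<one>\<^bsub>witt_ring p k\<^esub> \<odot>\<^bsub>wfam\<^esub> x = x"
      using ring_hom_one[OF thw_hom] xy L1(2) by (simp del: witt_ring_simps(5))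
  qed (rule Wk.is_cring)
qed

definition wfamF :: "(nat \<Rightarrow> nat \<Rightarrow> 'b) \<Rightarrow> nat \<Rightarrow> nat \<Rightarrow> 'b"
  where "wfamF x = (\<lambda>M. wfr p R (x M))"

definition wfamV :: "(nat \<Rightarrow> nat \<Rightarrow> 'b) \<Rightarrow> nat \<Rightarrow> nat \<Rightarrow> 'b"
  where "wfamV x = (\<lambda>M. vshift \<zero> (x M))"

lemma wfr_closed [simp]: "\<forall>i. a i \<in> carrier R \<Longrightarrow> wfr p R a i \<in> carrier R"
  by (simp add: wfr_def)

lemma vshift_closed [simp]: "\<forall>i. a i \<in> carrier R \<Longrightarrow> vshift \<zero> a i \<in> carrier R"
  by (cases i) auto

lemma wfam_p_mult:
  assumes x: "x \<in> carrier wfam" shows "[p] \<cdot>\<^bsub>wfam\<^esub> x = (\<lambda>M. vshift \<zero> (wfr p R (x M)))"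
proof -
  interpret N: Module.module "witt_ring p k" wfam by (rule wfam_module)
  have "[(n::nat)] \<cdot>\<^bsub>wfam\<^esub> x = (\<lambda>M. [n] \<cdot>\<^bsub>witt_ring p R\<^esub> (x M))" for n
    by (induction n) (auto simp: witt_ring_simps[OF p])
  then show ?thesis using x by (simp add: witt_p_mult[OF p R Rchar])
qed

lemmas wfam_laws =
  wfr_wadd[OF p R Rchar] wfr_wmul[OF p R Rchar] wadd_vshift[OF p R] wmul_vshift[OF p R Rchar] wfr_vshift[OF p R Rchar]

text \<open>
  \<open>F\<close> and \<open>V\<close> act on each Witt vector of a family, where the laws of Dieudonne modules are those
  of Witt vectors in characteristic \<open>p\<close>.
\<close>

lemma dieudonne_wfam:
  fixes M :: "('k, 'm, 'y) dmod_scheme"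
  assumes rep: "\<And>j. represented (witt_ring p k) wfam (\<rho> j) (C j) (z j) (pl j) (sm j)"
    and repF: "\<And>j x a. \<rho> j x a \<Longrightarrow> \<rho> (p * j) (wfamF x) (F j a)"
    and repV: "\<And>j x a. \<rho> (p * j) x a \<Longrightarrow> \<rho> j (wfamV x) (V j a)"
    and M: "dcomp M = (\<lambda>j. mod_on (witt_ring p k) (C j) (z j) (pl j) (sm j))"
      "dF M = (\<lambda>j. \<lambda>a\<in>C j. F j a)" "dV M = (\<lambda>j. \<lambda>a\<in>C (p * j). V j a)"
  shows "is_dieudonne p k M"
proof (rule dieudonne_represented[where N = wfam and FN = wfamF and VN = wfamV and \<rho> = \<rho> and F = F and V = V and C = C and z = z and pl = pl and sm = sm])
  fix x y l assume x: "x \<in> carrier wfam"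
  show "wfamF (wfamV x) = [p] \<cdot>\<^bsub>wfam\<^esub> x" "wfamV (wfamF x) = [p] \<cdot>\<^bsub>wfam\<^esub> x"
    using x wfam_p_mult[OF x] by (simp_all add: wfamF_def wfamV_def wfam_laws)
  {
    assume y: "y \<in> carrier wfam"
    show "wfamF (x \<oplus>\<^bsub>wfam\<^esub> y) = wfamF x \<oplus>\<^bsub>wfam\<^esub> wfamF y" "wfamV (x \<oplus>\<^bsub>wfam\<^esub> y) = wfamV x \<oplus>\<^bsub>wfam\<^esub> wfamV y"
      using x y by (simp_all add: wfamF_def wfamV_def wfam_laws)
  }
  assume l: "l \<in> carrier (witt_ring p k)"
  show "wfamF (l \<odot>\<^bsub>wfam\<^esub> x) = wfrob p k l \<odot>\<^bsub>wfam\<^esub> wfamF x" "wfamV (wfrob p k l \<odot>\<^bsub>wfam\<^esub> x) = l \<odot>\<^bsub>wfam\<^esub> wfamV x"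
    using x thw_closed[OF l] l by (simp_all add: wfamF_def wfamV_def wfam_laws thw_wfrob)
qed (fact rep wfrob_closed repF repV M)+

end

section \<open>Nilpotent ideals\<close>

text \<open>
  \<open>I\<close> is an ideal with \<open>I\<^sup>L = 0\<close>, stated without forming powers of ideals.
\<close>

definition nilp :: "('a, 'x) ring_scheme \<Rightarrow> 'a set \<Rightarrow> nat \<Rightarrow> bool"
  where "nilp R I L \<longleftrightarrow> ideal I R \<and> (\<forall>xs. set xs \<subseteq> I \<and> length xs = L \<longrightarrow> lprod R xs = \<zero>\<^bsub>R\<^esub>)"

lemma nilp_ideal: "nilp R I L \<Longrightarrow> ideal I R"
  by (simp add: nilp_def)

context cring begin

lemma ideal_sub: "ideal I R \<Longrightarrow> x \<in> I \<Longrightarrow> x \<in> carrier R"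
  using ideal.Icarr by metis

lemma ideal_zero: "ideal I R \<Longrightarrow> \<zero> \<in> I"
  by (simp add: additive_subgroup.zero_closed ideal.axioms(1))

lemma ideal_add: "ideal I R \<Longrightarrow> x \<in> I \<Longrightarrow> y \<in> I \<Longrightarrow> x \<oplus> y \<in> I"
  by (simp add: additive_subgroup.a_closed ideal.axioms(1))

lemma ideal_mult: "ideal I R \<Longrightarrow> x \<in> carrier R \<Longrightarrow> y \<in> I \<Longrightarrow> x \<otimes> y \<in> I"
  by (simp add: ideal.I_l_closed)

lemma ideal_multr: "ideal I R \<Longrightarrow> x \<in> carrier R \<Longrightarrow> y \<in> I \<Longrightarrow> y \<otimes> x \<in> I"
  by (simp add: ideal.I_r_closed)

lemma nilp_long:
  assumes n: "nilp R I L" and xs: "set xs \<subseteq> I" "L \<le> length xs"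
  shows "lprod R xs = \<zero>"
proof -
  have c: "set xs \<subseteq> carrier R" using xs ideal_sub[OF nilp_ideal[OF n]] by auto
  have "lprod R xs = lprod R (take L xs) \<otimes> lprod R (drop L xs)"
    using lprod_append[of "take L xs" "drop L xs"] c set_take_subset[of L xs] set_drop_subset[of L xs] by auto
  moreover have "lprod R (take L xs) = \<zero>"
    using n xs set_take_subset[of L xs] by (auto simp: nilp_def)
  ultimately show ?thesis using c set_drop_subset[of L xs] by (metis l_null lprod_closed order_trans)
qed

lemma lprod_filter_split:
  assumes "\<forall>i. f i \<in> carrier R"
  shows "lprod R (map f vs) = lprod R (map f (filter Q vs)) \<otimes> lprod R (map f (filter (\<lambda>v. \<not> Q v) vs))"
proof (induction vs)
  case (Cons v vs)
  have c: "lprod R (map f ws) \<in> carrier R" for ws using assms by (auto intro!: lprod_closed)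
  show ?case using Cons c assms by (auto simp: m_assoc m_lcomm)
qed simp

lemma lprod_mset_cong:
  fixes f :: "nat \<Rightarrow> 'a"
  assumes "\<forall>i. f i \<in> carrier R" "mset vs = mset ws"
  shows "lprod R (map f vs) = lprod R (map f ws)"
proof -
  have e: "(\<Sum>i\<leftarrow>vs. Poly_Mapping.single i (1::nat)) = (\<Sum>i\<leftarrow>ws. Poly_Mapping.single i (1::nat))"
    using assms(2) by (metis mset_map sum_mset_sum_list)
  show ?thesis unfolding mev_eq_lprod[OF assms(1), symmetric] by (rule arg_cong[OF e])
qed

lemma lprod_concat:
  assumes "\<forall>g\<in>set gs. set g \<subseteq> carrier R"
  shows "lprod R (concat gs) = lprod R (map (lprod R) gs)"
  using assms
proof (induction gs)
  case (Cons g gs)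
  then have "set (concat gs) \<subseteq> carrier R" by auto
  then show ?case using Cons by (simp add: lprod_append)
qed simp

lemma lprod_in_ideal:
  assumes "ideal I R" "set xs \<subseteq> carrier R" "x \<in> set xs" "x \<in> I"
  shows "lprod R xs \<in> I"
  using assms(2,3)
proof (induction xs)
  case (Cons y ys)
  then show ?case using assms ideal_mult[OF assms(1)] ideal_multr[OF assms(1)] by (cases "x = y") auto
qed simp

lemma nilp_zero: "nilp R {\<zero>} 1"
  unfolding nilp_def using zeroideal by (auto simp: length_Suc_conv)

text \<open>
  In the expansion of a product of \<open>L + M\<close> sums, each term has \<open>L\<close> factors in \<open>I\<close> or \<open>M\<close> factors
  in \<open>J\<close>. The induction multiplies out one sum after the other and collects the factors in \<open>as\<close>
  and \<open>bs\<close>.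
\<close>

lemma nilp_add:
  assumes I: "nilp R I L" and J: "nilp R J M"
  shows "nilp R (I <+>\<^bsub>R\<^esub> J) (L + M)"
proof -
  note iI = nilp_ideal[OF I] and iJ = nilp_ideal[OF J]
  have key: "lprod R ys \<otimes> lprod R as \<otimes> lprod R bs = \<zero>"
    if "set ys \<subseteq> I <+>\<^bsub>R\<^esub> J" "set as \<subseteq> I" "set bs \<subseteq> J" "L + M \<le> length ys + length as + length bs" for ys as bs
    using that
  proof (induction ys arbitrary: as bs)
    case Nil
    have c: "lprod R as \<in> carrier R" "lprod R bs \<in> carrier R"
      using Nil ideal_sub[OF iI] ideal_sub[OF iJ] by (auto intro!: lprod_closed)
    have "L \<le> length as \<or> M \<le> length bs" using Nil by auto
    then show ?case using nilp_long[OF I, of as] nilp_long[OF J, of bs] Nil c by auto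
  next
    case (Cons y ys)
    then obtain a b where y: "y = a \<oplus> b" "a \<in> I" "b \<in> J" by (auto simp: set_add_def set_mult_def)
    have c: "lprod R as \<in> carrier R" "lprod R bs \<in> carrier R" "lprod R ys \<in> carrier R" "a \<in> carrier R" "b \<in> carrier R"
      using Cons y ideal_sub[OF iI] ideal_sub[OF iJ] ideal_sub[OF add_ideals[OF iI iJ]]
      by (auto intro!: lprod_closed)
    have "lprod R (y # ys) \<otimes> lprod R as \<otimes> lprod R bs
      = lprod R ys \<otimes> lprod R (a # as) \<otimes> lprod R bs \<oplus> lprod R ys \<otimes> lprod R as \<otimes> lprod R (b # bs)"
      using c y by (simp add: l_distr r_distr m_ac)
    moreover have "lprod R ys \<otimes> lprod R (a # as) \<otimes> lprod R bs = \<zero>"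
      using Cons.prems y by (intro Cons.IH) auto
    moreover have "lprod R ys \<otimes> lprod R as \<otimes> lprod R (b # bs) = \<zero>"
      using Cons.prems y by (intro Cons.IH) auto
    ultimately show ?case by simp
  qed
  show ?thesis unfolding nilp_def
  proof (intro conjI allI impI)
    show "ideal (I <+>\<^bsub>R\<^esub> J) R" by (rule add_ideals[OF iI iJ])
    fix xs assume xs: "set xs \<subseteq> I <+>\<^bsub>R\<^esub> J \<and> length xs = L + M"
    then have "lprod R xs \<in> carrier R" using ideal_sub[OF add_ideals[OF iI iJ]] by (auto intro!: lprod_closed)
    then show "lprod R xs = \<zero>" using key[of xs "[]" "[]"] xs by simp
  qed
qed

lemma ideal_add_left: "ideal I R \<Longrightarrow> ideal J R \<Longrightarrow> x \<in> I \<Longrightarrow> x \<in> I <+>\<^bsub>R\<^esub> J"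
  using ideal_sub[of I x] ideal_zero[of J] unfolding set_add_def set_mult_def by (force intro: exI[of _ x])

lemma ideal_add_right: "ideal I R \<Longrightarrow> ideal J R \<Longrightarrow> x \<in> J \<Longrightarrow> x \<in> I <+>\<^bsub>R\<^esub> J"
  using ideal_sub[of J x] ideal_zero[of I] unfolding set_add_def set_mult_def by (force intro: exI[of _ x])

lemma nilp_principal:
  assumes x: "x \<in> carrier R" "x [^] (n::nat) = \<zero>"
  shows "nilp R (PIdl x) n"
proof -
  have "\<exists>r\<in>carrier R. lprod R xs = r \<otimes> x [^] length xs" if "set xs \<subseteq> PIdl x" for xs
    using that
  proof (induction xs)
    case Nil
    show ?case by (intro bexI[of _ \<one>]) auto
  next
    case (Cons y ys)
    then obtain r s where r: "r \<in> carrier R" "lprod R ys = r \<otimes> x [^] length ys" and s: "s \<in> carrier R" "y = s \<otimes> x"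
      by (auto simp: cgenideal_def)
    have "lprod R (y # ys) = (s \<otimes> r) \<otimes> x [^] length (y # ys)" using r s x by (simp add: m_ac)
    then show ?case using r s by blast
  qed
  then show ?thesis unfolding nilp_def using cgenideal_ideal x by (metis r_null)
qed

lemma finsum_in_ideal:
  assumes "ideal I R" "finite S" "\<And>i. i \<in> S \<Longrightarrow> f i \<in> I"
  shows "finsum R f S \<in> I"
  using assms(2,3)
proof (induction S rule: finite_induct)
  case empty
  then show ?case using ideal_zero[OF assms(1)] by simp
next
  case (insert x F)
  then have "f \<in> F \<rightarrow> carrier R" "f x \<in> carrier R" using ideal_sub[OF assms(1)] by auto
  then show ?case using insert ideal_add[OF assms(1)] by simp
qed

end

section \<open>Isobaric monomials with a factor of low weight\<close>

text \<open>
  A sum of powers of \<open>p\<close> below \<open>p ^ d\<close> that includes \<open>p ^ 0\<close> and is divisible by \<open>p ^ d\<close> has at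
  least \<open>d + 1\<close> terms: the terms equal to \<open>1\<close> come in groups of \<open>p\<close>, and carrying each group to
  the next power shortens the sum by at least one.
\<close>

lemma count_low:
  fixes f :: "nat \<Rightarrow> nat"
  assumes p: "2 \<le> p" and "1 \<le> d" and "p ^ d dvd (\<Sum>e<d. f e * p ^ e)" and "f 0 > 0"
  shows "d + 1 \<le> (\<Sum>e<d. f e)"
  using assms(2-4)
proof (induction d arbitrary: f)
  case (Suc d)
  have s: "(\<Sum>e<Suc d. f e * p ^ e) = f 0 + p * (\<Sum>e<d. f (Suc e) * p ^ e)"
    unfolding sum.lessThan_Suc_shift by (simp add: sum_distrib_left algebra_simps)
  have "p dvd f 0 + p * (\<Sum>e<d. f (Suc e) * p ^ e)"
    using Suc.prems(2) unfolding s by (metis dvd_trans dvd_triv_left power_Suc)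
  then have "p dvd f 0" by (metis dvd_add_left_iff dvd_triv_left)
  then obtain h where h: "f 0 = p * h" by blast
  with Suc.prems have h0: "h > 0" by auto
  have ph: "h + 1 \<le> p * h" using p h0 mult_le_mono1[OF p, of h] by linarith
  show ?case
  proof (cases "d = 0")
    case True
    then show ?thesis using h h0 ph by simp
  next
    case False
    \<comment> \<open>the carry: \<open>p * h\<close> terms \<open>1\<close> become \<open>h\<close> terms \<open>p\<close>, and everything is divided by \<open>p\<close>\<close>
    define g where "g e = f (Suc e) + (if e = 0 then h else 0)" for e
    have g: "(\<Sum>e<d. g e * c e) = (\<Sum>e<d. f (Suc e) * c e) + h * c 0" for c :: "nat \<Rightarrow> nat"
    proof -
      have "g e * c e = f (Suc e) * c e + (if e = 0 then h * c 0 else 0)" for e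
        by (simp add: g_def distrib_right)
      then show ?thesis using False by (simp add: sum.distrib)
    qed
    have "p * p ^ d dvd p * (\<Sum>e<d. g e * p ^ e)"
      using Suc.prems(2) unfolding s g h by (simp add: algebra_simps)
    then have "p ^ d dvd (\<Sum>e<d. g e * p ^ e)" using p by simp
    then have "d + 1 \<le> (\<Sum>e<d. g e)" using Suc.IH[of g] False h0 by (simp add: g_def)
    moreover have "(\<Sum>e<d. g e) = (\<Sum>e<d. f (Suc e)) + h" using g[of "\<lambda>_. 1"] by simp
    moreover have "(\<Sum>e<Suc d. f e) = p * h + (\<Sum>e<d. f (Suc e))"
      unfolding sum.lessThan_Suc_shift h[symmetric] by simp
    ultimately show ?thesis using ph by linarith
  qed
qed simp

lemma sum_list_filter_by_value:
  fixes g :: "nat \<Rightarrow> nat"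
  shows "(\<Sum>v\<leftarrow>filter (\<lambda>v. e v < q) vs. g (e v)) = (\<Sum>x<q. length (filter (\<lambda>v. e v = x) vs) * g x)"
proof (induction vs)
  case (Cons v vs)
  have "length (filter (\<lambda>v. e v = x) (v # vs)) * g x
    = length (filter (\<lambda>v. e v = x) vs) * g x + (if x = e v then g (e v) else 0)" for x
    by simp
  then have "(\<Sum>x<q. length (filter (\<lambda>v. e v = x) (v # vs)) * g x)
    = (\<Sum>x<q. length (filter (\<lambda>v. e v = x) vs) * g x) + (if e v < q then g (e v) else 0)"
    by (simp add: sum.distrib)
  then show ?case using Cons by simp
qed simp

text \<open>
  Hence a monomial of weight divisible by \<open>p ^ q\<close> that involves a variable of low index involves
  many variables of index below \<open>q\<close>. If the values of these lie in a nilpotent ideal, the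
  monomial vanishes. This is the reason why sums of covectors are eventually constant.
\<close>

lemma many_low_factors:
  fixes e :: "'v \<Rightarrow> nat" and p :: nat
  assumes p: "2 \<le> p" and s: "p ^ q dvd (\<Sum>v\<leftarrow>vs. p ^ e v)" and v: "v \<in> set vs" "e v < c" and cq: "c \<le> q"
  shows "q - c < length (filter (\<lambda>v. e v < q) vs)"
proof -
  define n where "n x = length (filter (\<lambda>v. e v = x) vs)" for x
  have nv: "n (e v) > 0" unfolding n_def using v(1) by (auto simp: length_pos_if_in_set filter_empty_conv)
  \<comment> \<open>dividing by the least power that occurs reduces to the situation of the previous count\<close>
  define a where "a = (LEAST x. n x > 0)"
  have a: "n a > 0" "a \<le> e v" "\<And>x. x < a \<Longrightarrow> n x = 0"
    unfolding a_def using LeastI[of "\<lambda>x. n x > 0", OF nv] Least_le[of "\<lambda>x. n x > 0", OF nv] not_less_Least by auto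
  have aq: "a < q" using a(2) v(2) cq by simp
  have split: "(\<Sum>v\<leftarrow>vs. p ^ e v) = (\<Sum>v\<leftarrow>filter (\<lambda>v. e v < q) vs. p ^ e v) + (\<Sum>v\<leftarrow>filter (\<lambda>v. \<not> e v < q) vs. p ^ e v)"
    by (induction vs) (auto simp: add_ac)
  have "p ^ q dvd (\<Sum>v\<leftarrow>filter (\<lambda>v. \<not> e v < q) vs. p ^ e v)"
    by (induction vs) (auto intro!: dvd_add le_imp_power_dvd)
  with s split have "p ^ q dvd (\<Sum>v\<leftarrow>filter (\<lambda>v. e v < q) vs. p ^ e v)"
    by (simp add: dvd_add_left_iff)
  then have d1: "p ^ q dvd (\<Sum>x<q. n x * p ^ x)"
    unfolding sum_list_filter_by_value[where g = "\<lambda>x. p ^ x" and e = e] n_def .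
  have shift: "(\<Sum>x<q. n x * g x) = (\<Sum>x<q - a. n (a + x) * g (a + x))" for g :: "nat \<Rightarrow> nat"
  proof -
    have "(\<Sum>x<q. n x * g x) = (\<Sum>x\<in>{a..<q}. n x * g x)"
      by (intro sum.mono_neutral_right) (auto simp: a(3))
    also have "\<dots> = (\<Sum>x<q - a. n (a + x) * g (a + x))"
      by (rule sum.reindex_bij_witness[of _ "\<lambda>x. a + x" "\<lambda>x. x - a"]) auto
    finally show ?thesis .
  qed
  have "(\<Sum>x<q - a. n (a + x) * p ^ (a + x)) = p ^ a * (\<Sum>x<q - a. n (a + x) * p ^ x)"
    by (simp add: power_add sum_distrib_left mult_ac)
  moreover have "p ^ q = p ^ a * p ^ (q - a)" using aq by (simp flip: power_add)
  ultimately have "p ^ a * p ^ (q - a) dvd p ^ a * (\<Sum>x<q - a. n (a + x) * p ^ x)"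
    using d1 unfolding shift by simp
  then have "p ^ (q - a) dvd (\<Sum>x<q - a. n (a + x) * p ^ x)" using p by simp
  from count_low[OF p _ this] have "q - a + 1 \<le> (\<Sum>x<q - a. n (a + x))" using a aq by simp
  moreover have "length (filter (\<lambda>v. e v < q) vs) = (\<Sum>x<q. n x)"
    using sum_list_filter_by_value[where g = "\<lambda>x. 1" and e = e and q = q and vs = vs] by (simp add: n_def sum_list_triv)
  moreover have "(\<Sum>x<q. n x) = (\<Sum>x<q - a. n (a + x))" using shift[of "\<lambda>_. 1"] by simp
  ultimately show ?thesis using a(2) v(2) by linarith
qed

section \<open>Variables on which isobaric polynomials depend\<close>

text \<open>
  The weights of the Witt polynomials: variable \<open>v\<close> is the entry of index \<open>v div 2\<close> of its
  argument, and only the active variables count (all of them for addition, the second argument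
  for multiplication).
\<close>

abbreviation actw :: "nat \<Rightarrow> (nat \<Rightarrow> bool) \<Rightarrow> nat \<Rightarrow> nat"
  where "actw p act \<equiv> \<lambda>v. if act v then p ^ (v div 2) else 0"

lemma actw_sum_list: "(\<Sum>v\<leftarrow>vs. actw p act v) = (\<Sum>v\<leftarrow>filter act vs. p ^ (v div 2))"
  by (induction vs) auto

lemma actw_bound:
  fixes p :: nat
  assumes p: "2 \<le> p" and s: "(\<Sum>v\<leftarrow>vs. actw p act v) = p ^ n" and v: "v \<in> set vs" "act v"
  shows "v div 2 \<le> n"
proof -
  have "p ^ (v div 2) \<le> p ^ n"
    using member_le_sum_list[of "actw p act v" "map (actw p act) vs"] s v by auto
  then show ?thesis using p by simp
qed

context cring begin

lemma pev_monomials_cong: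
  assumes "\<forall>v. x v \<in> carrier R" "\<forall>v. x' v \<in> carrier R"
    and "\<And>vs. (\<Sum>v\<leftarrow>vs. w v) = d \<Longrightarrow> lprod R (map x vs) = lprod R (map x' vs)" and P: "homog w d P"
  shows "pev R P x = pev R P x'"
proof -
  have e: "mev R x m = mev R x' m" if "m \<in> keys P" for m
  proof -
    have "wt w m = d" using P that by (simp add: homog_def)
    moreover obtain vs where vs: "m = (\<Sum>i\<leftarrow>vs. Poly_Mapping.single i 1)" by (rule monomial_list)
    ultimately have "lprod R (map x vs) = lprod R (map x' vs)"
      using assms(3) by (simp add: wt_monomial_list del: One_nat_def)
    then show ?thesis using assms(1,2) by (simp add: vs mev_eq_lprod del: One_nat_def)
  qed
  then show ?thesis unfolding pev_def using assms(1,2) by (intro finsum_cong') auto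
qed

text \<open>
  A monomial with a factor of index below \<open>c\<close> has at least \<open>L\<close> factors in \<open>I\<close> and vanishes at
  \<open>x\<close> and at \<open>x'\<close>; all other monomials take the same value at both.
\<close>

lemma pev_local:
  assumes p: "2 \<le> p" and P: "homog (actw p act) (p ^ n) P" and I: "nilp R I L"
    and x: "\<forall>v. x v \<in> carrier R" "\<forall>v. x' v \<in> carrier R"
    and inact: "\<And>v. \<not> act v \<Longrightarrow> x v = x' v"
    and hi: "\<And>v. act v \<Longrightarrow> c \<le> v div 2 \<Longrightarrow> v div 2 \<le> n \<Longrightarrow> x v = x' v"
    and lo: "\<And>v. act v \<Longrightarrow> v div 2 < q \<Longrightarrow> x v \<in> I \<and> x' v \<in> I"
    and q: "c + L \<le> q" "q \<le> n"
  shows "pev R P x = pev R P x'"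
proof (rule pev_monomials_cong[OF x _ P])
  fix vs assume s: "(\<Sum>v\<leftarrow>vs. actw p act v) = p ^ n"
  show "lprod R (map x vs) = lprod R (map x' vs)"
  proof (cases "\<exists>v\<in>set vs. act v \<and> v div 2 < c")
    case False
    then have "map x vs = map x' vs"
      using inact hi actw_bound[OF p s] by (intro map_cong) (auto simp: not_less)
    then show ?thesis by (rule arg_cong)
  next
    case True
    then obtain v where v: "v \<in> set (filter act vs)" "v div 2 < c" by auto
    let ?F = "filter (\<lambda>v. v div 2 < q) (filter act vs)"
    have "p ^ q dvd (\<Sum>v\<leftarrow>filter act vs. p ^ (v div 2))"
      using s unfolding actw_sum_list using q le_imp_power_dvd by simp
    from many_low_factors[OF p this v] have len: "L \<le> length ?F" using q by simp
    have z: "lprod R (map y vs) = \<zero>" if y: "\<forall>v. y v \<in> carrier R" "\<And>v. act v \<Longrightarrow> v div 2 < q \<Longrightarrow> y v \<in> I" for y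
    proof -
      have c: "lprod R (map y ws) \<in> carrier R" for ws using y by (auto intro!: lprod_closed)
      have "lprod R (map y ?F) = \<zero>" using len y(2) by (intro nilp_long[OF I]) auto
      then have "lprod R (map y (filter act vs)) = \<zero>"
        using lprod_filter_split[OF y(1), of "filter act vs" "\<lambda>v. v div 2 < q"] c by simp
      then show ?thesis using lprod_filter_split[OF y(1), of vs act] c by simp
    qed
    show ?thesis using z[OF x(1)] z[OF x(2)] lo by simp
  qed
qed

lemma pev_cong_upto:
  assumes p: "2 \<le> p" and P: "homog (actw p act) (p ^ n) P"
    and x: "\<forall>v. x v \<in> carrier R" "\<forall>v. x' v \<in> carrier R"
    and inact: "\<And>v. \<not> act v \<Longrightarrow> x v = x' v"
    and hi: "\<And>v. act v \<Longrightarrow> v div 2 \<le> n \<Longrightarrow> x v = x' v"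
  shows "pev R P x = pev R P x'"
proof (rule pev_monomials_cong[OF x _ P])
  fix vs assume s: "(\<Sum>v\<leftarrow>vs. actw p act v) = p ^ n"
  have "map x vs = map x' vs"
    using inact hi actw_bound[OF p s] by (intro map_cong) auto
  then show "lprod R (map x vs) = lprod R (map x' vs)" by (rule arg_cong)
qed

lemma pev_in_ideal:
  assumes p: "2 \<le> p" and P: "homog (actw p act) (p ^ n) P" and I: "ideal I R"
    and x: "\<forall>v. x v \<in> carrier R" and xI: "\<And>v. act v \<Longrightarrow> v div 2 \<le> n \<Longrightarrow> x v \<in> I"
  shows "pev R P x \<in> I"
  unfolding pev_def
proof (rule finsum_in_ideal[OF I])
  fix m assume "m \<in> keys P"
  then have "wt (actw p act) m = p ^ n" using P by (simp add: homog_def)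
  moreover obtain vs where vs: "m = (\<Sum>i\<leftarrow>vs. Poly_Mapping.single i 1)" by (rule monomial_list)
  ultimately have s: "(\<Sum>v\<leftarrow>vs. actw p act v) = p ^ n" by (simp add: wt_monomial_list del: One_nat_def)
  have "filter act vs \<noteq> []" using s p unfolding actw_sum_list by auto
  then obtain v where v: "v \<in> set vs" "act v" by (metis filter_False)
  have "mev R x m \<in> I"
    unfolding vs using v x xI actw_bound[OF p s]
    by (subst mev_eq_lprod) (auto intro!: lprod_in_ideal[OF I, of _ "x v"])
  then have "([lookup P m] \<cdot> \<one>) \<otimes> mev R x m \<in> I" by (intro ideal_mult[OF I]) auto
  then show "[lookup P m] \<cdot> mev R x m \<in> I" using x by (simp add: add_pow_ldistr_int)
qed simp

end

section \<open>Relations closed under p-fold multiplication\<close>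

text \<open>
  Making change: coins \<open>p ^ i\<close> with \<open>i \<le> n\<close> whose total is at least \<open>p ^ n\<close> contain a subset
  of total exactly \<open>p ^ n\<close>: a coin \<open>p ^ n\<close>, or \<open>p\<close> disjoint subsets of total \<open>p ^ (n - 1)\<close>.
\<close>

lemma split_off_group:
  fixes e :: "'v \<Rightarrow> nat" and p :: nat
  assumes p: "0 < p"
  shows "\<forall>v\<in>#M. e v \<le> n \<Longrightarrow> p ^ n \<le> (\<Sum>v\<in>#M. p ^ e v) \<Longrightarrow> \<exists>S. S \<subseteq># M \<and> (\<Sum>v\<in>#S. p ^ e v) = p ^ n"
proof (induction n arbitrary: M)
  case 0
  then have "M \<noteq> {#}" by auto
  then obtain v where v: "v \<in># M" by (meson multiset_nonemptyE)
  then show ?case using 0 by (intro exI[of _ "{#v#}"]) auto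
next
  case (Suc n)
  show ?case
  proof (cases "\<exists>v\<in>#M. e v = Suc n")
    case True
    then obtain v where "v \<in># M" "e v = Suc n" by blast
    then show ?thesis by (intro exI[of _ "{#v#}"]) auto
  next
    case False
    then have le: "\<forall>v\<in>#M. e v \<le> n" using Suc.prems(1) le_SucE by blast
    have "\<exists>S. S \<subseteq># M \<and> (\<Sum>v\<in>#S. p ^ e v) = c * p ^ n" if "c \<le> p" for c
      using that
    proof (induction c)
      case 0
      show ?case by (intro exI[of _ "{#}"]) auto
    next
      case (Suc c)
      then obtain S where S: "S \<subseteq># M" "(\<Sum>v\<in>#S. p ^ e v) = c * p ^ n" by auto
      have "(\<Sum>v\<in>#M. p ^ e v) = (\<Sum>v\<in>#S. p ^ e v) + (\<Sum>v\<in>#M - S. p ^ e v)"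
        using S(1) by (metis image_mset_union subset_mset.add_diff_inverse sum_mset.union)
      moreover have "Suc c * p ^ n \<le> p ^ Suc n" using mult_le_mono1[OF Suc.prems, of "p ^ n"] by simp
      ultimately have "p ^ n \<le> (\<Sum>v\<in>#M - S. p ^ e v)" using S(2) \<open>p ^ Suc n \<le> (\<Sum>v\<in>#M. p ^ e v)\<close> by simp
      moreover have "\<forall>v\<in>#M - S. e v \<le> n" using le in_diffD by fast
      ultimately obtain T where T: "T \<subseteq># M - S" "(\<Sum>v\<in>#T. p ^ e v) = p ^ n" using \<open>\<And>M. _ \<Longrightarrow> _ \<Longrightarrow> \<exists>S. S \<subseteq># M \<and> (\<Sum>v\<in>#S. p ^ e v) = p ^ n\<close> by blast
      then have "S + T \<subseteq># M" using S(1) by (metis subset_mset.add_diff_inverse subset_mset.add_left_mono)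
      then show ?case using S T by (intro exI[of _ "S + T"]) auto
    qed
    from this[of p] show ?thesis by simp
  qed
qed

lemma split_into_groups:
  fixes e :: "'v \<Rightarrow> nat" and p :: nat
  assumes p: "0 < p"
  shows "\<forall>v\<in>#M. e v \<le> n \<Longrightarrow> (\<Sum>v\<in>#M. p ^ e v) = c * p ^ n \<Longrightarrow>
    \<exists>gs. length gs = c \<and> mset (concat gs) = M \<and> (\<forall>g\<in>set gs. (\<Sum>v\<leftarrow>g. p ^ e v) = p ^ n)"
proof (induction c arbitrary: M)
  case 0
  have "M = {#}"
  proof (rule ccontr)
    assume "M \<noteq> {#}"
    then obtain v where "v \<in># M" by (meson multiset_nonemptyE)
    then have "p ^ e v \<le> (\<Sum>v\<in>#M. p ^ e v)" by (metis insert_DiffM image_mset_add_mset le_add1 sum_mset.add_mset)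
    then show False using 0 p by simp
  qed
  then show ?case by (intro exI[of _ "[]"]) auto
next
  case (Suc c)
  then obtain S where S: "S \<subseteq># M" "(\<Sum>v\<in>#S. p ^ e v) = p ^ n"
    using split_off_group[OF p Suc.prems(1)] by auto
  have "(\<Sum>v\<in>#M. p ^ e v) = (\<Sum>v\<in>#S. p ^ e v) + (\<Sum>v\<in>#M - S. p ^ e v)"
    using S(1) by (metis image_mset_union subset_mset.add_diff_inverse sum_mset.union)
  then have "(\<Sum>v\<in>#M - S. p ^ e v) = c * p ^ n" using Suc.prems S by simp
  moreover have "\<forall>v\<in>#M - S. e v \<le> n" using Suc.prems(1) in_diffD by fast
  ultimately obtain gs where gs: "length gs = c" "mset (concat gs) = M - S" "\<forall>g\<in>set gs. (\<Sum>v\<leftarrow>g. p ^ e v) = p ^ n"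
    using Suc.IH by blast
  obtain s where s: "mset s = S" by (meson ex_mset)
  have "(\<Sum>v\<leftarrow>s. p ^ e v) = p ^ n" using S(2) s by (metis mset_map sum_mset_sum_list)
  then show ?case using gs s S(1) by (intro exI[of _ "s # gs"]) auto
qed

lemma length_le_sum_powers:
  fixes p :: nat assumes "0 < p" shows "length vs \<le> (\<Sum>v\<leftarrow>vs. p ^ e v)"
proof (induction vs)
  case (Cons a vs)
  have "1 \<le> p ^ e a" using assms by simp
  with Cons show ?case by simp
qed simp

text \<open>
  A graded relation between two commutative algebras that is closed under sums, scalars and
  \<open>p\<close>-fold products of elements of equal degree, but not under arbitrary products. The typical
  example is the graph of a morphism of polar algebras, seen in the ambient algebras of its
  source and its target.
\<close>

locale correspondence =
  fixes p :: nat and k :: "('k, 'r) ring_scheme" and R :: "('a, 'x) ring_scheme" and S :: "('b, 'y) ring_scheme"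
    and \<iota> :: "'k \<Rightarrow> 'a" and \<kappa> :: "'k \<Rightarrow> 'b" and T :: "nat \<Rightarrow> 'a \<Rightarrow> 'b \<Rightarrow> bool"
  assumes p2: "2 \<le> p"
    and hR: "ring_hom_cring k R \<iota>" and hS: "ring_hom_cring k S \<kappa>"
    and Tin: "\<And>d x y. T d x y \<Longrightarrow> x \<in> carrier R \<and> y \<in> carrier S"
    and Tz: "\<And>d. T d \<zero>\<^bsub>R\<^esub> \<zero>\<^bsub>S\<^esub>"
    and Tadd: "\<And>d x y x' y'. T d x y \<Longrightarrow> T d x' y' \<Longrightarrow> T d (x \<oplus>\<^bsub>R\<^esub> x') (y \<oplus>\<^bsub>S\<^esub> y')"
    and Tscal: "\<And>d x y r. r \<in> carrier k \<Longrightarrow> T d x y \<Longrightarrow> T d (\<iota> r \<otimes>\<^bsub>R\<^esub> x) (\<kappa> r \<otimes>\<^bsub>S\<^esub> y)"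
    and Tprod: "\<And>d xs ys. length xs = p \<Longrightarrow> list_all2 (T d) xs ys \<Longrightarrow> T (d * p) (lprod R xs) (lprod S ys)"
begin

sublocale R: ring_hom_cring k R \<iota> by (rule hR)
sublocale S: ring_hom_cring k S \<kappa> by (rule hS)

text \<open>
  A monomial of weight \<open>p ^ (n + 1)\<close> is either a single variable or a product of \<open>p\<close> monomials
  of weight \<open>p ^ n\<close>, so its value is an iterated \<open>p\<close>-fold product. If the entry of index \<open>i\<close> has
  a degree proportional to \<open>p ^ i\<close>, the \<open>p\<close> factors have the same degree at each stage.
\<close>

lemma T_monomial:
  fixes x :: "nat \<Rightarrow> 'a" and y :: "nat \<Rightarrow> 'b"
  assumes x: "\<forall>v. x v \<in> carrier R" "\<forall>v. y v \<in> carrier S"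
  shows "(\<Sum>v\<leftarrow>vs. p ^ e v) = p ^ n \<Longrightarrow> (\<And>v. v \<in> set vs \<Longrightarrow> \<exists>\<delta>. \<delta> * p ^ (n - e v) = d \<and> T \<delta> (x v) (y v)) \<Longrightarrow>
    T d (lprod R (map x vs)) (lprod S (map y vs))"
proof (induction n arbitrary: d vs)
  case 0
  have "length vs \<le> (\<Sum>v\<leftarrow>vs. p ^ e v)" using p2 by (intro length_le_sum_powers) simp
  with 0 have "length vs \<le> 1" by simp
  moreover have "vs \<noteq> []" using 0 by auto
  ultimately obtain v where "vs = [v]" by (cases vs) auto
  then show ?case using 0 x by auto
next
  case (Suc n)
  have ne: "vs \<noteq> []" using Suc.prems(1) p2 by auto
  have le: "e v \<le> Suc n" if "v \<in> set vs" for v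
  proof -
    have "p ^ e v \<le> p ^ Suc n"
      using member_le_sum_list[of "p ^ e v" "map (\<lambda>v. p ^ e v) vs"] that Suc.prems(1) by auto
    then show ?thesis using p2 by (simp del: power_Suc)
  qed
  show ?case
  proof (cases "\<exists>v\<in>set vs. e v = Suc n")
    case True
    then obtain v where v: "v \<in> set vs" "e v = Suc n" by blast
    then obtain as bs where vs: "vs = as @ v # bs" by (meson split_list)
    have "(\<Sum>v\<leftarrow>as. p ^ e v) = 0" "(\<Sum>v\<leftarrow>bs. p ^ e v) = 0" using Suc.prems(1) v by (auto simp: vs)
    then have "as = []" "bs = []"
      using p2 length_le_sum_powers[of p as e] length_le_sum_powers[of p bs e] by auto
    then have "vs = [v]" using vs by simp
    then show ?thesis using Suc.prems(2)[OF v(1)] v x by auto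
  next
    case False
    then have le: "\<forall>v\<in>#mset vs. e v \<le> n" using le le_SucE by (metis set_mset_mset)
    have "(\<Sum>v\<in>#mset vs. p ^ e v) = p * p ^ n" using Suc.prems(1) by (simp add: sum_mset_sum_list flip: mset_map)
    from split_into_groups[OF _ le this] p2 obtain gs where gs: "length gs = p" "mset (concat gs) = mset vs"
      "\<forall>g\<in>set gs. (\<Sum>v\<leftarrow>g. p ^ e v) = p ^ n" by auto
    have sub: "set g \<subseteq> set vs" if "g \<in> set gs" for g
    proof -
      have "set g \<subseteq> set (concat gs)" using that by auto
      also have "\<dots> = set vs" using gs(2) mset_eq_setD by blast
      finally show ?thesis .
    qed
    obtain v where v: "v \<in> set vs" using ne by (cases vs) auto
    then obtain \<delta> where "\<delta> * p ^ (Suc n - e v) = d" using Suc.prems(2) by blast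
    then have "p dvd d" using le v by (auto simp: Suc_diff_le)
    then obtain d' where d': "d = d' * p" by (metis dvd_def mult.commute)
    have "T d' (lprod R (map x g)) (lprod S (map y g))" if g: "g \<in> set gs" for g
    proof (rule Suc.IH)
      show "(\<Sum>v\<leftarrow>g. p ^ e v) = p ^ n" using gs(3) g by blast
      fix v assume "v \<in> set g"
      then have v: "v \<in> set vs" using sub[OF g] by auto
      then obtain \<delta> where \<delta>: "\<delta> * p ^ (Suc n - e v) = d" "T \<delta> (x v) (y v)" using Suc.prems(2) by blast
      then have "\<delta> * p ^ (n - e v) = d'" using le v p2 by (auto simp: Suc_diff_le d')
      then show "\<exists>\<delta>. \<delta> * p ^ (n - e v) = d' \<and> T \<delta> (x v) (y v)" using \<delta> by blast
    qed
    then have "list_all2 (T d') (map (\<lambda>g. lprod R (map x g)) gs) (map (\<lambda>g. lprod S (map y g)) gs)"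
      by (auto simp: list_all2_conv_all_nth)
    from Tprod[OF _ this] have "T d (lprod R (map (\<lambda>g. lprod R (map x g)) gs)) (lprod S (map (\<lambda>g. lprod S (map y g)) gs))"
      using gs(1) by (simp add: d')
    moreover have "lprod R (map x vs) = lprod R (map (\<lambda>g. lprod R (map x g)) gs)"
      using R.S.lprod_mset_cong[OF x(1), of vs "concat gs"] gs(2) R.S.lprod_concat[of "map (map x) gs"] x
      by (simp add: map_concat o_def image_subset_iff)
    moreover have "lprod S (map y vs) = lprod S (map (\<lambda>g. lprod S (map y g)) gs)"
      using S.S.lprod_mset_cong[OF x(2), of vs "concat gs"] gs(2) S.S.lprod_concat[of "map (map y) gs"] x
      by (simp add: map_concat o_def image_subset_iff)
    ultimately show ?thesis by simp
  qed
qed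

lemma T_finsum:
  assumes "finite A" "\<And>i. i \<in> A \<Longrightarrow> T d (f i) (g i)"
  shows "T d (finsum R f A) (finsum S g A)"
  using assms
proof (induction A rule: finite_induct)
  case empty
  then show ?case using Tz by simp
next
  case (insert a A)
  then have "f \<in> A \<rightarrow> carrier R" "f a \<in> carrier R" "g \<in> A \<rightarrow> carrier S" "g a \<in> carrier S"
    using Tin by blast+
  then show ?case using insert Tadd by simp
qed

text \<open>
  This is where the Witt polynomials are seen to be polar: on entries of the right degrees,
  their values are obtained from \<open>p\<close>-fold products, sums and scalars.
\<close>

lemma T_pev:
  assumes P: "homog (actw p act) (p ^ n) P"
    and x: "\<forall>v. x v \<in> carrier R" "\<forall>v. y v \<in> carrier S"
    and inact: "\<And>v. \<not> act v \<Longrightarrow> \<exists>r\<in>carrier k. x v = \<iota> r \<and> y v = \<kappa> r"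
    and deg: "\<And>v. act v \<Longrightarrow> v div 2 \<le> n \<Longrightarrow> x v = \<zero>\<^bsub>R\<^esub> \<and> y v = \<zero>\<^bsub>S\<^esub> \<or>
      (\<exists>\<delta>. \<delta> * p ^ (n - v div 2) = d \<and> T \<delta> (x v) (y v))"
  shows "T d (pev R P x) (pev S P y)"
  unfolding pev_def
proof (rule T_finsum)
  fix m assume "m \<in> keys P"
  then have "wt (actw p act) m = p ^ n" using P by (simp add: homog_def)
  moreover obtain vs where vs: "m = (\<Sum>i\<leftarrow>vs. Poly_Mapping.single i 1)" by (rule monomial_list)
  ultimately have s: "(\<Sum>v\<leftarrow>vs. actw p act v) = p ^ n" by (simp add: wt_monomial_list del: One_nat_def)
  note bd = actw_bound[OF p2 s]
  have A: "T d (lprod R (map x (filter act vs))) (lprod S (map y (filter act vs)))"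
  proof (cases "\<exists>v\<in>set (filter act vs). x v = \<zero>\<^bsub>R\<^esub> \<and> y v = \<zero>\<^bsub>S\<^esub>")
    case True
    then obtain v where "v \<in> set (filter act vs)" "x v = \<zero>\<^bsub>R\<^esub>" "y v = \<zero>\<^bsub>S\<^esub>" by blast
    then have "lprod R (map x (filter act vs)) \<in> {\<zero>\<^bsub>R\<^esub>}" "lprod S (map y (filter act vs)) \<in> {\<zero>\<^bsub>S\<^esub>}"
      using x R.S.lprod_in_ideal[OF R.S.zeroideal, of "map x (filter act vs)" "\<zero>\<^bsub>R\<^esub>"]
        S.S.lprod_in_ideal[OF S.S.zeroideal, of "map y (filter act vs)" "\<zero>\<^bsub>S\<^esub>"] by (force simp: image_iff)+
    then show ?thesis using Tz by simp
  next
    case False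
    show ?thesis
    proof (rule T_monomial[OF x])
      show "(\<Sum>v\<leftarrow>filter act vs. p ^ (v div 2)) = p ^ n" using s unfolding actw_sum_list .
      fix v assume "v \<in> set (filter act vs)"
      then show "\<exists>\<delta>. \<delta> * p ^ (n - v div 2) = d \<and> T \<delta> (x v) (y v)" using deg[of v] False bd by auto
    qed
  qed
  have B: "\<exists>r\<in>carrier k. lprod R (map x ws) = \<iota> r \<and> lprod S (map y ws) = \<kappa> r" if "\<forall>v\<in>set ws. \<not> act v" for ws
    using that
  proof (induction ws)
    case Nil
    show ?case by (intro bexI[of _ "\<one>\<^bsub>k\<^esub>"]) auto
  next
    case (Cons v ws)
    then obtain r r' where "r \<in> carrier k" "lprod R (map x ws) = \<iota> r" "lprod S (map y ws) = \<kappa> r"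
      "r' \<in> carrier k" "x v = \<iota> r'" "y v = \<kappa> r'" using inact[of v] by auto
    then show ?case by (intro bexI[of _ "r' \<otimes>\<^bsub>k\<^esub> r"]) auto
  qed
  obtain r where r: "r \<in> carrier k" "lprod R (map x (filter (\<lambda>v. \<not> act v) vs)) = \<iota> r"
    "lprod S (map y (filter (\<lambda>v. \<not> act v) vs)) = \<kappa> r" using B[of "filter (\<lambda>v. \<not> act v) vs"] by auto
  have "mev R x m = \<iota> r \<otimes>\<^bsub>R\<^esub> lprod R (map x (filter act vs))"
    unfolding vs using r Tin[OF A] R.S.lprod_filter_split[OF x(1), of vs act]
    by (simp add: R.S.mev_eq_lprod[OF x(1)] R.S.m_comm del: One_nat_def)
  moreover have "mev S y m = \<kappa> r \<otimes>\<^bsub>S\<^esub> lprod S (map y (filter act vs))"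
    unfolding vs using r Tin[OF A] S.S.lprod_filter_split[OF x(2), of vs act]
    by (simp add: S.S.mev_eq_lprod[OF x(2)] S.S.m_comm del: One_nat_def)
  ultimately have C: "T d (mev R x m) (mev S y m)" using Tscal[OF r(1) A] by simp
  let ?c = "[lookup P m] \<cdot>\<^bsub>k\<^esub> \<one>\<^bsub>k\<^esub>"
  have cc: "?c \<in> carrier k" by simp
  have "\<iota> ?c \<otimes>\<^bsub>R\<^esub> mev R x m = [lookup P m] \<cdot>\<^bsub>R\<^esub> mev R x m"
    using Tin[OF C] by (simp add: R.hom_int_add_pow R.S.add_pow_ldistr_int)
  moreover have "\<kappa> ?c \<otimes>\<^bsub>S\<^esub> mev S y m = [lookup P m] \<cdot>\<^bsub>S\<^esub> mev S y m"
    using Tin[OF C] by (simp add: S.hom_int_add_pow S.S.add_pow_ldistr_int)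
  ultimately show "T d ([lookup P m] \<cdot>\<^bsub>R\<^esub> mev R x m) ([lookup P m] \<cdot>\<^bsub>S\<^esub> mev S y m)"
    using Tscal[OF cc C] by simp
qed simp

end

section \<open>Covectors with a nilpotent tail\<close>

lemma ev_value_eq:
  assumes "\<And>m. m0 \<le> m \<Longrightarrow> f m = v" shows "ev_value f = v"
  unfolding ev_value_def
proof (rule the_equality)
  show "\<forall>\<^sub>F m in sequentially. f m = v" using assms by (auto simp: eventually_sequentially)
  fix w assume "\<forall>\<^sub>F m in sequentially. f m = w"
  then obtain N where "\<forall>n\<ge>N. f n = w" by (auto simp: eventually_sequentially)
  then show "w = v" using assms[of "max N m0"] by (metis max.cobounded1 max.cobounded2)
qed

text \<open>
  The covector \<open>a\<close> cut off to the Witt vector \<open>(a\<^sub>-\<^sub>M, \<dots>, a\<^sub>0)\<close> and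
  continued by the default value \<open>a\<^sub>0\<close>.
\<close>

definition wv :: "(nat \<Rightarrow> 'a) \<Rightarrow> nat \<Rightarrow> nat \<Rightarrow> 'a"
  where "wv a M = (\<lambda>s. a (M - s))"

context walg begin

lemma p2: "2 \<le> p" using p by (rule prime_ge_2_nat)

lemma wadd_eq_pev: "wadd p R a b n = pev R (witt_sum p n) (ilv a b)"
  by (simp add: wadd_def peval_pev)

lemma wmul_eq_pev: "wmul p R a b n = pev R (witt_prod p n) (ilv a b)"
  by (simp add: wmul_def peval_pev)

lemma homog_sum': "homog (actw p (\<lambda>_. True)) (p ^ n) (witt_sum p n)"
  using homog_witt_sum[OF p] by simp

lemmas homog_prod' = homog_witt_prod(2)[OF p]

lemma wadd_local:
  assumes I: "nilp R I L" and c: "\<forall>i. a i \<in> carrier R" "\<forall>i. b i \<in> carrier R" "\<forall>i. a' i \<in> carrier R" "\<forall>i. b' i \<in> carrier R"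
    and hi: "\<And>s. t \<le> s \<Longrightarrow> s \<le> n \<Longrightarrow> a s = a' s \<and> b s = b' s"
    and lo: "\<And>s. s < q \<Longrightarrow> a s \<in> I \<and> a' s \<in> I \<and> b s \<in> I \<and> b' s \<in> I"
    and q: "t + L \<le> q" "q \<le> n"
  shows "wadd p R a b n = wadd p R a' b' n"
  unfolding wadd_eq_pev
proof (rule R.pev_local[OF p2 homog_sum' I _ _ _ _ _ q])
  show "\<forall>v. ilv a b v \<in> carrier R" "\<forall>v. ilv a' b' v \<in> carrier R" using c by (auto simp: ilv_def)
qed (use hi lo in \<open>auto simp: ilv_def\<close>)

lemma wmul_local:
  assumes I: "nilp R I L" and c: "\<forall>i. l i \<in> carrier R" "\<forall>i. b i \<in> carrier R" "\<forall>i. b' i \<in> carrier R"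
    and hi: "\<And>s. t \<le> s \<Longrightarrow> s \<le> n \<Longrightarrow> b s = b' s"
    and lo: "\<And>s. s < q \<Longrightarrow> b s \<in> I \<and> b' s \<in> I"
    and q: "t + L \<le> q" "q \<le> n"
  shows "wmul p R l b n = wmul p R l b' n"
  unfolding wmul_eq_pev
proof (rule R.pev_local[OF p2 homog_prod' I _ _ _ _ _ q])
  show "\<forall>v. ilv l b v \<in> carrier R" "\<forall>v. ilv l b' v \<in> carrier R" using c by (auto simp: ilv_def)
qed (use hi lo in \<open>auto simp: ilv_def\<close>)

lemma wadd_in_ideal:
  assumes I: "ideal I R" and c: "\<forall>i. a i \<in> carrier R" "\<forall>i. b i \<in> carrier R"
    and "\<And>s. s \<le> n \<Longrightarrow> a s \<in> I \<and> b s \<in> I"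
  shows "wadd p R a b n \<in> I"
  unfolding wadd_eq_pev
proof (rule R.pev_in_ideal[OF p2 homog_sum' I])
  show "\<forall>v. ilv a b v \<in> carrier R" using c by (auto simp: ilv_def)
qed (use assms in \<open>auto simp: ilv_def\<close>)

lemma wmul_in_ideal:
  assumes I: "ideal I R" and c: "\<forall>i. l i \<in> carrier R" "\<forall>i. b i \<in> carrier R"
    and "\<And>s. s \<le> n \<Longrightarrow> b s \<in> I"
  shows "wmul p R l b n \<in> I"
  unfolding wmul_eq_pev
proof (rule R.pev_in_ideal[OF p2 homog_prod' I])
  show "\<forall>v. ilv l b v \<in> carrier R" using c by (auto simp: ilv_def)
qed (use assms in \<open>auto simp: ilv_def\<close>)

definition cwadd :: "(nat \<Rightarrow> 'b) \<Rightarrow> (nat \<Rightarrow> 'b) \<Rightarrow> nat \<Rightarrow> 'b"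
  where "cwadd a b = (\<lambda>i. ev_value (\<lambda>m. wadd p R (wv a (i + m)) (wv b (i + m)) m))"

definition cwmul :: "(nat \<Rightarrow> 'k) \<Rightarrow> (nat \<Rightarrow> 'b) \<Rightarrow> nat \<Rightarrow> 'b"
  where "cwmul l a = (\<lambda>i. ev_value (\<lambda>m. wmul p R (thw (i + m) l) (wv a (i + m)) m))"

text \<open>
  Twists for consecutive cut-offs differ by a Frobenius, which is the Frobenius in the
  projection formula.
\<close>

lemma thw_Suc: "l \<in> carrier (witt_ring p k) \<Longrightarrow> wfr p R (thw (Suc M) l) = thw M l"
proof -
  assume l: "l \<in> carrier (witt_ring p k)"
  have "(wfrob_inv p k ^^ Suc M) (wfrob p k l) = (wfrob_inv p k ^^ M) l"
    using l by (simp add: wfin_wfrob wfi_left wfin_closed)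
  then show ?thesis unfolding thw_wfrob[OF l, symmetric] by (simp add: thw_def)
qed

text \<open>
  All entries of the covector from \<open>a\<^sub>-\<^sub>r\<close> on lie in a nilpotent ideal. This covers
  finite covectors (with the ideal zero) and connected ones of degree zero (with \<open>r = 0\<close>).
\<close>

definition tailed :: "'b set \<Rightarrow> nat \<Rightarrow> nat \<Rightarrow> (nat \<Rightarrow> 'b) \<Rightarrow> bool"
  where "tailed I L r a \<longleftrightarrow> nilp R I L \<and> (\<forall>i. a i \<in> carrier R) \<and> (\<forall>i\<ge>r. a i \<in> I)"

text \<open>
  Lengthening the cut-off by one replaces a lowest entry zero by an element of the nilpotent
  ideal, and the sum at a position that far above does not change. The bound \<open>r + L\<close> is uniform
  in \<open>i\<close>, which makes addition continuous.
\<close>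

lemma cwadd_value:
  assumes a: "tailed I L r a" and b: "tailed I L r b" and m: "r + L \<le> m"
  shows "cwadd a b i = wadd p R (wv a (i + m)) (wv b (i + m)) m"
proof -
  let ?s = "\<lambda>m. wadd p R (wv a (i + m)) (wv b (i + m)) m"
  have I: "nilp R I L" and ac: "\<forall>i. a i \<in> carrier R" "\<forall>i. b i \<in> carrier R" and at: "\<And>i. r \<le> i \<Longrightarrow> a i \<in> I \<and> b i \<in> I"
    using a b by (auto simp: tailed_def)
  have wvc: "\<forall>s. wv a M s \<in> carrier R" "\<forall>s. wv b M s \<in> carrier R" for M using ac by (auto simp: wv_def)
  have stp: "?s (Suc m) = ?s m" if m: "r + L \<le> m" for m
  proof -
    have "wadd p R (wv a (i + Suc m)) (wv b (i + Suc m)) (Suc m) =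
      wadd p R (vshift \<zero> (wv a (i + m))) (vshift \<zero> (wv b (i + m))) (Suc m)"
    \<comment> \<open>only entry \<open>0\<close> differs, and all entries below \<open>m + 1 - r\<close> lie in the nilpotent ideal\<close>
    proof (rule wadd_local[OF I, where t = 1 and q = "Suc m - r"])
      show "\<forall>s. wv a (i + Suc m) s \<in> carrier R" "\<forall>s. wv b (i + Suc m) s \<in> carrier R" by (rule wvc)+
      show "\<forall>s. vshift \<zero> (wv a (i + m)) s \<in> carrier R" "\<forall>s. vshift \<zero> (wv b (i + m)) s \<in> carrier R"
        using wvc by (simp_all add: vshift_closed)
      fix s
      show "wv a (i + Suc m) s = vshift \<zero> (wv a (i + m)) s \<and> wv b (i + Suc m) s = vshift \<zero> (wv b (i + m)) s" if "1 \<le> s"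
        using that by (cases s) (auto simp: wv_def)
      show "wv a (i + Suc m) s \<in> I \<and> vshift \<zero> (wv a (i + m)) s \<in> I \<and> wv b (i + Suc m) s \<in> I \<and> vshift \<zero> (wv b (i + m)) s \<in> I"
        if "s < Suc m - r"
        using that at R.ideal_zero[OF nilp_ideal[OF I]] by (cases s) (auto simp: wv_def)
    qed (use m in auto)
    also have "\<dots> = ?s m" using wadd_vshift[OF p R wvc] by simp
    finally show ?thesis .
  qed
  have const: "?s n = ?s (r + L)" if "r + L \<le> n" for n
    using that
  proof (induction n rule: dec_induct)
    case (step j)
    then show ?case using stp[of j] by (simp only:)
  qed (rule refl)
  have "cwadd a b i = ?s (r + L)" unfolding cwadd_def by (rule ev_value_eq) (rule const)
  then show ?thesis using const[OF m] by simp
qed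

lemma cwmul_value:
  assumes l: "l \<in> carrier (witt_ring p k)" and b: "tailed I L r b" and m: "r + L \<le> m"
  shows "cwmul l b i = wmul p R (thw (i + m) l) (wv b (i + m)) m"
proof -
  let ?s = "\<lambda>m. wmul p R (thw (i + m) l) (wv b (i + m)) m"
  have I: "nilp R I L" and bc: "\<forall>i. b i \<in> carrier R" and bt: "\<And>i. r \<le> i \<Longrightarrow> b i \<in> I"
    using b by (auto simp: tailed_def)
  have wvc: "\<forall>s. wv b M s \<in> carrier R" for M using bc by (auto simp: wv_def)
  have tc: "\<forall>s. thw M l s \<in> carrier R" for M using thw_closed[OF l] by auto
  have stp: "?s (Suc m) = ?s m" if m: "r + L \<le> m" for m
  proof -
    have "wmul p R (thw (i + Suc m) l) (wv b (i + Suc m)) (Suc m) =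
      wmul p R (thw (i + Suc m) l) (vshift \<zero> (wv b (i + m))) (Suc m)"
    proof (rule wmul_local[OF I, where t = 1 and q = "Suc m - r"])
      show "\<forall>s. thw (i + Suc m) l s \<in> carrier R" by (rule tc)
      show "\<forall>s. wv b (i + Suc m) s \<in> carrier R" by (rule wvc)+
      show "\<forall>s. vshift \<zero> (wv b (i + m)) s \<in> carrier R"
        using wvc by (simp add: vshift_closed)
      fix s
      show "wv b (i + Suc m) s = vshift \<zero> (wv b (i + m)) s" if "1 \<le> s"
        using that by (cases s) (auto simp: wv_def)
      show "wv b (i + Suc m) s \<in> I \<and> vshift \<zero> (wv b (i + m)) s \<in> I"
        if "s < Suc m - r"
        using that bt R.ideal_zero[OF nilp_ideal[OF I]] by (cases s) (auto simp: wv_def)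
    qed (use m in auto)
    also have "\<dots> = ?s m" using wmul_vshift[OF p R Rchar tc wvc] thw_Suc[OF l] by simp
    finally show ?thesis .
  qed
  have const: "?s n = ?s (r + L)" if "r + L \<le> n" for n
    using that
  proof (induction n rule: dec_induct)
    case (step j)
    then show ?case using stp[of j] by (simp only:)
  qed (rule refl)
  have "cwmul l b i = ?s (r + L)" unfolding cwmul_def by (rule ev_value_eq) (rule const)
  then show ?thesis using const[OF m] by simp
qed

text \<open>
  The family \<open>x\<close> of Witt vectors represents the covector \<open>a\<close>: up to \<open>c\<close> initial entries, \<open>x M\<close>
  is \<open>(a\<^sub>-\<^sub>M, \<dots>, a\<^sub>0)\<close>, and it lies in the nilpotent ideal outside of
  the last \<open>r\<close> entries. The \<open>c\<close> wrong entries are needed because sums of cut-off covectors are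
  correct only from some entry on.
\<close>

definition rp :: "'b set \<Rightarrow> nat \<Rightarrow> nat \<Rightarrow> nat \<Rightarrow> (nat \<Rightarrow> nat \<Rightarrow> 'b) \<Rightarrow> (nat \<Rightarrow> 'b) \<Rightarrow> bool"
  where "rp I L r c x a \<longleftrightarrow> nilp R I L \<and> (\<forall>M s. x M s \<in> carrier R) \<and>
    (\<forall>M s. c \<le> s \<longrightarrow> s \<le> M \<longrightarrow> x M s = a (M - s)) \<and> (\<forall>M s. s + r \<le> M \<longrightarrow> x M s \<in> I)"

lemma rp_tailed: assumes "rp I L r c x a" shows "tailed I L r a"
proof -
  have e: "a i = x (i + c) c" for i using assms by (auto simp: rp_def)
  have xc: "\<forall>M s. x M s \<in> carrier R" and xI: "\<forall>M s. s + r \<le> M \<longrightarrow> x M s \<in> I"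
    using assms by (auto simp: rp_def)
  show ?thesis unfolding tailed_def
  proof (intro conjI allI impI)
    show "nilp R I L" using assms by (simp add: rp_def)
    fix i
    show "a i \<in> carrier R" using xc by (simp add: e)
    show "a i \<in> I" if "r \<le> i" using xI that by (simp add: e)
  qed
qed

lemma rp_of_tailed: "tailed I L r a \<Longrightarrow> rp I L r 0 (wv a) a"
  by (auto simp: rp_def tailed_def wv_def)

lemma rp_mono:
  assumes "rp I L r c x a" "I \<subseteq> J" "nilp R J K" "r \<le> r'" "c \<le> c'"
  shows "rp J K r' c' x a"
  using assms by (fastforce simp: rp_def)

text \<open>
  Two representations are made comparable by adding up their nilpotent ideals.
\<close>

lemma rp_join:
  assumes x: "rp I L r c x a" and y: "rp J K r' c' y b"
  shows "\<exists>I L r c. rp I L r c x a \<and> rp I L r c y b"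
proof -
  have I: "nilp R I L" and J: "nilp R J K" using x y by (auto simp: rp_def)
  note n = R.nilp_add[OF I J]
  have sub: "I \<subseteq> I <+>\<^bsub>R\<^esub> J" "J \<subseteq> I <+>\<^bsub>R\<^esub> J"
    using R.ideal_add_left R.ideal_add_right nilp_ideal[OF I] nilp_ideal[OF J] by auto
  show ?thesis
    using rp_mono[OF x sub(1) n max.cobounded1 max.cobounded1] rp_mono[OF y sub(2) n max.cobounded2 max.cobounded2] by blast
qed

lemma rp_unique:
  assumes x: "rp I L r c x a" and y: "rp J K r' c' x b" shows "a = b"
proof
  fix i
  show "a i = b i" using x y unfolding rp_def
    by (metis add_diff_cancel_right' le_add2 max.cobounded1 max.cobounded2)
qed

lemma rp_zero: "rp {\<zero>} 1 0 0 (\<lambda>M s. \<zero>) (\<lambda>i. \<zero>)"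
  using R.nilp_zero by (auto simp: rp_def)

lemma rp_add:
  assumes x: "rp I L r c x a" and y: "rp I L r c y b"
  shows "rp I L r (c + r + L) (\<lambda>M. wadd p R (x M) (y M)) (cwadd a b)"
  unfolding rp_def
proof (intro conjI allI impI)
  note ta = rp_tailed[OF x] and tb = rp_tailed[OF y]
  show I: "nilp R I L" using x by (simp add: rp_def)
  fix M s
  have xc: "\<forall>s. x M s \<in> carrier R" "\<forall>s. y M s \<in> carrier R" using x y by (auto simp: rp_def)
  then show "wadd p R (x M) (y M) s \<in> carrier R" by simp
  show "wadd p R (x M) (y M) s = cwadd a b (M - s)" if s: "c + r + L \<le> s" "s \<le> M"
  proof -
    have "cwadd a b (M - s) = wadd p R (wv a M) (wv b M) s"
      using cwadd_value[OF ta tb, of s "M - s"] s by simp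
    also have "\<dots> = wadd p R (x M) (y M) s"
    \<comment> \<open>\<open>x M\<close> and the cut-off covector agree from entry \<open>c\<close> on, and lie in \<open>I\<close> below \<open>s - r\<close>\<close>
    proof (rule wadd_local[OF I, where t = c and q = "s - r"])
      show "\<forall>i. wv a M i \<in> carrier R" "\<forall>i. wv b M i \<in> carrier R"
        using ta tb by (auto simp: tailed_def wv_def)
      fix t
      show "wv a M t = x M t \<and> wv b M t = y M t" if "c \<le> t" "t \<le> s"
        using that s x y by (auto simp: rp_def wv_def)
      show "wv a M t \<in> I \<and> x M t \<in> I \<and> wv b M t \<in> I \<and> y M t \<in> I" if "t < s - r"
        using that s x y ta tb by (auto simp: rp_def wv_def tailed_def)
    qed (use xc s in auto)
    finally show ?thesis by simp
  qed
  show "wadd p R (x M) (y M) s \<in> I" if "s + r \<le> M"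
    using that x y by (intro wadd_in_ideal[OF nilp_ideal[OF I] xc]) (auto simp: rp_def)
qed

lemma rp_smult:
  assumes l: "l \<in> carrier (witt_ring p k)" and y: "rp I L r c y b"
  shows "rp I L r (c + r + L) (\<lambda>M. wmul p R (thw M l) (y M)) (cwmul l b)"
  unfolding rp_def
proof (intro conjI allI impI)
  note tb = rp_tailed[OF y]
  show I: "nilp R I L" using y by (simp add: rp_def)
  fix M s
  have xc: "\<forall>s. thw M l s \<in> carrier R" "\<forall>s. y M s \<in> carrier R" using thw_closed[OF l] y by (auto simp: rp_def)
  then show "wmul p R (thw M l) (y M) s \<in> carrier R" by simp
  show "wmul p R (thw M l) (y M) s = cwmul l b (M - s)" if s: "c + r + L \<le> s" "s \<le> M"
  proof -
    have "cwmul l b (M - s) = wmul p R (thw M l) (wv b M) s"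
      using cwmul_value[OF l tb, of s "M - s"] s by simp
    also have "\<dots> = wmul p R (thw M l) (y M) s"
    proof (rule wmul_local[OF I, where t = c and q = "s - r"])
      show "\<forall>i. wv b M i \<in> carrier R" using tb by (auto simp: tailed_def wv_def)
      fix t
      show "wv b M t = y M t" if "c \<le> t" "t \<le> s"
        using that s y by (auto simp: rp_def wv_def)
      show "wv b M t \<in> I \<and> y M t \<in> I" if "t < s - r"
        using that s y tb by (auto simp: rp_def wv_def tailed_def)
    qed (use xc s in auto)
    finally show ?thesis by simp
  qed
  show "wmul p R (thw M l) (y M) s \<in> I" if "s + r \<le> M"
    using that y by (intro wmul_in_ideal[OF nilp_ideal[OF I] xc]) (auto simp: rp_def)
qed

lemma ideal_pow: "ideal I R \<Longrightarrow> x \<in> I \<Longrightarrow> x [^] p \<in> I"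
proof -
  assume I: "ideal I R" and x: "x \<in> I"
  obtain q where "p = Suc q" using ppos by (metis gr0_implies_Suc)
  then show ?thesis using I x R.ideal_mult[OF I, of "x [^] q" x] R.ideal_sub[OF I x] by simp
qed

lemma rp_F:
  assumes y: "rp I L r c y b" shows "rp I L r c (wfamF y) (\<lambda>i. b i [^] p)"
  using y ideal_pow[of I] nilp_ideal[of R I L] by (auto simp: rp_def wfamF_def wfr_def)

lemma rp_V:
  assumes y: "rp I L r c y b" shows "rp I L r (Suc c) (wfamV y) (\<lambda>i. b (Suc i))"
  unfolding rp_def
proof (intro conjI allI impI)
  show I: "nilp R I L" using y by (simp add: rp_def)
  fix M s
  show "wfamV y M s \<in> carrier R" using y by (cases s) (auto simp: rp_def wfamV_def)
  show "wfamV y M s = b (Suc (M - s))" if "Suc c \<le> s" "s \<le> M"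
    using that y by (cases s) (auto simp: rp_def wfamV_def Suc_diff_le[symmetric])
  show "wfamV y M s \<in> I" if "s + r \<le> M"
    using that y R.ideal_zero[OF nilp_ideal[OF I]] by (cases s) (auto simp: rp_def wfamV_def)
qed

lemma tailed_cwadd: "tailed I L r a \<Longrightarrow> tailed I L r b \<Longrightarrow> tailed I L r (cwadd a b)"
  using rp_tailed[OF rp_add[OF rp_of_tailed rp_of_tailed]] .

lemma tailed_cwmul: "l \<in> carrier (witt_ring p k) \<Longrightarrow> tailed I L r b \<Longrightarrow> tailed I L r (cwmul l b)"
  using rp_tailed[OF rp_smult[OF _ rp_of_tailed]] .

end

section \<open>The even part of a graded commutative algebra\<close>

text \<open>
  For a graded-commutative algebra \<open>B\<close>, the even part \<open>R\<close> is a commutative ring and an algebra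
  over \<open>k\<close>; its Witt vectors and covectors are those of \<open>B\<close>.
\<close>

locale galgebra =
  fixes p :: nat and k :: "('k, 'r) ring_scheme" and B :: "('k, 'b) galg"
  assumes p: "prime p" and k: "field k" and kchar: "[p] \<cdot>\<^bsub>k\<^esub> \<one>\<^bsub>k\<^esub> = \<zero>\<^bsub>k\<^esub>"
    and perf: "(\<lambda>x. x [^]\<^bsub>k\<^esub> p) ` carrier k = carrier k"
    and B: "graded_comm_algebra k B"
begin

sublocale B: ring B using B unfolding graded_comm_algebra_def by blast
sublocale Bm: Module.module k B using B unfolding graded_comm_algebra_def by blast
sublocale k: field k by (rule k)

lemma smult_mult:
  "r \<in> carrier k \<Longrightarrow> x \<in> carrier B \<Longrightarrow> y \<in> carrier B \<Longrightarrow> (r \<odot>\<^bsub>B\<^esub> x) \<otimes>\<^bsub>B\<^esub> y = r \<odot>\<^bsub>B\<^esub> (x \<otimes>\<^bsub>B\<^esub> y)"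
  "r \<in> carrier k \<Longrightarrow> x \<in> carrier B \<Longrightarrow> y \<in> carrier B \<Longrightarrow> x \<otimes>\<^bsub>B\<^esub> (r \<odot>\<^bsub>B\<^esub> y) = r \<odot>\<^bsub>B\<^esub> (x \<otimes>\<^bsub>B\<^esub> y)"
  using B unfolding graded_comm_algebra_def by blast+

lemma gr_sub: "submodule (gr B j) k B" using B unfolding graded_comm_algebra_def by blast
lemma one_gr: "\<one>\<^bsub>B\<^esub> \<in> gr B 0" using B unfolding graded_comm_algebra_def by blast
lemma mult_gr: "x \<in> gr B i \<Longrightarrow> y \<in> gr B j \<Longrightarrow> x \<otimes>\<^bsub>B\<^esub> y \<in> gr B (i + j)"
  using B unfolding graded_comm_algebra_def by blast
lemma comm_gr: "x \<in> gr B i \<Longrightarrow> y \<in> gr B j \<Longrightarrow> x \<otimes>\<^bsub>B\<^esub> y = [((- 1 :: int) ^ (i * j))] \<cdot>\<^bsub>B\<^esub> (y \<otimes>\<^bsub>B\<^esub> x)"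
  using B unfolding graded_comm_algebra_def by blast

lemma gr_carrier: "x \<in> gr B j \<Longrightarrow> x \<in> carrier B" using Bm.submoduleE(1)[OF gr_sub] by blast
lemma gr_add: "x \<in> gr B j \<Longrightarrow> y \<in> gr B j \<Longrightarrow> x \<oplus>\<^bsub>B\<^esub> y \<in> gr B j" using Bm.submoduleE(5)[OF gr_sub] .
lemma gr_neg: "x \<in> gr B j \<Longrightarrow> \<ominus>\<^bsub>B\<^esub> x \<in> gr B j" using Bm.submoduleE(3)[OF gr_sub] .
lemma gr_smult: "r \<in> carrier k \<Longrightarrow> x \<in> gr B j \<Longrightarrow> r \<odot>\<^bsub>B\<^esub> x \<in> gr B j" using Bm.submoduleE(4)[OF gr_sub] .
lemma gr_zero: "\<zero>\<^bsub>B\<^esub> \<in> gr B j"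
  using subgroup.one_closed[OF submodule.axioms(1)[OF gr_sub]] by simp

abbreviation R where "R \<equiv> ev_part p B"

lemma R_simps [simp]: "monoid.mult R = monoid.mult B" "one R = one B" "zero R = zero B" "add R = add B" "smult R = smult B"
  "gr R = (\<lambda>j. if ev_degree p j then gr B j else {\<zero>\<^bsub>B\<^esub>})"
  by (auto simp: ev_part_def)

lemma R_pow [simp]: "x [^]\<^bsub>R\<^esub> (n::nat) = x [^]\<^bsub>B\<^esub> n"
  by (simp add: nat_pow_def)

lemma R_lprod [simp]: "lprod R xs = lprod B xs"
  by (simp add: lprod_def)

lemma R_carrier: "carrier R = {x. \<exists>c J. finite J \<and> (\<forall>j\<in>J. ev_degree p j \<and> c j \<in> gr B j) \<and> x = finsum B c J}"
  by (simp add: ev_part_def)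

lemma R_zero_in: "\<zero>\<^bsub>B\<^esub> \<in> carrier R"
  unfolding R_carrier by (rule CollectI, rule exI[of _ "\<lambda>_. \<zero>\<^bsub>B\<^esub>"], rule exI[of _ "{}"]) simp

lemma R_step:
  assumes j: "ev_degree p j" "y \<in> gr B j" and z: "z \<in> carrier R"
  shows "y \<oplus>\<^bsub>B\<^esub> z \<in> carrier R"
proof -
  obtain c J where c: "finite J" "\<forall>j\<in>J. ev_degree p j \<and> c j \<in> gr B j" "z = finsum B c J"
    using z unfolding R_carrier by blast
  have cc: "c \<in> J' \<rightarrow> carrier B" if "J' \<subseteq> J" for J' using c that gr_carrier by blast
  have yc: "y \<in> carrier B" using gr_carrier j by blast
  define d where "d = c(j := if j \<in> J then y \<oplus>\<^bsub>B\<^esub> c j else y)"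
  have dj: "d j \<in> gr B j" using j c(2) gr_add by (auto simp: d_def)
  have fs: "finsum B d (J - {j}) = finsum B c (J - {j})"
    using cc by (intro B.finsum_cong') (auto simp: d_def Pi_def)
  have dcar: "d \<in> (J - {j}) \<rightarrow> carrier B" using cc[of "J - {j}"] by (auto simp: d_def Pi_def)
  have "finsum B d (insert j J) = d j \<oplus>\<^bsub>B\<^esub> finsum B d (J - {j})"
    using B.finsum_insert[of "J - {j}" j d] c(1) dcar dj gr_carrier by (simp add: insert_Diff_single)
  also have "\<dots> = y \<oplus>\<^bsub>B\<^esub> z"
  proof (cases "j \<in> J")
    case True
    then have cj: "c j \<in> carrier B" using c(2) gr_carrier by blast
    from True have "z = c j \<oplus>\<^bsub>B\<^esub> finsum B c (J - {j})"
      using B.finsum_insert[of "J - {j}" j c] c cc[of "J - {j}"] cj by (simp add: insert_absorb)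
    then show ?thesis using True fs yc cj cc[of "J - {j}"] by (simp add: d_def B.a_assoc)
  next
    case False
    then show ?thesis using fs c by (simp add: d_def)
  qed
  finally have e: "y \<oplus>\<^bsub>B\<^esub> z = finsum B d (insert j J)" by simp
  have "\<forall>i\<in>insert j J. ev_degree p i \<and> d i \<in> gr B i" using c(2) j dj by (auto simp: d_def)
  then show ?thesis using c(1) e unfolding R_carrier by blast
qed

lemma R_induct [consumes 1, case_names zero step]:
  assumes x: "x \<in> carrier R" and "Q \<zero>\<^bsub>B\<^esub>"
    and "\<And>j y z. ev_degree p j \<Longrightarrow> y \<in> gr B j \<Longrightarrow> z \<in> carrier R \<Longrightarrow> z \<in> carrier B \<Longrightarrow> y \<in> carrier B \<Longrightarrow> Q z \<Longrightarrow> Q (y \<oplus>\<^bsub>B\<^esub> z)"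
  shows "Q x"
proof -
  obtain c J where c: "finite J" "\<forall>j\<in>J. ev_degree p j \<and> c j \<in> gr B j" "x = finsum B c J"
    using x unfolding R_carrier by blast
  have "Q (finsum B c J) \<and> finsum B c J \<in> carrier R \<and> finsum B c J \<in> carrier B" using c(1,2)
  proof (induction J rule: finite_induct)
    case empty
    then show ?case using assms(2) R_zero_in by simp
  next
    case (insert j J)
    then have cc: "c \<in> J \<rightarrow> carrier B" "c j \<in> carrier B" using gr_carrier by blast+
    then show ?case using insert assms(3)[of j "c j" "finsum B c J"] R_step[of j "c j" "finsum B c J"] by simp
  qed
  then show ?thesis using c by simp
qed

lemma R_sub: "x \<in> carrier R \<Longrightarrow> x \<in> carrier B"
  by (induction x rule: R_induct) auto

lemma gr_R: "ev_degree p j \<Longrightarrow> y \<in> gr B j \<Longrightarrow> y \<in> carrier R"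
  using R_step[OF _ _ R_zero_in, of j y] gr_carrier[of y j] by simp

lemma R_add: "x \<in> carrier R \<Longrightarrow> y \<in> carrier R \<Longrightarrow> x \<oplus>\<^bsub>B\<^esub> y \<in> carrier R"
proof (induction x rule: R_induct)
  case zero
  then show ?case using R_sub by simp
next
  case (step j u z)
  then show ?case using R_step[of j u "z \<oplus>\<^bsub>B\<^esub> y"] R_sub[of y] by (simp add: B.a_assoc)
qed

lemma R_neg: "x \<in> carrier R \<Longrightarrow> \<ominus>\<^bsub>B\<^esub> x \<in> carrier R"
proof (induction x rule: R_induct)
  case zero
  then show ?case using R_zero_in by simp
next
  case (step j u z)
  then show ?case using R_step[of j "\<ominus>\<^bsub>B\<^esub> u" "\<ominus>\<^bsub>B\<^esub> z"] gr_neg by (simp add: B.minus_add)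
qed

lemma ev_degree_add: "ev_degree p i \<Longrightarrow> ev_degree p j \<Longrightarrow> ev_degree p (i + j)"
  by (auto simp: ev_degree_def)

lemma R_mult: "x \<in> carrier R \<Longrightarrow> y \<in> carrier R \<Longrightarrow> x \<otimes>\<^bsub>B\<^esub> y \<in> carrier R"
proof (induction x rule: R_induct)
  case zero
  then show ?case using R_sub R_zero_in by simp
next
  case (step i u z)
  have "u \<otimes>\<^bsub>B\<^esub> y \<in> carrier R" using \<open>y \<in> carrier R\<close>
  proof (induction y rule: R_induct)
    case zero
    then show ?case using step R_zero_in by simp
  next
    case (step j w t)
    then show ?case
      using R_step[of "i + j" "u \<otimes>\<^bsub>B\<^esub> w" "u \<otimes>\<^bsub>B\<^esub> t"] mult_gr \<open>ev_degree p i\<close> \<open>u \<in> gr B i\<close> \<open>u \<in> carrier B\<close>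
      by (simp add: B.r_distr ev_degree_add)
  qed
  then show ?case using step R_add R_sub[of y] by (simp add: B.l_distr)
qed

lemma p_mult_zero: "x \<in> carrier B \<Longrightarrow> [p] \<cdot>\<^bsub>B\<^esub> x = \<zero>\<^bsub>B\<^esub>"
proof -
  assume x: "x \<in> carrier B"
  have "[n] \<cdot>\<^bsub>B\<^esub> x = ([n] \<cdot>\<^bsub>k\<^esub> \<one>\<^bsub>k\<^esub>) \<odot>\<^bsub>B\<^esub> x" for n :: nat
    using x by (induction n) (auto simp: Bm.smult_l_distr)
  then show ?thesis using kchar x by simp
qed

text \<open>
  For \<open>p = 2\<close> odd degrees also commute, because signs do not matter in characteristic \<open>2\<close>.
\<close>

lemma comm_ev:
  assumes i: "ev_degree p i" "x \<in> gr B i" and j: "ev_degree p j" "y \<in> gr B j"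
  shows "x \<otimes>\<^bsub>B\<^esub> y = y \<otimes>\<^bsub>B\<^esub> x"
proof -
  have c: "x \<in> carrier B" "y \<in> carrier B" using i j gr_carrier by auto
  have 1: "[(1::int)] \<cdot>\<^bsub>B\<^esub> z = z" if "z \<in> carrier B" for z using that by (simp add: add_pow_int_ge)
  show ?thesis
  proof (cases "even (i * j)")
    case True
    then show ?thesis using comm_gr[OF i(2) j(2)] 1 c by simp
  next
    case False
    then have p2: "p = 2" using i by (auto simp: ev_degree_def)
    have "[(2::nat)] \<cdot>\<^bsub>B\<^esub> (y \<otimes>\<^bsub>B\<^esub> x) = \<zero>\<^bsub>B\<^esub>" using p_mult_zero[of "y \<otimes>\<^bsub>B\<^esub> x"] c p2 by simp
    then have "(y \<otimes>\<^bsub>B\<^esub> x) \<oplus>\<^bsub>B\<^esub> (y \<otimes>\<^bsub>B\<^esub> x) = \<zero>\<^bsub>B\<^esub>" using c by (simp add: numeral_2_eq_2)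
    then have "y \<otimes>\<^bsub>B\<^esub> x = \<ominus>\<^bsub>B\<^esub> (y \<otimes>\<^bsub>B\<^esub> x)" using c by (metis B.m_closed B.minus_equality)
    moreover have "[(- 1::int)] \<cdot>\<^bsub>B\<^esub> (y \<otimes>\<^bsub>B\<^esub> x) = \<ominus>\<^bsub>B\<^esub> (y \<otimes>\<^bsub>B\<^esub> x)" using c by (simp add: add_pow_int_lt)
    ultimately show ?thesis using comm_gr[OF i(2) j(2)] False by simp
  qed
qed

lemma R_comm: "x \<in> carrier R \<Longrightarrow> y \<in> carrier R \<Longrightarrow> x \<otimes>\<^bsub>B\<^esub> y = y \<otimes>\<^bsub>B\<^esub> x"
proof (induction x rule: R_induct)
  case zero
  then show ?case using R_sub by simp
next
  case (step i u z)
  have "u \<otimes>\<^bsub>B\<^esub> y = y \<otimes>\<^bsub>B\<^esub> u" using \<open>y \<in> carrier R\<close>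
  proof (induction y rule: R_induct)
    case zero
    then show ?case using step by simp
  next
    case (step j w t)
    then show ?case
      using comm_ev[of i u j w] \<open>ev_degree p i\<close> \<open>u \<in> gr B i\<close> \<open>u \<in> carrier B\<close> by (simp add: B.r_distr B.l_distr)
  qed
  then show ?case using step R_sub[of y] by (simp add: B.l_distr B.r_distr)
qed

lemma R_cring: "cring R"
proof (rule cringI)
  show "abelian_group R"
    by (rule abelian_groupI) (auto simp: R_add R_zero_in R_sub B.a_ac B.r_neg intro!: bexI[OF _ R_neg] B.l_neg)
  show "comm_monoid R"
    using gr_R[OF _ one_gr]
    by (intro comm_monoidI) (auto simp: R_mult R_sub ev_degree_def intro: B.m_assoc R_comm)
qed (auto simp: R_sub B.l_distr)

definition iota :: "'k \<Rightarrow> 'b" where "iota r = r \<odot>\<^bsub>B\<^esub> \<one>\<^bsub>B\<^esub>"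

lemma iota_hom: "iota \<in> ring_hom k R"
proof (rule ring_hom_memI)
  fix x y assume xy: "x \<in> carrier k" "y \<in> carrier k"
  have one: "\<one>\<^bsub>B\<^esub> \<in> carrier B" by simp
  show "iota x \<in> carrier R" unfolding iota_def using gr_R[of 0] gr_smult[OF xy(1) one_gr] by (simp add: ev_degree_def)
  show "iota (x \<otimes>\<^bsub>k\<^esub> y) = iota x \<otimes>\<^bsub>R\<^esub> iota y"
    using xy by (simp add: iota_def smult_mult(1) Bm.smult_assoc1)
  show "iota (x \<oplus>\<^bsub>k\<^esub> y) = iota x \<oplus>\<^bsub>R\<^esub> iota y"
    using xy by (simp add: iota_def Bm.smult_l_distr)
qed (simp add: iota_def)

lemma iota_mult: "r \<in> carrier k \<Longrightarrow> x \<in> carrier B \<Longrightarrow> iota r \<otimes>\<^bsub>B\<^esub> x = r \<odot>\<^bsub>B\<^esub> x"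
  by (simp add: iota_def smult_mult)

sublocale W: walg p k R iota
  by (rule walg.intro) (fact p k kchar perf R_cring iota_hom)+

end

section \<open>Embedded polar algebras\<close>

text \<open>
  The part of the polar algebra \<open>A\<close> that corresponds to the even part of an ambient algebra.
\<close>

definition pAcar :: "nat \<Rightarrow> ('k, 'a) polar \<Rightarrow> nat \<Rightarrow> 'a set"
  where "pAcar p A d = (if ev_degree p d then carrier (pcomp A d) else {\<zero>\<^bsub>pcomp A d\<^esub>})"

text \<open>
  A polar algebra \<open>A\<close> together with an embedding \<open>f\<close> into the polar algebra of \<open>B\<close>. Operations
  on Witt vectors with entries in \<open>A\<close> are computed in \<open>B\<close> and transported back along \<open>f\<close>.
\<close>

locale polemb = galgebra p k B for p :: nat and k :: "('k, 'r) ring_scheme" and B :: "('k, 'b) galg" +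
  fixes A :: "('k, 'a) polar" and f :: "nat \<Rightarrow> 'a \<Rightarrow> 'b"
  assumes A: "M_object p k A" and f: "f \<in> M_hom p k A (pol_obj p k B)"
    and finj: "\<And>j. inj_on (f j) (carrier (pcomp A j))"
begin

lemma Amod: "Module.module k (pcomp A j)" using A by (simp add: M_object_def)

lemma A_simps:
  "\<zero>\<^bsub>pcomp A j\<^esub> \<in> carrier (pcomp A j)"
  "x \<in> carrier (pcomp A j) \<Longrightarrow> y \<in> carrier (pcomp A j) \<Longrightarrow> x \<oplus>\<^bsub>pcomp A j\<^esub> y \<in> carrier (pcomp A j)"
  "r \<in> carrier k \<Longrightarrow> x \<in> carrier (pcomp A j) \<Longrightarrow> r \<odot>\<^bsub>pcomp A j\<^esub> x \<in> carrier (pcomp A j)"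
proof -
  interpret M: Module.module k "pcomp A j" by (rule Amod)
  show "\<zero>\<^bsub>pcomp A j\<^esub> \<in> carrier (pcomp A j)"
  "x \<in> carrier (pcomp A j) \<Longrightarrow> y \<in> carrier (pcomp A j) \<Longrightarrow> x \<oplus>\<^bsub>pcomp A j\<^esub> y \<in> carrier (pcomp A j)"
  "r \<in> carrier k \<Longrightarrow> x \<in> carrier (pcomp A j) \<Longrightarrow> r \<odot>\<^bsub>pcomp A j\<^esub> x \<in> carrier (pcomp A j)" by auto
qed

lemma pmu_closed: "xs \<in> ptuples p (carrier (pcomp A j)) \<Longrightarrow> pmu A j xs \<in> carrier (pcomp A (j * p))"
  using A unfolding M_object_def by blast

lemma f_lin: "f j \<in> lin_maps k (pcomp A j) (gr_component k B j)"
  using f by (simp add: M_hom_def pol_obj_def)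

lemma f_gr: "x \<in> carrier (pcomp A j) \<Longrightarrow> f j x \<in> gr B j"
  using f_lin[of j] by (auto simp: lin_maps_def gr_component_def)

lemma f_add: "x \<in> carrier (pcomp A j) \<Longrightarrow> y \<in> carrier (pcomp A j) \<Longrightarrow> f j (x \<oplus>\<^bsub>pcomp A j\<^esub> y) = f j x \<oplus>\<^bsub>B\<^esub> f j y"
  using f_lin[of j] f_gr by (auto simp: lin_maps_def gr_component_def)

lemma f_smult: "r \<in> carrier k \<Longrightarrow> x \<in> carrier (pcomp A j) \<Longrightarrow> f j (r \<odot>\<^bsub>pcomp A j\<^esub> x) = r \<odot>\<^bsub>B\<^esub> f j x"
  using f_lin[of j] f_gr by (auto simp: lin_maps_def gr_component_def)

lemma f_zero: "f j \<zero>\<^bsub>pcomp A j\<^esub> = \<zero>\<^bsub>B\<^esub>"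
proof -
  interpret M: Module.module k "pcomp A j" by (rule Amod)
  have "f j (\<zero>\<^bsub>k\<^esub> \<odot>\<^bsub>pcomp A j\<^esub> \<zero>\<^bsub>pcomp A j\<^esub>) = \<zero>\<^bsub>k\<^esub> \<odot>\<^bsub>B\<^esub> f j \<zero>\<^bsub>pcomp A j\<^esub>" by (rule f_smult) auto
  then show ?thesis using gr_carrier[OF f_gr[OF A_simps(1)]] by simp
qed

lemma f_pmu:
  assumes xs: "xs \<in> ptuples p (carrier (pcomp A j))"
  shows "f (j * p) (pmu A j xs) = lprod B (map (f j) xs)"
proof -
  have "f (j * p) (pmu A j xs) = pmu (pol_obj p k B) j (map (f j) xs)"
    using f xs unfolding M_hom_def by blast
  moreover have "map (f j) xs \<in> ptuples p (gr B j)" using xs f_gr by (auto simp: ptuples_def)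
  ultimately show ?thesis by (simp add: pol_obj_def lprod_def)
qed

lemma f_inj: "x \<in> carrier (pcomp A j) \<Longrightarrow> y \<in> carrier (pcomp A j) \<Longrightarrow> f j x = f j y \<Longrightarrow> x = y"
  using finj by (auto simp: inj_on_def)

lemma pAcar_sub: "x \<in> pAcar p A d \<Longrightarrow> x \<in> carrier (pcomp A d)"
  using A_simps(1) by (auto simp: pAcar_def split: if_splits)

lemma pAcar_zero [simp]: "\<zero>\<^bsub>pcomp A d\<^esub> \<in> pAcar p A d"
  using A_simps(1) by (auto simp: pAcar_def)

lemma f_R: "x \<in> pAcar p A d \<Longrightarrow> f d x \<in> carrier R"
  using gr_R[of d "f d x"] f_gr f_zero R_zero_in by (auto simp: pAcar_def split: if_splits)

lemma inv_f:
  assumes "c \<in> pAcar p A d" "y = f d c"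
  shows "inv_into (pAcar p A d) (f d) y = c"
  using assms finj[of d] pAcar_sub by (metis inj_onI inv_into_f_f f_inj)

lemma lprod_replicate: "x \<in> carrier B \<Longrightarrow> lprod B (replicate n x) = x [^]\<^bsub>B\<^esub> n"
proof (induction n)
  case (Suc n)
  then show ?case using B.nat_pow_Suc2[of x n] by simp
qed simp

lemma ev_degree_mult: "ev_degree p d \<Longrightarrow> ev_degree p (d * p)"
  by (auto simp: ev_degree_def)

lemma pmu_pow:
  assumes x: "x \<in> pAcar p A d"
  shows "pmu A d (replicate p x) \<in> pAcar p A (d * p)" "f (d * p) (pmu A d (replicate p x)) = f d x [^]\<^bsub>B\<^esub> p"
proof -
  have t: "replicate p x \<in> ptuples p (carrier (pcomp A d))"
    using pAcar_sub[OF x] by (auto simp: ptuples_def)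
  show e: "f (d * p) (pmu A d (replicate p x)) = f d x [^]\<^bsub>B\<^esub> p"
    using f_pmu[OF t] lprod_replicate[OF gr_carrier[OF f_gr[OF pAcar_sub[OF x]]]] by simp
  show "pmu A d (replicate p x) \<in> pAcar p A (d * p)"
  proof (cases "ev_degree p d")
    case True
    then show ?thesis using pmu_closed[OF t] ev_degree_mult by (simp add: pAcar_def)
  next
    case False
    then have "x = \<zero>\<^bsub>pcomp A d\<^esub>" using x by (simp add: pAcar_def)
    then have "f (d * p) (pmu A d (replicate p x)) = f (d * p) \<zero>\<^bsub>pcomp A (d * p)\<^esub>"
      using e W.ppos by (simp add: f_zero B.nat_pow_zero)
    then have "pmu A d (replicate p x) = \<zero>\<^bsub>pcomp A (d * p)\<^esub>"
      using f_inj[OF pmu_closed[OF t] A_simps(1)] by simp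
    then show ?thesis by simp
  qed
qed

end

text \<open>
  A morphism of polar algebras between two embedded ones. The ambient algebras are unrelated: a
  morphism of polar algebras need not extend to them. Taking the identity of \<open>A\<close> for two
  different embeddings is allowed, and yields independence of the embedding.
\<close>

locale polhom = P: polemb p k B A f + Q: polemb p k B' A' f'
  for p :: nat and k :: "('k, 'r) ring_scheme" and B :: "('k, 'b) galg" and A :: "('k, 'a) polar" and f
    and B' :: "('k, 'b2) galg" and A' :: "('k, 'a) polar" and f' +
  fixes g :: "nat \<Rightarrow> 'a \<Rightarrow> 'a"
  assumes g: "g \<in> M_hom p k A A'"
begin

lemma g_lin: "g j \<in> lin_maps k (pcomp A j) (pcomp A' j)"
  using g by (simp add: M_hom_def)

lemma g_car: "x \<in> carrier (pcomp A j) \<Longrightarrow> g j x \<in> carrier (pcomp A' j)"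
  using g_lin[of j] by (auto simp: lin_maps_def)

lemma g_zero: "g j \<zero>\<^bsub>pcomp A j\<^esub> = \<zero>\<^bsub>pcomp A' j\<^esub>"
proof -
  interpret M: Module.module k "pcomp A j" by (rule P.Amod)
  interpret M': Module.module k "pcomp A' j" by (rule Q.Amod)
  have "g j (\<zero>\<^bsub>k\<^esub> \<odot>\<^bsub>pcomp A j\<^esub> \<zero>\<^bsub>pcomp A j\<^esub>) = \<zero>\<^bsub>k\<^esub> \<odot>\<^bsub>pcomp A' j\<^esub> g j \<zero>\<^bsub>pcomp A j\<^esub>"
  proof -
    have "\<zero>\<^bsub>k\<^esub> \<in> carrier k" by simp
    then show ?thesis using g_lin[of j] P.A_simps(1) unfolding lin_maps_def by blast
  qed
  then show ?thesis using g_car[OF P.A_simps(1)] by simp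
qed

lemma g_pmu: "xs \<in> ptuples p (carrier (pcomp A j)) \<Longrightarrow> g (j * p) (pmu A j xs) = pmu A' j (map (g j) xs)"
  using g unfolding M_hom_def by blast

lemma g_pAcar: "x \<in> pAcar p A d \<Longrightarrow> g d x \<in> pAcar p A' d"
  using g_car g_zero by (auto simp: pAcar_def split: if_splits)

text \<open>
  The graph of \<open>g\<close>, seen in the ambient algebras.
\<close>

definition T :: "nat \<Rightarrow> 'b \<Rightarrow> 'b2 \<Rightarrow> bool"
  where "T d x y \<longleftrightarrow> (\<exists>c\<in>pAcar p A d. x = f d c \<and> y = f' d (g d c))"

lemma pAcar_add: "x \<in> pAcar p A d \<Longrightarrow> y \<in> pAcar p A d \<Longrightarrow> x \<oplus>\<^bsub>pcomp A d\<^esub> y \<in> pAcar p A d"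
proof -
  interpret M: Module.module k "pcomp A d" by (rule P.Amod)
  show "x \<in> pAcar p A d \<Longrightarrow> y \<in> pAcar p A d \<Longrightarrow> x \<oplus>\<^bsub>pcomp A d\<^esub> y \<in> pAcar p A d"
    by (auto simp: pAcar_def split: if_splits)
qed

lemma pAcar_smult: "r \<in> carrier k \<Longrightarrow> x \<in> pAcar p A d \<Longrightarrow> r \<odot>\<^bsub>pcomp A d\<^esub> x \<in> pAcar p A d"
proof -
  interpret M: Module.module k "pcomp A d" by (rule P.Amod)
  show "r \<in> carrier k \<Longrightarrow> x \<in> pAcar p A d \<Longrightarrow> r \<odot>\<^bsub>pcomp A d\<^esub> x \<in> pAcar p A d"
    by (auto simp: pAcar_def split: if_splits)
qed

lemma T_zero: "T d \<zero>\<^bsub>B\<^esub> \<zero>\<^bsub>B'\<^esub>"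
  unfolding T_def using P.f_zero Q.f_zero g_zero P.pAcar_zero by metis

sublocale T: correspondence p k "ev_part p B" "ev_part p B'" P.iota Q.iota T
proof (rule correspondence.intro)
  show "2 \<le> p" by (rule P.W.p2)
  show "ring_hom_cring k (ev_part p B) P.iota" by (rule P.W.io.ring_hom_cring_axioms)
  show "ring_hom_cring k (ev_part p B') Q.iota" by (rule Q.W.io.ring_hom_cring_axioms)
next
  fix d x y assume "T d x y"
  then show "x \<in> carrier (ev_part p B) \<and> y \<in> carrier (ev_part p B')"
    unfolding T_def using P.f_R Q.f_R g_pAcar by blast
next
  fix d show "T d \<zero>\<^bsub>ev_part p B\<^esub> \<zero>\<^bsub>ev_part p B'\<^esub>" using T_zero by simp
next
  fix d x y x' y' assume "T d x y" "T d x' y'"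
  then obtain c c' where c: "c \<in> pAcar p A d" "x = f d c" "y = f' d (g d c)" "c' \<in> pAcar p A d" "x' = f d c'" "y' = f' d (g d c')"
    unfolding T_def by blast
  note cc = P.pAcar_sub[OF c(1)] P.pAcar_sub[OF c(4)]
  have "f d (c \<oplus>\<^bsub>pcomp A d\<^esub> c') = x \<oplus>\<^bsub>B\<^esub> x'" using P.f_add[OF cc] c by simp
  moreover have "g d (c \<oplus>\<^bsub>pcomp A d\<^esub> c') = g d c \<oplus>\<^bsub>pcomp A' d\<^esub> g d c'"
    using g_lin[of d] cc by (simp add: lin_maps_def)
  then have "f' d (g d (c \<oplus>\<^bsub>pcomp A d\<^esub> c')) = y \<oplus>\<^bsub>B'\<^esub> y'"
    using Q.f_add[OF g_car[OF cc(1)] g_car[OF cc(2)]] c by simp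
  ultimately show "T d (x \<oplus>\<^bsub>ev_part p B\<^esub> x') (y \<oplus>\<^bsub>ev_part p B'\<^esub> y')"
    unfolding T_def using pAcar_add[OF c(1,4)] by (auto intro!: bexI[of _ "c \<oplus>\<^bsub>pcomp A d\<^esub> c'"])
next
  fix d x y r assume r: "r \<in> carrier k" and "T d x y"
  then obtain c where c: "c \<in> pAcar p A d" "x = f d c" "y = f' d (g d c)"
    unfolding T_def by blast
  note cc = P.pAcar_sub[OF c(1)]
  have "f d (r \<odot>\<^bsub>pcomp A d\<^esub> c) = r \<odot>\<^bsub>B\<^esub> x" using P.f_smult[OF r cc] c by simp
  moreover have "g d (r \<odot>\<^bsub>pcomp A d\<^esub> c) = r \<odot>\<^bsub>pcomp A' d\<^esub> g d c"
    using g_lin[of d] cc r by (simp add: lin_maps_def)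
  then have "f' d (g d (r \<odot>\<^bsub>pcomp A d\<^esub> c)) = r \<odot>\<^bsub>B'\<^esub> y"
    using Q.f_smult[OF r g_car[OF cc]] c by simp
  moreover have "x \<in> carrier B" "y \<in> carrier B'"
    using c P.gr_carrier P.f_gr[OF cc] Q.gr_carrier Q.f_gr[OF g_car[OF cc]] by auto
  ultimately show "T d (P.iota r \<otimes>\<^bsub>ev_part p B\<^esub> x) (Q.iota r \<otimes>\<^bsub>ev_part p B'\<^esub> y)"
    unfolding T_def using pAcar_smult[OF r c(1)] r
    by (auto simp: P.iota_mult Q.iota_mult intro!: bexI[of _ "r \<odot>\<^bsub>pcomp A d\<^esub> c"])
next
  fix d xs ys assume len: "length xs = p" and T: "list_all2 (T d) xs ys"
  have "\<forall>i<p. \<exists>c\<in>pAcar p A d. xs ! i = f d c \<and> ys ! i = f' d (g d c)"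
    using T len by (auto simp: list_all2_conv_all_nth T_def)
  then obtain c where c: "\<forall>i<p. c i \<in> pAcar p A d \<and> xs ! i = f d (c i) \<and> ys ! i = f' d (g d (c i))" by metis
  define cs where "cs = map c [0..<p]"
  have leny: "length ys = p" using len list_all2_lengthD[OF T] by simp
  have cs: "xs = map (f d) cs" "ys = map (f' d) (map (g d) cs)" "set cs \<subseteq> pAcar p A d" "length cs = p"
  proof -
    show "xs = map (f d) cs" by (rule nth_equalityI) (simp_all add: cs_def len c)
    show "ys = map (f' d) (map (g d) cs)" by (rule nth_equalityI) (simp_all add: cs_def leny c)
    show "set cs \<subseteq> pAcar p A d" using c by (auto simp: cs_def)
    show "length cs = p" by (simp add: cs_def)
  qed
  have sub: "set cs \<subseteq> carrier (pcomp A d)" using cs(3) P.pAcar_sub by blast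
  then have t: "cs \<in> ptuples p (carrier (pcomp A d))" using cs(4) by (simp add: ptuples_def)
  have "g d ` set cs \<subseteq> carrier (pcomp A' d)" using sub g_car by blast
  then have t': "map (g d) cs \<in> ptuples p (carrier (pcomp A' d))" using cs(4) by (simp add: ptuples_def)
  have e: "f (d * p) (pmu A d cs) = lprod B xs" "f' (d * p) (g (d * p) (pmu A d cs)) = lprod B' ys"
    unfolding P.f_pmu[OF t] g_pmu[OF t] Q.f_pmu[OF t'] cs(1,2) by (rule refl)+
  have "T (d * p) (lprod B xs) (lprod B' ys)"
  proof (cases "ev_degree p d")
    case True
    then have "pmu A d cs \<in> pAcar p A (d * p)"
      using P.pmu_closed[OF t] P.ev_degree_mult by (simp add: pAcar_def)
    then show ?thesis unfolding T_def using e by force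
  next
    case False
    then have "set cs \<subseteq> {\<zero>\<^bsub>pcomp A d\<^esub>}" using cs(3) by (simp add: pAcar_def)
    then have "cs = replicate p \<zero>\<^bsub>pcomp A d\<^esub>" using cs(4) by (auto intro!: replicate_eqI)
    then show ?thesis using P.pmu_pow(1)[OF P.pAcar_zero[of d]] e unfolding T_def by force
  qed
  then show "T (d * p) (lprod (ev_part p B) xs) (lprod (ev_part p B') ys)" by simp
qed

lemma T_wadd:
  assumes c: "\<forall>i. a i \<in> carrier (ev_part p B)" "\<forall>i. b i \<in> carrier (ev_part p B)"
      "\<forall>i. a' i \<in> carrier (ev_part p B')" "\<forall>i. b' i \<in> carrier (ev_part p B')"
    and r: "\<And>s. s \<le> n \<Longrightarrow> a s = \<zero>\<^bsub>B\<^esub> \<and> a' s = \<zero>\<^bsub>B'\<^esub> \<or> (\<exists>\<delta>. \<delta> * p ^ (n - s) = d \<and> T \<delta> (a s) (a' s))"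
      "\<And>s. s \<le> n \<Longrightarrow> b s = \<zero>\<^bsub>B\<^esub> \<and> b' s = \<zero>\<^bsub>B'\<^esub> \<or> (\<exists>\<delta>. \<delta> * p ^ (n - s) = d \<and> T \<delta> (b s) (b' s))"
  shows "T d (wadd p (ev_part p B) a b n) (wadd p (ev_part p B') a' b' n)"
  unfolding P.W.wadd_eq_pev Q.W.wadd_eq_pev
proof (rule T.T_pev[OF P.W.homog_sum'])
  show "\<forall>v. ilv a b v \<in> carrier (ev_part p B)" "\<forall>v. ilv a' b' v \<in> carrier (ev_part p B')"
    using c by (auto simp: ilv_def)
  fix v :: nat
  show "ilv a b v = \<zero>\<^bsub>ev_part p B\<^esub> \<and> ilv a' b' v = \<zero>\<^bsub>ev_part p B'\<^esub> \<or>
      (\<exists>\<delta>. \<delta> * p ^ (n - v div 2) = d \<and> T \<delta> (ilv a b v) (ilv a' b' v))"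
    if "v div 2 \<le> n"
    using r(1)[OF that] r(2)[OF that] by (simp add: ilv_def)
qed simp

lemma T_wmul:
  assumes c: "\<forall>i. b i \<in> carrier (ev_part p B)" "\<forall>i. b' i \<in> carrier (ev_part p B')"
    and l: "\<forall>i. l i \<in> carrier k"
    and r: "\<And>s. s \<le> n \<Longrightarrow> b s = \<zero>\<^bsub>B\<^esub> \<and> b' s = \<zero>\<^bsub>B'\<^esub> \<or> (\<exists>\<delta>. \<delta> * p ^ (n - s) = d \<and> T \<delta> (b s) (b' s))"
  shows "T d (wmul p (ev_part p B) (P.iota \<circ> l) b n) (wmul p (ev_part p B') (Q.iota \<circ> l) b' n)"
  unfolding P.W.wmul_eq_pev Q.W.wmul_eq_pev
proof (rule T.T_pev[OF P.W.homog_prod'])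
  show "\<forall>v. ilv (P.iota \<circ> l) b v \<in> carrier (ev_part p B)" "\<forall>v. ilv (Q.iota \<circ> l) b' v \<in> carrier (ev_part p B')"
    using c l P.W.io.hom_closed Q.W.io.hom_closed by (auto simp: ilv_def)
  fix v :: nat
  show "\<exists>r\<in>carrier k. ilv (P.iota \<circ> l) b v = P.iota r \<and> ilv (Q.iota \<circ> l) b' v = Q.iota r" if "\<not> odd v"
    using that l by (intro bexI[of _ "l (v div 2)"]) (simp_all add: ilv_def)
  show "ilv (P.iota \<circ> l) b v = \<zero>\<^bsub>ev_part p B\<^esub> \<and> ilv (Q.iota \<circ> l) b' v = \<zero>\<^bsub>ev_part p B'\<^esub> \<or>
      (\<exists>\<delta>. \<delta> * p ^ (n - v div 2) = d \<and> T \<delta> (ilv (P.iota \<circ> l) b v) (ilv (Q.iota \<circ> l) b' v))"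
    if "odd v" "v div 2 \<le> n"
    using r[OF that(2)] that(1) by (simp add: ilv_def)
qed

end

text \<open>
  The identity morphism turns statements about pairs of polar algebras into closure statements
  about a single one.
\<close>

lemma (in polemb) polhom_self: "polhom p k B A f B A f (\<lambda>j. \<lambda>x\<in>carrier (pcomp A j). x)"
proof (intro polhom.intro polhom_axioms.intro polemb_axioms)
  have "map (\<lambda>x\<in>carrier (pcomp A j). x) xs = xs" if "xs \<in> ptuples p (carrier (pcomp A j))" for j xs
    using that by (auto simp: ptuples_def intro!: map_idI)
  then show "(\<lambda>j. \<lambda>x\<in>carrier (pcomp A j). x) \<in> M_hom p k A A"
    using A_simps pmu_closed by (auto simp: M_hom_def lin_maps_def)
qed

section \<open>Witt vectors of polar algebras\<close>

definition WpolC :: "nat \<Rightarrow> enat \<Rightarrow> ('k, 'a) polar \<Rightarrow> nat \<Rightarrow> (nat \<Rightarrow> 'a) set"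
  where "WpolC p n A j = (\<Pi>\<^sub>E i\<in>{i. enat i \<le> n}. pAcar p A (j * p ^ i))"

definition Wlift :: "nat \<Rightarrow> enat \<Rightarrow> ('k, 'b) galg \<Rightarrow> (nat \<Rightarrow> 'a \<Rightarrow> 'b) \<Rightarrow> nat \<Rightarrow> (nat \<Rightarrow> 'a) \<Rightarrow> nat \<Rightarrow> 'b"
  where "Wlift p n B f j a = (\<lambda>i. if enat i \<le> n then f (j * p ^ i) (a i) else \<zero>\<^bsub>B\<^esub>)"

definition Wpadd where
  "Wpadd p n A B f j a b = (\<lambda>i\<in>{i. enat i \<le> n}. inv_into (pAcar p A (j * p ^ i)) (f (j * p ^ i))
     (wadd p (ev_part p B) (Wlift p n B f j a) (Wlift p n B f j b) i))"

definition Wpsm where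
  "Wpsm p n A B f j l a = (\<lambda>i\<in>{i. enat i \<le> n}. inv_into (pAcar p A (j * p ^ i)) (f (j * p ^ i))
     (wmul p (ev_part p B) (\<lambda>s. l s \<odot>\<^bsub>B\<^esub> \<one>\<^bsub>B\<^esub>) (Wlift p n B f j a) i))"

text \<open>
  \<open>W\<^sub>n\<close> of the polar algebra \<open>A\<close>. The Frobenius needs no ambient algebra, since it is the
  polar multiplication on the diagonal.
\<close>

definition Wpol :: "nat \<Rightarrow> ('k, 'r) ring_scheme \<Rightarrow> enat \<Rightarrow> ('k, 'a) polar \<Rightarrow> ('k, 'b) galg \<Rightarrow> (nat \<Rightarrow> 'a \<Rightarrow> 'b) \<Rightarrow> ('k, nat \<Rightarrow> 'a) dmod"
  where "Wpol p k n A B f =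
    \<lparr>dcomp = (\<lambda>j. mod_on (witt_ring p k) (WpolC p n A j) (\<lambda>i\<in>{i. enat i \<le> n}. \<zero>\<^bsub>pcomp A (j * p ^ i)\<^esub>)
       (Wpadd p n A B f j) (Wpsm p n A B f j)),
     dF = (\<lambda>j. \<lambda>a\<in>WpolC p n A j. \<lambda>i\<in>{i. enat i \<le> n}. pmu A (j * p ^ i) (replicate p (a i))),
     dV = (\<lambda>j. \<lambda>a\<in>WpolC p n A (p * j). \<lambda>i\<in>{i. enat i \<le> n}. (case i of 0 \<Rightarrow> \<zero>\<^bsub>pcomp A j\<^esub> | Suc m \<Rightarrow> a m))\<rparr>"

definition Wmor where
  "Wmor p n A g j = (\<lambda>a\<in>WpolC p n A j. \<lambda>i\<in>{i. enat i \<le> n}. g (j * p ^ i) (a i))"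

context polhom begin

lemma lift_R: "a \<in> WpolC p n A j \<Longrightarrow> Wlift p n B f j a i \<in> carrier (ev_part p B)"
  using P.f_R P.R_zero_in by (auto simp: Wlift_def WpolC_def)

lemma Wmor_in: "a \<in> WpolC p n A j \<Longrightarrow> Wmor p n A g j a \<in> WpolC p n A' j"
  using g_pAcar by (auto simp: Wmor_def WpolC_def)

lemma lift_T:
  assumes a: "a \<in> WpolC p n A j" and s: "s \<le> i" "enat i \<le> n"
  shows "\<exists>\<delta>. \<delta> * p ^ (i - s) = j * p ^ i \<and> T \<delta> (Wlift p n B f j a s) (Wlift p n B' f' j (Wmor p n A g j a) s)"
proof (intro exI[of _ "j * p ^ s"] conjI)
  have sn: "enat s \<le> n" using s order_trans enat_ord_simps(1) by blast
  show "j * p ^ s * p ^ (i - s) = j * p ^ i" using s by (simp add: power_add[symmetric])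
  show "T (j * p ^ s) (Wlift p n B f j a s) (Wlift p n B' f' j (Wmor p n A g j a) s)"
    using a sn by (auto simp: Wlift_def Wmor_def T_def WpolC_def)
qed

lemma Q_lift_R: "a \<in> WpolC p n A j \<Longrightarrow> Wlift p n B' f' j (Wmor p n A g j a) i \<in> carrier (ev_part p B')"
  using Wmor_in[of a n j] Q.f_R Q.R_zero_in by (auto simp: Wlift_def WpolC_def)

text \<open>
  Since the graph of \<open>g\<close> is closed under Witt addition, the sum computed in \<open>B\<close> has entries in
  \<open>A\<close>, and \<open>g\<close> takes it to the sum computed in \<open>B'\<close>.
\<close>

lemma Wpadd_T:
  assumes a: "a \<in> WpolC p n A j" and b: "b \<in> WpolC p n A j" and i: "enat i \<le> n"
  shows "Wpadd p n A B f j a b i \<in> pAcar p A (j * p ^ i)"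
    and "f (j * p ^ i) (Wpadd p n A B f j a b i) = wadd p (ev_part p B) (Wlift p n B f j a) (Wlift p n B f j b) i"
    and "g (j * p ^ i) (Wpadd p n A B f j a b i) = Wpadd p n A' B' f' j (Wmor p n A g j a) (Wmor p n A g j b) i"
proof -
  have "T (j * p ^ i) (wadd p (ev_part p B) (Wlift p n B f j a) (Wlift p n B f j b) i)
     (wadd p (ev_part p B') (Wlift p n B' f' j (Wmor p n A g j a)) (Wlift p n B' f' j (Wmor p n A g j b)) i)"
    using lift_T[OF a _ i] lift_T[OF b _ i] lift_R[OF a] lift_R[OF b] Q_lift_R[OF a] Q_lift_R[OF b]
    by (intro T_wadd) auto
  then obtain c where c: "c \<in> pAcar p A (j * p ^ i)"
    "wadd p (ev_part p B) (Wlift p n B f j a) (Wlift p n B f j b) i = f (j * p ^ i) c"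
    "wadd p (ev_part p B') (Wlift p n B' f' j (Wmor p n A g j a)) (Wlift p n B' f' j (Wmor p n A g j b)) i = f' (j * p ^ i) (g (j * p ^ i) c)"
    unfolding T_def by blast
  have e: "Wpadd p n A B f j a b i = c" using P.inv_f[OF c(1,2)] i by (simp add: Wpadd_def)
  show "Wpadd p n A B f j a b i \<in> pAcar p A (j * p ^ i)"
    "f (j * p ^ i) (Wpadd p n A B f j a b i) = wadd p (ev_part p B) (Wlift p n B f j a) (Wlift p n B f j b) i"
    using c e by auto
  show "g (j * p ^ i) (Wpadd p n A B f j a b i) = Wpadd p n A' B' f' j (Wmor p n A g j a) (Wmor p n A g j b) i"
    using Q.inv_f[OF g_pAcar[OF c(1)] c(3)] i e by (simp add: Wpadd_def)
qed

lemma Wpsm_T: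
  assumes l: "l \<in> carrier (witt_ring p k)" and b: "b \<in> WpolC p n A j" and i: "enat i \<le> n"
  shows "Wpsm p n A B f j l b i \<in> pAcar p A (j * p ^ i)"
    and "f (j * p ^ i) (Wpsm p n A B f j l b i) = wmul p (ev_part p B) (\<lambda>s. l s \<odot>\<^bsub>B\<^esub> \<one>\<^bsub>B\<^esub>) (Wlift p n B f j b) i"
    and "g (j * p ^ i) (Wpsm p n A B f j l b i) = Wpsm p n A' B' f' j l (Wmor p n A g j b) i"
proof -
  have l': "\<forall>i. l i \<in> carrier k" using l by (simp add: witt_ring_simps[OF P.p])
  have io: "P.iota \<circ> l = (\<lambda>s. l s \<odot>\<^bsub>B\<^esub> \<one>\<^bsub>B\<^esub>)" "Q.iota \<circ> l = (\<lambda>s. l s \<odot>\<^bsub>B'\<^esub> \<one>\<^bsub>B'\<^esub>)"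
    by (auto simp: P.iota_def Q.iota_def)
  have "T (j * p ^ i) (wmul p (ev_part p B) (P.iota \<circ> l) (Wlift p n B f j b) i)
     (wmul p (ev_part p B') (Q.iota \<circ> l) (Wlift p n B' f' j (Wmor p n A g j b)) i)"
    using lift_T[OF b _ i] lift_R[OF b] Q_lift_R[OF b] l'
    by (intro T_wmul) auto
  then obtain c where c: "c \<in> pAcar p A (j * p ^ i)"
    "wmul p (ev_part p B) (\<lambda>s. l s \<odot>\<^bsub>B\<^esub> \<one>\<^bsub>B\<^esub>) (Wlift p n B f j b) i = f (j * p ^ i) c"
    "wmul p (ev_part p B') (\<lambda>s. l s \<odot>\<^bsub>B'\<^esub> \<one>\<^bsub>B'\<^esub>) (Wlift p n B' f' j (Wmor p n A g j b)) i = f' (j * p ^ i) (g (j * p ^ i) c)"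
    unfolding T_def io by blast
  have e: "Wpsm p n A B f j l b i = c" using P.inv_f[OF c(1,2)] i by (simp add: Wpsm_def)
  show "Wpsm p n A B f j l b i \<in> pAcar p A (j * p ^ i)"
    "f (j * p ^ i) (Wpsm p n A B f j l b i) = wmul p (ev_part p B) (\<lambda>s. l s \<odot>\<^bsub>B\<^esub> \<one>\<^bsub>B\<^esub>) (Wlift p n B f j b) i"
    using c e by auto
  show "g (j * p ^ i) (Wpsm p n A B f j l b i) = Wpsm p n A' B' f' j l (Wmor p n A g j b) i"
    using Q.inv_f[OF g_pAcar[OF c(1)] c(3)] i e by (simp add: Wpsm_def)
qed

lemma Wpadd_in: "a \<in> WpolC p n A j \<Longrightarrow> b \<in> WpolC p n A j \<Longrightarrow> Wpadd p n A B f j a b \<in> WpolC p n A j"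
  unfolding WpolC_def[of p n A j] PiE_iff using Wpadd_T(1)[of a n j b]
  by (auto simp: WpolC_def PiE_iff) (auto simp: Wpadd_def)

lemma Wpsm_in: "l \<in> carrier (witt_ring p k) \<Longrightarrow> b \<in> WpolC p n A j \<Longrightarrow> Wpsm p n A B f j l b \<in> WpolC p n A j"
  unfolding WpolC_def[of p n A j] PiE_iff using Wpsm_T(1)[of l b n j]
  by (auto simp: WpolC_def PiE_iff) (auto simp: Wpsm_def)

lemma Wmor_hom: "Wmor p n A g \<in> dmod_hom p k (Wpol p k n A B f) (Wpol p k n A' B' f')"
  unfolding dmod_hom_def
proof (intro CollectI allI conjI ballI)
  fix j
  show "Wmor p n A g j \<in> lin_maps (witt_ring p k) (dcomp (Wpol p k n A B f) j) (dcomp (Wpol p k n A' B' f') j) \<inter>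
        extensional (carrier (dcomp (Wpol p k n A B f) j))"
  proof (intro IntI)
    show "Wmor p n A g j \<in> extensional (carrier (dcomp (Wpol p k n A B f) j))"
      by (simp add: Wmor_def Wpol_def)
    have "Wmor p n A g j (Wpadd p n A B f j a b) = Wpadd p n A' B' f' j (Wmor p n A g j a) (Wmor p n A g j b)"
      if a: "a \<in> WpolC p n A j" and b: "b \<in> WpolC p n A j" for a b
      using Wpadd_T(3)[OF a b] Wpadd_in[OF a b] by (auto simp: Wmor_def[of p n A g j] Wpadd_def[of p n A'] restrict_def)
    moreover have "Wmor p n A g j (Wpsm p n A B f j l b) = Wpsm p n A' B' f' j l (Wmor p n A g j b)"
      if l: "l \<in> carrier (witt_ring p k)" and b: "b \<in> WpolC p n A j" for l b
      using Wpsm_T(3)[OF l b] Wpsm_in[OF l b] by (auto simp: Wmor_def[of p n A g j] Wpsm_def[of p n A'] restrict_def)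
    ultimately show "Wmor p n A g j \<in> lin_maps (witt_ring p k) (dcomp (Wpol p k n A B f) j) (dcomp (Wpol p k n A' B' f') j)"
      using Wmor_in Wpadd_in Wpsm_in by (auto simp: lin_maps_def Wpol_def)
  qed
next
  fix j a assume "a \<in> carrier (dcomp (Wpol p k n A B f) j)"
  then have a: "a \<in> WpolC p n A j" by (simp add: Wpol_def)
  let ?F = "\<lambda>i\<in>{i. enat i \<le> n}. pmu A (j * p ^ i) (replicate p (a i))"
  have ai: "a i \<in> pAcar p A (j * p ^ i)" if "enat i \<le> n" for i using a that by (auto simp: WpolC_def)
  have deg: "p * j * p ^ i = j * p ^ i * p" for i by (simp add: mult_ac)
  have F: "?F \<in> WpolC p n A (p * j)"
    unfolding WpolC_def PiE_iff deg using P.pmu_pow(1)[OF ai] by auto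
  have gF: "g (j * p ^ i * p) (pmu A (j * p ^ i) (replicate p (a i))) = pmu A' (j * p ^ i) (replicate p (g (j * p ^ i) (a i)))"
    if "enat i \<le> n" for i
    using g_pmu[of "replicate p (a i)" "j * p ^ i"] P.pAcar_sub[OF ai[OF that]] by (simp add: ptuples_def set_replicate_conv_if)
  show "Wmor p n A g (p * j) (dF (Wpol p k n A B f) j a) = dF (Wpol p k n A' B' f') j (Wmor p n A g j a)"
    using a F Wmor_in[OF a] gF by (auto simp: Wpol_def Wmor_def deg restrict_def)
next
  fix j a assume "a \<in> carrier (dcomp (Wpol p k n A B f) (p * j))"
  then have a: "a \<in> WpolC p n A (p * j)" by (simp add: Wpol_def)
  let ?V = "\<lambda>i\<in>{i. enat i \<le> n}. (case i of 0 \<Rightarrow> \<zero>\<^bsub>pcomp A j\<^esub> | Suc m \<Rightarrow> a m)"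
  have sm: "enat m \<le> n" if "enat (Suc m) \<le> n" for m using that order_trans[of "enat m" "enat (Suc m)" n] by simp
  have ai: "a i \<in> pAcar p A (j * p ^ Suc i)" if "enat i \<le> n" for i using a that by (auto simp: WpolC_def mult_ac)
  have V: "?V \<in> WpolC p n A j"
    unfolding WpolC_def PiE_iff using ai sm by (auto split: nat.splits)
  show "Wmor p n A g j (dV (Wpol p k n A B f) j a) = dV (Wpol p k n A' B' f') j (Wmor p n A g (p * j) a)"
    using a V Wmor_in[OF a] g_zero sm
    by (auto simp: Wpol_def Wmor_def restrict_def fun_eq_iff mult_ac split: nat.splits)
qed

end

context polemb begin

text \<open>
  A Witt vector over \<open>A\<close> is represented by the families whose member of index \<open>0\<close> agrees with it
  in the entries up to \<open>n\<close>; the other members and entries are arbitrary.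
\<close>

lemma Wpol_dieudonne: "is_dieudonne p k (Wpol p k n A B f)"
proof -
  interpret S: polhom p k B A f B A f "\<lambda>j. \<lambda>x\<in>carrier (pcomp A j). x" by (rule polhom_self)
  let ?\<rho> = "\<lambda>j (x :: nat \<Rightarrow> nat \<Rightarrow> 'b) a. a \<in> WpolC p n A j \<and> (\<forall>M i. x M i \<in> carrier R) \<and> (\<forall>i. enat i \<le> n \<longrightarrow> x 0 i = f (j * p ^ i) (a i))"
  have up: "enat s \<le> n" if "s \<le> i" "enat i \<le> n" for s i using that order_trans enat_ord_simps(1) by blast
  have th0: "W.thw 0 l = (\<lambda>s. l s \<odot>\<^bsub>B\<^esub> \<one>\<^bsub>B\<^esub>)" for l by (auto simp: W.thw_def iota_def)
  show ?thesis
  proof (rule W.dieudonne_wfam[where \<rho> = ?\<rho> and C = "WpolC p n A" and z = "\<lambda>j. \<lambda>i\<in>{i. enat i \<le> n}. \<zero>\<^bsub>pcomp A (j * p ^ i)\<^esub>"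
       and pl = "Wpadd p n A B f" and sm = "Wpsm p n A B f"
       and F = "\<lambda>j a. \<lambda>i\<in>{i. enat i \<le> n}. pmu A (j * p ^ i) (replicate p (a i))"
       and V = "\<lambda>j a. \<lambda>i\<in>{i. enat i \<le> n}. (case i of 0 \<Rightarrow> \<zero>\<^bsub>pcomp A j\<^esub> | Suc m \<Rightarrow> a m)"])
    fix j
    show "represented (witt_ring p k) W.wfam (?\<rho> j) (WpolC p n A j) (\<lambda>i\<in>{i. enat i \<le> n}. \<zero>\<^bsub>pcomp A (j * p ^ i)\<^esub>)
       (Wpadd p n A B f j) (Wpsm p n A B f j)"
    proof (rule represented.intro)
      show "Module.module (witt_ring p k) W.wfam" by (rule W.wfam_module)
    next
      fix a assume a: "a \<in> WpolC p n A j"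
      show "\<exists>x. ?\<rho> j x a"
        by (rule exI[of _ "\<lambda>M. Wlift p n B f j a"]) (use a S.lift_R[OF a] in \<open>auto simp: Wlift_def\<close>)
    next
      fix x a b assume "?\<rho> j x a" "?\<rho> j x b"
      then have a: "a \<in> WpolC p n A j" and b: "b \<in> WpolC p n A j"
        and e: "\<And>i. enat i \<le> n \<Longrightarrow> f (j * p ^ i) (a i) = f (j * p ^ i) (b i)" by auto
      have "a i = b i" if i: "enat i \<le> n" for i
        using e[OF i] f_inj[of "a i" "j * p ^ i" "b i"] pAcar_sub a b i by (auto simp: WpolC_def)
      then show "a = b" using a b unfolding WpolC_def by (intro PiE_ext) auto
    next
      show "?\<rho> j \<zero>\<^bsub>W.wfam\<^esub> (\<lambda>i\<in>{i. enat i \<le> n}. \<zero>\<^bsub>pcomp A (j * p ^ i)\<^esub>)"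
        using R_zero_in by (auto simp: WpolC_def f_zero)
    next
      fix x a y b assume xa: "?\<rho> j x a" and yb: "?\<rho> j y b"
      have "wadd p R (x 0) (y 0) i = f (j * p ^ i) (Wpadd p n A B f j a b i)" if i: "enat i \<le> n" for i
      proof -
        have "wadd p R (x 0) (y 0) i = wadd p R (Wlift p n B f j a) (Wlift p n B f j b) i"
          unfolding W.wadd_eq_pev
        proof (rule W.R.pev_cong_upto[OF W.p2 W.homog_sum'])
          show "\<forall>v. ilv (x 0) (y 0) v \<in> carrier R" using xa yb by (auto simp: ilv_def)
          show "\<forall>v. ilv (Wlift p n B f j a) (Wlift p n B f j b) v \<in> carrier R"
            using S.lift_R xa yb by (auto simp: ilv_def)
        qed (use xa yb up[OF _ i] in \<open>auto simp: ilv_def Wlift_def\<close>)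
        then show ?thesis using S.Wpadd_T(2) xa yb i by simp
      qed
      then show "?\<rho> j (x \<oplus>\<^bsub>W.wfam\<^esub> y) (Wpadd p n A B f j a b)"
        using xa yb S.Wpadd_in by simp
    next
      fix y b l assume l: "l \<in> carrier (witt_ring p k)" and yb: "?\<rho> j y b"
      have "wmul p R (W.thw 0 l) (y 0) i = f (j * p ^ i) (Wpsm p n A B f j l b i)" if i: "enat i \<le> n" for i
      proof -
        have "wmul p R (W.thw 0 l) (y 0) i = wmul p R (W.thw 0 l) (Wlift p n B f j b) i"
          unfolding W.wmul_eq_pev
        proof (rule W.R.pev_cong_upto[OF W.p2 W.homog_prod'])
          show "\<forall>v. ilv (W.thw 0 l) (y 0) v \<in> carrier R" using W.thw_closed[OF l] yb by (auto simp: ilv_def)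
          show "\<forall>v. ilv (W.thw 0 l) (Wlift p n B f j b) v \<in> carrier R"
            using W.thw_closed[OF l] S.lift_R yb by (auto simp: ilv_def)
        qed (use yb up[OF _ i] in \<open>auto simp: ilv_def Wlift_def\<close>)
        then show ?thesis using S.Wpsm_T(2)[OF l] yb i by (simp add: th0)
      qed
      then show "?\<rho> j (l \<odot>\<^bsub>W.wfam\<^esub> y) (Wpsm p n A B f j l b)"
        using yb S.Wpsm_in[OF l] W.thw_closed[OF l] by simp
    qed auto
  next
    fix j x a assume xa: "?\<rho> j x a"
    have ai: "a i \<in> pAcar p A (j * p ^ i)" if "enat i \<le> n" for i using xa that by (auto simp: WpolC_def)
    have deg: "p * j * p ^ i = j * p ^ i * p" for i by (simp add: mult_ac)
    show "?\<rho> (p * j) (W.wfamF x) (\<lambda>i\<in>{i. enat i \<le> n}. pmu A (j * p ^ i) (replicate p (a i)))"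
    proof (intro conjI)
      show "\<forall>M i. W.wfamF x M i \<in> carrier R" using xa by (simp add: W.wfamF_def W.wfr_closed)
    qed (unfold WpolC_def PiE_iff deg, use pmu_pow[OF ai] xa in \<open>auto simp: W.wfamF_def wfr_def\<close>)
  next
    fix j x a assume xa: "?\<rho> (p * j) x a"
    have sm: "enat m \<le> n" if "enat (Suc m) \<le> n" for m using that order_trans[of "enat m" "enat (Suc m)" n] by simp
    have ai: "a i \<in> pAcar p A (j * p ^ Suc i)" if "enat i \<le> n" for i using xa that by (auto simp: WpolC_def mult_ac)
    have x0: "x 0 i = f (j * p ^ Suc i) (a i)" if "enat i \<le> n" for i using xa that by (auto simp: mult_ac)
    show "?\<rho> j (W.wfamV x) (\<lambda>i\<in>{i. enat i \<le> n}. (case i of 0 \<Rightarrow> \<zero>\<^bsub>pcomp A j\<^esub> | Suc m \<Rightarrow> a m))"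
    proof (intro conjI allI impI)
      show "(\<lambda>i\<in>{i. enat i \<le> n}. (case i of 0 \<Rightarrow> \<zero>\<^bsub>pcomp A j\<^esub> | Suc m \<Rightarrow> a m)) \<in> WpolC p n A j"
        unfolding WpolC_def PiE_iff using ai sm by (auto split: nat.splits)
      fix M i
      show "W.wfamV x M i \<in> carrier R" using xa R_zero_in by (cases i) (auto simp: W.wfamV_def)
      show "W.wfamV x 0 i = f (j * p ^ i) ((\<lambda>i\<in>{i. enat i \<le> n}. (case i of 0 \<Rightarrow> \<zero>\<^bsub>pcomp A j\<^esub> | Suc m \<Rightarrow> a m)) i)"
        if "enat i \<le> n" using that x0 sm f_zero by (cases i) (auto simp: W.wfamV_def)
    qed
  qed (auto simp: Wpol_def)
qed

end

section \<open>Covectors of polar algebras\<close>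

text \<open>
  The possible values of the entry \<open>a\<^sub>-\<^sub>i\<close> of a covector of degree \<open>j\<close>. If \<open>p ^ i\<close>
  does not divide \<open>j\<close> only zero is possible, and the zero of degree \<open>0\<close> is chosen as its name.
\<close>

definition slotcar :: "nat \<Rightarrow> ('k, 'a) polar \<Rightarrow> nat \<Rightarrow> nat \<Rightarrow> 'a set"
  where "slotcar p A j i = (if p ^ i dvd j then pAcar p A (j div p ^ i) else {\<zero>\<^bsub>pcomp A 0\<^esub>})"

definition slotzero :: "nat \<Rightarrow> ('k, 'a) polar \<Rightarrow> nat \<Rightarrow> nat \<Rightarrow> 'a"
  where "slotzero p A j i = (if p ^ i dvd j then \<zero>\<^bsub>pcomp A (j div p ^ i)\<^esub> else \<zero>\<^bsub>pcomp A 0\<^esub>)"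

definition slotmap :: "nat \<Rightarrow> ('k, 'b) galg \<Rightarrow> (nat \<Rightarrow> 'a \<Rightarrow> 'b) \<Rightarrow> nat \<Rightarrow> nat \<Rightarrow> 'a \<Rightarrow> 'b"
  where "slotmap p B f j i x = (if p ^ i dvd j then f (j div p ^ i) x else \<zero>\<^bsub>B\<^esub>)"

definition slotg :: "nat \<Rightarrow> ('k, 'a) polar \<Rightarrow> (nat \<Rightarrow> 'a \<Rightarrow> 'a) \<Rightarrow> nat \<Rightarrow> nat \<Rightarrow> 'a \<Rightarrow> 'a"
  where "slotg p A' g j i x = (if p ^ i dvd j then g (j div p ^ i) x else \<zero>\<^bsub>pcomp A' 0\<^esub>)"

definition clift :: "nat \<Rightarrow> ('k, 'b) galg \<Rightarrow> (nat \<Rightarrow> 'a \<Rightarrow> 'b) \<Rightarrow> nat \<Rightarrow> (nat \<Rightarrow> 'a) \<Rightarrow> nat \<Rightarrow> 'b"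
  where "clift p B f j a = (\<lambda>i. slotmap p B f j i (a i))"

definition cpadd where
  "cpadd p A B f j a b = (\<lambda>i. inv_into (slotcar p A j i) (slotmap p B f j i)
     (CW_add p (ev_part p B) (clift p B f j a) (clift p B f j b) i))"

definition cpsm where
  "cpsm p k A B f j l a = (\<lambda>i. inv_into (slotcar p A j i) (slotmap p B f j i)
     (CW_smult p k (ev_part p B) l (clift p B f j a) i))"

definition cpF where
  "cpF p A j a = (\<lambda>i. if p ^ i dvd j then pmu A (j div p ^ i) (replicate p (a i)) else slotzero p A (p * j) i)"

definition CWpol :: "nat \<Rightarrow> ('k, 'r) ring_scheme \<Rightarrow> (nat \<Rightarrow> (nat \<Rightarrow> 'a) set) \<Rightarrow> ('k, 'a) polar \<Rightarrow> ('k, 'b) galg \<Rightarrow>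
    (nat \<Rightarrow> 'a \<Rightarrow> 'b) \<Rightarrow> ('k, nat \<Rightarrow> 'a) dmod"
  where "CWpol p k C A B f =
    \<lparr>dcomp = (\<lambda>j. mod_on (witt_ring p k) (C j) (slotzero p A j) (cpadd p A B f j) (cpsm p k A B f j)),
     dF = (\<lambda>j. \<lambda>a\<in>C j. cpF p A j a), dV = (\<lambda>j. \<lambda>a\<in>C (p * j). \<lambda>i. a (Suc i))\<rparr>"

definition Cmor where
  "Cmor p C A' g j = (\<lambda>a\<in>C j. \<lambda>i. slotg p A' g j i (a i))"

lemma (in polemb) slotmap_R: "x \<in> slotcar p A j i \<Longrightarrow> slotmap p B f j i x \<in> carrier R"
  using f_R R_zero_in by (auto simp: slotmap_def slotcar_def split: if_splits)

context polhom begin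

lemma slotg_in: "x \<in> slotcar p A j i \<Longrightarrow> slotg p A' g j i x \<in> slotcar p A' j i"
  using g_pAcar by (auto simp: slotcar_def slotg_def)

lemma slotg_zero: "slotg p A' g j i (slotzero p A j i) = slotzero p A' j i"
  using g_zero by (auto simp: slotzero_def slotg_def)

lemma slotmap_T:
  assumes "x \<in> slotcar p A j i" "p ^ i dvd j"
  shows "T (j div p ^ i) (slotmap p B f j i x) (slotmap p B' f' j i (slotg p A' g j i x))"
  using assms by (auto simp: slotmap_def slotg_def slotcar_def T_def)

lemma slotmap_zero:
  assumes "\<not> p ^ i dvd j"
  shows "slotmap p B f j i x = \<zero>\<^bsub>B\<^esub>" "slotmap p B' f' j i y = \<zero>\<^bsub>B'\<^esub>"
  using assms by (auto simp: slotmap_def)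

text \<open>
  The degrees \<open>j / p ^ i\<close> of the entries of a covector fit the weights of the Witt polynomials
  as those of the entries of a Witt vector do.
\<close>

lemma entry_T:
  assumes a: "\<And>i. a i \<in> slotcar p A j i" and i: "p ^ i dvd j" and s: "s \<le> m"
  defines "x \<equiv> wv (clift p B f j a) (i + m) s" and "y \<equiv> wv (clift p B' f' j (\<lambda>i. slotg p A' g j i (a i))) (i + m) s"
  shows "x = \<zero>\<^bsub>B\<^esub> \<and> y = \<zero>\<^bsub>B'\<^esub> \<or> (\<exists>\<delta>. \<delta> * p ^ (m - s) = j div p ^ i \<and> T \<delta> x y)"
proof (cases "p ^ (i + m - s) dvd j")
  case False
  then show ?thesis unfolding x_def y_def wv_def clift_def using slotmap_zero by blast
next
  case True
  then have "T (j div p ^ (i + m - s)) x y"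
    unfolding x_def y_def wv_def clift_def using slotmap_T[OF a True] by simp
  moreover have "j div p ^ (i + m - s) * p ^ (m - s) = j div p ^ i"
  proof -
    have "i + m - s = i + (m - s)" using s by simp
    then have e: "p ^ (i + m - s) = p ^ i * p ^ (m - s)" by (simp add: power_add)
    obtain q where q: "j = p ^ i * p ^ (m - s) * q" using True unfolding e by blast
    then show ?thesis unfolding e q using P.W.ppos by (simp add: mult.assoc)
  qed
  ultimately show ?thesis by blast
qed

lemma clift_R: "(\<And>i. a i \<in> slotcar p A j i) \<Longrightarrow> clift p B f j a i \<in> carrier (ev_part p B)"
  unfolding clift_def by (rule P.slotmap_R)

lemma clift_R': "(\<And>i. a i \<in> slotcar p A' j i) \<Longrightarrow> clift p B' f' j a i \<in> carrier (ev_part p B')"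
  unfolding clift_def by (rule Q.slotmap_R)

lemma wv_carrier: "(\<And>i. a i \<in> U) \<Longrightarrow> \<forall>s. wv a M s \<in> U"
  by (simp add: wv_def)

text \<open>
  If \<open>p ^ i\<close> does not divide \<open>j\<close>, then all entries from which entry \<open>i\<close> of the sum is computed
  are zero, and so is that entry.
\<close>

lemma cwadd_T:
  assumes a: "\<And>i. a i \<in> slotcar p A j i" and b: "\<And>i. b i \<in> slotcar p A j i"
    and ta: "P.W.tailed I L r (clift p B f j a)" and tb: "P.W.tailed I L r (clift p B f j b)"
    and ta': "Q.W.tailed I' L' r' (clift p B' f' j (\<lambda>i. slotg p A' g j i (a i)))"
    and tb': "Q.W.tailed I' L' r' (clift p B' f' j (\<lambda>i. slotg p A' g j i (b i)))"
  shows "\<exists>c\<in>slotcar p A j i. P.W.cwadd (clift p B f j a) (clift p B f j b) i = slotmap p B f j i c \<and>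
     Q.W.cwadd (clift p B' f' j (\<lambda>i. slotg p A' g j i (a i))) (clift p B' f' j (\<lambda>i. slotg p A' g j i (b i))) i
       = slotmap p B' f' j i (slotg p A' g j i c)"
proof -
  define m where "m = max (r + L) (r' + L')"
  let ?a = "clift p B f j a" and ?b = "clift p B f j b"
  let ?a' = "clift p B' f' j (\<lambda>i. slotg p A' g j i (a i))" and ?b' = "clift p B' f' j (\<lambda>i. slotg p A' g j i (b i))"
  note v = P.W.cwadd_value[OF ta tb, of m i] Q.W.cwadd_value[OF ta' tb', of m i]
  have v: "P.W.cwadd ?a ?b i = wadd p (ev_part p B) (wv ?a (i + m)) (wv ?b (i + m)) m"
    "Q.W.cwadd ?a' ?b' i = wadd p (ev_part p B') (wv ?a' (i + m)) (wv ?b' (i + m)) m"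
    using v by (auto simp: m_def)
  have c: "\<forall>s. wv ?a M s \<in> carrier (ev_part p B)" "\<forall>s. wv ?b M s \<in> carrier (ev_part p B)"
    "\<forall>s. wv ?a' M s \<in> carrier (ev_part p B')" "\<forall>s. wv ?b' M s \<in> carrier (ev_part p B')" for M
    by (intro wv_carrier clift_R clift_R' a b slotg_in)+
  show ?thesis
  proof (cases "p ^ i dvd j")
    case True
    have "T (j div p ^ i) (wadd p (ev_part p B) (wv ?a (i + m)) (wv ?b (i + m)) m)
        (wadd p (ev_part p B') (wv ?a' (i + m)) (wv ?b' (i + m)) m)"
      by (rule T_wadd[OF c(1) c(2) c(3) c(4) entry_T[OF a True] entry_T[OF b True]])
    then show ?thesis unfolding v T_def using True by (auto simp: slotcar_def slotmap_def slotg_def)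
  next
    case False
    have nd: "\<not> p ^ (i + m - s) dvd j" if "s \<le> m" for s
    proof -
      have "p ^ i dvd p ^ (i + m - s)" using that by (intro le_imp_power_dvd) simp
      then show ?thesis using False dvd_trans by blast
    qed
    have "wadd p (ev_part p B) (wv ?a (i + m)) (wv ?b (i + m)) m \<in> {\<zero>\<^bsub>ev_part p B\<^esub>}"
      by (rule P.W.wadd_in_ideal[OF P.W.R.zeroideal c(1) c(2)]) (use nd slotmap_zero in \<open>auto simp: wv_def clift_def\<close>)
    moreover have "wadd p (ev_part p B') (wv ?a' (i + m)) (wv ?b' (i + m)) m \<in> {\<zero>\<^bsub>ev_part p B'\<^esub>}"
      by (rule Q.W.wadd_in_ideal[OF Q.W.R.zeroideal c(3) c(4)]) (use nd slotmap_zero in \<open>auto simp: wv_def clift_def\<close>)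
    ultimately show ?thesis unfolding v using False by (auto simp: slotcar_def slotmap_def)
  qed
qed

lemma cwmul_T:
  assumes l: "l \<in> carrier (witt_ring p k)" and b: "\<And>i. b i \<in> slotcar p A j i"
    and tb: "P.W.tailed I L r (clift p B f j b)"
    and tb': "Q.W.tailed I' L' r' (clift p B' f' j (\<lambda>i. slotg p A' g j i (b i)))"
  shows "\<exists>c\<in>slotcar p A j i. P.W.cwmul l (clift p B f j b) i = slotmap p B f j i c \<and>
     Q.W.cwmul l (clift p B' f' j (\<lambda>i. slotg p A' g j i (b i))) i = slotmap p B' f' j i (slotg p A' g j i c)"
proof -
  define m where "m = max (r + L) (r' + L')"
  let ?b = "clift p B f j b" and ?b' = "clift p B' f' j (\<lambda>i. slotg p A' g j i (b i))"
  note v = P.W.cwmul_value[OF l tb, of m i] Q.W.cwmul_value[OF l tb', of m i]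
  have v: "P.W.cwmul l ?b i = wmul p (ev_part p B) (P.W.thw (i + m) l) (wv ?b (i + m)) m"
    "Q.W.cwmul l ?b' i = wmul p (ev_part p B') (Q.W.thw (i + m) l) (wv ?b' (i + m)) m"
    using v by (auto simp: m_def)
  have c: "\<forall>s. wv ?b M s \<in> carrier (ev_part p B)" "\<forall>s. wv ?b' M s \<in> carrier (ev_part p B')" for M
    by (intro wv_carrier clift_R clift_R' b slotg_in)+
  have lc: "\<forall>s. P.W.thw M l s \<in> carrier (ev_part p B)" "\<forall>s. Q.W.thw M l s \<in> carrier (ev_part p B')" for M
    using P.W.thw_closed[OF l] Q.W.thw_closed[OF l] by auto
  have lk: "\<forall>s. (wfrob_inv p k ^^ M) l s \<in> carrier k" for M
    using P.W.wfin_closed[OF l, of M] by (simp add: witt_ring_simps[OF P.p])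
  show ?thesis
  proof (cases "p ^ i dvd j")
    case True
    have "T (j div p ^ i) (wmul p (ev_part p B) (P.W.thw (i + m) l) (wv ?b (i + m)) m)
        (wmul p (ev_part p B') (Q.W.thw (i + m) l) (wv ?b' (i + m)) m)"
      unfolding P.W.thw_def Q.W.thw_def by (rule T_wmul[OF c(1) c(2) lk entry_T[OF b True]])
    then show ?thesis unfolding v T_def using True by (auto simp: slotcar_def slotmap_def slotg_def)
  next
    case False
    have nd: "\<not> p ^ (i + m - s) dvd j" if "s \<le> m" for s
    proof -
      have "p ^ i dvd p ^ (i + m - s)" using that by (intro le_imp_power_dvd) simp
      then show ?thesis using False dvd_trans by blast
    qed
    have "wmul p (ev_part p B) (P.W.thw (i + m) l) (wv ?b (i + m)) m \<in> {\<zero>\<^bsub>ev_part p B\<^esub>}"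
      by (rule P.W.wmul_in_ideal[OF P.W.R.zeroideal lc(1) c(1)]) (use nd slotmap_zero in \<open>auto simp: wv_def clift_def\<close>)
    moreover have "wmul p (ev_part p B') (Q.W.thw (i + m) l) (wv ?b' (i + m)) m \<in> {\<zero>\<^bsub>ev_part p B'\<^esub>}"
      by (rule Q.W.wmul_in_ideal[OF Q.W.R.zeroideal lc(2) c(2)]) (use nd slotmap_zero in \<open>auto simp: wv_def clift_def\<close>)
    ultimately show ?thesis unfolding v using False by (auto simp: slotcar_def slotmap_def)
  qed
qed

end

context galgebra begin

lemma CW_add_eq: "CW_add p R a b = W.cwadd a b"
  by (simp add: CW_add_def W.cwadd_def wadd_def wv_def)

lemma CW_smult_eq: "CW_smult p k R l a = W.cwmul l a"
proof -
  have "W.thw M l = (\<lambda>s. (wfrob_inv p k ^^ M) l s \<odot>\<^bsub>B\<^esub> \<one>\<^bsub>B\<^esub>)" for M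
    by (auto simp: W.thw_def iota_def)
  then show ?thesis by (simp add: CW_smult_def W.cwmul_def wmul_def wv_def)
qed

lemma tailed_common:
  assumes "W.tailed I L r a" "W.tailed J K s b"
  shows "\<exists>I L r. W.tailed I L r a \<and> W.tailed I L r b"
proof -
  obtain I L r c where "W.rp I L r c (wv a) a" "W.rp I L r c (wv b) b"
    using W.rp_join[OF W.rp_of_tailed[OF assms(1)] W.rp_of_tailed[OF assms(2)]] by blast
  then show ?thesis using W.rp_tailed by blast
qed

end

context polemb begin

text \<open>
  Families of sets of covectors over \<open>A\<close> whose sums are eventually constant.
\<close>

definition covset :: "(nat \<Rightarrow> (nat \<Rightarrow> 'a) set) \<Rightarrow> bool"
  where "covset C \<longleftrightarrow> (\<forall>j. \<forall>a\<in>C j. (\<forall>i. a i \<in> slotcar p A j i) \<and> (\<exists>I L r. W.tailed I L r (clift p B f j a)))"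

text \<open>
  Those which are in addition closed under the operations of a Dieudonne module. Finite
  covectors and connected covectors are the two instances.
\<close>

definition stable_family :: "(nat \<Rightarrow> (nat \<Rightarrow> 'a) set) \<Rightarrow> bool"
  where "stable_family C \<longleftrightarrow> covset C \<and> (\<forall>j. slotzero p A j \<in> C j) \<and>
    (\<forall>j. \<forall>a\<in>C j. \<forall>b\<in>C j. \<forall>c. (\<forall>i. c i \<in> slotcar p A j i) \<longrightarrow>
       clift p B f j c = W.cwadd (clift p B f j a) (clift p B f j b) \<longrightarrow> c \<in> C j) \<and>
    (\<forall>j. \<forall>l\<in>carrier (witt_ring p k). \<forall>b\<in>C j. \<forall>c. (\<forall>i. c i \<in> slotcar p A j i) \<longrightarrow>
       clift p B f j c = W.cwmul l (clift p B f j b) \<longrightarrow> c \<in> C j) \<and>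
    (\<forall>j. \<forall>a\<in>C j. cpF p A j a \<in> C (p * j)) \<and> (\<forall>j. \<forall>a\<in>C (p * j). (\<lambda>i. a (Suc i)) \<in> C j)"

lemma slotmap_inj: "x \<in> slotcar p A j i \<Longrightarrow> y \<in> slotcar p A j i \<Longrightarrow> slotmap p B f j i x = slotmap p B f j i y \<Longrightarrow> x = y"
  using f_inj[OF pAcar_sub pAcar_sub, of x "j div p ^ i" y] by (auto simp: slotcar_def slotmap_def split: if_splits)

lemma inv_slotmap: "c \<in> slotcar p A j i \<Longrightarrow> y = slotmap p B f j i c \<Longrightarrow> inv_into (slotcar p A j i) (slotmap p B f j i) y = c"
  by (metis f_inv_into_f imageI inv_into_into slotmap_inj)

lemma slotmap_slotzero: "slotmap p B f j i (slotzero p A j i) = \<zero>\<^bsub>B\<^esub>"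
  by (simp add: slotmap_def slotzero_def f_zero)

lemma slotzero_in: "slotzero p A j i \<in> slotcar p A j i"
  by (simp add: slotcar_def slotzero_def)

lemma clift_inj:
  assumes "\<And>i. a i \<in> slotcar p A j i" "\<And>i. b i \<in> slotcar p A j i" "clift p B f j a = clift p B f j b"
  shows "a = b"
proof
  fix i
  have "slotmap p B f j i (a i) = slotmap p B f j i (b i)" using fun_cong[OF assms(3), of i] by (simp add: clift_def)
  then show "a i = b i" by (rule slotmap_inj[OF assms(1,2)])
qed

lemma slot_F:
  assumes a: "\<And>i. a i \<in> slotcar p A j i"
  shows "cpF p A j a i \<in> slotcar p A (p * j) i" "slotmap p B f (p * j) i (cpF p A j a i) = slotmap p B f j i (a i) [^]\<^bsub>B\<^esub> p"
proof -
  have "cpF p A j a i \<in> slotcar p A (p * j) i \<and> slotmap p B f (p * j) i (cpF p A j a i) = slotmap p B f j i (a i) [^]\<^bsub>B\<^esub> p"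
  proof (cases "p ^ i dvd j")
    case True
    then have e: "p * j div p ^ i = j div p ^ i * p" "p ^ i dvd p * j" by (simp_all add: div_mult_swap mult.commute)
    have "a i \<in> pAcar p A (j div p ^ i)" using a[of i] True by (simp add: slotcar_def)
    from pmu_pow[OF this] show ?thesis using True e by (simp add: slotcar_def cpF_def slotmap_def)
  next
    case False
    then show ?thesis
      using slotzero_in[of "p * j" i] slotmap_slotzero[of "p * j" i] W.ppos by (simp add: cpF_def slotmap_def B.nat_pow_zero)
  qed
  then show "cpF p A j a i \<in> slotcar p A (p * j) i" "slotmap p B f (p * j) i (cpF p A j a i) = slotmap p B f j i (a i) [^]\<^bsub>B\<^esub> p"
    by auto
qed

lemma slot_V: "slotcar p A (p * j) (Suc i) = slotcar p A j i" "slotmap p B f (p * j) (Suc i) = slotmap p B f j i"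
    "slotzero p A (p * j) (Suc i) = slotzero p A j i"
  using W.ppos by (auto simp: slotcar_def slotmap_def slotzero_def)

lemma self_clift:
  assumes "\<And>i. a i \<in> slotcar p A j i"
  shows "clift p B f j (\<lambda>i. slotg p A (\<lambda>j. \<lambda>x\<in>carrier (pcomp A j). x) j i (a i)) = clift p B f j a"
proof
  fix i
  show "clift p B f j (\<lambda>i. slotg p A (\<lambda>j. \<lambda>x\<in>carrier (pcomp A j). x) j i (a i)) i = clift p B f j a i"
    using assms[of i] pAcar_sub[of "a i" "j div p ^ i"] by (auto simp: clift_def slotmap_def slotg_def slotcar_def)
qed

lemma clift_carrier: "(\<And>i. a i \<in> slotcar p A j i) \<Longrightarrow> clift p B f j a i \<in> carrier R"
  unfolding clift_def by (rule slotmap_R)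

lemma cpadd_props:
  assumes C: "covset C" and a: "a \<in> C j" and b: "b \<in> C j"
  shows "cpadd p A B f j a b i \<in> slotcar p A j i" "clift p B f j (cpadd p A B f j a b) = W.cwadd (clift p B f j a) (clift p B f j b)"
proof -
  interpret S: polhom p k B A f B A f "\<lambda>j. \<lambda>x\<in>carrier (pcomp A j). x" by (rule polhom_self)
  have s: "\<And>i. a i \<in> slotcar p A j i" "\<And>i. b i \<in> slotcar p A j i" using C a b by (auto simp: covset_def)
  obtain I L r where t: "W.tailed I L r (clift p B f j a)" "W.tailed I L r (clift p B f j b)"
    using C a b tailed_common unfolding covset_def by meson
  have key: "cpadd p A B f j a b i \<in> slotcar p A j i \<and> slotmap p B f j i (cpadd p A B f j a b i) = W.cwadd (clift p B f j a) (clift p B f j b) i" for i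
  proof -
    obtain c where c: "c \<in> slotcar p A j i" "W.cwadd (clift p B f j a) (clift p B f j b) i = slotmap p B f j i c"
      using S.cwadd_T[OF s t, unfolded self_clift[OF s(1)] self_clift[OF s(2)], OF t, of i] by blast
    have "cpadd p A B f j a b i = c" unfolding cpadd_def CW_add_eq by (rule inv_slotmap[OF c])
    then show ?thesis using c by simp
  qed
  then show "cpadd p A B f j a b i \<in> slotcar p A j i" "clift p B f j (cpadd p A B f j a b) = W.cwadd (clift p B f j a) (clift p B f j b)"
    by (auto simp: clift_def[of p B f j "cpadd p A B f j a b"])
qed

lemma cpsm_props:
  assumes C: "covset C" and l: "l \<in> carrier (witt_ring p k)" and b: "b \<in> C j"
  shows "cpsm p k A B f j l b i \<in> slotcar p A j i" "clift p B f j (cpsm p k A B f j l b) = W.cwmul l (clift p B f j b)"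
proof -
  interpret S: polhom p k B A f B A f "\<lambda>j. \<lambda>x\<in>carrier (pcomp A j). x" by (rule polhom_self)
  have s: "\<And>i. b i \<in> slotcar p A j i" using C b by (auto simp: covset_def)
  obtain I L r where t: "W.tailed I L r (clift p B f j b)"
    using C b unfolding covset_def by meson
  have key: "cpsm p k A B f j l b i \<in> slotcar p A j i \<and> slotmap p B f j i (cpsm p k A B f j l b i) = W.cwmul l (clift p B f j b) i" for i
  proof -
    obtain c where c: "c \<in> slotcar p A j i" "W.cwmul l (clift p B f j b) i = slotmap p B f j i c"
      using S.cwmul_T[OF l s t, unfolded self_clift[OF s], OF t, of i] by blast
    have "cpsm p k A B f j l b i = c" unfolding cpsm_def CW_smult_eq by (rule inv_slotmap[OF c])
    then show ?thesis using c by simp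
  qed
  then show "cpsm p k A B f j l b i \<in> slotcar p A j i" "clift p B f j (cpsm p k A B f j l b) = W.cwmul l (clift p B f j b)"
    by (auto simp: clift_def[of p B f j "cpsm p k A B f j l b"])
qed

lemma stable_cov: "stable_family C \<Longrightarrow> covset C" by (simp add: stable_family_def)

lemma stable_add:
  assumes "stable_family C" "a \<in> C j" "b \<in> C j" "\<And>i. c i \<in> slotcar p A j i"
    "clift p B f j c = W.cwadd (clift p B f j a) (clift p B f j b)"
  shows "c \<in> C j"
proof -
  have "\<forall>j. \<forall>a\<in>C j. \<forall>b\<in>C j. \<forall>c. (\<forall>i. c i \<in> slotcar p A j i) \<longrightarrow>
       clift p B f j c = W.cwadd (clift p B f j a) (clift p B f j b) \<longrightarrow> c \<in> C j"
    using assms(1) unfolding stable_family_def by (elim conjE)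
  from this[rule_format, OF assms(2-5)] show ?thesis .
qed

lemma stable_smult:
  assumes "stable_family C" "l \<in> carrier (witt_ring p k)" "b \<in> C j" "\<And>i. c i \<in> slotcar p A j i"
    "clift p B f j c = W.cwmul l (clift p B f j b)"
  shows "c \<in> C j"
proof -
  have "\<forall>j. \<forall>l\<in>carrier (witt_ring p k). \<forall>b\<in>C j. \<forall>c. (\<forall>i. c i \<in> slotcar p A j i) \<longrightarrow>
       clift p B f j c = W.cwmul l (clift p B f j b) \<longrightarrow> c \<in> C j"
    using assms(1) unfolding stable_family_def by (elim conjE)
  from this[rule_format, OF assms(2-5)] show ?thesis .
qed

lemma stable_FV: "stable_family C \<Longrightarrow> a \<in> C j \<Longrightarrow> cpF p A j a \<in> C (p * j)" "stable_family C \<Longrightarrow> a \<in> C (p * j) \<Longrightarrow> (\<lambda>i. a (Suc i)) \<in> C j"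
  and stable_zero: "stable_family C \<Longrightarrow> slotzero p A j \<in> C j"
  by (simp_all add: stable_family_def)

lemma cpadd_in: "stable_family C \<Longrightarrow> a \<in> C j \<Longrightarrow> b \<in> C j \<Longrightarrow> cpadd p A B f j a b \<in> C j"
  by (rule stable_add[OF _ _ _ cpadd_props(1)[OF stable_cov] cpadd_props(2)[OF stable_cov]])

lemma cpsm_in: "stable_family C \<Longrightarrow> l \<in> carrier (witt_ring p k) \<Longrightarrow> b \<in> C j \<Longrightarrow> cpsm p k A B f j l b \<in> C j"
  by (rule stable_smult[OF _ _ _ cpsm_props(1)[OF stable_cov] cpsm_props(2)[OF stable_cov]])

lemma CWpol_dieudonne:
  fixes M :: "('k, nat \<Rightarrow> 'a, 'z) dmod_scheme"
  assumes C: "stable_family C"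
    and M: "dcomp M = (\<lambda>j. mod_on (witt_ring p k) (C j) (slotzero p A j) (cpadd p A B f j) (cpsm p k A B f j))"
      "dF M = (\<lambda>j. \<lambda>a\<in>C j. cpF p A j a)" "dV M = (\<lambda>j. \<lambda>a\<in>C (p * j). \<lambda>i. a (Suc i))"
  shows "is_dieudonne p k M"
proof -
  note cov = stable_cov[OF C]
  have sl: "a i \<in> slotcar p A j i" if "a \<in> C j" for a j i using cov that by (auto simp: covset_def)
  let ?\<rho> = "\<lambda>j (x :: nat \<Rightarrow> nat \<Rightarrow> 'b) a. a \<in> C j \<and> (\<exists>I L r c. W.rp I L r c x (clift p B f j a))"
  show ?thesis
  proof (rule W.dieudonne_wfam[where \<rho> = ?\<rho> and C = C and z = "slotzero p A"
       and pl = "cpadd p A B f" and sm = "cpsm p k A B f" and F = "cpF p A" and V = "\<lambda>j a i. a (Suc i)"])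
    fix j
    show "represented (witt_ring p k) W.wfam (?\<rho> j) (C j) (slotzero p A j) (cpadd p A B f j) (cpsm p k A B f j)"
    proof (rule represented.intro)
      show "Module.module (witt_ring p k) W.wfam" by (rule W.wfam_module)
    next
      fix a assume a: "a \<in> C j"
      then obtain I L r where "W.tailed I L r (clift p B f j a)" using cov unfolding covset_def by meson
      from W.rp_of_tailed[OF this] show "\<exists>x. ?\<rho> j x a" using a by blast
    next
      fix x a assume "?\<rho> j x a"
      then show "x \<in> carrier W.wfam \<and> a \<in> C j" by (auto simp: W.rp_def)
    next
      fix x a b assume "?\<rho> j x a" "?\<rho> j x b"
      then obtain I L r c J K s d where "W.rp I L r c x (clift p B f j a)" "W.rp J K s d x (clift p B f j b)"
        and ab: "a \<in> C j" "b \<in> C j" by blast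
      from W.rp_unique[OF this(1,2)] show "a = b" by (rule clift_inj[OF sl[OF ab(1)] sl[OF ab(2)]])
    next
      have "clift p B f j (slotzero p A j) = (\<lambda>i. \<zero>\<^bsub>B\<^esub>)" by (simp add: clift_def slotmap_slotzero)
      moreover have "slotzero p A j \<in> C j" by (rule stable_zero[OF C])
      ultimately show "?\<rho> j \<zero>\<^bsub>W.wfam\<^esub> (slotzero p A j)"
        using W.rp_zero by auto
    next
      fix x a y b assume xa: "?\<rho> j x a" and yb: "?\<rho> j y b"
      then obtain I L r c where "W.rp I L r c x (clift p B f j a)" "W.rp I L r c y (clift p B f j b)"
        using W.rp_join by blast
      from W.rp_add[OF this] show "?\<rho> j (x \<oplus>\<^bsub>W.wfam\<^esub> y) (cpadd p A B f j a b)"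
        using cpadd_props(2)[OF cov, of a j b] cpadd_in[OF C, of a j b] xa yb by auto
    next
      fix y b l assume l: "l \<in> carrier (witt_ring p k)" and yb: "?\<rho> j y b"
      then obtain I L r c where "W.rp I L r c y (clift p B f j b)" by blast
      from W.rp_smult[OF l this] show "?\<rho> j (l \<odot>\<^bsub>W.wfam\<^esub> y) (cpsm p k A B f j l b)"
        using cpsm_props(2)[OF cov l, of b j] cpsm_in[OF C l, of b j] yb by auto
    qed
  next
    fix j x a assume xa: "?\<rho> j x a"
    then obtain I L r c where "W.rp I L r c x (clift p B f j a)" by blast
    note rpF = W.rp_F[OF this]
    have "clift p B f (p * j) (cpF p A j a) = (\<lambda>i. clift p B f j a i [^]\<^bsub>R\<^esub> p)"
      using slot_F(2)[of a j] sl xa by (simp add: clift_def)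
    moreover have "cpF p A j a \<in> C (p * j)" using stable_FV(1)[OF C] xa by blast
    ultimately show "?\<rho> (p * j) (W.wfamF x) (cpF p A j a)" using rpF by metis
  next
    fix j x a assume xa: "?\<rho> (p * j) x a"
    then obtain I L r c where "W.rp I L r c x (clift p B f (p * j) a)" by blast
    note rpV = W.rp_V[OF this]
    have "clift p B f j (\<lambda>i. a (Suc i)) = (\<lambda>i. clift p B f (p * j) a (Suc i))"
      by (simp add: clift_def slot_V)
    moreover have "(\<lambda>i. a (Suc i)) \<in> C j" using stable_FV(2)[OF C] xa by blast
    ultimately show "?\<rho> j (W.wfamV x) (\<lambda>i. a (Suc i))" using rpV by metis
  qed (use M in auto)
qed

end

context polhom begin

lemma Cmor_hom:
  fixes M M' :: "('k, nat \<Rightarrow> 'a, 'z) dmod_scheme"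
  assumes C: "P.stable_family C" and C': "Q.stable_family C'"
    and gC: "\<And>j a. a \<in> C j \<Longrightarrow> (\<lambda>i. slotg p A' g j i (a i)) \<in> C' j"
    and M: "dcomp M = (\<lambda>j. mod_on (witt_ring p k) (C j) (slotzero p A j) (cpadd p A B f j) (cpsm p k A B f j))"
      "dF M = (\<lambda>j. \<lambda>a\<in>C j. cpF p A j a)" "dV M = (\<lambda>j. \<lambda>a\<in>C (p * j). \<lambda>i. a (Suc i))"
    and M': "dcomp M' = (\<lambda>j. mod_on (witt_ring p k) (C' j) (slotzero p A' j) (cpadd p A' B' f' j) (cpsm p k A' B' f' j))"
      "dF M' = (\<lambda>j. \<lambda>a\<in>C' j. cpF p A' j a)" "dV M' = (\<lambda>j. \<lambda>a\<in>C' (p * j). \<lambda>i. a (Suc i))"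
  shows "Cmor p C A' g \<in> dmod_hom p k M M'"
proof -
  note cov = P.stable_cov[OF C] and cov' = Q.stable_cov[OF C']
  have sl: "a i \<in> slotcar p A j i" if "a \<in> C j" for a j i using cov that by (auto simp: P.covset_def)
  have sl': "a i \<in> slotcar p A' j i" if "a \<in> C' j" for a j i using cov' that by (auto simp: Q.covset_def)
  let ?g = "\<lambda>j a i. slotg p A' g j i (a i)"
  have add: "?g j (cpadd p A B f j a b) = cpadd p A' B' f' j (?g j a) (?g j b)" if a: "a \<in> C j" and b: "b \<in> C j" for a b j
  proof
    fix i
    obtain I L r where t: "P.W.tailed I L r (clift p B f j a)" "P.W.tailed I L r (clift p B f j b)"
      using cov a b P.tailed_common unfolding P.covset_def by meson
    obtain I' L' r' where t': "Q.W.tailed I' L' r' (clift p B' f' j (?g j a))" "Q.W.tailed I' L' r' (clift p B' f' j (?g j b))"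
      using cov' gC[OF a] gC[OF b] Q.tailed_common unfolding Q.covset_def by meson
    obtain c where c: "c \<in> slotcar p A j i" "P.W.cwadd (clift p B f j a) (clift p B f j b) i = slotmap p B f j i c"
      "Q.W.cwadd (clift p B' f' j (?g j a)) (clift p B' f' j (?g j b)) i = slotmap p B' f' j i (slotg p A' g j i c)"
      using cwadd_T[OF sl[OF a] sl[OF b] t t', of i] by blast
    have "cpadd p A B f j a b i = c" unfolding cpadd_def P.CW_add_eq by (rule P.inv_slotmap[OF c(1,2)])
    moreover have "cpadd p A' B' f' j (?g j a) (?g j b) i = slotg p A' g j i c"
      unfolding cpadd_def Q.CW_add_eq by (rule Q.inv_slotmap[OF slotg_in[OF c(1)] c(3)])
    ultimately show "?g j (cpadd p A B f j a b) i = cpadd p A' B' f' j (?g j a) (?g j b) i" by simp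
  qed
  have smul: "?g j (cpsm p k A B f j l b) = cpsm p k A' B' f' j l (?g j b)" if l: "l \<in> carrier (witt_ring p k)" and b: "b \<in> C j" for l b j
  proof
    fix i
    obtain I L r where t: "P.W.tailed I L r (clift p B f j b)" using cov b unfolding P.covset_def by meson
    obtain I' L' r' where t': "Q.W.tailed I' L' r' (clift p B' f' j (?g j b))"
      using cov' gC[OF b] unfolding Q.covset_def by meson
    obtain c where c: "c \<in> slotcar p A j i" "P.W.cwmul l (clift p B f j b) i = slotmap p B f j i c"
      "Q.W.cwmul l (clift p B' f' j (?g j b)) i = slotmap p B' f' j i (slotg p A' g j i c)"
      using cwmul_T[OF l sl[OF b] t t', of i] by blast
    have "cpsm p k A B f j l b i = c" unfolding cpsm_def P.CW_smult_eq by (rule P.inv_slotmap[OF c(1,2)])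
    moreover have "cpsm p k A' B' f' j l (?g j b) i = slotg p A' g j i c"
      unfolding cpsm_def Q.CW_smult_eq by (rule Q.inv_slotmap[OF slotg_in[OF c(1)] c(3)])
    ultimately show "?g j (cpsm p k A B f j l b) i = cpsm p k A' B' f' j l (?g j b) i" by simp
  qed
  have F: "?g (p * j) (cpF p A j a) = cpF p A' j (?g j a)" if a: "a \<in> C j" for a j
  proof
    fix i
    show "?g (p * j) (cpF p A j a) i = cpF p A' j (?g j a) i"
    proof (cases "p ^ i dvd j")
      case True
      then have e: "p * j div p ^ i = j div p ^ i * p" "p ^ i dvd p * j" by (simp_all add: div_mult_swap mult.commute)
      have "a i \<in> carrier (pcomp A (j div p ^ i))" using P.pAcar_sub sl[OF a, of i] True by (simp add: slotcar_def)
      then have "replicate p (a i) \<in> ptuples p (carrier (pcomp A (j div p ^ i)))" by (auto simp: ptuples_def)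
      from g_pmu[OF this] show ?thesis using True e by (simp add: cpF_def slotg_def)
    next
      case False
      then show ?thesis using slotg_zero[of "p * j" i] by (simp add: cpF_def)
    qed
  qed
  have V: "?g j (\<lambda>i. a (Suc i)) = (\<lambda>i. ?g (p * j) a (Suc i))" for a j
    using P.W.ppos by (auto simp: slotg_def)
  have FC: "cpF p A j a \<in> C (p * j)" if "a \<in> C j" for a j using P.stable_FV(1)[OF C that] .
  have VC: "(\<lambda>i. a (Suc i)) \<in> C j" if "a \<in> C (p * j)" for a j using P.stable_FV(2)[OF C that] .
  show ?thesis
    unfolding dmod_hom_def
  proof (intro CollectI allI conjI ballI IntI)
    fix j
    show "Cmor p C A' g j \<in> extensional (carrier (dcomp M j))" by (simp add: Cmor_def M)
    show "Cmor p C A' g j \<in> lin_maps (witt_ring p k) (dcomp M j) (dcomp M' j)"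
      using gC add smul P.cpadd_in[OF C] P.cpsm_in[OF C] by (auto simp: lin_maps_def M M' Cmor_def)
  next
    fix j a assume "a \<in> carrier (dcomp M j)"
    then have a: "a \<in> C j" by (simp add: M)
    show "Cmor p C A' g (p * j) (dF M j a) = dF M' j (Cmor p C A' g j a)"
      using a FC[OF a] gC[OF a] F[OF a] by (simp add: M M' Cmor_def)
  next
    fix j a assume "a \<in> carrier (dcomp M (p * j))"
    then have a: "a \<in> C (p * j)" by (simp add: M)
    show "Cmor p C A' g j (dV M j a) = dV M' j (Cmor p C A' g (p * j) a)"
      using a VC[OF a] gC[OF a] V by (simp add: M M' Cmor_def)
  qed
qed

end

section \<open>Profinite modules of sequences\<close>

text \<open>
  The length of the longest chain below a submodule is a rank function: bounded, and strictly
  increasing along strict inclusions.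
\<close>

lemma finite_colength_rank:
  assumes N: "Module.module k N" and fin: "finite_colength k N {\<zero>\<^bsub>N\<^esub>}"
  obtains rk :: "'a set \<Rightarrow> nat" and b where "\<And>S. submodule S k N \<Longrightarrow> rk S \<le> b"
    and "\<And>S S'. submodule S k N \<Longrightarrow> submodule S' k N \<Longrightarrow> S \<subset> S' \<Longrightarrow> rk S < rk S'"
proof -
  interpret N: Module.module k N by (rule N)
  define chain where "chain C n \<longleftrightarrow> (\<forall>i\<le>n. submodule (C i) k N \<and> {\<zero>\<^bsub>N\<^esub>} \<subseteq> C i) \<and> (\<forall>i<n. C i \<subset> C (Suc i))" for C and n :: nat
  obtain b where b: "\<And>C n. chain C n \<Longrightarrow> n \<le> b" using fin unfolding finite_colength_def chain_def by blast
  \<comment> \<open>the lengths of chains below \<open>S\<close>; the rank is their maximum\<close>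
  define L where "L S = {n. \<exists>C. chain C n \<and> C n \<subseteq> S}" for S
  have Lfin: "finite (L S)" for S using b by (auto simp: L_def intro!: finite_subset[of _ "{..b}"])
  have z: "\<zero>\<^bsub>N\<^esub> \<in> S" if "submodule S k N" for S
    using subgroup.one_closed[OF submodule.axioms(1)[OF that]] by simp
  have zsub: "submodule {\<zero>\<^bsub>N\<^esub>} k N" by (rule N.submoduleI) auto
  have Lne: "0 \<in> L S" if "submodule S k N" for S
    unfolding L_def chain_def using z[OF that] zsub by (auto intro!: exI[of _ "\<lambda>_. {\<zero>\<^bsub>N\<^esub>}"])
  show thesis
  proof (rule that[of "\<lambda>S. Max (L S)" b])
    fix S assume "submodule S k N"
    then show "Max (L S) \<le> b" using Lfin Lne[of S] b by (intro Max.boundedI) (auto simp: L_def)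
  next
    fix S S' assume S: "submodule S k N" "submodule S' k N" "S \<subset> S'"
    obtain n where n: "n = Max (L S)" by blast
    have "n \<in> L S" unfolding n using Lfin Lne[OF S(1)] by (intro Max_in) auto
    then obtain C where C: "chain C n" "C n \<subseteq> S" by (auto simp: L_def)
    have "chain (C(Suc n := S')) (Suc n)"
      using C S z[OF S(2)] unfolding chain_def by (auto simp: less_Suc_eq le_Suc_eq)
    moreover have "(C(Suc n := S')) (Suc n) \<subseteq> S'" by simp
    ultimately have "Suc n \<in> L S'" unfolding L_def by blast
    then show "Max (L S) < Max (L S')" using Max_ge[OF Lfin, of "Suc n" S'] by (simp add: n Suc_le_eq)
  qed
qed

text \<open>
  A module of sequences, with values restricted entrywise, such that an entry of a sum or a
  multiple depends only on the \<open>c + 1\<close> entries from the same position on. On sequences that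
  vanish from \<open>a\<^sub>i\<^sub>+\<^sub>1\<close> on, entry \<open>i\<close> behaves as an element of the module
  \<open>N i\<close> of finite length. Connected covectors in a given degree are of this form; there \<open>c\<close> is
  the bound for sums of covectors, and \<open>\<theta> i l\<close> is the first entry of
  \<open>frob\<^sup>-\<^sup>i l\<close>.
\<close>

locale sequence_module =
  fixes K :: "('K, 'r) ring_scheme" and k :: "('k, 's) ring_scheme" and M :: "('K, nat \<Rightarrow> 'a, 'x) module_scheme"
    and E :: "nat \<Rightarrow> 'a set" and z :: "nat \<Rightarrow> 'a" and c :: nat and N :: "nat \<Rightarrow> ('k, 'a) module" and \<theta> :: "nat \<Rightarrow> 'K \<Rightarrow> 'k"
  assumes M: "Module.module K M" and carr: "carrier M = {a. \<forall>i. a i \<in> E i}" and zero: "\<zero>\<^bsub>M\<^esub> = z"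
    and loc_add: "\<And>a b a' b' i. a \<in> carrier M \<Longrightarrow> b \<in> carrier M \<Longrightarrow> a' \<in> carrier M \<Longrightarrow> b' \<in> carrier M \<Longrightarrow>
       (\<And>s. i \<le> s \<Longrightarrow> s \<le> i + c \<Longrightarrow> a s = a' s \<and> b s = b' s) \<Longrightarrow> (a \<oplus>\<^bsub>M\<^esub> b) i = (a' \<oplus>\<^bsub>M\<^esub> b') i"
    and loc_smult: "\<And>l a a' i. l \<in> carrier K \<Longrightarrow> a \<in> carrier M \<Longrightarrow> a' \<in> carrier M \<Longrightarrow>
       (\<And>s. i \<le> s \<Longrightarrow> s \<le> i + c \<Longrightarrow> a s = a' s) \<Longrightarrow> (l \<odot>\<^bsub>M\<^esub> a) i = (l \<odot>\<^bsub>M\<^esub> a') i"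
    and top_add: "\<And>a b i. a \<in> carrier M \<Longrightarrow> b \<in> carrier M \<Longrightarrow> (\<And>s. i < s \<Longrightarrow> a s = z s \<and> b s = z s) \<Longrightarrow>
       (a \<oplus>\<^bsub>M\<^esub> b) i = a i \<oplus>\<^bsub>N i\<^esub> b i"
    and top_smult: "\<And>l a i. l \<in> carrier K \<Longrightarrow> a \<in> carrier M \<Longrightarrow> (\<And>s. i < s \<Longrightarrow> a s = z s) \<Longrightarrow>
       (l \<odot>\<^bsub>M\<^esub> a) i = \<theta> i l \<odot>\<^bsub>N i\<^esub> a i"
    and N: "\<And>i. Module.module k (N i)" and EN: "\<And>i. E i \<subseteq> carrier (N i)" and zN: "\<And>i. z i = \<zero>\<^bsub>N i\<^esub>"
    and \<theta>: "\<And>i r. r \<in> carrier k \<Longrightarrow> \<exists>l\<in>carrier K. \<theta> i l = r"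
    and fin: "\<And>i. finite_colength k (N i) {\<zero>\<^bsub>N i\<^esub>}"
begin

sublocale M: Module.module K M by (rule M)

abbreviation T where "T \<equiv> product_topology (\<lambda>i. discrete_topology (E i)) UNIV"

definition cyl :: "nat \<Rightarrow> (nat \<Rightarrow> 'a) \<Rightarrow> (nat \<Rightarrow> 'a) set"
  where "cyl n x = {y \<in> carrier M. \<forall>i<n. y i = x i}"

lemma topspace_T: "topspace T = carrier M"
  by (auto simp: carr PiE_def Pi_def)

lemma open_cyl: assumes "x \<in> carrier M" shows "openin T (cyl n x)"
proof -
  let ?U = "\<lambda>i. if i < n then {x i} else E i"
  have "finite {i. ?U i \<noteq> topspace (discrete_topology (E i))}"
    by (rule finite_subset[of _ "{..<n}"]) auto
  then have "openin T (\<Pi>\<^sub>E i\<in>UNIV. ?U i)"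
    using assms by (subst openin_PiE_gen) (auto simp: carr)
  moreover have "(\<Pi>\<^sub>E i\<in>UNIV. ?U i) = cyl n x"
  proof (intro subset_antisym subsetI)
    fix y assume y: "y \<in> (\<Pi>\<^sub>E i\<in>UNIV. ?U i)"
    have u: "y i \<in> ?U i" for i by (rule PiE_mem[OF y UNIV_I])
    have "y i \<in> E i" for i using u[of i] assms by (cases "i < n") (auto simp: carr)
    moreover have "y i = x i" if "i < n" for i using u[of i] that by simp
    ultimately show "y \<in> cyl n x" by (simp add: cyl_def carr)
  qed (auto simp: cyl_def carr)
  ultimately show ?thesis by simp
qed

lemma open_contains_cyl:
  assumes V: "openin T V" and x: "x \<in> V" shows "\<exists>n. cyl n x \<subseteq> V"
proof -
  obtain U where U: "finite {i \<in> UNIV. U i \<noteq> topspace (discrete_topology (E i))}" "x \<in> Pi\<^sub>E UNIV U" "Pi\<^sub>E UNIV U \<subseteq> V"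
    using V x unfolding openin_product_topology_alt by blast
  obtain n where n: "\<And>i. U i \<noteq> E i \<Longrightarrow> i < n"
    using U(1) finite_nat_set_iff_bounded[of "{i. U i \<noteq> E i}"] by auto
  have "cyl n x \<subseteq> Pi\<^sub>E UNIV U"
  proof
    fix y assume y: "y \<in> cyl n x"
    have "y i \<in> U i" for i
    proof (cases "i < n")
      case True
      then have "y i = x i" using y by (simp add: cyl_def)
      then show ?thesis using U(2) by auto
    next
      case False
      then have "U i = E i" using n by blast
      then show ?thesis using y by (simp add: cyl_def carr)
    qed
    then show "y \<in> Pi\<^sub>E UNIV U" by auto
  qed
  then show ?thesis using U(3) by blast
qed

lemma z_in: "z \<in> carrier M" using M.zero_closed zero by simp

lemma neg_smult: "a \<in> carrier M \<Longrightarrow> \<ominus>\<^bsub>M\<^esub> a = (\<ominus>\<^bsub>K\<^esub> \<one>\<^bsub>K\<^esub>) \<odot>\<^bsub>M\<^esub> a"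
  by (simp add: M.smult_l_minus)

lemma loc_neg:
  assumes "a \<in> carrier M" "a' \<in> carrier M" "\<And>s. i \<le> s \<Longrightarrow> s \<le> i + c \<Longrightarrow> a s = a' s"
  shows "(\<ominus>\<^bsub>M\<^esub> a) i = (\<ominus>\<^bsub>M\<^esub> a') i"
  using loc_smult[of "\<ominus>\<^bsub>K\<^esub> \<one>\<^bsub>K\<^esub>" a a' i] assms neg_smult by simp

lemma loc_minus:
  assumes "a \<in> carrier M" "b \<in> carrier M" and e: "\<And>s. i \<le> s \<Longrightarrow> s \<le> i + 2 * c \<Longrightarrow> a s = b s"
  shows "(a \<ominus>\<^bsub>M\<^esub> b) i = z i"
proof -
  have "(a \<oplus>\<^bsub>M\<^esub> \<ominus>\<^bsub>M\<^esub> b) i = (a \<oplus>\<^bsub>M\<^esub> \<ominus>\<^bsub>M\<^esub> a) i"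
  proof (rule loc_add)
    fix s assume s: "i \<le> s" "s \<le> i + c"
    have "(\<ominus>\<^bsub>M\<^esub> b) s = (\<ominus>\<^bsub>M\<^esub> a) s" using s assms by (intro loc_neg) auto
    then show "a s = a s \<and> (\<ominus>\<^bsub>M\<^esub> b) s = (\<ominus>\<^bsub>M\<^esub> a) s" by simp
  qed (use assms in auto)
  then show ?thesis using assms by (simp add: a_minus_def M.r_neg zero)
qed

lemma minus_plus: "a \<in> carrier M \<Longrightarrow> b \<in> carrier M \<Longrightarrow> (a \<ominus>\<^bsub>M\<^esub> b) \<oplus>\<^bsub>M\<^esub> b = a"
  by (simp add: a_minus_def M.a_assoc M.l_neg)

text \<open>
  The open submodules that generate the topology. The cylinder of all sequences starting with
  \<open>m\<close> zeros need not be a submodule; \<open>U m\<close> is the largest submodule whose elements do not affect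
  the first \<open>m\<close> entries when added.
\<close>

definition U :: "nat \<Rightarrow> (nat \<Rightarrow> 'a) set"
  where "U m = {a \<in> carrier M. \<forall>l\<in>carrier K. \<forall>b\<in>carrier M. \<forall>i<m. (l \<odot>\<^bsub>M\<^esub> a \<oplus>\<^bsub>M\<^esub> b) i = b i}"

lemma U_D: "a \<in> U m \<Longrightarrow> l \<in> carrier K \<Longrightarrow> b \<in> carrier M \<Longrightarrow> i < m \<Longrightarrow> (l \<odot>\<^bsub>M\<^esub> a \<oplus>\<^bsub>M\<^esub> b) i = b i"
  by (simp add: U_def)

lemma U_D1: "a \<in> U m \<Longrightarrow> b \<in> carrier M \<Longrightarrow> i < m \<Longrightarrow> (a \<oplus>\<^bsub>M\<^esub> b) i = b i"
  using U_D[of a m "\<one>\<^bsub>K\<^esub>" b i] by (simp add: U_def)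

lemma U_sub: "submodule (U m) K M"
proof (rule M.submoduleI)
  show s: "U m \<subseteq> carrier M" by (auto simp: U_def)
  show "\<zero>\<^bsub>M\<^esub> \<in> U m" by (simp add: U_def)
  show sm: "l \<odot>\<^bsub>M\<^esub> a \<in> U m" if l: "l \<in> carrier K" and a: "a \<in> U m" for l a
    unfolding U_def
  proof (intro CollectI conjI ballI allI impI)
    show "l \<odot>\<^bsub>M\<^esub> a \<in> carrier M" using l a s by auto
    fix r b i assume *: "r \<in> carrier K" "b \<in> carrier M" "i < m"
    have "r \<odot>\<^bsub>M\<^esub> (l \<odot>\<^bsub>M\<^esub> a) = (r \<otimes>\<^bsub>K\<^esub> l) \<odot>\<^bsub>M\<^esub> a" using * l a s by (simp add: M.smult_assoc1 subset_iff)
    then show "(r \<odot>\<^bsub>M\<^esub> (l \<odot>\<^bsub>M\<^esub> a) \<oplus>\<^bsub>M\<^esub> b) i = b i" using U_D[OF a, of "r \<otimes>\<^bsub>K\<^esub> l"] * l by simp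
  qed
  show "\<ominus>\<^bsub>M\<^esub> a \<in> U m" if a: "a \<in> U m" for a
    using sm[of "\<ominus>\<^bsub>K\<^esub> \<one>\<^bsub>K\<^esub>" a] a neg_smult[of a] s by auto
  show "a \<oplus>\<^bsub>M\<^esub> a' \<in> U m" if a: "a \<in> U m" and a': "a' \<in> U m" for a a'
    unfolding U_def
  proof (intro CollectI conjI ballI allI impI)
    show "a \<oplus>\<^bsub>M\<^esub> a' \<in> carrier M" using a a' s by auto
    fix r b i assume *: "r \<in> carrier K" "b \<in> carrier M" "i < m"
    have ac: "a \<in> carrier M" "a' \<in> carrier M" using a a' s by auto
    have "r \<odot>\<^bsub>M\<^esub> (a \<oplus>\<^bsub>M\<^esub> a') \<oplus>\<^bsub>M\<^esub> b = r \<odot>\<^bsub>M\<^esub> a \<oplus>\<^bsub>M\<^esub> (r \<odot>\<^bsub>M\<^esub> a' \<oplus>\<^bsub>M\<^esub> b)"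
      using * ac by (simp add: M.smult_r_distr M.a_assoc)
    then show "(r \<odot>\<^bsub>M\<^esub> (a \<oplus>\<^bsub>M\<^esub> a') \<oplus>\<^bsub>M\<^esub> b) i = b i"
      using U_D[OF a *(1) _ *(3), of "r \<odot>\<^bsub>M\<^esub> a' \<oplus>\<^bsub>M\<^esub> b"] U_D[OF a' *] * ac by simp
  qed
qed

lemma cyl_U: "cyl (m + 2 * c) z \<subseteq> U m"
proof
  fix a assume "a \<in> cyl (m + 2 * c) z"
  then have a: "a \<in> carrier M" "\<And>i. i < m + 2 * c \<Longrightarrow> a i = z i" by (auto simp: cyl_def)
  show "a \<in> U m" unfolding U_def
  proof (intro CollectI conjI ballI allI impI a(1))
    fix r b i assume *: "r \<in> carrier K" "b \<in> carrier M" "i < m"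
    have "(r \<odot>\<^bsub>M\<^esub> a \<oplus>\<^bsub>M\<^esub> b) i = (\<zero>\<^bsub>M\<^esub> \<oplus>\<^bsub>M\<^esub> b) i"
    proof (rule loc_add)
      fix s assume s: "i \<le> s" "s \<le> i + c"
      have "(r \<odot>\<^bsub>M\<^esub> a) s = (r \<odot>\<^bsub>M\<^esub> z) s" using s * a z_in by (intro loc_smult) auto
      also have "r \<odot>\<^bsub>M\<^esub> z = \<zero>\<^bsub>M\<^esub>" using * zero[symmetric] by simp
      finally show "(r \<odot>\<^bsub>M\<^esub> a) s = \<zero>\<^bsub>M\<^esub> s \<and> b s = b s" by simp
    qed (use * a in auto)
    then show "(r \<odot>\<^bsub>M\<^esub> a \<oplus>\<^bsub>M\<^esub> b) i = b i" using * by simp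
  qed
qed

lemma U_cyl: "U m \<subseteq> cyl m z"
proof
  fix a assume a: "a \<in> U m"
  then have ac: "a \<in> carrier M" by (simp add: U_def)
  have "a i = z i" if "i < m" for i using U_D1[OF a z_in that] ac by (simp add: zero[symmetric])
  then show "a \<in> cyl m z" using ac by (simp add: cyl_def)
qed

lemma cyl_coset:
  assumes S: "submodule S K M" and n: "cyl n z \<subseteq> S" and x: "x \<in> carrier M" and y: "y \<in> cyl (n + 2 * c) x"
  shows "\<exists>h\<in>S. y = h \<oplus>\<^bsub>M\<^esub> x"
proof (rule bexI[of _ "y \<ominus>\<^bsub>M\<^esub> x"])
  have yc: "y \<in> carrier M" and e: "\<And>i. i < n + 2 * c \<Longrightarrow> y i = x i" using y by (auto simp: cyl_def)
  show "y = (y \<ominus>\<^bsub>M\<^esub> x) \<oplus>\<^bsub>M\<^esub> x" using minus_plus yc x by simp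
  have "(y \<ominus>\<^bsub>M\<^esub> x) i = z i" if "i < n" for i using yc x e that by (intro loc_minus) auto
  then show "y \<ominus>\<^bsub>M\<^esub> x \<in> S" using n yc x by (auto simp: cyl_def)
qed

lemma sub_open:
  assumes S: "submodule S K M" and n: "cyl n z \<subseteq> S" shows "openin T S"
proof (subst openin_subopen, rule ballI)
  fix x assume x: "x \<in> S"
  have xc: "x \<in> carrier M" using x M.submoduleE(1)[OF S] by auto
  have "cyl (n + 2 * c) x \<subseteq> S" using cyl_coset[OF S n xc] M.submoduleE(5)[OF S _ x] by blast
  then show "\<exists>V. openin T V \<and> x \<in> V \<and> V \<subseteq> S"
    using open_cyl[OF xc, of "n + 2 * c"] xc by (intro exI[of _ "cyl (n + 2 * c) x"]) (auto simp: cyl_def)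
qed

lemma zz: "z \<oplus>\<^bsub>M\<^esub> z = z" "l \<in> carrier K \<Longrightarrow> l \<odot>\<^bsub>M\<^esub> z = z"
  using M.l_zero[OF M.zero_closed] M.smult_r_null[of l] unfolding zero by auto

text \<open>
  Sequences with zeros from position \<open>t\<close> on. Together with \<open>D\<close>, the set of leading entries at
  position \<open>t\<close>, they measure a submodule by submodules of the \<open>N t\<close>.
\<close>

definition Kn :: "nat \<Rightarrow> (nat \<Rightarrow> 'a) set"
  where "Kn t = {a \<in> carrier M. \<forall>i\<ge>t. a i = z i}"

definition D :: "nat \<Rightarrow> (nat \<Rightarrow> 'a) set \<Rightarrow> 'a set"
  where "D t S = (\<lambda>a. a t) ` (S \<inter> Kn (Suc t))"

lemma Kn_add: "a \<in> Kn t \<Longrightarrow> b \<in> Kn t \<Longrightarrow> a \<oplus>\<^bsub>M\<^esub> b \<in> Kn t"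
proof -
  assume a: "a \<in> Kn t" and b: "b \<in> Kn t"
  have "(a \<oplus>\<^bsub>M\<^esub> b) i = (\<zero>\<^bsub>M\<^esub> \<oplus>\<^bsub>M\<^esub> \<zero>\<^bsub>M\<^esub>) i" if "t \<le> i" for i
    using a b that by (intro loc_add) (auto simp: Kn_def zero z_in)
  then show ?thesis using a b by (simp add: Kn_def zero zz)
qed

lemma Kn_smult: "a \<in> Kn t \<Longrightarrow> l \<in> carrier K \<Longrightarrow> l \<odot>\<^bsub>M\<^esub> a \<in> Kn t"
proof -
  assume a: "a \<in> Kn t" and l: "l \<in> carrier K"
  have "(l \<odot>\<^bsub>M\<^esub> a) i = (l \<odot>\<^bsub>M\<^esub> \<zero>\<^bsub>M\<^esub>) i" if "t \<le> i" for i
    using a l that by (intro loc_smult) (auto simp: Kn_def zero z_in)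
  then show ?thesis using a l by (simp add: Kn_def zero zz)
qed

lemma D_sub: assumes S: "submodule S K M" shows "submodule (D t S) k (N t)"
proof -
  interpret N: Module.module k "N t" by (rule N)
  have SC: "S \<subseteq> carrier M" by (rule M.submoduleE(1)[OF S])
  show ?thesis
  proof (rule N.submoduleI)
    show DC: "D t S \<subseteq> carrier (N t)" using SC EN[of t] by (auto simp: D_def carr)
    have "z \<in> S" using subgroup.one_closed[OF submodule.axioms(1)[OF S]] zero by simp
    then show "\<zero>\<^bsub>N t\<^esub> \<in> D t S" using z_in zN by (auto simp: D_def Kn_def image_iff intro!: bexI[of _ z])
    show "x \<oplus>\<^bsub>N t\<^esub> y \<in> D t S" if xy: "x \<in> D t S" "y \<in> D t S" for x y
    proof -
      obtain a b where ab: "a \<in> S" "a \<in> Kn (Suc t)" "x = a t" "b \<in> S" "b \<in> Kn (Suc t)" "y = b t" using xy by (auto simp: D_def)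
      have "(a \<oplus>\<^bsub>M\<^esub> b) t = x \<oplus>\<^bsub>N t\<^esub> y" using ab by (subst top_add) (auto simp: Kn_def)
      then show ?thesis using Kn_add[OF ab(2,5)] M.submoduleE(5)[OF S ab(1,4)]
        unfolding D_def by (intro image_eqI[where x = "a \<oplus>\<^bsub>M\<^esub> b"]) auto
    qed
    show sm: "r \<odot>\<^bsub>N t\<^esub> x \<in> D t S" if r: "r \<in> carrier k" and x: "x \<in> D t S" for r x
    proof -
      obtain a where a: "a \<in> S" "a \<in> Kn (Suc t)" "x = a t" using x by (auto simp: D_def)
      obtain l where l: "l \<in> carrier K" "\<theta> t l = r" using \<theta>[OF r] by blast
      have "(l \<odot>\<^bsub>M\<^esub> a) t = r \<odot>\<^bsub>N t\<^esub> x" using a l by (subst top_smult) (auto simp: Kn_def)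
      then show ?thesis using Kn_smult[OF a(2) l(1)] M.submoduleE(4)[OF S l(1) a(1)]
        unfolding D_def by (intro image_eqI[where x = "l \<odot>\<^bsub>M\<^esub> a"]) auto
    qed
    show "\<ominus>\<^bsub>N t\<^esub> x \<in> D t S" if x: "x \<in> D t S" for x
    proof -
      have "x \<in> carrier (N t)" using x DC by blast
      then have "(\<ominus>\<^bsub>k\<^esub> \<one>\<^bsub>k\<^esub>) \<odot>\<^bsub>N t\<^esub> x = \<ominus>\<^bsub>N t\<^esub> x" by (simp add: N.smult_l_minus)
      then show ?thesis using sm[of "\<ominus>\<^bsub>k\<^esub> \<one>\<^bsub>k\<^esub>" x] x by simp
    qed
  qed
qed

text \<open>
  Leading entries are cancelled successively, from position \<open>n - 1\<close> down to \<open>0\<close>; what remains is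
  zero. The entries from position \<open>n\<close> on are removed first, by subtracting an element of the
  cylinder.
\<close>

lemma D_eq:
  assumes S: "submodule S K M" and S': "submodule S' K M" and sub: "S \<subseteq> S'" and n: "cyl n z \<subseteq> S"
    and e: "\<And>t. t < n \<Longrightarrow> D t S' \<subseteq> D t S"
  shows "S' \<subseteq> S"
proof
  have SC: "S \<subseteq> carrier M" "S' \<subseteq> carrier M" using M.submoduleE(1) S S' by auto
  have minus: "a \<ominus>\<^bsub>M\<^esub> b \<in> Q" if "submodule Q K M" "a \<in> Q" "b \<in> Q" for a b Q
    using M.submoduleE(3,5)[OF that(1)] that by (simp add: a_minus_def)
  have step: "y \<in> S" if "t \<le> n" "y \<in> S'" "y \<in> Kn t" for t y
    using that
  proof (induction t arbitrary: y)
    case 0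
    then have "y = z" by (auto simp: Kn_def)
    then show ?case using n z_in by (auto simp: cyl_def)
  next
    case (Suc t)
    then have "y t \<in> D t S'" by (auto simp: D_def)
    then obtain w where w: "w \<in> S" "w \<in> Kn (Suc t)" "w t = y t" using e[of t] Suc.prems by (auto simp: D_def)
    have wc: "w \<in> carrier M" "y \<in> carrier M" using w Suc.prems by (auto simp: Kn_def)
    have "(y \<ominus>\<^bsub>M\<^esub> w) i = z i" if "t \<le> i" for i
    proof (rule loc_minus[OF wc(2,1)])
      fix s assume "i \<le> s"
      then have "t = s \<or> Suc t \<le> s" using that by auto
      then show "y s = w s" using w Suc.prems by (auto simp: Kn_def)
    qed
    then have k: "y \<ominus>\<^bsub>M\<^esub> w \<in> Kn t" using wc by (simp add: Kn_def)
    have "y \<ominus>\<^bsub>M\<^esub> w \<in> S'" using minus[OF S'] Suc.prems w sub by auto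
    then have "y \<ominus>\<^bsub>M\<^esub> w \<in> S" using Suc.IH[of "y \<ominus>\<^bsub>M\<^esub> w"] Suc.prems k by simp
    then show ?case using M.submoduleE(5)[OF S _ w(1)] minus_plus[OF wc(2,1)] by metis
  qed
  fix x assume x: "x \<in> S'"
  have xc: "x \<in> carrier M" using x SC by auto
  define t where "t = (\<lambda>i. if i < n then z i else x i)"
  have tc: "t \<in> carrier M" using xc z_in by (auto simp: t_def carr)
  have ts: "t \<in> S" using n tc by (auto simp: cyl_def t_def)
  have "(x \<ominus>\<^bsub>M\<^esub> t) i = z i" if "n \<le> i" for i
    using that by (intro loc_minus[OF xc tc]) (auto simp: t_def)
  then have "x \<ominus>\<^bsub>M\<^esub> t \<in> Kn n" using xc tc by (simp add: Kn_def)
  moreover have "x \<ominus>\<^bsub>M\<^esub> t \<in> S'" using minus[OF S'] x ts sub by auto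
  ultimately have "x \<ominus>\<^bsub>M\<^esub> t \<in> S" using step[of n] by simp
  then show "x \<in> S" using M.submoduleE(5)[OF S _ ts] minus_plus[OF xc tc] by metis
qed

text \<open>
  The ranks of the finitely many submodules \<open>D t Q\<close> with \<open>t < n\<close> add up to a rank function on
  the submodules \<open>Q\<close> that contain \<open>S\<close>.
\<close>

lemma open_finite_colength:
  assumes S: "submodule S K M" and n: "cyl n z \<subseteq> S" shows "finite_colength K M S"
proof -
  define P where "P t rk b \<longleftrightarrow> (\<forall>S. submodule S k (N t) \<longrightarrow> rk S \<le> b) \<and>
     (\<forall>S S'. submodule S k (N t) \<longrightarrow> submodule S' k (N t) \<longrightarrow> S \<subset> S' \<longrightarrow> rk S < (rk S' :: nat))" for t rk b
  have "\<exists>rk b. P t rk b" for t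
  proof (rule finite_colength_rank[OF N[of t] fin[of t]])
    fix rk :: "'a set \<Rightarrow> nat" and b
    assume "\<And>S. submodule S k (N t) \<Longrightarrow> rk S \<le> b"
      "\<And>S S'. submodule S k (N t) \<Longrightarrow> submodule S' k (N t) \<Longrightarrow> S \<subset> S' \<Longrightarrow> rk S < rk S'"
    then have "P t rk b" unfolding P_def by blast
    then show ?thesis by blast
  qed
  then obtain rk b where P: "\<And>t. P t (rk t) (b t)" by metis
  have rk: "\<And>t S. submodule S k (N t) \<Longrightarrow> rk t S \<le> b t"
    "\<And>t S S'. submodule S k (N t) \<Longrightarrow> submodule S' k (N t) \<Longrightarrow> S \<subset> S' \<Longrightarrow> rk t S < rk t S'"
    using P unfolding P_def by blast+
  define R where "R Q = (\<Sum>t<n. rk t (D t Q))" for Q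
  have mono: "R Q < R Q'" if Q: "submodule Q K M" "submodule Q' K M" "S \<subseteq> Q" "Q \<subset> Q'" for Q Q'
  proof -
    have le: "D t Q \<subseteq> D t Q'" for t using Q by (auto simp: D_def)
    have "rk t (D t Q) \<le> rk t (D t Q')" for t
      using le[of t] rk(2)[OF D_sub[OF Q(1)] D_sub[OF Q(2)], of t] by (cases "D t Q = D t Q'") (auto simp: psubset_eq)
    moreover have "\<exists>t<n. D t Q \<subset> D t Q'"
    proof (rule ccontr)
      assume "\<not> (\<exists>t<n. D t Q \<subset> D t Q')"
      then have d: "D t Q' \<subseteq> D t Q" if "t < n" for t using le[of t] that by blast
      have "Q' \<subseteq> Q"
      proof (rule D_eq[OF Q(1,2)])
        show "Q \<subseteq> Q'" using Q(4) by blast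
        show "cyl n z \<subseteq> Q" using Q(3) n by blast
      qed (rule d)
      then show False using Q by blast
    qed
    then obtain t where "t < n" "rk t (D t Q) < rk t (D t Q')"
      using rk(2)[OF D_sub[OF Q(1)] D_sub[OF Q(2)]] by blast
    ultimately show ?thesis unfolding R_def by (intro sum_strict_mono_ex1) auto
  qed
  have bound: "R Q \<le> (\<Sum>t<n. b t)" if "submodule Q K M" for Q
    unfolding R_def by (intro sum_mono rk(1) D_sub that)
  show ?thesis unfolding finite_colength_def
  proof (intro exI[of _ "\<Sum>t<n. b t"] allI impI)
    fix C :: "nat \<Rightarrow> (nat \<Rightarrow> 'a) set" and q
    assume C: "(\<forall>i\<le>q. submodule (C i) K M \<and> S \<subseteq> C i) \<and> (\<forall>i<q. C i \<subset> C (Suc i))"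
    have "i \<le> R (C i)" if "i \<le> q" for i
      using that
    proof (induction i)
      case (Suc i)
      then have "R (C i) < R (C (Suc i))" using C by (intro mono) auto
      then show ?case using Suc by simp
    qed simp
    from this[of q] bound[of "C q"] C show "q \<le> (\<Sum>t<n. b t)" by simp
  qed
qed

lemma open_fin_iff: "S \<in> open_fin_submods K M T \<longleftrightarrow> submodule S K M \<and> (\<exists>n. cyl n z \<subseteq> S)"
proof
  assume "S \<in> open_fin_submods K M T"
  then have S: "submodule S K M" "openin T S" by (auto simp: open_fin_submods_def)
  have "z \<in> S" using subgroup.one_closed[OF submodule.axioms(1)[OF S(1)]] zero by simp
  then show "submodule S K M \<and> (\<exists>n. cyl n z \<subseteq> S)" using S open_contains_cyl by blast
next
  assume "submodule S K M \<and> (\<exists>n. cyl n z \<subseteq> S)"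
  then show "S \<in> open_fin_submods K M T" using sub_open open_finite_colength by (auto simp: open_fin_submods_def)
qed

lemma U_open_fin: "U m \<in> open_fin_submods K M T"
  unfolding open_fin_iff using U_sub cyl_U by blast

lemma coset_iff: "y \<in> S +>\<^bsub>M\<^esub> x \<longleftrightarrow> (\<exists>h\<in>S. y = h \<oplus>\<^bsub>M\<^esub> x)"
  by (auto simp: a_r_coset_def r_coset_def)

text \<open>
  For completeness, elements of the given cosets of the \<open>U m\<close> agree in more and more entries and
  so converge to a sequence; since addition is continuous, this limit lies in all the cosets.
\<close>

lemma profinite: "profinite_module K M T"
  unfolding profinite_module_def
proof (intro conjI allI impI)
  show "Module.module K M" by (rule M)
  show "topspace T = carrier M" by (rule topspace_T)
  show "openin T V \<longleftrightarrow> V \<subseteq> carrier M \<and> (\<forall>x\<in>V. \<exists>S\<in>open_fin_submods K M T. S +>\<^bsub>M\<^esub> x \<subseteq> V)" for V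
  proof
    assume V: "openin T V"
    have VC: "V \<subseteq> carrier M" using openin_subset[OF V] topspace_T by simp
    have "\<exists>S\<in>open_fin_submods K M T. S +>\<^bsub>M\<^esub> x \<subseteq> V" if x: "x \<in> V" for x
    proof -
      obtain n where n: "cyl n x \<subseteq> V" using open_contains_cyl[OF V x] by blast
      have "U n +>\<^bsub>M\<^esub> x \<subseteq> cyl n x"
      proof
        fix y assume "y \<in> U n +>\<^bsub>M\<^esub> x"
        then obtain h where h: "h \<in> U n" "y = h \<oplus>\<^bsub>M\<^esub> x" unfolding coset_iff by blast
        then show "y \<in> cyl n x" using U_D1[OF h(1)] x VC by (auto simp: cyl_def U_def)
      qed
      then show ?thesis using n U_open_fin by blast
    qed
    then show "V \<subseteq> carrier M \<and> (\<forall>x\<in>V. \<exists>S\<in>open_fin_submods K M T. S +>\<^bsub>M\<^esub> x \<subseteq> V)" using VC by blast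
  next
    assume V: "V \<subseteq> carrier M \<and> (\<forall>x\<in>V. \<exists>S\<in>open_fin_submods K M T. S +>\<^bsub>M\<^esub> x \<subseteq> V)"
    show "openin T V"
    proof (subst openin_subopen, rule ballI)
      fix x assume x: "x \<in> V"
      then obtain S n where S: "submodule S K M" "cyl n z \<subseteq> S" "S +>\<^bsub>M\<^esub> x \<subseteq> V"
        using V unfolding open_fin_iff Bex_def by blast
      have xc: "x \<in> carrier M" using x V by blast
      have "cyl (n + 2 * c) x \<subseteq> V" using cyl_coset[OF S(1,2) xc] S(3) unfolding coset_iff subset_iff by blast
      then show "\<exists>W. openin T W \<and> x \<in> W \<and> W \<subseteq> V"
        using open_cyl[OF xc] xc by (intro exI[of _ "cyl (n + 2 * c) x"]) (auto simp: cyl_def)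
    qed
  qed
  show "\<Inter> (open_fin_submods K M T) = {\<zero>\<^bsub>M\<^esub>}"
  proof (intro subset_antisym subsetI)
    fix x assume "x \<in> \<Inter> (open_fin_submods K M T)"
    then have "x \<in> cyl (Suc i) z" for i using U_open_fin[of "Suc i"] U_cyl by blast
    then show "x \<in> {\<zero>\<^bsub>M\<^esub>}" by (auto simp: cyl_def zero fun_eq_iff)
  next
    fix x assume "x \<in> {\<zero>\<^bsub>M\<^esub>}"
    then show "x \<in> \<Inter> (open_fin_submods K M T)"
      using subgroup.one_closed[OF submodule.axioms(1)] unfolding open_fin_iff Inter_iff Ball_def by fastforce
  qed
  fix co :: "(nat \<Rightarrow> 'a) set \<Rightarrow> (nat \<Rightarrow> 'a) set"
  assume co: "(\<forall>S\<in>open_fin_submods K M T. co S \<in> a_rcosets\<^bsub>M\<^esub> S) \<and>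
    (\<forall>S\<in>open_fin_submods K M T. \<forall>S'\<in>open_fin_submods K M T. S \<subseteq> S' \<longrightarrow> co S \<subseteq> co S')"
  have coset: "\<exists>y\<in>carrier M. co S = S +>\<^bsub>M\<^esub> y" if "S \<in> open_fin_submods K M T" for S
    using co that by (auto simp: A_RCOSETS_def RCOSETS_def a_r_coset_def)
  have co_mono: "co S \<subseteq> co S'" if "S \<in> open_fin_submods K M T" "S' \<in> open_fin_submods K M T" "S \<subseteq> S'" for S S'
    using co that by blast
  have ex: "\<exists>x. x \<in> co (U m) \<and> x \<in> carrier M" for m
  proof -
    obtain y where y: "y \<in> carrier M" "co (U m) = U m +>\<^bsub>M\<^esub> y" using coset[OF U_open_fin] by blast
    have "\<zero>\<^bsub>M\<^esub> \<in> U m" by (simp add: U_def)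
    then have "\<exists>h\<in>U m. y = h \<oplus>\<^bsub>M\<^esub> y" using y by (intro bexI[of _ "\<zero>\<^bsub>M\<^esub>"]) auto
    then show ?thesis using y unfolding y(2) coset_iff by blast
  qed
  then obtain xs where xs: "\<And>m. xs m \<in> co (U m)" "\<And>m. xs m \<in> carrier M" by metis
  have U_mono: "U m' \<subseteq> U m" if "m \<le> m'" for m m' using that by (auto simp: U_def)
  have agree: "xs m' i = xs m i" if "m \<le> m'" "i < m" for m m' i
  proof -
    obtain y where y: "y \<in> carrier M" "co (U m) = U m +>\<^bsub>M\<^esub> y" using coset[OF U_open_fin] by blast
    have A: "w i = y i" if w: "w \<in> co (U m)" for w
    proof -
      obtain h where h: "h \<in> U m" "w = h \<oplus>\<^bsub>M\<^esub> y" using w unfolding y(2) coset_iff by blast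
      show ?thesis using U_D1[OF h(1) y(1) \<open>i < m\<close>] h(2) by simp
    qed
    have B: "xs m' \<in> co (U m)" using xs(1)[of m'] co_mono[OF U_open_fin U_open_fin U_mono[OF that(1)]] by blast
    show ?thesis using A[OF B] A[OF xs(1)[of m]] by simp
  qed
  \<comment> \<open>the diagonal sequence: entry \<open>i\<close> is constant from the coset of \<open>U (i + 1)\<close> on\<close>
  define x where "x i = xs (Suc i) i" for i
  have xc: "x \<in> carrier M" using xs(2) by (auto simp: x_def carr)
  have xe: "x i = xs m i" if "i < m" for i m using agree[of "Suc i" m i] that by (simp add: x_def)
  show "\<exists>x\<in>carrier M. \<forall>S\<in>open_fin_submods K M T. x \<in> co S"
  proof (intro bexI[of _ x] ballI xc)
    fix S assume S: "S \<in> open_fin_submods K M T"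
    then obtain n where n: "submodule S K M" "cyl n z \<subseteq> S" unfolding open_fin_iff by blast
    let ?m = "n + 2 * c"
    have "cyl ?m z \<subseteq> cyl n z" by (auto simp: cyl_def)
    then have "U ?m \<subseteq> S" using U_cyl[of ?m] n(2) by blast
    then have "xs ?m \<in> co S" using xs(1) co_mono[OF U_open_fin S] by blast
    moreover obtain y where y: "y \<in> carrier M" "co S = S +>\<^bsub>M\<^esub> y" using coset[OF S] by blast
    ultimately obtain h where h: "h \<in> S" "xs ?m = h \<oplus>\<^bsub>M\<^esub> y" unfolding y(2) coset_iff by blast
    have "x \<in> cyl ?m (xs ?m)" using xc xe by (simp add: cyl_def)
    then obtain h' where h': "h' \<in> S" "x = h' \<oplus>\<^bsub>M\<^esub> xs ?m" using cyl_coset[OF n xs(2)] by blast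
    have SC: "S \<subseteq> carrier M" by (rule M.submoduleE(1)[OF n(1)])
    have "x = (h' \<oplus>\<^bsub>M\<^esub> h) \<oplus>\<^bsub>M\<^esub> y" using h h' y SC by (simp add: M.a_assoc subset_iff)
    then show "x \<in> co S" unfolding y(2) coset_iff using M.submoduleE(5)[OF n(1) h'(1) h(1)] by blast
  qed
qed

end

section \<open>The first nonzero entry of a Witt vector\<close>

lemma ghost_zero_index: "ghost p 0 f = f 0"
  by (simp add: ghost_def)

context walg begin

lemma wadd_0: "\<forall>i. a i \<in> carrier R \<Longrightarrow> \<forall>i. b i \<in> carrier R \<Longrightarrow> wadd p R a b 0 = a 0 \<oplus> b 0"
  using witt_sum_ghost[OF p, of 0] unfolding ghost_zero_index wadd_eq_pev
  by (simp add: R.pev_add ilv_carrier) (simp add: ilv_def)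

lemma wmul_0: "\<forall>i. a i \<in> carrier R \<Longrightarrow> \<forall>i. b i \<in> carrier R \<Longrightarrow> wmul p R a b 0 = a 0 \<otimes> b 0"
  using witt_prod_ghost[OF p, of 0] unfolding ghost_zero_index wmul_eq_pev
  by (simp add: R.pev_mult ilv_carrier) (simp add: ilv_def)

lemma vshift_eta: "a 0 = z \<Longrightarrow> vshift z (\<lambda>i. a (Suc i)) = a"
  by (auto simp: vshift_def fun_eq_iff split: nat.splits)

text \<open>
  Splitting off \<open>V\<close> repeatedly reduces this to the entries of index zero, which are added and
  multiplied as in \<open>R\<close>.
\<close>

lemma wadd_top:
  assumes "\<forall>i. a i \<in> carrier R" "\<forall>i. b i \<in> carrier R" "\<And>s. s < m \<Longrightarrow> a s = \<zero> \<and> b s = \<zero>"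
  shows "wadd p R a b m = a m \<oplus> b m"
  using assms
proof (induction m arbitrary: a b)
  case 0
  then show ?case by (simp add: wadd_0)
next
  case (Suc m)
  have e: "a = vshift \<zero> (\<lambda>i. a (Suc i))" "b = vshift \<zero> (\<lambda>i. b (Suc i))"
    by (rule vshift_eta[symmetric], use Suc.prems(3)[of 0] in simp)+
  have c: "\<forall>i. (\<lambda>i. a (Suc i)) i \<in> carrier R" "\<forall>i. (\<lambda>i. b (Suc i)) i \<in> carrier R" using Suc.prems by auto
  have "wadd p R a b (Suc m) = wadd p R (\<lambda>i. a (Suc i)) (\<lambda>i. b (Suc i)) m"
    using wadd_vshift[OF p R c] e by (metis vshift_simps(2))
  then show ?case using Suc.IH[OF c] Suc.prems(3) by simp
qed

lemma wmul_top:
  assumes l: "l \<in> carrier (witt_ring p k)" and "\<forall>i. b i \<in> carrier R" "\<And>s. s < m \<Longrightarrow> b s = \<zero>"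
  shows "wmul p R (thw (i + m) l) b m = \<iota> ((wfrob_inv p k ^^ i) l 0) \<otimes> b m"
  using assms(2,3)
proof (induction m arbitrary: b)
  case 0
  then show ?case using thw_closed[OF l] by (simp add: wmul_0) (simp add: thw_def)
next
  case (Suc m)
  have e: "b = vshift \<zero> (\<lambda>i. b (Suc i))"
    by (rule vshift_eta[symmetric], use Suc.prems(2)[of 0] in simp)
  have c: "\<forall>i. (\<lambda>i. b (Suc i)) i \<in> carrier R" using Suc.prems by auto
  have t: "\<forall>s. thw (Suc (i + m)) l s \<in> carrier R" using thw_closed[OF l] by auto
  have "wmul p R (thw (i + Suc m) l) b (Suc m) = wmul p R (thw (i + m) l) (\<lambda>i. b (Suc i)) m"
    using wmul_vshift[OF p R Rchar t c] e thw_Suc[OF l] by (metis add_Suc_right vshift_simps(2))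
  then show ?case using Suc.IH[OF c] Suc.prems(2) by simp
qed

lemma wadd_cong_upto:
  assumes c: "\<forall>i. a i \<in> carrier R" "\<forall>i. b i \<in> carrier R" "\<forall>i. a' i \<in> carrier R" "\<forall>i. b' i \<in> carrier R"
    and "\<And>s. s \<le> n \<Longrightarrow> a s = a' s \<and> b s = b' s"
  shows "wadd p R a b n = wadd p R a' b' n"
  unfolding wadd_eq_pev
proof (rule R.pev_cong_upto[OF p2 homog_sum'])
  show "\<forall>v. ilv a b v \<in> carrier R" "\<forall>v. ilv a' b' v \<in> carrier R" using c by (auto simp: ilv_def)
qed (use assms(5) in \<open>auto simp: ilv_def\<close>)

lemma wmul_cong_upto:
  assumes c: "\<forall>i. l i \<in> carrier R" "\<forall>i. b i \<in> carrier R" "\<forall>i. b' i \<in> carrier R"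
    and "\<And>s. s \<le> n \<Longrightarrow> b s = b' s"
  shows "wmul p R l b n = wmul p R l b' n"
  unfolding wmul_eq_pev
proof (rule R.pev_cong_upto[OF p2 homog_prod'])
  show "\<forall>v. ilv l b v \<in> carrier R" "\<forall>v. ilv l b' v \<in> carrier R" using c by (auto simp: ilv_def)
qed (use assms(4) in \<open>auto simp: ilv_def\<close>)

text \<open>
  Frobenius is bijective on \<open>W(k)\<close>, so the first entry of \<open>frob\<^sup>-\<^sup>i l\<close> takes all
  values in \<open>k\<close>.
\<close>

lemma wfin_surj:
  assumes "r \<in> carrier k" shows "\<exists>l\<in>carrier (witt_ring p k). (wfrob_inv p k ^^ i) l 0 = r"
proof -
  have s: "\<exists>l\<in>carrier (witt_ring p k). (wfrob_inv p k ^^ i) l = l'" if "l' \<in> carrier (witt_ring p k)" for l'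
    using that
  proof (induction i arbitrary: l')
    case (Suc i)
    obtain l where l: "l \<in> carrier (witt_ring p k)" "(wfrob_inv p k ^^ i) l = wfrob p k l'"
      using Suc.IH[OF wfrob_closed[OF Suc.prems]] by blast
    then have "(wfrob_inv p k ^^ Suc i) l = l'" using wfi_left[OF Suc.prems] by simp
    then show ?case using l by blast
  qed auto
  have "(\<lambda>s. r) \<in> carrier (witt_ring p k)" using assms by (simp add: witt_ring_simps[OF p])
  then obtain l where l: "l \<in> carrier (witt_ring p k)" "(wfrob_inv p k ^^ i) l = (\<lambda>s. r)" using s by blast
  have "(wfrob_inv p k ^^ i) l 0 = r" by (simp only: l(2))
  then show ?thesis using l(1) by blast
qed

lemma nilp_pow: assumes "nilp R I L" "x \<in> I" "L \<le> n" shows "x [^] (n::nat) = \<zero>"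
proof -
  have "lprod R (replicate n x) = \<zero>" by (rule R.nilp_long[OF assms(1)]) (use assms in auto)
  moreover have "lprod R (replicate n x) = x [^] n" for n
    using R.ideal_sub[OF nilp_ideal[OF assms(1)] assms(2)]
    by (induction n) (auto simp: R.m_comm)
  ultimately show ?thesis by simp
qed

end

section \<open>Finite covectors\<close>

definition CWuC :: "nat \<Rightarrow> ('k, 'a) polar \<Rightarrow> nat \<Rightarrow> (nat \<Rightarrow> 'a) set"
  where "CWuC p A j = {a. (\<forall>i. a i \<in> slotcar p A j i) \<and> finite {i. a i \<noteq> slotzero p A j i}}"

text \<open>
  The iterated \<open>p\<close>-th power, which is the only kind of power that a polar algebra has.
\<close>

primrec ppow :: "nat \<Rightarrow> ('k, 'a) polar \<Rightarrow> nat \<Rightarrow> nat \<Rightarrow> 'a \<Rightarrow> 'a" where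
  "ppow p A d 0 x = x"
| "ppow p A d (Suc n) x = pmu A (d * p ^ n) (replicate p (ppow p A d n x))"

text \<open>
  The entries of connected covectors. Nilpotence is expressed by the powers with exponent
  \<open>p ^ n\<close>, so that it does not refer to an ambient algebra.
\<close>

definition nilslot :: "nat \<Rightarrow> ('k, 'a) polar \<Rightarrow> nat \<Rightarrow> nat \<Rightarrow> 'a set"
  where "nilslot p A j i = {x \<in> slotcar p A j i. p ^ i dvd j \<longrightarrow>
     (\<exists>n. ppow p A (j div p ^ i) n x = \<zero>\<^bsub>pcomp A (j div p ^ i * p ^ n)\<^esub>)}"

definition CWcC :: "nat \<Rightarrow> ('k, 'a) polar \<Rightarrow> nat \<Rightarrow> (nat \<Rightarrow> 'a) set"
  where "CWcC p A j = {a. \<forall>i. a i \<in> nilslot p A j i}"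

lemma finite_support_iff: "finite {i::nat. a i \<noteq> z i} \<longleftrightarrow> (\<exists>r. \<forall>i\<ge>r. a i = z i)"
proof
  assume "finite {i. a i \<noteq> z i}"
  then obtain r where "\<forall>i\<in>{i. a i \<noteq> z i}. i < r" using finite_nat_set_iff_bounded by blast
  then have "\<forall>i\<ge>r. a i = z i" using leD by blast
  then show "\<exists>r. \<forall>i\<ge>r. a i = z i" by blast
next
  assume "\<exists>r. \<forall>i\<ge>r. a i = z i"
  then obtain r where "\<forall>i\<ge>r. a i = z i" by blast
  then have "{i. a i \<noteq> z i} \<subseteq> {..<r}" by (auto simp: not_less[symmetric])
  then show "finite {i. a i \<noteq> z i}" by (rule finite_subset) simp
qed

context polemb begin

lemma slot_zero_iff: "x \<in> slotcar p A j i \<Longrightarrow> slotmap p B f j i x = \<zero>\<^bsub>B\<^esub> \<longleftrightarrow> x = slotzero p A j i"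
  using slotmap_inj[OF _ slotzero_in] slotmap_slotzero by metis

lemma tailed_zero_iff:
  assumes "\<And>i. a i \<in> slotcar p A j i"
  shows "W.tailed {\<zero>\<^bsub>B\<^esub>} 1 r (clift p B f j a) \<longleftrightarrow> (\<forall>i\<ge>r. a i = slotzero p A j i)"
  using W.R.nilp_zero clift_carrier[OF assms] slot_zero_iff[OF assms]
  by (auto simp: W.tailed_def clift_def)

lemma CWuC_iff: "a \<in> CWuC p A j \<longleftrightarrow> (\<forall>i. a i \<in> slotcar p A j i) \<and> (\<exists>r. W.tailed {\<zero>\<^bsub>B\<^esub>} 1 r (clift p B f j a))"
  unfolding CWuC_def mem_Collect_eq finite_support_iff using tailed_zero_iff[of a j] by blast

lemma tailed_mono: "W.tailed I L r a \<Longrightarrow> r \<le> s \<Longrightarrow> W.tailed I L s a"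
  by (auto simp: W.tailed_def)

lemma stable_CWuC: "stable_family (CWuC p A)"
  unfolding stable_family_def
proof (intro conjI allI ballI impI)
  show "covset (CWuC p A)" unfolding covset_def using CWuC_iff by blast
  show "slotzero p A j \<in> CWuC p A j" for j by (simp add: CWuC_def slotzero_in)
next
  fix j a b c
  assume a: "a \<in> CWuC p A j" and b: "b \<in> CWuC p A j" and c: "\<forall>i. c i \<in> slotcar p A j i"
    and e: "clift p B f j c = W.cwadd (clift p B f j a) (clift p B f j b)"
  obtain r r' where t: "W.tailed {\<zero>\<^bsub>B\<^esub>} 1 r (clift p B f j a)" "W.tailed {\<zero>\<^bsub>B\<^esub>} 1 r' (clift p B f j b)"
    using a b unfolding CWuC_iff by blast
  have "W.tailed {\<zero>\<^bsub>B\<^esub>} 1 (max r r') (clift p B f j c)"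
    unfolding e by (rule W.tailed_cwadd[OF tailed_mono[OF t(1)] tailed_mono[OF t(2)]]) auto
  then show "c \<in> CWuC p A j" using c unfolding CWuC_iff by blast
next
  fix j l b c
  assume l: "l \<in> carrier (witt_ring p k)" and b: "b \<in> CWuC p A j" and c: "\<forall>i. c i \<in> slotcar p A j i"
    and e: "clift p B f j c = W.cwmul l (clift p B f j b)"
  obtain r where t: "W.tailed {\<zero>\<^bsub>B\<^esub>} 1 r (clift p B f j b)"
    using b unfolding CWuC_iff by blast
  have "W.tailed {\<zero>\<^bsub>B\<^esub>} 1 r (clift p B f j c)" unfolding e by (rule W.tailed_cwmul[OF l t])
  then show "c \<in> CWuC p A j" using c unfolding CWuC_iff by blast
next
  fix j a assume a: "a \<in> CWuC p A j"
  then have s: "a i \<in> slotcar p A j i" for i by (simp add: CWuC_def)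
  have "cpF p A j a i = slotzero p A (p * j) i" if "a i = slotzero p A j i" for i
    using slot_F[OF s, of i] that slot_zero_iff[OF slot_F(1)[OF s]] W.ppos by (simp add: slotmap_slotzero B.nat_pow_zero)
  then have "{i. cpF p A j a i \<noteq> slotzero p A (p * j) i} \<subseteq> {i. a i \<noteq> slotzero p A j i}" by blast
  then show "cpF p A j a \<in> CWuC p A (p * j)"
    using a slot_F(1)[OF s] finite_subset by (auto simp: CWuC_def)
next
  fix j a assume a: "a \<in> CWuC p A (p * j)"
  then have s: "a i \<in> slotcar p A (p * j) i" for i by (simp add: CWuC_def)
  obtain r where "\<forall>i\<ge>r. a i = slotzero p A (p * j) i" using a unfolding CWuC_def mem_Collect_eq finite_support_iff by blast
  then have "\<forall>i\<ge>r. a (Suc i) = slotzero p A j i" using slot_V(3) by simp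
  then show "(\<lambda>i. a (Suc i)) \<in> CWuC p A j"
    unfolding CWuC_def mem_Collect_eq finite_support_iff using s[of "Suc _"] slot_V(1) by auto
qed

lemma power_gt_self: "n < p ^ n"
  using W.p2 by (metis less_exp order_less_le_trans power_mono zero_le)

text \<open>
  In positive degrees \<open>V\<^sup>n\<close> is undefined for large \<open>n\<close>, so only degree \<open>0\<close> matters. There
  each \<open>V\<close> removes one entry of a finite covector.
\<close>

lemma unipotent_CWpol: "unipotent p (CWpol p k (CWuC p A) A B f)"
  unfolding unipotent_def
proof (intro allI ballI)
  fix d x assume x: "x \<in> carrier (dcomp (CWpol p k (CWuC p A) A B f) d)"
  let ?M = "CWpol p k (CWuC p A) A B f"
  show "\<exists>n0. \<forall>n\<ge>n0. \<forall>j. d = p ^ n * j \<longrightarrow> Vpow p ?M n j x = \<zero>\<^bsub>dcomp ?M j\<^esub>"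
  proof (cases "d = 0")
    case False
    have "d \<noteq> p ^ n * j" if "d \<le> n" for n j
    proof
      assume e: "d = p ^ n * j"
      then have "p ^ n \<le> d" using False by (cases j) auto
      then show False using that power_gt_self[of n] by simp
    qed
    then show ?thesis by blast
  next
    case True
    have xC: "x \<in> CWuC p A 0" using x True by (simp add: CWpol_def)
    obtain r where r: "\<forall>i\<ge>r. x i = slotzero p A 0 i" using xC unfolding CWuC_def mem_Collect_eq finite_support_iff by blast
    have V: "Vpow p ?M n 0 x = (\<lambda>i. x (i + n)) \<and> (\<lambda>i. x (i + n)) \<in> CWuC p A 0" for n
    proof (induction n)
      case (Suc n)
      then have "(\<lambda>i. x (Suc i + n)) \<in> CWuC p A 0" using stable_FV(2)[OF stable_CWuC, of "\<lambda>i. x (i + n)" 0] by simp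
      then show ?case using Suc by (simp add: CWpol_def)
    qed (use xC in simp)
    have "Vpow p ?M n 0 x = \<zero>\<^bsub>dcomp ?M 0\<^esub>" if "r \<le> n" for n
    proof -
      have "x (i + n) = slotzero p A 0 i" for i using r that by (simp add: slotzero_def)
      then show ?thesis using V[of n] by (simp add: CWpol_def)
    qed
    then show ?thesis using True W.ppos by (intro exI[of _ r]) auto
  qed
qed

text \<open>
  As for covectors, only degree \<open>0\<close> matters; there each \<open>V\<close> shifts a zero into a Witt vector of
  length \<open>N + 1\<close>.
\<close>

lemma unipotent_Wpol: "unipotent p (Wpol p k (enat N) A B f)"
  unfolding unipotent_def
proof (intro allI ballI)
  fix d x assume x: "x \<in> carrier (dcomp (Wpol p k (enat N) A B f) d)"
  let ?M = "Wpol p k (enat N) A B f"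
  show "\<exists>n0. \<forall>n\<ge>n0. \<forall>j. d = p ^ n * j \<longrightarrow> Vpow p ?M n j x = \<zero>\<^bsub>dcomp ?M j\<^esub>"
  proof (cases "d = 0")
    case False
    have "d \<noteq> p ^ n * j" if "d \<le> n" for n j
    proof
      assume e: "d = p ^ n * j"
      then have "p ^ n \<le> d" using False by (cases j) auto
      then show False using that power_gt_self[of n] by simp
    qed
    then show ?thesis by blast
  next
    case True
    have xC: "x \<in> WpolC p (enat N) A 0" using x True by (simp add: Wpol_def)
    have dV_0: "dV ?M 0 y = (\<lambda>i\<in>{i. enat i \<le> enat N}. (case i of 0 \<Rightarrow> \<zero>\<^bsub>pcomp A 0\<^esub> | Suc m \<Rightarrow> y m))"
      if "y \<in> WpolC p (enat N) A 0" for y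
      using that by (simp add: Wpol_def)
    have V: "Vpow p ?M n 0 x \<in> WpolC p (enat N) A 0 \<and> (\<forall>i<n. i \<le> N \<longrightarrow> Vpow p ?M n 0 x i = \<zero>\<^bsub>pcomp A 0\<^esub>)" for n
    proof (induction n)
      case (Suc n)
      let ?y = "Vpow p ?M n 0 x"
      have y: "?y \<in> WpolC p (enat N) A 0" "\<And>i. i < n \<Longrightarrow> i \<le> N \<Longrightarrow> ?y i = \<zero>\<^bsub>pcomp A 0\<^esub>" using Suc by auto
      then have yi: "\<And>i. i \<le> N \<Longrightarrow> ?y i \<in> pAcar p A 0" by (auto simp: WpolC_def)
      have e: "Vpow p ?M (Suc n) 0 x = (\<lambda>i\<in>{i. enat i \<le> enat N}. (case i of 0 \<Rightarrow> \<zero>\<^bsub>pcomp A 0\<^esub> | Suc m \<Rightarrow> ?y m))"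
        unfolding Vpow.simps(2) mult_0_right by (rule dV_0[OF y(1)])
      show ?case unfolding e WpolC_def PiE_iff using y(2) yi by (auto split: nat.splits)
    qed (use xC in simp)
    have "Vpow p ?M n 0 x = \<zero>\<^bsub>dcomp ?M 0\<^esub>" if "Suc N \<le> n" for n
    proof -
      have "Vpow p ?M n 0 x = (\<lambda>i\<in>{i. enat i \<le> enat N}. \<zero>\<^bsub>pcomp A (0 * p ^ i)\<^esub>)"
      proof
        fix i
        show "Vpow p ?M n 0 x i = (\<lambda>i\<in>{i. enat i \<le> enat N}. \<zero>\<^bsub>pcomp A (0 * p ^ i)\<^esub>) i"
          using V[of n] that by (auto simp: WpolC_def PiE_iff extensional_def)
      qed
      then show ?thesis by (simp add: Wpol_def)
    qed
    then show ?thesis using True W.ppos by (intro exI[of _ "Suc N"]) auto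
  qed
qed

section \<open>Nilpotent entries\<close>

lemma ppow_props: "x \<in> pAcar p A d \<Longrightarrow> ppow p A d n x \<in> pAcar p A (d * p ^ n) \<and> f (d * p ^ n) (ppow p A d n x) = f d x [^]\<^bsub>B\<^esub> (p ^ n)"
proof (induction n)
  case 0
  then show ?case using gr_carrier[OF f_gr[OF pAcar_sub]] by simp
next
  case (Suc n)
  then have h: "ppow p A d n x \<in> pAcar p A (d * p ^ n)" "f (d * p ^ n) (ppow p A d n x) = f d x [^]\<^bsub>B\<^esub> (p ^ n)" by auto
  have e: "d * p ^ Suc n = d * p ^ n * p" by simp
  have "f d x \<in> carrier B" using gr_carrier[OF f_gr[OF pAcar_sub[OF Suc.prems]]] .
  then show ?case using pmu_pow[OF h(1)] h(2) unfolding e ppow.simps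
    by (simp add: B.nat_pow_pow mult.commute)
qed

lemma nil_iff:
  assumes x: "x \<in> pAcar p A d"
  shows "(\<exists>n. ppow p A d n x = \<zero>\<^bsub>pcomp A (d * p ^ n)\<^esub>) \<longleftrightarrow> (\<exists>m::nat. f d x [^]\<^bsub>B\<^esub> m = \<zero>\<^bsub>B\<^esub>)"
proof
  assume "\<exists>n. ppow p A d n x = \<zero>\<^bsub>pcomp A (d * p ^ n)\<^esub>"
  then obtain n where "ppow p A d n x = \<zero>\<^bsub>pcomp A (d * p ^ n)\<^esub>" by blast
  then have "f d x [^]\<^bsub>B\<^esub> (p ^ n) = \<zero>\<^bsub>B\<^esub>" using ppow_props[OF x, of n] f_zero by simp
  then show "\<exists>m::nat. f d x [^]\<^bsub>B\<^esub> m = \<zero>\<^bsub>B\<^esub>" by blast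
next
  assume "\<exists>m::nat. f d x [^]\<^bsub>B\<^esub> m = \<zero>\<^bsub>B\<^esub>"
  then obtain m :: nat where m: "f d x [^]\<^bsub>B\<^esub> m = \<zero>\<^bsub>B\<^esub>" by blast
  have c: "f d x \<in> carrier B" using gr_carrier[OF f_gr[OF pAcar_sub[OF x]]] .
  have "f d x [^]\<^bsub>B\<^esub> (p ^ m) = f d x [^]\<^bsub>B\<^esub> m \<otimes>\<^bsub>B\<^esub> f d x [^]\<^bsub>B\<^esub> (p ^ m - m)"
    using power_gt_self[of m] c by (simp add: B.nat_pow_mult)
  then have "f d x [^]\<^bsub>B\<^esub> (p ^ m) = \<zero>\<^bsub>B\<^esub>" using m c by simp
  then have "f (d * p ^ m) (ppow p A d m x) = f (d * p ^ m) \<zero>\<^bsub>pcomp A (d * p ^ m)\<^esub>"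
    using ppow_props[OF x, of m] f_zero by simp
  then have "ppow p A d m x = \<zero>\<^bsub>pcomp A (d * p ^ m)\<^esub>"
    using f_inj[OF pAcar_sub A_simps(1)] ppow_props[OF x, of m] by blast
  then show "\<exists>n. ppow p A d n x = \<zero>\<^bsub>pcomp A (d * p ^ n)\<^esub>" by blast
qed

lemma nilslot_iff:
  "x \<in> nilslot p A j i \<longleftrightarrow> x \<in> slotcar p A j i \<and> (\<exists>m::nat. slotmap p B f j i x [^]\<^bsub>B\<^esub> m = \<zero>\<^bsub>B\<^esub>)"
proof (cases "p ^ i dvd j")
  case True
  then show ?thesis using nil_iff[of x "j div p ^ i"] by (auto simp: nilslot_def slotcar_def slotmap_def)
next
  case False
  moreover have "\<exists>m::nat. \<zero>\<^bsub>B\<^esub> [^]\<^bsub>B\<^esub> m = \<zero>\<^bsub>B\<^esub>" by (rule exI[of _ 1]) simp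
  ultimately show ?thesis by (simp add: nilslot_def slotcar_def slotmap_def)
qed

lemma nilslot_V: "nilslot p A (p * j) (Suc i) = nilslot p A j i"
  by (auto simp: nilslot_iff slot_V)

lemma nilslot_F:
  assumes "\<And>i. a i \<in> nilslot p A j i" shows "cpF p A j a i \<in> nilslot p A (p * j) i"
proof -
  have s: "a i \<in> slotcar p A j i" for i using assms nilslot_iff by blast
  obtain m :: nat where m: "slotmap p B f j i (a i) [^]\<^bsub>B\<^esub> m = \<zero>\<^bsub>B\<^esub>" using assms[of i] nilslot_iff by blast
  have c: "slotmap p B f j i (a i) \<in> carrier B" using R_sub[OF slotmap_R[OF s]] .
  have "(slotmap p B f j i (a i) [^]\<^bsub>B\<^esub> p) [^]\<^bsub>B\<^esub> m = (slotmap p B f j i (a i) [^]\<^bsub>B\<^esub> m) [^]\<^bsub>B\<^esub> p"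
    using c by (simp add: B.nat_pow_pow mult.commute)
  then have "(slotmap p B f j i (a i) [^]\<^bsub>B\<^esub> p) [^]\<^bsub>B\<^esub> m = \<zero>\<^bsub>B\<^esub>" using m W.ppos by (simp add: B.nat_pow_zero)
  then show ?thesis unfolding nilslot_iff slot_F(2)[of a j, OF s] using slot_F(1)[of a j, OF s] by blast
qed

end

locale polemb_fin = polemb p k B A f for p :: nat and k :: "('k, 'r) ring_scheme" and B :: "('k, 'b) galg"
    and A :: "('k, 'a) polar" and f +
  assumes fin: "gr_finite_length k (pcomp A)"
begin

lemma pos_degree_nil:
  assumes x: "x \<in> pAcar p A d" and d: "d > 0"
  shows "\<exists>m::nat. f d x [^]\<^bsub>B\<^esub> m = \<zero>\<^bsub>B\<^esub>"
proof -
  have "finite {j. {\<zero>\<^bsub>pcomp A j\<^esub>} \<noteq> carrier (pcomp A j)}"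
    using fin by (simp add: gr_finite_length_def gr_finite_colength_def)
  then obtain b where "\<forall>j\<in>{j. {\<zero>\<^bsub>pcomp A j\<^esub>} \<noteq> carrier (pcomp A j)}. j < b"
    unfolding finite_nat_set_iff_bounded by (rule exE)
  then have b: "{\<zero>\<^bsub>pcomp A j\<^esub>} \<noteq> carrier (pcomp A j) \<Longrightarrow> j < b" for j by simp
  have "b \<le> d * p ^ b" using power_gt_self[of b] d by (cases d) auto
  then have "carrier (pcomp A (d * p ^ b)) = {\<zero>\<^bsub>pcomp A (d * p ^ b)\<^esub>}" using b[of "d * p ^ b"] by force
  then have "ppow p A d b x = \<zero>\<^bsub>pcomp A (d * p ^ b)\<^esub>" using ppow_props[OF x, of b] pAcar_sub by blast
  then show ?thesis using nil_iff[OF x] by blast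
qed

text \<open>
  Finitely many degrees are nonzero, so all elements of positive degree are nilpotent.
\<close>

lemma nilslot_pos: "j > 0 \<Longrightarrow> nilslot p A j i = slotcar p A j i"
proof -
  assume j: "j > 0"
  have "x \<in> nilslot p A j i" if x: "x \<in> slotcar p A j i" for x
  proof (cases "p ^ i dvd j")
    case True
    then have "j div p ^ i > 0" using j by (auto elim!: dvdE)
    then show ?thesis using pos_degree_nil[of x "j div p ^ i"] x True by (simp add: nilslot_iff slotcar_def slotmap_def)
  next
    case False
    then show ?thesis using x by (simp add: nilslot_def)
  qed
  then show ?thesis by (auto simp: nilslot_def)
qed

text \<open>
  Each nilpotent element generates a nilpotent ideal of \<open>R\<close>, and so do finitely many of them.
  Finite length of the component of degree \<open>0\<close> bounds the number of elements that have to be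
  added. The chain condition is one on \<open>A\<close>, while \<open>R\<close> may be arbitrarily large; this is why the
  argument enlarges subspaces of \<open>A\<close> rather than ideals of \<open>R\<close>.
\<close>

lemma nil_ideal: "\<exists>I L. nilp R I L \<and> (\<forall>x\<in>carrier (pcomp A 0). (\<exists>m::nat. f 0 x [^]\<^bsub>B\<^esub> m = \<zero>\<^bsub>B\<^esub>) \<longrightarrow> f 0 x \<in> I)"
proof (rule ccontr)
  assume no: "\<not> ?thesis"
  interpret M: Module.module k "pcomp A 0" by (rule Amod)
  have car: "f 0 x \<in> carrier R" if "x \<in> carrier (pcomp A 0)" for x
    using f_R[of x 0] that by (simp add: pAcar_def ev_degree_def)
  define G where "G D \<longleftrightarrow> submodule D k (pcomp A 0) \<and> {\<zero>\<^bsub>pcomp A 0\<^esub>} \<subseteq> D \<and> (\<exists>I L. nilp R I L \<and> f 0 ` D \<subseteq> I)" for D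
  have G0: "G {\<zero>\<^bsub>pcomp A 0\<^esub>}"
    unfolding G_def using W.R.nilp_zero f_zero by (auto intro!: M.submoduleI exI[of _ "{\<zero>\<^bsub>B\<^esub>}"])
  have step: "\<exists>D'. G D' \<and> D \<subset> D'" if D: "G D" for D
  proof -
    obtain I L where sub: "submodule D k (pcomp A 0)" and I: "nilp R I L" "f 0 ` D \<subseteq> I" using D unfolding G_def by blast
    have DC: "D \<subseteq> carrier (pcomp A 0)" by (rule M.submoduleE(1)[OF sub])
    obtain x and m :: nat where x: "x \<in> carrier (pcomp A 0)" "f 0 x [^]\<^bsub>B\<^esub> m = \<zero>\<^bsub>B\<^esub>" "f 0 x \<notin> I" using no I(1) by blast
    have xD: "x \<notin> D" using x(3) I(2) by blast
    define D' where "D' = {d \<oplus>\<^bsub>pcomp A 0\<^esub> r \<odot>\<^bsub>pcomp A 0\<^esub> x | d r. d \<in> D \<and> r \<in> carrier k}"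
    have z: "\<zero>\<^bsub>pcomp A 0\<^esub> \<in> D" using D by (auto simp: G_def)
    have inD': "d \<oplus>\<^bsub>pcomp A 0\<^esub> r \<odot>\<^bsub>pcomp A 0\<^esub> x \<in> D'" if "d \<in> D" "r \<in> carrier k" for d r
      using that by (auto simp: D'_def)
    have DD': "D \<subseteq> D'"
    proof
      fix d assume d: "d \<in> D"
      then show "d \<in> D'" using inD'[OF d, of "\<zero>\<^bsub>k\<^esub>"] x DC by auto
    qed
    have xD': "x \<in> D'" using inD'[OF z, of "\<one>\<^bsub>k\<^esub>"] x by simp
    have sub': "submodule D' k (pcomp A 0)"
    proof (rule M.submoduleI)
      show D'C: "D' \<subseteq> carrier (pcomp A 0)" using DC x by (auto simp: D'_def)
      show "\<zero>\<^bsub>pcomp A 0\<^esub> \<in> D'" using DD' z by blast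
      fix u v assume u: "u \<in> D'"
      obtain d r where d: "d \<in> D" "r \<in> carrier k" "u = d \<oplus>\<^bsub>pcomp A 0\<^esub> r \<odot>\<^bsub>pcomp A 0\<^esub> x" using u by (auto simp: D'_def)
      have dc: "d \<in> carrier (pcomp A 0)" using d DC by auto
      show sm: "s \<odot>\<^bsub>pcomp A 0\<^esub> u \<in> D'" if s: "s \<in> carrier k" for s
      proof -
        have "s \<odot>\<^bsub>pcomp A 0\<^esub> u = s \<odot>\<^bsub>pcomp A 0\<^esub> d \<oplus>\<^bsub>pcomp A 0\<^esub> (s \<otimes>\<^bsub>k\<^esub> r) \<odot>\<^bsub>pcomp A 0\<^esub> x"
          using d dc s x by (simp add: M.smult_r_distr M.smult_assoc1)
        then show ?thesis using inD'[OF M.submoduleE(4)[OF sub s d(1)], of "s \<otimes>\<^bsub>k\<^esub> r"] s d by simp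
      qed
      have "(\<ominus>\<^bsub>k\<^esub> \<one>\<^bsub>k\<^esub>) \<odot>\<^bsub>pcomp A 0\<^esub> u = \<ominus>\<^bsub>pcomp A 0\<^esub> u" using D'C u by (auto simp: M.smult_l_minus)
      then show "\<ominus>\<^bsub>pcomp A 0\<^esub> u \<in> D'" using sm[of "\<ominus>\<^bsub>k\<^esub> \<one>\<^bsub>k\<^esub>"] by simp
      assume v: "v \<in> D'"
      obtain e s where e: "e \<in> D" "s \<in> carrier k" "v = e \<oplus>\<^bsub>pcomp A 0\<^esub> s \<odot>\<^bsub>pcomp A 0\<^esub> x" using v by (auto simp: D'_def)
      have ec: "e \<in> carrier (pcomp A 0)" using e DC by auto
      have "u \<oplus>\<^bsub>pcomp A 0\<^esub> v = (d \<oplus>\<^bsub>pcomp A 0\<^esub> e) \<oplus>\<^bsub>pcomp A 0\<^esub> (r \<oplus>\<^bsub>k\<^esub> s) \<odot>\<^bsub>pcomp A 0\<^esub> x"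
        using d e dc ec x by (simp add: M.smult_l_distr M.a_ac)
      then show "u \<oplus>\<^bsub>pcomp A 0\<^esub> v \<in> D'" using inD'[OF M.submoduleE(5)[OF sub d(1) e(1)], of "r \<oplus>\<^bsub>k\<^esub> s"] d e by simp
    qed
    let ?J = "PIdl\<^bsub>R\<^esub> (f 0 x)"
    have xc: "f 0 x \<in> carrier R" by (rule car[OF x(1)])
    have J: "nilp R ?J m" using W.R.nilp_principal[OF xc, of m] x(2) by simp
    note IJ = W.R.nilp_add[OF I(1) J]
    have "f 0 u \<in> I <+>\<^bsub>R\<^esub> ?J" if u: "u \<in> D'" for u
    proof -
      obtain d r where d: "d \<in> D" "r \<in> carrier k" "u = d \<oplus>\<^bsub>pcomp A 0\<^esub> r \<odot>\<^bsub>pcomp A 0\<^esub> x" using u by (auto simp: D'_def)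
      have dc: "d \<in> carrier (pcomp A 0)" using d DC by auto
      have "f 0 u = f 0 d \<oplus>\<^bsub>B\<^esub> r \<odot>\<^bsub>B\<^esub> f 0 x" using d dc x by (simp add: f_add f_smult A_simps)
      also have "r \<odot>\<^bsub>B\<^esub> f 0 x = iota r \<otimes>\<^bsub>B\<^esub> f 0 x" using iota_mult[OF d(2) R_sub[OF xc]] by simp
      finally have e: "f 0 u = f 0 d \<oplus>\<^bsub>R\<^esub> iota r \<otimes>\<^bsub>R\<^esub> f 0 x" by simp
      have "iota r \<otimes>\<^bsub>R\<^esub> f 0 x \<in> ?J" unfolding cgenideal_def using W.io.hom_closed[OF d(2)] by blast
      moreover have "f 0 d \<in> I" using d I(2) by blast
      ultimately show ?thesis
        using W.R.ideal_add[OF nilp_ideal[OF IJ]] W.R.ideal_add_left[OF nilp_ideal[OF I(1)] nilp_ideal[OF J]]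
          W.R.ideal_add_right[OF nilp_ideal[OF I(1)] nilp_ideal[OF J]] unfolding e by blast
    qed
    then have "f 0 ` D' \<subseteq> I <+>\<^bsub>R\<^esub> ?J" by blast
    then have "G D'" unfolding G_def using sub' DD' z IJ by blast
    then show ?thesis using DD' xD xD' by blast
  qed
  \<comment> \<open>iterating the enlargement step gives a strict chain longer than the length of the component\<close>
  define nx where "nx D = (SOME D'. G D' \<and> D \<subset> D')" for D
  have nx: "G (nx D) \<and> D \<subset> nx D" if "G D" for D
    unfolding nx_def by (rule someI_ex[OF step[OF that]])
  define C where "C n = (nx ^^ n) {\<zero>\<^bsub>pcomp A 0\<^esub>}" for n
  have C: "G (C n)" "C n \<subset> C (Suc n)" for n
  proof -
    show g: "G (C n)" for n by (induction n) (auto simp: C_def G0 nx)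
    show "C n \<subset> C (Suc n)" using nx[OF g[of n]] by (simp add: C_def)
  qed
  have "finite_colength k (pcomp A 0) {\<zero>\<^bsub>pcomp A 0\<^esub>}"
    using fin by (simp add: gr_finite_length_def gr_finite_colength_def)
  then obtain b where b: "\<And>C n. (\<forall>i\<le>n. submodule (C i) k (pcomp A 0) \<and> {\<zero>\<^bsub>pcomp A 0\<^esub>} \<subseteq> C i) \<and> (\<forall>i<n. C i \<subset> C (Suc i)) \<Longrightarrow> n \<le> b"
    unfolding finite_colength_def by blast
  have "Suc b \<le> b" by (rule b[of "Suc b" C]) (use C in \<open>auto simp: G_def\<close>)
  then show False by simp
qed

text \<open>
  In positive degree \<open>j\<close> the entries \<open>a\<^sub>-\<^sub>i\<close> with \<open>i \<ge> j\<close> vanish, since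
  \<open>p ^ i > j\<close>; in degree zero all entries lie in one nilpotent ideal. Both bounds are uniform
  over all connected covectors.
\<close>

lemma CWcC_tailed0: "\<exists>I L r. (j = 0 \<longrightarrow> r = 0) \<and> (\<forall>a\<in>CWcC p A j. W.tailed I L r (clift p B f j a))"
proof (cases "j = 0")
  case True
  obtain I L where I: "nilp R I L" "\<And>x. x \<in> carrier (pcomp A 0) \<Longrightarrow> (\<exists>m::nat. f 0 x [^]\<^bsub>B\<^esub> m = \<zero>\<^bsub>B\<^esub>) \<Longrightarrow> f 0 x \<in> I"
    using nil_ideal by blast
  have "W.tailed I L 0 (clift p B f j a)" if a: "a \<in> CWcC p A j" for a
  proof -
    have "clift p B f j a i \<in> I" for i
      using a I(2)[of "a i"] pAcar_sub[of "a i" 0] True by (auto simp: CWcC_def nilslot_iff slotcar_def slotmap_def clift_def)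
    then show ?thesis using I(1) W.R.ideal_sub[OF nilp_ideal[OF I(1)]] by (auto simp: W.tailed_def)
  qed
  then show ?thesis by blast
next
  case False
  have "W.tailed {\<zero>\<^bsub>B\<^esub>} 1 j (clift p B f j a)" if a: "a \<in> CWcC p A j" for a
  proof -
    have s: "a i \<in> slotcar p A j i" for i using a by (auto simp: CWcC_def nilslot_def)
    have "a i = slotzero p A j i" if "j \<le> i" for i
    proof -
      have "\<not> p ^ i dvd j" using dvd_imp_le[of "p ^ i" j] power_gt_self[of i] that False by auto
      then show ?thesis using s[of i] by (simp add: slotcar_def slotzero_def)
    qed
    then show ?thesis using tailed_zero_iff[OF s] by blast
  qed
  then show ?thesis using False by blast
qed

lemma CWcC_tailed: "\<exists>I L r. \<forall>a\<in>CWcC p A j. W.tailed I L r (clift p B f j a)"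
  using CWcC_tailed0[of j] by (elim exE conjE) (intro exI)

lemma CWcC_I:
  assumes c: "\<And>i. c i \<in> slotcar p A j i" and t: "W.tailed I L r (clift p B f j c)" and r: "j = 0 \<Longrightarrow> r = 0"
  shows "c \<in> CWcC p A j"
proof (cases "j = 0")
  case True
  have "slotmap p B f j i (c i) [^]\<^bsub>R\<^esub> L = \<zero>\<^bsub>R\<^esub>" for i
    using t r[OF True] W.nilp_pow[of I L "slotmap p B f j i (c i)" L] by (simp add: W.tailed_def clift_def del: R_pow)
  then show ?thesis using c by (auto simp: CWcC_def nilslot_iff)
next
  case False
  then show ?thesis using c by (simp add: CWcC_def nilslot_pos)
qed

text \<open>
  In degree zero, membership in a nilpotent ideal is preserved by the operations; in positive
  degrees all covectors are connected.
\<close>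

lemma stable_CWcC: "stable_family (CWcC p A)"
  unfolding stable_family_def
proof (intro conjI allI ballI impI)
  have s: "a i \<in> slotcar p A j i" if "a \<in> CWcC p A j" for a j i using that by (auto simp: CWcC_def nilslot_def)
  show "covset (CWcC p A)" unfolding covset_def using s CWcC_tailed by blast
  have ex: "\<exists>m::nat. \<zero>\<^bsub>B\<^esub> [^]\<^bsub>B\<^esub> m = \<zero>\<^bsub>B\<^esub>" by (rule exI[of _ 1]) simp
  have "slotzero p A j i \<in> nilslot p A j i" for j i
    unfolding nilslot_iff slotmap_slotzero using ex slotzero_in by blast
  then show "slotzero p A j \<in> CWcC p A j" for j by (simp add: CWcC_def)
next
  fix j a b c
  assume a: "a \<in> CWcC p A j" and b: "b \<in> CWcC p A j" and c: "\<forall>i. c i \<in> slotcar p A j i"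
    and e: "clift p B f j c = W.cwadd (clift p B f j a) (clift p B f j b)"
  obtain I L r where r: "j = 0 \<longrightarrow> r = 0" and t: "\<forall>a\<in>CWcC p A j. W.tailed I L r (clift p B f j a)"
    using CWcC_tailed0[of j] by (elim exE conjE)
  have "W.tailed I L r (clift p B f j c)" unfolding e by (rule W.tailed_cwadd[OF bspec[OF t a] bspec[OF t b]])
  from CWcC_I[OF _ this] c r show "c \<in> CWcC p A j" by simp
next
  fix j l b c
  assume l: "l \<in> carrier (witt_ring p k)" and b: "b \<in> CWcC p A j" and c: "\<forall>i. c i \<in> slotcar p A j i"
    and e: "clift p B f j c = W.cwmul l (clift p B f j b)"
  obtain I L r where r: "j = 0 \<longrightarrow> r = 0" and t: "\<forall>a\<in>CWcC p A j. W.tailed I L r (clift p B f j a)"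
    using CWcC_tailed0[of j] by (elim exE conjE)
  have "W.tailed I L r (clift p B f j c)" unfolding e by (rule W.tailed_cwmul[OF l bspec[OF t b]])
  from CWcC_I[OF _ this] c r show "c \<in> CWcC p A j" by simp
next
  fix j a assume "a \<in> CWcC p A j"
  then show "cpF p A j a \<in> CWcC p A (p * j)" using nilslot_F[of a j] by (simp add: CWcC_def)
next
  fix j a assume "a \<in> CWcC p A (p * j)"
  then show "(\<lambda>i. a (Suc i)) \<in> CWcC p A j" using nilslot_V by (auto simp: CWcC_def)
qed

end

section \<open>Connected covectors of polar algebras of finite length\<close>

lemma continuous_entrywise:
  assumes "\<And>i x. x \<in> E (\<sigma> i) \<Longrightarrow> h i x \<in> E' i"
  shows "continuous_map (product_topology (\<lambda>i. discrete_topology (E i)) UNIV)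
    (product_topology (\<lambda>i. discrete_topology (E' i)) UNIV) (\<lambda>a i. h i (a (\<sigma> i)))"
  unfolding continuous_map_componentwise_UNIV
proof
  fix i
  have "continuous_map (product_topology (\<lambda>i. discrete_topology (E i)) UNIV) (discrete_topology (E (\<sigma> i))) (\<lambda>a. a (\<sigma> i))"
    by (rule continuous_map_product_projection) simp
  moreover have "continuous_map (discrete_topology (E (\<sigma> i))) (discrete_topology (E' i)) (h i)"
    using assms by simp
  ultimately show "continuous_map (product_topology (\<lambda>i. discrete_topology (E i)) UNIV) (discrete_topology (E' i)) (\<lambda>a. h i (a (\<sigma> i)))"
    using continuous_map_compose[of _ _ "\<lambda>a. a (\<sigma> i)" _ "h i"] by (simp add: o_def)
qed

lemma continuous_entrywise_restrict:
  assumes "\<And>i x. x \<in> E (\<sigma> i) \<Longrightarrow> h i x \<in> E' i"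
  shows "continuous_map (product_topology (\<lambda>i. discrete_topology (E i)) UNIV)
    (product_topology (\<lambda>i. discrete_topology (E' i)) UNIV) (\<lambda>a\<in>{a. \<forall>i. a i \<in> E i}. \<lambda>i. h i (a (\<sigma> i)))"
  by (rule continuous_map_eq[OF continuous_entrywise[OF assms]]) auto

definition CWcpol :: "nat \<Rightarrow> ('k, 'r) ring_scheme \<Rightarrow> ('k, 'a) polar \<Rightarrow> ('k, 'b) galg \<Rightarrow>
    (nat \<Rightarrow> 'a \<Rightarrow> 'b) \<Rightarrow> ('k, nat \<Rightarrow> 'a) tdmod"
  where "CWcpol p k A B f = dmod.extend (CWpol p k (CWcC p A) A B f)
    (tdmod.fields (\<lambda>j. product_topology (\<lambda>i. discrete_topology (nilslot p A j i)) UNIV))"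

lemma CWcpol_simps [simp]:
  "dcomp (CWcpol p k A B f) = (\<lambda>j. mod_on (witt_ring p k) (CWcC p A j) (slotzero p A j) (cpadd p A B f j) (cpsm p k A B f j))"
  "dF (CWcpol p k A B f) = (\<lambda>j. \<lambda>a\<in>CWcC p A j. cpF p A j a)"
  "dV (CWcpol p k A B f) = (\<lambda>j. \<lambda>a\<in>CWcC p A (p * j). \<lambda>i. a (Suc i))"
  "dtop (CWcpol p k A B f) = (\<lambda>j. product_topology (\<lambda>i. discrete_topology (nilslot p A j i)) UNIV)"
  by (simp_all add: CWcpol_def CWpol_def dmod.defs tdmod.defs)

lemma finite_colength_carrier:
  fixes M :: "('K, 'm, 'z) module_scheme"
  shows "Module.module K M \<Longrightarrow> finite_colength K M (carrier M)"
  unfolding finite_colength_def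
proof (intro exI[of _ 0] allI impI)
  fix C :: "nat \<Rightarrow> 'm set" and n
  assume M: "Module.module K M" and C: "(\<forall>i\<le>n. submodule (C i) K M \<and> carrier M \<subseteq> C i) \<and> (\<forall>i<n. C i \<subset> C (Suc i))"
  show "n \<le> 0"
  proof (rule ccontr)
    assume "\<not> n \<le> 0"
    then have "C 0 \<subset> C 1" "carrier M \<subseteq> C 0" "submodule (C 1) K M" using C by auto
    then show False using module.submoduleE(1)[OF M] by blast
  qed
qed

context polemb_fin begin

abbreviation cmod where
  "cmod j \<equiv> mod_on (witt_ring p k) (CWcC p A j) (slotzero p A j) (cpadd p A B f j) (cpsm p k A B f j)"

lemma CWcpol_dieudonne: "is_dieudonne p k (CWcpol p k A B f)"
  by (rule CWpol_dieudonne[OF stable_CWcC]) simp_all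

lemma cmod_module: "Module.module (witt_ring p k) (cmod j)"
  using CWcpol_dieudonne unfolding is_dieudonne_def by simp

lemma fin_len: "finite_colength k (pcomp A d) {\<zero>\<^bsub>pcomp A d\<^esub>}"
  using fin by (simp add: gr_finite_length_def gr_finite_colength_def)

definition slotmod :: "nat \<Rightarrow> nat \<Rightarrow> ('k, 'a) module"
  where "slotmod j i = pcomp A (if p ^ i dvd j then j div p ^ i else 0)"

text \<open>
  The bounds for sums of connected covectors are uniform, so they form a module of sequences to
  which the general results apply.
\<close>

lemma cmod_cov: "\<exists>c. sequence_module (witt_ring p k) k (cmod j) (nilslot p A j) (slotzero p A j) c (slotmod j) (\<lambda>i l. (wfrob_inv p k ^^ i) l 0)"
proof -
  interpret S: polhom p k B A f B A f "\<lambda>j. \<lambda>x\<in>carrier (pcomp A j). x" by (rule polhom_self)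
  obtain I L r where t: "\<And>a. a \<in> CWcC p A j \<Longrightarrow> W.tailed I L r (clift p B f j a)"
    using CWcC_tailed[of j] by blast
  note cov = stable_cov[OF stable_CWcC]
  have sl: "a i \<in> slotcar p A j i" if "a \<in> CWcC p A j" for a i using that by (auto simp: CWcC_def nilslot_def)
  define c where "c = r + L"
  have lc: "\<forall>s. wv (clift p B f j a) M s \<in> carrier R" if "a \<in> CWcC p A j" for a M
    using clift_carrier[OF sl[OF that]] by (simp add: wv_def)
  have va: "slotmap p B f j i (cpadd p A B f j a b i) = wadd p R (wv (clift p B f j a) (i + c)) (wv (clift p B f j b) (i + c)) c"
    if ab: "a \<in> CWcC p A j" "b \<in> CWcC p A j" for a b i
  proof -
    have "slotmap p B f j i (cpadd p A B f j a b i) = clift p B f j (cpadd p A B f j a b) i" by (simp add: clift_def)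
    also have "\<dots> = W.cwadd (clift p B f j a) (clift p B f j b) i" by (simp only: cpadd_props(2)[OF cov ab])
    also have "\<dots> = wadd p R (wv (clift p B f j a) (i + c)) (wv (clift p B f j b) (i + c)) c"
      by (rule W.cwadd_value[OF t[OF ab(1)] t[OF ab(2)]]) (simp add: c_def)
    finally show ?thesis .
  qed
  have vm: "slotmap p B f j i (cpsm p k A B f j l b i) = wmul p R (W.thw (i + c) l) (wv (clift p B f j b) (i + c)) c"
    if l: "l \<in> carrier (witt_ring p k)" and b: "b \<in> CWcC p A j" for l b i
  proof -
    have "slotmap p B f j i (cpsm p k A B f j l b i) = clift p B f j (cpsm p k A B f j l b) i" by (simp add: clift_def)
    also have "\<dots> = W.cwmul l (clift p B f j b) i" by (simp only: cpsm_props(2)[OF cov l b])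
    also have "\<dots> = wmul p R (W.thw (i + c) l) (wv (clift p B f j b) (i + c)) c"
      by (rule W.cwmul_value[OF l t[OF b]]) (simp add: c_def)
    finally show ?thesis .
  qed
  have tc: "\<forall>s. W.thw M l s \<in> carrier R" if "l \<in> carrier (witt_ring p k)" for M l using W.thw_closed[OF that] by auto
  note addin = cpadd_in[OF stable_CWcC] and smin = cpsm_in[OF stable_CWcC]
  have zc: "clift p B f j a s = \<zero>\<^bsub>B\<^esub>" if "a s = slotzero p A j s" for a s
    using that by (simp add: clift_def slotmap_slotzero)
  have "sequence_module (witt_ring p k) k (cmod j) (nilslot p A j) (slotzero p A j) c (slotmod j) (\<lambda>i l. (wfrob_inv p k ^^ i) l 0)"
  proof (rule sequence_module.intro)
    show "Module.module (witt_ring p k) (cmod j)" by (rule cmod_module)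
    show "carrier (cmod j) = {a. \<forall>i. a i \<in> nilslot p A j i}" by (simp add: CWcC_def)
    show "\<zero>\<^bsub>cmod j\<^esub> = slotzero p A j" by simp
  next
    fix a b a' b' i
    assume "a \<in> carrier (cmod j)" "b \<in> carrier (cmod j)" "a' \<in> carrier (cmod j)" "b' \<in> carrier (cmod j)"
      and e: "\<And>s. i \<le> s \<Longrightarrow> s \<le> i + c \<Longrightarrow> a s = a' s \<and> b s = b' s"
    then have m: "a \<in> CWcC p A j" "b \<in> CWcC p A j" "a' \<in> CWcC p A j" "b' \<in> CWcC p A j" by auto
    have "slotmap p B f j i (cpadd p A B f j a b i) = slotmap p B f j i (cpadd p A B f j a' b' i)"
      unfolding va[OF m(1,2)] va[OF m(3,4)]
      by (rule W.wadd_cong_upto[OF lc[OF m(1)] lc[OF m(2)] lc[OF m(3)] lc[OF m(4)]]) (use e in \<open>simp add: wv_def clift_def\<close>)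
    then have "cpadd p A B f j a b i = cpadd p A B f j a' b' i"
      by (rule slotmap_inj[OF sl[OF addin[OF m(1,2)]] sl[OF addin[OF m(3,4)]]])
    then show "(a \<oplus>\<^bsub>cmod j\<^esub> b) i = (a' \<oplus>\<^bsub>cmod j\<^esub> b') i" using m by simp
  next
    fix l a a' i
    assume l: "l \<in> carrier (witt_ring p k)" and "a \<in> carrier (cmod j)" "a' \<in> carrier (cmod j)"
      and e: "\<And>s. i \<le> s \<Longrightarrow> s \<le> i + c \<Longrightarrow> a s = a' s"
    then have m: "a \<in> CWcC p A j" "a' \<in> CWcC p A j" by auto
    have "slotmap p B f j i (cpsm p k A B f j l a i) = slotmap p B f j i (cpsm p k A B f j l a' i)"
      unfolding vm[OF l m(1)] vm[OF l m(2)]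
      by (rule W.wmul_cong_upto[OF tc[OF l] lc[OF m(1)] lc[OF m(2)]]) (use e in \<open>simp add: wv_def clift_def\<close>)
    then have "cpsm p k A B f j l a i = cpsm p k A B f j l a' i"
      by (rule slotmap_inj[OF sl[OF smin[OF l m(1)]] sl[OF smin[OF l m(2)]]])
    then show "(l \<odot>\<^bsub>cmod j\<^esub> a) i = (l \<odot>\<^bsub>cmod j\<^esub> a') i" using m l by simp
  next
    fix a b i
    assume "a \<in> carrier (cmod j)" "b \<in> carrier (cmod j)"
      and e: "\<And>s. i < s \<Longrightarrow> a s = slotzero p A j s \<and> b s = slotzero p A j s"
    then have m: "a \<in> CWcC p A j" "b \<in> CWcC p A j" by auto
    note ai = sl[OF m(1), of i] and bi = sl[OF m(2), of i] and ci = sl[OF addin[OF m], of i]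
    have "cpadd p A B f j a b i = a i \<oplus>\<^bsub>slotmod j i\<^esub> b i"
    proof (cases "p ^ i dvd j")
      case False
      interpret M: Module.module k "pcomp A 0" by (rule Amod)
      show ?thesis using False ai bi ci by (simp add: slotcar_def slotmod_def)
    next
      case True
      let ?d = "j div p ^ i"
      have ac: "a i \<in> pAcar p A ?d" "b i \<in> pAcar p A ?d" using ai bi True by (auto simp: slotcar_def)
      have "slotmap p B f j i (cpadd p A B f j a b i) = wv (clift p B f j a) (i + c) c \<oplus>\<^bsub>R\<^esub> wv (clift p B f j b) (i + c) c"
        unfolding va[OF m]
      proof (rule W.wadd_top[OF lc[OF m(1)] lc[OF m(2)]])
        fix s assume "s < c"
        then have "i < i + c - s" by simp
        then show "wv (clift p B f j a) (i + c) s = \<zero>\<^bsub>R\<^esub> \<and> wv (clift p B f j b) (i + c) s = \<zero>\<^bsub>R\<^esub>"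
          using e zc by (simp add: wv_def)
      qed
      also have "\<dots> = f ?d (a i) \<oplus>\<^bsub>B\<^esub> f ?d (b i)" using True by (simp add: wv_def clift_def slotmap_def)
      also have "\<dots> = f ?d (a i \<oplus>\<^bsub>pcomp A ?d\<^esub> b i)" using f_add[OF pAcar_sub[OF ac(1)] pAcar_sub[OF ac(2)]] by simp
      finally have "slotmap p B f j i (cpadd p A B f j a b i) = slotmap p B f j i (a i \<oplus>\<^bsub>pcomp A ?d\<^esub> b i)"
        using True by (simp add: slotmap_def)
      moreover have "a i \<oplus>\<^bsub>pcomp A ?d\<^esub> b i \<in> slotcar p A j i" using S.pAcar_add[OF ac] True by (simp add: slotcar_def)
      ultimately have "cpadd p A B f j a b i = a i \<oplus>\<^bsub>pcomp A ?d\<^esub> b i" using slotmap_inj[OF ci] by blast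
      then show ?thesis using True by (simp add: slotmod_def)
    qed
    then show "(a \<oplus>\<^bsub>cmod j\<^esub> b) i = a i \<oplus>\<^bsub>slotmod j i\<^esub> b i" using m by simp
  next
    fix l a i
    assume l: "l \<in> carrier (witt_ring p k)" and "a \<in> carrier (cmod j)"
      and e: "\<And>s. i < s \<Longrightarrow> a s = slotzero p A j s"
    then have m: "a \<in> CWcC p A j" by auto
    let ?r = "(wfrob_inv p k ^^ i) l 0"
    have rk: "?r \<in> carrier k" using W.wfin_closed[OF l, of i] by (simp add: witt_ring_simps[OF p])
    note ai = sl[OF m, of i] and ci = sl[OF smin[OF l m], of i]
    have "cpsm p k A B f j l a i = ?r \<odot>\<^bsub>slotmod j i\<^esub> a i"
    proof (cases "p ^ i dvd j")
      case False
      interpret M: Module.module k "pcomp A 0" by (rule Amod)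
      show ?thesis using False ai ci rk by (simp add: slotcar_def slotmod_def)
    next
      case True
      let ?d = "j div p ^ i"
      have ac: "a i \<in> pAcar p A ?d" using ai True by (auto simp: slotcar_def)
      have "slotmap p B f j i (cpsm p k A B f j l a i) = iota ?r \<otimes>\<^bsub>R\<^esub> wv (clift p B f j a) (i + c) c"
        unfolding vm[OF l m]
      proof (rule W.wmul_top[OF l lc[OF m]])
        fix s assume "s < c"
        then have "i < i + c - s" by simp
        then show "wv (clift p B f j a) (i + c) s = \<zero>\<^bsub>R\<^esub>"
          using e zc by (simp add: wv_def)
      qed
      also have "\<dots> = ?r \<odot>\<^bsub>B\<^esub> f ?d (a i)"
        using True iota_mult[OF rk gr_carrier[OF f_gr[OF pAcar_sub[OF ac]]]] by (simp add: wv_def clift_def slotmap_def)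
      also have "\<dots> = f ?d (?r \<odot>\<^bsub>pcomp A ?d\<^esub> a i)" using f_smult[OF rk pAcar_sub[OF ac]] by simp
      finally have "slotmap p B f j i (cpsm p k A B f j l a i) = slotmap p B f j i (?r \<odot>\<^bsub>pcomp A ?d\<^esub> a i)"
        using True by (simp add: slotmap_def)
      moreover have "?r \<odot>\<^bsub>pcomp A ?d\<^esub> a i \<in> slotcar p A j i" using S.pAcar_smult[OF rk ac] True by (simp add: slotcar_def)
      ultimately have "cpsm p k A B f j l a i = ?r \<odot>\<^bsub>pcomp A ?d\<^esub> a i" using slotmap_inj[OF ci] by blast
      then show ?thesis using True by (simp add: slotmod_def)
    qed
    then show "(l \<odot>\<^bsub>cmod j\<^esub> a) i = ?r \<odot>\<^bsub>slotmod j i\<^esub> a i" using m l by simp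
  next
    fix i
    show "Module.module k (slotmod j i)" unfolding slotmod_def by (rule Amod)
    show "nilslot p A j i \<subseteq> carrier (slotmod j i)"
      using pAcar_sub A_simps(1) by (auto simp: nilslot_def slotcar_def slotmod_def)
    show "slotzero p A j i = \<zero>\<^bsub>slotmod j i\<^esub>" by (simp add: slotzero_def slotmod_def)
    show "finite_colength k (slotmod j i) {\<zero>\<^bsub>slotmod j i\<^esub>}" unfolding slotmod_def by (rule fin_len)
    fix r assume "r \<in> carrier k"
    then show "\<exists>l\<in>carrier (witt_ring p k). (wfrob_inv p k ^^ i) l 0 = r" by (rule W.wfin_surj)
  qed
  then show ?thesis by blast
qed

lemma CWcC_carrier: "CWcC p A j = {a. \<forall>i. a i \<in> nilslot p A j i}"
  by (simp add: CWcC_def)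

lemma Fpow_closed: "a \<in> CWcC p A i \<Longrightarrow> Fpow p (CWcpol p k A B f) n i a \<in> CWcC p A (p ^ n * i)"
proof (induction n)
  case (Suc n)
  then show ?case using stable_FV(1)[OF stable_CWcC, of _ "p ^ n * i"] by (simp add: mult.assoc)
qed simp

lemma Fpow_0:
  assumes a: "a \<in> CWcC p A 0"
  shows "Fpow p (CWcpol p k A B f) n 0 a \<in> CWcC p A 0 \<and>
    (\<forall>i. slotmap p B f 0 i (Fpow p (CWcpol p k A B f) n 0 a i) = slotmap p B f 0 i (a i) [^]\<^bsub>B\<^esub> (p ^ n))"
proof (induction n)
  case 0
  have "slotmap p B f 0 i (a i) \<in> carrier B" for i
    using a R_sub[OF slotmap_R] by (auto simp: CWcC_def nilslot_def)
  then show ?case using a by simp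
next
  case (Suc n)
  let ?y = "Fpow p (CWcpol p k A B f) n 0 a"
  have y: "?y \<in> CWcC p A 0" "\<And>i. slotmap p B f 0 i (?y i) = slotmap p B f 0 i (a i) [^]\<^bsub>B\<^esub> (p ^ n)" using Suc by auto
  have s: "?y i \<in> slotcar p A 0 i" for i using y(1) by (auto simp: CWcC_def nilslot_def)
  have c: "slotmap p B f 0 i (a i) \<in> carrier B" for i
    using a R_sub[OF slotmap_R] by (auto simp: CWcC_def nilslot_def)
  have e: "Fpow p (CWcpol p k A B f) (Suc n) 0 a = cpF p A 0 ?y"
    unfolding Fpow.simps mult_0_right using y(1) by simp
  have "cpF p A 0 ?y \<in> CWcC p A 0" using stable_FV(1)[OF stable_CWcC y(1)] by simp
  moreover have "slotmap p B f 0 i (cpF p A 0 ?y i) = slotmap p B f 0 i (a i) [^]\<^bsub>B\<^esub> (p ^ Suc n)" for i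
    using slot_F(2)[of ?y 0 i, OF s] y(2)[of i] c[of i] by (simp add: B.nat_pow_pow mult.commute)
  ultimately show ?case unfolding e by blast
qed

text \<open>
  Near zero in degree \<open>j\<close>, one takes a small open submodule in degree \<open>j\<close> and everything in the
  other degrees. If \<open>j > 0\<close>, a high iterate of \<open>F\<close> never ends up in degree \<open>j\<close>; if \<open>j = 0\<close>, a
  high iterate of \<open>F\<close> is zero in degree \<open>0\<close>, where all entries lie in one nilpotent ideal.
\<close>

lemma CWcpol_connected: "connected_dmod p k (CWcpol p k A B f)"
proof -
  let ?M = "CWcpol p k A B f"
  have prof: "profinite_module (witt_ring p k) (dcomp ?M j) (dtop ?M j)" for j
  proof -
    obtain c where "sequence_module (witt_ring p k) k (cmod j) (nilslot p A j) (slotzero p A j) c (slotmod j) (\<lambda>i l. (wfrob_inv p k ^^ i) l 0)"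
      using cmod_cov[of j] by blast
    from sequence_module.profinite[OF this] show ?thesis by simp
  qed
  have contF: "continuous_map (dtop ?M j) (dtop ?M (p * j)) (dF ?M j)" for j
  proof -
    let ?h = "\<lambda>i x. if p ^ i dvd j then pmu A (j div p ^ i) (replicate p x) else slotzero p A (p * j) i"
    have "?h i x \<in> nilslot p A (p * j) i" if x: "x \<in> nilslot p A j i" for i x
    proof -
      have z: "(\<lambda>i. slotzero p A j i) \<in> CWcC p A j" using stable_zero[OF stable_CWcC] .
      define a where "a = (slotzero p A j)(i := x)"
      have a: "a s \<in> nilslot p A j s" for s using x z by (simp add: a_def CWcC_def)
      have ax: "a i = x" by (simp add: a_def)
      show ?thesis using nilslot_F[of a j i, OF a] by (simp only: cpF_def ax)
    qed
    from continuous_entrywise_restrict[where \<sigma> = "\<lambda>i. i" and h = ?h, OF this]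
    show ?thesis by (simp add: CWcC_carrier cpF_def[abs_def])
  qed
  have contV: "continuous_map (dtop ?M (p * j)) (dtop ?M j) (dV ?M j)" for j
    using continuous_entrywise_restrict[where \<sigma> = Suc and h = "\<lambda>i x. x" and E = "nilslot p A (p * j)" and E' = "nilslot p A j"] nilslot_V
    by (simp add: CWcC_carrier)
  have sys: "\<exists>N. (\<forall>i. submodule (N i) (witt_ring p k) (dcomp ?M i) \<and> openin (dtop ?M i) (N i)) \<and>
        gr_finite_colength (witt_ring p k) (dcomp ?M) N \<and> N j \<subseteq> U \<and>
        (\<exists>n0. \<forall>n\<ge>n0. \<forall>i. Fpow p ?M n i ` carrier (dcomp ?M i) \<subseteq> N (p ^ n * i))"
    if U: "openin (dtop ?M j) U" and zU: "\<zero>\<^bsub>dcomp ?M j\<^esub> \<in> U" for j U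
  proof -
    obtain c where "sequence_module (witt_ring p k) k (cmod j) (nilslot p A j) (slotzero p A j) c (slotmod j) (\<lambda>i l. (wfrob_inv p k ^^ i) l 0)"
      using cmod_cov[of j] by blast
    then interpret cm: sequence_module "witt_ring p k" k "cmod j" "nilslot p A j" "slotzero p A j" c "slotmod j" "\<lambda>i l. (wfrob_inv p k ^^ i) l 0" .
    obtain n where n: "cm.cyl n (slotzero p A j) \<subseteq> U" using cm.open_contains_cyl[of U "slotzero p A j"] U zU by auto
    \<comment> \<open>\<open>cm.U n\<close> is contained in the cylinder of covectors with \<open>n\<close> zeros, hence in \<open>U\<close>\<close>
    define N where "N = (\<lambda>i. if i = j then cm.U n else CWcC p A i)"
    have sub: "submodule (N i) (witt_ring p k) (dcomp ?M i)" for i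
      using cm.U_sub[of n] module.carrier_is_submodule[OF cmod_module[of i]] by (simp add: N_def)
    have op: "openin (dtop ?M i) (N i)" for i
    proof (cases "i = j")
      case True
      then show ?thesis using cm.U_open_fin[of n] by (simp add: N_def open_fin_submods_def)
    next
      case False
      have "topspace (dtop ?M i) = CWcC p A i" by (auto simp: CWcC_carrier PiE_def Pi_def)
      then show ?thesis using False openin_topspace[of "dtop ?M i"] by (simp add: N_def)
    qed
    have fc: "gr_finite_colength (witt_ring p k) (dcomp ?M) N"
      unfolding gr_finite_colength_def
    proof (intro conjI allI)
      fix i
      show "finite_colength (witt_ring p k) (dcomp ?M i) (N i)"
        using cm.U_open_fin[of n] finite_colength_carrier[OF cmod_module[of i]] by (auto simp: N_def open_fin_submods_def)
      show "finite {j. N j \<noteq> carrier (dcomp ?M j)}"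
        by (rule finite_subset[of _ "{j}"]) (auto simp: N_def)
    qed
    have NU: "N j \<subseteq> U" using cm.U_cyl[of n] n by (auto simp: N_def)
    have zN: "slotzero p A j \<in> N j" using cm.U_open_fin[of n] subgroup.one_closed[OF submodule.axioms(1)[OF cm.U_sub[of n]]] by (simp add: N_def)
    have F0: "\<exists>n0. \<forall>n\<ge>n0. \<forall>a\<in>CWcC p A 0. Fpow p ?M n 0 a = slotzero p A 0"
    proof -
      obtain I L r where r: "(0::nat) = 0 \<longrightarrow> r = 0" and t: "\<And>a. a \<in> CWcC p A 0 \<Longrightarrow> W.tailed I L r (clift p B f 0 a)"
        using CWcC_tailed0[of 0] by (elim exE conjE) blast
      have "Fpow p ?M m 0 a = slotzero p A 0" if m: "L \<le> m" and a: "a \<in> CWcC p A 0" for m a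
      proof
        fix i
        have I: "nilp R I L" "slotmap p B f 0 i (a i) \<in> I" using t[OF a] r by (auto simp: W.tailed_def clift_def)
        have "L \<le> p ^ m" using m power_gt_self[of m] by simp
        then have "slotmap p B f 0 i (a i) [^]\<^bsub>R\<^esub> (p ^ m) = \<zero>\<^bsub>R\<^esub>" by (rule W.nilp_pow[OF I])
        then have "slotmap p B f 0 i (Fpow p ?M m 0 a i) = \<zero>\<^bsub>B\<^esub>" using Fpow_0[OF a, of m] by simp
        moreover have "Fpow p ?M m 0 a i \<in> slotcar p A 0 i" using Fpow_0[OF a, of m] by (auto simp: CWcC_def nilslot_def)
        ultimately show "Fpow p ?M m 0 a i = slotzero p A 0 i" using slot_zero_iff by blast
      qed
      then show ?thesis by blast
    qed
    have "\<exists>n0. \<forall>n\<ge>n0. \<forall>i. Fpow p ?M n i ` carrier (dcomp ?M i) \<subseteq> N (p ^ n * i)"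
    proof (cases "j = 0")
      case True
      obtain n0 where n0: "\<And>n a. n0 \<le> n \<Longrightarrow> a \<in> CWcC p A 0 \<Longrightarrow> Fpow p ?M n 0 a = slotzero p A 0" using F0 by blast
      have "Fpow p ?M n i a \<in> N (p ^ n * i)" if "n0 \<le> n" "a \<in> CWcC p A i" for n i a
      proof (cases "i = 0")
        case True
        then show ?thesis using n0[OF that(1)] that(2) zN \<open>j = 0\<close> by simp
      next
        case False
        then have "p ^ n * i \<noteq> j" using True W.ppos by simp
        then show ?thesis using Fpow_closed[OF that(2)] by (simp add: N_def)
      qed
      then show ?thesis by (intro exI[of _ n0]) auto
    next
      case False
      have "Fpow p ?M n i a \<in> N (p ^ n * i)" if "j \<le> n" "a \<in> CWcC p A i" for n i a
      proof -
        have "p ^ n * i \<noteq> j"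
        proof
          assume e: "p ^ n * i = j"
          then have "p ^ n \<le> j" using False by (cases i) auto
          then show False using that(1) power_gt_self[of n] by simp
        qed
        then show ?thesis using Fpow_closed[OF that(2)] by (simp add: N_def)
      qed
      then show ?thesis by (intro exI[of _ j]) auto
    qed
    with sub op fc NU have "(\<forall>i. submodule (N i) (witt_ring p k) (dcomp ?M i) \<and> openin (dtop ?M i) (N i)) \<and>
        gr_finite_colength (witt_ring p k) (dcomp ?M) N \<and> N j \<subseteq> U \<and>
        (\<exists>n0. \<forall>n\<ge>n0. \<forall>i. Fpow p ?M n i ` carrier (dcomp ?M i) \<subseteq> N (p ^ n * i))" by (intro conjI allI)
    then show ?thesis by (rule exI[of _ N])
  qed
  show ?thesis unfolding connected_dmod_def
    by (intro conjI allI impI CWcpol_dieudonne prof contF contV, rule sys) (elim conjE, assumption)+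
qed

end

context polhom begin

lemma slotg_CWuC: "a \<in> CWuC p A j \<Longrightarrow> (\<lambda>i. slotg p A' g j i (a i)) \<in> CWuC p A' j"
proof -
  assume a: "a \<in> CWuC p A j"
  have "{i. slotg p A' g j i (a i) \<noteq> slotzero p A' j i} \<subseteq> {i. a i \<noteq> slotzero p A j i}"
    using slotg_zero by auto
  then show ?thesis using a slotg_in finite_subset by (auto simp: CWuC_def)
qed

lemma g_ppow: "x \<in> pAcar p A d \<Longrightarrow> g (d * p ^ n) (ppow p A d n x) = ppow p A' d n (g d x)"
proof (induction n)
  case (Suc n)
  let ?y = "ppow p A d n x"
  have "?y \<in> carrier (pcomp A (d * p ^ n))" using P.ppow_props[OF Suc.prems, of n] P.pAcar_sub by blast
  then have "replicate p ?y \<in> ptuples p (carrier (pcomp A (d * p ^ n)))" by (auto simp: ptuples_def)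
  from g_pmu[OF this] show ?case using Suc by (simp add: mult.assoc mult.commute[of p])
qed simp

lemma slotg_nil: "x \<in> nilslot p A j i \<Longrightarrow> slotg p A' g j i x \<in> nilslot p A' j i"
proof -
  assume x: "x \<in> nilslot p A j i"
  have s: "slotg p A' g j i x \<in> slotcar p A' j i" using x slotg_in by (auto simp: nilslot_def)
  have "\<exists>n. ppow p A' (j div p ^ i) n (slotg p A' g j i x) = \<zero>\<^bsub>pcomp A' (j div p ^ i * p ^ n)\<^esub>" if d: "p ^ i dvd j"
  proof -
    obtain n where n: "ppow p A (j div p ^ i) n x = \<zero>\<^bsub>pcomp A (j div p ^ i * p ^ n)\<^esub>" using x d by (auto simp: nilslot_def)
    have "x \<in> pAcar p A (j div p ^ i)" using x d by (simp add: nilslot_def slotcar_def)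
    from g_ppow[OF this, of n] have "ppow p A' (j div p ^ i) n (g (j div p ^ i) x) = \<zero>\<^bsub>pcomp A' (j div p ^ i * p ^ n)\<^esub>"
      unfolding n g_zero by (rule sym)
    then show ?thesis using d by (auto simp: slotg_def)
  qed
  then show ?thesis using s by (simp add: nilslot_def)
qed

lemma slotg_CWcC: "a \<in> CWcC p A j \<Longrightarrow> (\<lambda>i. slotg p A' g j i (a i)) \<in> CWcC p A' j"
  using slotg_nil by (simp add: CWcC_def)

lemma Cmor_u_hom: "Cmor p (CWuC p A) A' g \<in> dmod_hom p k (CWpol p k (CWuC p A) A B f) (CWpol p k (CWuC p A') A' B' f')"
  by (rule Cmor_hom[OF P.stable_CWuC Q.stable_CWuC slotg_CWuC]) (simp_all add: CWpol_def)

lemma Cmor_c_hom: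
  assumes "gr_finite_length k (pcomp A)" "gr_finite_length k (pcomp A')"
  shows "Cmor p (CWcC p A) A' g \<in> dmod_hom p k (CWcpol p k A B f) (CWcpol p k A' B' f')"
proof -
  interpret PF: polemb_fin p k B A f by unfold_locales (rule assms)
  interpret QF: polemb_fin p k B' A' f' by unfold_locales (rule assms)
  show ?thesis by (rule Cmor_hom[OF PF.stable_CWcC QF.stable_CWcC slotg_CWcC]) simp_all
qed

lemma Cmor_c_continuous:
  "continuous_map (dtop (CWcpol p k A B f) j) (dtop (CWcpol p k A' B' f') j) (Cmor p (CWcC p A) A' g j)"
  using continuous_entrywise_restrict[where \<sigma> = "\<lambda>i. i" and h = "\<lambda>i. slotg p A' g j i" and E = "nilslot p A j" and E' = "nilslot p A' j", OF slotg_nil]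
  by (simp add: Cmor_def CWcC_def)

end

section \<open>Graded-commutative algebras are polar algebras\<close>

context galgebra begin

lemma lprod_carrier: "set xs \<subseteq> carrier B \<Longrightarrow> lprod B xs \<in> carrier B"
  by (induction xs) auto

lemma lprod_append_gr:
  "set xs \<subseteq> carrier B \<Longrightarrow> set ys \<subseteq> carrier B \<Longrightarrow> lprod B (xs @ ys) = lprod B xs \<otimes>\<^bsub>B\<^esub> lprod B ys"
  by (induction xs) (auto simp: B.m_assoc lprod_carrier)

lemma lprod_gr: "set xs \<subseteq> gr B j \<Longrightarrow> lprod B xs \<in> gr B (j * length xs)"
proof (induction xs)
  case (Cons x xs)
  then show ?case using mult_gr[of x j "lprod B xs" "j * length xs"] by simp
qed (simp add: one_gr)

lemma lprod_update:
  assumes "i < length xs" "set xs \<subseteq> carrier B" "x \<in> carrier B"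
  shows "lprod B (xs[i := x]) = lprod B (take i xs) \<otimes>\<^bsub>B\<^esub> (x \<otimes>\<^bsub>B\<^esub> lprod B (drop (Suc i) xs))"
    and "lprod B (take i xs) \<in> carrier B" "lprod B (drop (Suc i) xs) \<in> carrier B"
proof -
  have s: "set (take i xs) \<subseteq> carrier B" "set (drop (Suc i) xs) \<subseteq> carrier B"
    using assms(2) set_take_subset set_drop_subset by fast+
  show "lprod B (xs[i := x]) = lprod B (take i xs) \<otimes>\<^bsub>B\<^esub> (x \<otimes>\<^bsub>B\<^esub> lprod B (drop (Suc i) xs))"
    using s assms(3) by (simp add: upd_conv_take_nth_drop[OF assms(1)] lprod_append_gr)
  show "lprod B (take i xs) \<in> carrier B" "lprod B (drop (Suc i) xs) \<in> carrier B"
    using s lprod_carrier by auto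
qed

lemma smult_int: "x \<in> carrier B \<Longrightarrow> [(c::int)] \<cdot>\<^bsub>B\<^esub> x = ([c] \<cdot>\<^bsub>k\<^esub> \<one>\<^bsub>k\<^esub>) \<odot>\<^bsub>B\<^esub> x"
proof -
  assume x: "x \<in> carrier B"
  have n: "[n] \<cdot>\<^bsub>B\<^esub> x = ([n] \<cdot>\<^bsub>k\<^esub> \<one>\<^bsub>k\<^esub>) \<odot>\<^bsub>B\<^esub> x" for n :: nat
    using x by (induction n) (auto simp: Bm.smult_l_distr)
  show ?thesis using x by (cases "c \<ge> 0") (auto simp: add_pow_int_ge add_pow_int_lt n Bm.smult_l_minus)
qed

lemma component_module: "Module.module k (gr_component k B j)"
  unfolding gr_component_def
proof (rule represented.rep_module[where N = B and \<rho> = "\<lambda>x a. x = a \<and> a \<in> gr B j"], rule represented.intro)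
  show "Module.module k B" by (rule Bm.module_axioms)
  show "\<zero>\<^bsub>B\<^esub> = \<zero>\<^bsub>B\<^esub> \<and> \<zero>\<^bsub>B\<^esub> \<in> gr B j" using gr_zero by simp
  show "\<exists>x. x = a \<and> a \<in> gr B j" if "a \<in> gr B j" for a using that by simp
  show "x \<in> carrier B \<and> a \<in> gr B j" if "x = a \<and> a \<in> gr B j" for x a using that gr_carrier by blast
qed (auto intro: gr_add gr_smult)

lemma component_int:
  assumes x: "x \<in> gr B j" shows "[(c::int)] \<cdot>\<^bsub>gr_component k B j\<^esub> x = [c] \<cdot>\<^bsub>B\<^esub> x"
proof -
  let ?M = "gr_component k B j"
  interpret M: Module.module k ?M by (rule component_module)
  have s: "carrier ?M = gr B j" "x \<in> gr B j \<Longrightarrow> y \<in> gr B j \<Longrightarrow> x \<oplus>\<^bsub>?M\<^esub> y = x \<oplus>\<^bsub>B\<^esub> y" "\<zero>\<^bsub>?M\<^esub> = \<zero>\<^bsub>B\<^esub>"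
    "r \<in> carrier k \<Longrightarrow> x \<in> gr B j \<Longrightarrow> r \<odot>\<^bsub>?M\<^esub> x = r \<odot>\<^bsub>B\<^esub> x" for x y r by (simp_all add: gr_component_def)
  have n: "[n] \<cdot>\<^bsub>?M\<^esub> x = [n] \<cdot>\<^bsub>B\<^esub> x \<and> [n] \<cdot>\<^bsub>B\<^esub> x \<in> gr B j" for n :: nat
    using x by (induction n) (auto simp: s gr_zero gr_add)
  have neg: "\<ominus>\<^bsub>?M\<^esub> y = \<ominus>\<^bsub>B\<^esub> y" if y: "y \<in> gr B j" for y
  proof -
    have "\<ominus>\<^bsub>?M\<^esub> y = (\<ominus>\<^bsub>k\<^esub> \<one>\<^bsub>k\<^esub>) \<odot>\<^bsub>?M\<^esub> y" using M.smult_l_minus[of "\<one>\<^bsub>k\<^esub>" y] y by (simp add: s(1))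
    also have "\<dots> = \<ominus>\<^bsub>B\<^esub> y" using y gr_carrier[OF y] by (simp add: s(4) Bm.smult_l_minus)
    finally show ?thesis .
  qed
  show ?thesis using n by (cases "c \<ge> 0") (auto simp: add_pow_int_ge add_pow_int_lt neg)
qed

lemma lprod_swap_adjacent:
  assumes xs: "length xs = n" "set xs \<subseteq> gr B j" and a: "Suc a < n"
  shows "lprod B (permute_list (Transposition.transpose a (Suc a)) xs) = [((- 1 :: int) ^ (j * j))] \<cdot>\<^bsub>B\<^esub> lprod B xs"
proof -
  let ?L = "take a xs" and ?D = "drop (Suc (Suc a)) xs" and ?x = "xs ! a" and ?y = "xs ! Suc a"
  have e1: "xs = ?L @ ?x # ?y # ?D"
    using a xs by (simp add: Cons_nth_drop_Suc)
  have e2: "permute_list (Transposition.transpose a (Suc a)) xs = ?L @ ?y # ?x # ?D"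
  proof (rule nth_equalityI)
    show "length (permute_list (Transposition.transpose a (Suc a)) xs) = length (?L @ ?y # ?x # ?D)"
      using a xs by simp
    fix i assume "i < length (permute_list (Transposition.transpose a (Suc a)) xs)"
    then have i: "i < n" using xs by simp
    consider "i < a" | "i = a" | "i = Suc a" | "i > Suc a" by linarith
    then show "permute_list (Transposition.transpose a (Suc a)) xs ! i = (?L @ ?y # ?x # ?D) ! i"
    proof cases
      case 4
      then obtain d where "i = Suc (Suc a + d)" using less_imp_Suc_add by blast
      then show ?thesis using i a xs by (simp add: permute_list_def Transposition.transpose_def nth_append)
    qed (use i a xs in \<open>auto simp: permute_list_def Transposition.transpose_def nth_append\<close>)
  qed
  have c: "?x \<in> gr B j" "?y \<in> gr B j" "set ?L \<subseteq> carrier B" "set ?D \<subseteq> carrier B"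
    using xs a gr_carrier set_take_subset[of a xs] set_drop_subset[of "Suc (Suc a)" xs] by (auto simp: subset_iff)
  note cc = gr_carrier[OF c(1)] gr_carrier[OF c(2)] lprod_carrier[OF c(3)] lprod_carrier[OF c(4)]
  let ?s = "[((- 1 :: int) ^ (j * j))] \<cdot>\<^bsub>k\<^esub> \<one>\<^bsub>k\<^esub>"
  have sk: "?s \<in> carrier k" by simp
  have "lprod B (?L @ ?y # ?x # ?D) = lprod B ?L \<otimes>\<^bsub>B\<^esub> (?y \<otimes>\<^bsub>B\<^esub> ?x \<otimes>\<^bsub>B\<^esub> lprod B ?D)"
    using c cc by (subst lprod_append_gr) (auto simp: B.m_assoc)
  also have "?y \<otimes>\<^bsub>B\<^esub> ?x = ?s \<odot>\<^bsub>B\<^esub> (?x \<otimes>\<^bsub>B\<^esub> ?y)"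
    using comm_gr[OF c(2,1)] cc by (simp add: smult_int)
  also have "lprod B ?L \<otimes>\<^bsub>B\<^esub> (?s \<odot>\<^bsub>B\<^esub> (?x \<otimes>\<^bsub>B\<^esub> ?y) \<otimes>\<^bsub>B\<^esub> lprod B ?D) = ?s \<odot>\<^bsub>B\<^esub> (lprod B ?L \<otimes>\<^bsub>B\<^esub> (?x \<otimes>\<^bsub>B\<^esub> ?y \<otimes>\<^bsub>B\<^esub> lprod B ?D))"
    using cc sk by (simp add: smult_mult)
  also have "lprod B ?L \<otimes>\<^bsub>B\<^esub> (?x \<otimes>\<^bsub>B\<^esub> ?y \<otimes>\<^bsub>B\<^esub> lprod B ?D) = lprod B (?L @ ?x # ?y # ?D)"
    using c cc by (subst lprod_append_gr) (auto simp: B.m_assoc)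
  also have "\<dots> = lprod B xs" using e1 by simp
  also have "?s \<odot>\<^bsub>B\<^esub> lprod B xs = [((- 1 :: int) ^ (j * j))] \<cdot>\<^bsub>B\<^esub> lprod B xs"
    using xs gr_carrier by (intro smult_int[symmetric] lprod_carrier) blast
  finally show ?thesis unfolding e2 .
qed

text \<open>
  The permutations of \<open>n\<close> factors of degree \<open>j\<close> that obey the sign rule. They contain the
  transpositions of neighbours and are closed under composition, so they are all permutations.
\<close>

definition koszul :: "nat \<Rightarrow> nat \<Rightarrow> (nat \<Rightarrow> nat) \<Rightarrow> bool"
  where "koszul n j \<sigma> \<longleftrightarrow> \<sigma> permutes {..<n} \<and>
    (\<forall>xs. length xs = n \<longrightarrow> set xs \<subseteq> gr B j \<longrightarrow>
      lprod B (permute_list \<sigma> xs) = [(sign \<sigma> ^ (j * j))] \<cdot>\<^bsub>B\<^esub> lprod B xs)"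

lemma koszul_compose:
  assumes f: "koszul n j \<sigma>" and g: "koszul n j \<tau>"
  shows "koszul n j (\<sigma> \<circ> \<tau>)"
  unfolding koszul_def
proof (intro conjI allI impI)
  have pf: "\<sigma> permutes {..<n}" and pg: "\<tau> permutes {..<n}" using f g by (auto simp: koszul_def)
  show "\<sigma> \<circ> \<tau> permutes {..<n}" using permutes_compose[OF pg pf] .
  fix xs assume xs: "length xs = n" "set xs \<subseteq> gr B j"
  have s: "set (permute_list \<sigma> xs) \<subseteq> gr B j" using set_permute_list[of \<sigma> xs] pf xs by simp
  have c: "lprod B xs \<in> carrier B" using xs gr_carrier by (intro lprod_carrier) blast
  have "permute_list (\<sigma> \<circ> \<tau>) xs = permute_list \<tau> (permute_list \<sigma> xs)"
    using permute_list_compose[of \<tau> xs \<sigma>] pg xs by simp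
  then have "lprod B (permute_list (\<sigma> \<circ> \<tau>) xs) = [(sign \<tau> ^ (j * j))] \<cdot>\<^bsub>B\<^esub> lprod B (permute_list \<sigma> xs)"
    using g s xs by (simp add: koszul_def)
  also have "\<dots> = [(sign \<tau> ^ (j * j))] \<cdot>\<^bsub>B\<^esub> ([(sign \<sigma> ^ (j * j))] \<cdot>\<^bsub>B\<^esub> lprod B xs)"
    using f xs by (simp add: koszul_def)
  also have "\<dots> = [(sign (\<sigma> \<circ> \<tau>) ^ (j * j))] \<cdot>\<^bsub>B\<^esub> lprod B xs"
    using c pf pg by (subst sign_compose) (auto simp: B.add.int_pow_pow power_mult_distrib permutation_permutes mult.commute)
  finally show "lprod B (permute_list (\<sigma> \<circ> \<tau>) xs) = [(sign (\<sigma> \<circ> \<tau>) ^ (j * j))] \<cdot>\<^bsub>B\<^esub> lprod B xs" .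
qed

text \<open>
  \<open>(a b) = (a a+1) (a+1 b) (a a+1)\<close>.
\<close>

lemma koszul_transpose_less:
  assumes "a < b" "b < n" shows "koszul n j (Transposition.transpose a b)"
  using assms
proof (induction "b - Suc a" arbitrary: a)
  case 0
  then have b: "b = Suc a" by simp
  show ?case unfolding koszul_def b
    using lprod_swap_adjacent 0 b permutes_swap_id[of a "{..<n}" "Suc a"] by (auto simp: sign_swap_id)
next
  case (Suc d)
  have adj: "koszul n j (Transposition.transpose a (Suc a))"
    unfolding koszul_def using lprod_swap_adjacent Suc.prems permutes_swap_id[of a "{..<n}" "Suc a"] by (auto simp: sign_swap_id)
  have "koszul n j (Transposition.transpose (Suc a) b)" using Suc by simp
  then have "koszul n j (Transposition.transpose a (Suc a) \<circ> (Transposition.transpose (Suc a) b \<circ> Transposition.transpose a (Suc a)))"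
    by (intro koszul_compose adj)
  moreover have "Transposition.transpose a (Suc a) \<circ> (Transposition.transpose (Suc a) b \<circ> Transposition.transpose a (Suc a)) = Transposition.transpose a b"
    using Suc by (auto simp: fun_eq_iff Transposition.transpose_def)
  ultimately show ?case by simp
qed

lemma koszul_permutes:
  assumes "\<sigma> permutes {..<n}" shows "koszul n j \<sigma>"
  using assms finite_lessThan[of n]
proof (induction rule: permutes_induct)
  show "koszul n j id" unfolding koszul_def
  proof (intro conjI permutes_id allI impI)
    fix xs assume "length xs = n" "set xs \<subseteq> gr B j"
    then have "lprod B xs \<in> carrier B" using gr_carrier by (intro lprod_carrier) blast
    then show "lprod B (permute_list id xs) = [(sign id ^ (j * j))] \<cdot>\<^bsub>B\<^esub> lprod B xs" by (simp add: add_pow_int_ge)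
  qed
next
  fix a b \<sigma> assume ab: "a \<in> {..<n}" "b \<in> {..<n}" "a \<noteq> b" and s: "koszul n j \<sigma>"
  have "koszul n j (Transposition.transpose a b)"
    using koszul_transpose_less[of a b n j] koszul_transpose_less[of b a n j] ab transpose_commute[of a b]
    by (cases "a < b") auto
  then show "koszul n j (Transposition.transpose a b \<circ> \<sigma>)" using s by (rule koszul_compose)
qed

lemma pol_obj_simps [simp]:
  "carrier (pcomp (pol_obj p k B) j) = gr B j" "\<zero>\<^bsub>pcomp (pol_obj p k B) j\<^esub> = \<zero>\<^bsub>B\<^esub>"
  "x \<in> gr B j \<Longrightarrow> y \<in> gr B j \<Longrightarrow> x \<oplus>\<^bsub>pcomp (pol_obj p k B) j\<^esub> y = x \<oplus>\<^bsub>B\<^esub> y"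
  "r \<in> carrier k \<Longrightarrow> x \<in> gr B j \<Longrightarrow> r \<odot>\<^bsub>pcomp (pol_obj p k B) j\<^esub> x = r \<odot>\<^bsub>B\<^esub> x"
  "xs \<in> ptuples p (gr B j) \<Longrightarrow> pmu (pol_obj p k B) j xs = lprod B xs"
  by (simp_all add: pol_obj_def gr_component_def lprod_def)

lemma pol_obj_M_object: "M_object p k (pol_obj p k B)"
  unfolding M_object_def
proof (intro allI conjI ballI impI)
  fix j show "Module.module k (pcomp (pol_obj p k B) j)" using component_module by (simp add: pol_obj_def)
next
  fix j xs assume "xs \<in> ptuples p (carrier (pcomp (pol_obj p k B) j))"
  then have xs: "xs \<in> ptuples p (gr B j)" "length xs = p" "set xs \<subseteq> gr B j" "set xs \<subseteq> carrier B"
    using gr_carrier by (auto simp: ptuples_def)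
  have upd: "xs[i := x] \<in> ptuples p (gr B j)" if "x \<in> gr B j" for i x
    using xs that set_update_subset_insert[of xs i x] by (auto simp: ptuples_def)
  have lg: "lprod B ys \<in> gr B (j * p)" if "ys \<in> ptuples p (gr B j)" for ys
    using lprod_gr[of ys j] that by (simp add: ptuples_def)
  show "pmu (pol_obj p k B) j xs \<in> carrier (pcomp (pol_obj p k B) (j * p))"
    using lg xs by simp
  fix i assume i: "i < p"
  note u = lprod_update[OF _ xs(4), of i, unfolded xs(2), OF i]
  {
    fix x y assume "x \<in> carrier (pcomp (pol_obj p k B) j)" "y \<in> carrier (pcomp (pol_obj p k B) j)"
    then have xy: "x \<in> gr B j" "y \<in> gr B j" by auto
    note c = gr_carrier[OF xy(1)] gr_carrier[OF xy(2)] 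
    have "lprod B (xs[i := x \<oplus>\<^bsub>B\<^esub> y]) = lprod B (xs[i := x]) \<oplus>\<^bsub>B\<^esub> lprod B (xs[i := y])"
      using c u(2,3)[OF c(1)] by (simp add: u(1) B.l_distr B.r_distr)
    then show "pmu (pol_obj p k B) j (xs[i := x \<oplus>\<^bsub>pcomp (pol_obj p k B) j\<^esub> y]) =
          pmu (pol_obj p k B) j (xs[i := x]) \<oplus>\<^bsub>pcomp (pol_obj p k B) (j * p)\<^esub> pmu (pol_obj p k B) j (xs[i := y])"
      using xy upd lg gr_add by simp
  }
  fix r x assume r: "r \<in> carrier k" and "x \<in> carrier (pcomp (pol_obj p k B) j)"
  then have x: "x \<in> gr B j" by simp
  note c = gr_carrier[OF x]
  have "lprod B (xs[i := r \<odot>\<^bsub>B\<^esub> x]) = r \<odot>\<^bsub>B\<^esub> lprod B (xs[i := x])"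
    using r c u(2,3)[OF c] by (simp add: u(1) smult_mult)
  then show "pmu (pol_obj p k B) j (xs[i := r \<odot>\<^bsub>pcomp (pol_obj p k B) j\<^esub> x]) = r \<odot>\<^bsub>pcomp (pol_obj p k B) (j * p)\<^esub> pmu (pol_obj p k B) j (xs[i := x])"
    using r x upd lg gr_smult by simp
next
  fix j xs \<sigma> assume "xs \<in> ptuples p (carrier (pcomp (pol_obj p k B) j))" and s: "\<sigma> permutes {..<p}"
  then have xs: "xs \<in> ptuples p (gr B j)" "length xs = p" "set xs \<subseteq> gr B j" by (auto simp: ptuples_def)
  have ps: "permute_list \<sigma> xs \<in> ptuples p (gr B j)" using xs s by (simp add: ptuples_def)
  have "lprod B xs \<in> gr B (j * p)" using lprod_gr[OF xs(3)] xs(2) by simp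
  then have "[(sign \<sigma> ^ (j * j))] \<cdot>\<^bsub>pcomp (pol_obj p k B) (j * p)\<^esub> lprod B xs = [(sign \<sigma> ^ (j * j))] \<cdot>\<^bsub>B\<^esub> lprod B xs"
    using component_int by (simp add: pol_obj_def)
  then show "pmu (pol_obj p k B) j (permute_list \<sigma> xs) = [(sign \<sigma> ^ (j * j))] \<cdot>\<^bsub>pcomp (pol_obj p k B) (j * p)\<^esub> pmu (pol_obj p k B) j xs"
    using koszul_permutes[OF s, of j] xs ps by (simp add: koszul_def)
qed

definition idf :: "nat \<Rightarrow> 'b \<Rightarrow> 'b" where "idf = (\<lambda>j. \<lambda>x\<in>gr B j. x)"

lemma idf_M_hom: "idf \<in> M_hom p k (pol_obj p k B) (pol_obj p k B)"
  unfolding M_hom_def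
proof (intro CollectI allI conjI ballI)
  fix j show "idf j \<in> lin_maps k (pcomp (pol_obj p k B) j) (pcomp (pol_obj p k B) j) \<inter> extensional (carrier (pcomp (pol_obj p k B) j))"
    by (auto simp: idf_def lin_maps_def gr_add gr_smult)
  fix xs assume "xs \<in> ptuples p (carrier (pcomp (pol_obj p k B) j))"
  then have xs: "xs \<in> ptuples p (gr B j)" "length xs = p" "set xs \<subseteq> gr B j" by (auto simp: ptuples_def)
  have "map (idf j) xs = xs" using xs by (intro map_idI) (auto simp: idf_def)
  moreover have "lprod B xs \<in> gr B (j * p)" using lprod_gr[OF xs(3)] xs(2) by simp
  ultimately show "idf (j * p) (pmu (pol_obj p k B) j xs) = pmu (pol_obj p k B) j (map (idf j) xs)"
    using xs by (simp add: idf_def)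
qed

lemma polemb_self: "polemb p k B (pol_obj p k B) idf"
  by (intro polemb.intro polemb_axioms.intro galgebra_axioms pol_obj_M_object idf_M_hom)
     (auto simp: idf_def inj_on_def)

end

section \<open>Independence of the embedding\<close>

lemma mod_on_eqI:
  assumes lin: "(\<lambda>x\<in>C. x) \<in> lin_maps K (mod_on K C z pl sm) (mod_on K C z pl' sm')"
    and M: "Module.module K (mod_on K C z pl sm)"
  shows "mod_on K C z pl sm = mod_on K C z pl' sm'"
proof -
  interpret M: Module.module K "mod_on K C z pl sm" by (rule M)
  have pl: "pl x y \<in> C" if "x \<in> C" "y \<in> C" for x y using M.a_closed[of x y] that by simp
  have sm: "sm r x \<in> C" if "r \<in> carrier K" "x \<in> C" for r x using M.smult_closed[of r x] that by simp
  have "pl x y = pl' x y" if "x \<in> C" "y \<in> C" for x y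
  proof -
    have "\<forall>x\<in>C. \<forall>y\<in>C. (\<lambda>x\<in>C. x) (x \<oplus>\<^bsub>mod_on K C z pl sm\<^esub> y) = (\<lambda>x\<in>C. x) x \<oplus>\<^bsub>mod_on K C z pl' sm'\<^esub> (\<lambda>x\<in>C. x) y"
      using lin by (simp add: lin_maps_def)
    from this[rule_format, OF that] show ?thesis using that pl[OF that] by simp
  qed
  moreover have "sm r x = sm' r x" if "r \<in> carrier K" "x \<in> C" for r x
  proof -
    have "\<forall>r\<in>carrier K. \<forall>x\<in>C. (\<lambda>x\<in>C. x) (r \<odot>\<^bsub>mod_on K C z pl sm\<^esub> x) = r \<odot>\<^bsub>mod_on K C z pl' sm'\<^esub> (\<lambda>x\<in>C. x) x"
      using lin by (simp add: lin_maps_def)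
    from this[rule_format, OF that] show ?thesis using that sm[OF that] by simp
  qed
  ultimately show ?thesis by (auto simp: mod_on_def restrict_def fun_eq_iff)
qed

lemma polhom_same:
  assumes "polemb p k B A f" "polemb p k B' A f'"
  shows "polhom p k B A f B' A f' (\<lambda>j. \<lambda>x\<in>carrier (pcomp A j). x)"
  by (rule polhom.intro[OF assms polhom_axioms.intro[OF polhom.g[OF polemb.polhom_self[OF assms(1)]]]])

context polemb begin

abbreviation idg :: "nat \<Rightarrow> 'a \<Rightarrow> 'a" where "idg \<equiv> \<lambda>j. \<lambda>x\<in>carrier (pcomp A j). x"

lemma Wmor_id: "Wmor p n A idg j = (\<lambda>a\<in>WpolC p n A j. a)"
proof -
  have "(\<lambda>i\<in>{i. enat i \<le> n}. idg (j * p ^ i) (a i)) = a" if a: "a \<in> WpolC p n A j" for a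
  proof
    fix i show "(\<lambda>i\<in>{i. enat i \<le> n}. idg (j * p ^ i) (a i)) i = a i"
      using a pAcar_sub[of "a i" "j * p ^ i"] by (auto simp: WpolC_def PiE_iff extensional_def)
  qed
  then show ?thesis by (auto simp: Wmor_def restrict_def)
qed

lemma slotg_id: "x \<in> slotcar p A j i \<Longrightarrow> slotg p A idg j i x = x"
  using pAcar_sub[of x "j div p ^ i"] by (auto simp: slotcar_def slotg_def split: if_splits)

lemma Cmor_id:
  assumes "\<And>a i. a \<in> C j \<Longrightarrow> a i \<in> slotcar p A j i"
  shows "Cmor p C A idg j = (\<lambda>a\<in>C j. a)"
  using slotg_id[OF assms] by (auto simp: Cmor_def restrict_def)

text \<open>
  Functoriality, applied to the identity of \<open>A\<close> and two embeddings, shows that the Witt vectors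
  of \<open>A\<close> depend on \<open>A\<close> only.
\<close>

lemma Wpol_indep:
  assumes Q: "polemb p k B' A f'"
  shows "Wpol p k n A B f = Wpol p k n A B' f'"
proof -
  interpret H: polhom p k B A f B' A f' idg by (rule polhom_same[OF polemb_axioms Q])
  have "mod_on (witt_ring p k) (WpolC p n A j) (\<lambda>i\<in>{i. enat i \<le> n}. \<zero>\<^bsub>pcomp A (j * p ^ i)\<^esub>) (Wpadd p n A B f j) (Wpsm p n A B f j)
      = mod_on (witt_ring p k) (WpolC p n A j) (\<lambda>i\<in>{i. enat i \<le> n}. \<zero>\<^bsub>pcomp A (j * p ^ i)\<^esub>) (Wpadd p n A B' f' j) (Wpsm p n A B' f' j)" for j
  proof (rule mod_on_eqI)
    have "Wmor p n A idg j \<in> lin_maps (witt_ring p k) (dcomp (Wpol p k n A B f) j) (dcomp (Wpol p k n A B' f') j)"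
      using H.Wmor_hom[of n] by (simp add: dmod_hom_def)
    then show "(\<lambda>a\<in>WpolC p n A j. a) \<in> lin_maps (witt_ring p k)
        (mod_on (witt_ring p k) (WpolC p n A j) (\<lambda>i\<in>{i. enat i \<le> n}. \<zero>\<^bsub>pcomp A (j * p ^ i)\<^esub>) (Wpadd p n A B f j) (Wpsm p n A B f j))
        (mod_on (witt_ring p k) (WpolC p n A j) (\<lambda>i\<in>{i. enat i \<le> n}. \<zero>\<^bsub>pcomp A (j * p ^ i)\<^esub>) (Wpadd p n A B' f' j) (Wpsm p n A B' f' j))"
      unfolding Wmor_id by (simp add: Wpol_def)
    show "Module.module (witt_ring p k) (mod_on (witt_ring p k) (WpolC p n A j) (\<lambda>i\<in>{i. enat i \<le> n}. \<zero>\<^bsub>pcomp A (j * p ^ i)\<^esub>) (Wpadd p n A B f j) (Wpsm p n A B f j))"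
      using Wpol_dieudonne[of n] by (simp add: is_dieudonne_def Wpol_def)
  qed
  then show ?thesis by (simp add: Wpol_def)
qed

lemma CWpol_indep:
  assumes Q: "polemb p k B' A f'" and C: "stable_family C" and C': "polemb.stable_family p k B' A f' C"
  shows "CWpol p k C A B f = CWpol p k C A B' f'"
proof -
  interpret H: polhom p k B A f B' A f' idg by (rule polhom_same[OF polemb_axioms Q])
  have sl: "a i \<in> slotcar p A j i" if "a \<in> C j" for a i j using stable_cov[OF C] that by (auto simp: covset_def)
  have gC: "(\<lambda>i. slotg p A idg j i (a i)) \<in> C j" if "a \<in> C j" for a j
    using slotg_id[OF sl[OF that]] that by simp
  have hom: "Cmor p C A idg \<in> dmod_hom p k (CWpol p k C A B f) (CWpol p k C A B' f')"
    by (rule H.Cmor_hom[OF C C' gC]) (simp_all add: CWpol_def)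
  have D: "is_dieudonne p k (CWpol p k C A B f)" by (rule CWpol_dieudonne[OF C]) (simp_all add: CWpol_def)
  have "mod_on (witt_ring p k) (C j) (slotzero p A j) (cpadd p A B f j) (cpsm p k A B f j)
      = mod_on (witt_ring p k) (C j) (slotzero p A j) (cpadd p A B' f' j) (cpsm p k A B' f' j)" for j
  proof (rule mod_on_eqI)
    have "Cmor p C A idg j \<in> lin_maps (witt_ring p k) (dcomp (CWpol p k C A B f) j) (dcomp (CWpol p k C A B' f') j)"
      using hom by (simp add: dmod_hom_def)
    moreover have "Cmor p C A idg j = (\<lambda>a\<in>C j. a)" by (rule Cmor_id) (rule sl)
    ultimately show "(\<lambda>a\<in>C j. a) \<in> lin_maps (witt_ring p k)
        (mod_on (witt_ring p k) (C j) (slotzero p A j) (cpadd p A B f j) (cpsm p k A B f j))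
        (mod_on (witt_ring p k) (C j) (slotzero p A j) (cpadd p A B' f' j) (cpsm p k A B' f' j))"
      by (simp add: CWpol_def)
    show "Module.module (witt_ring p k) (mod_on (witt_ring p k) (C j) (slotzero p A j) (cpadd p A B f j) (cpsm p k A B f j))"
      using D by (simp add: is_dieudonne_def CWpol_def)
  qed
  then show ?thesis by (simp add: CWpol_def)
qed

end

section \<open>The polar algebra of a graded-commutative algebra\<close>

text \<open>
  Here \<open>y\<close> may leave the ring in variables that do not occur. Truncated Witt vectors are
  undefined outside of their domain, so this is needed to evaluate Witt polynomials at them.
\<close>

lemma (in cring) pev_cong_keys:
  assumes P: "2 \<le> p" "homog (actw p act) (p ^ n) P"
    and x: "\<forall>v. x v \<in> carrier R"
    and inact: "\<And>v. \<not> act v \<Longrightarrow> y v = x v"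
    and hi: "\<And>v. act v \<Longrightarrow> v div 2 \<le> n \<Longrightarrow> y v = x v"
  shows "pev R P y = pev R P x"
  unfolding pev_def
proof (rule finsum_cong')
  fix m assume m: "m \<in> keys P"
  obtain vs where vs: "m = (\<Sum>i\<leftarrow>vs. Poly_Mapping.single i 1)" by (rule monomial_list)
  have "wt (actw p act) m = p ^ n" using m P(2) by (simp add: homog_def)
  then have s: "(\<Sum>v\<leftarrow>vs. actw p act v) = p ^ n" unfolding vs wt_monomial_list .
  have "y v = x v" if "v \<in> keys m" for v
    using inact[of v] hi[of v] actw_bound[OF P(1) s, of v] that unfolding vs keys_monomial_list by blast
  then have "mev R y m = mev R x m" using x by (intro mev_cong) auto
  then show "[lookup P m] \<cdot> mev R y m = [lookup P m] \<cdot> mev R x m" by simp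
qed (use x in auto)

context galgebra begin

abbreviation pB where "pB \<equiv> pol_obj p k B"

interpretation S: polemb p k B "pol_obj p k B" idf by (rule polemb_self)

interpretation SH: polhom p k B "pol_obj p k B" idf B "pol_obj p k B" idf "\<lambda>j. \<lambda>x\<in>carrier (pcomp (pol_obj p k B) j). x"
  by (rule S.polhom_self)

lemma pAcar_pol: "pAcar p pB d = gr R d"
  by (simp add: pAcar_def)

lemma gr_R_sub: "x \<in> gr R d \<Longrightarrow> x \<in> gr B d"
  using gr_zero by (auto split: if_splits)

lemma idf_gr: "x \<in> gr B d \<Longrightarrow> idf d x = x" by (simp add: idf_def)

lemma WpolC_pol: "WpolC p n pB j = W_carrier0 p n R j"
  by (simp only: WpolC_def W_carrier0_def pAcar_pol)

lemma Wlift_pol: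
  assumes "a \<in> WpolC p n pB j" "enat i \<le> n"
  shows "Wlift p n B idf j a i = a i"
  using assms idf_gr[OF gr_R_sub, of "a i" "j * p ^ i"] by (auto simp: Wlift_def WpolC_def pAcar_pol)

lemma Wpadd_pol:
  assumes a: "a \<in> WpolC p n pB j" and b: "b \<in> WpolC p n pB j"
  shows "Wpadd p n pB B idf j a b = (\<lambda>i\<in>{i. enat i \<le> n}. peval R (witt_sum p i) a b)"
proof
  fix i
  show "Wpadd p n pB B idf j a b i = (\<lambda>i\<in>{i. enat i \<le> n}. peval R (witt_sum p i) a b) i"
  proof (cases "enat i \<le> n")
    case True
    have "Wpadd p n pB B idf j a b i = idf (j * p ^ i) (Wpadd p n pB B idf j a b i)"
      using SH.Wpadd_T(1)[OF a b True] idf_gr[OF gr_R_sub] by (simp add: pAcar_pol del: R_simps)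
    also have "\<dots> = wadd p R (Wlift p n B idf j a) (Wlift p n B idf j b) i" by (rule SH.Wpadd_T(2)[OF a b True])
    also have "\<dots> = pev R (witt_sum p i) (ilv a b)"
      unfolding W.wadd_eq_pev
    proof (rule W.R.pev_cong_keys[OF W.p2 W.homog_sum', symmetric])
      show "\<forall>v. ilv (Wlift p n B idf j a) (Wlift p n B idf j b) v \<in> carrier R"
        using SH.lift_R[OF a] SH.lift_R[OF b] by (auto simp: ilv_def)
      fix v :: nat assume "v div 2 \<le> i"
      then have "enat (v div 2) \<le> n" using True order_trans enat_ord_simps(1) by blast
      then show "ilv a b v = ilv (Wlift p n B idf j a) (Wlift p n B idf j b) v"
        using Wlift_pol[OF a] Wlift_pol[OF b] by (simp add: ilv_def)
    qed simp
    finally show ?thesis using True by (simp add: peval_pev)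
  next
    case False
    then show ?thesis by (simp add: Wpadd_def)
  qed
qed

lemma Wpsm_pol:
  assumes l: "l \<in> carrier (witt_ring p k)" and b: "b \<in> WpolC p n pB j"
  shows "Wpsm p n pB B idf j l b = (\<lambda>i\<in>{i. enat i \<le> n}. peval R (witt_prod p i) (\<lambda>s. l s \<odot>\<^bsub>R\<^esub> \<one>\<^bsub>R\<^esub>) b)"
proof
  fix i
  have lk: "l s \<in> carrier k" for s using l by (simp add: witt_ring_simps[OF p])
  have lR: "l s \<odot>\<^bsub>B\<^esub> \<one>\<^bsub>B\<^esub> \<in> carrier R" for s using W.io.hom_closed[OF lk, of s] by (simp add: iota_def)
  show "Wpsm p n pB B idf j l b i = (\<lambda>i\<in>{i. enat i \<le> n}. peval R (witt_prod p i) (\<lambda>s. l s \<odot>\<^bsub>R\<^esub> \<one>\<^bsub>R\<^esub>) b) i"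
  proof (cases "enat i \<le> n")
    case True
    have "Wpsm p n pB B idf j l b i = idf (j * p ^ i) (Wpsm p n pB B idf j l b i)"
      using SH.Wpsm_T(1)[OF l b True] idf_gr[OF gr_R_sub] by (simp add: pAcar_pol del: R_simps)
    also have "\<dots> = wmul p R (\<lambda>s. l s \<odot>\<^bsub>B\<^esub> \<one>\<^bsub>B\<^esub>) (Wlift p n B idf j b) i" by (rule SH.Wpsm_T(2)[OF l b True])
    also have "\<dots> = pev R (witt_prod p i) (ilv (\<lambda>s. l s \<odot>\<^bsub>B\<^esub> \<one>\<^bsub>B\<^esub>) b)"
      unfolding W.wmul_eq_pev
    proof (rule W.R.pev_cong_keys[OF W.p2 W.homog_prod', symmetric])
      show "\<forall>v. ilv (\<lambda>s. l s \<odot>\<^bsub>B\<^esub> \<one>\<^bsub>B\<^esub>) (Wlift p n B idf j b) v \<in> carrier R"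
        using SH.lift_R[OF b] lR by (auto simp: ilv_def)
      fix v :: nat
      show "ilv (\<lambda>s. l s \<odot>\<^bsub>B\<^esub> \<one>\<^bsub>B\<^esub>) b v = ilv (\<lambda>s. l s \<odot>\<^bsub>B\<^esub> \<one>\<^bsub>B\<^esub>) (Wlift p n B idf j b) v" if "\<not> odd v"
        using that by (simp add: ilv_def)
      assume "v div 2 \<le> i"
      then have "enat (v div 2) \<le> n" using True order_trans enat_ord_simps(1) by blast
      then show "ilv (\<lambda>s. l s \<odot>\<^bsub>B\<^esub> \<one>\<^bsub>B\<^esub>) b v = ilv (\<lambda>s. l s \<odot>\<^bsub>B\<^esub> \<one>\<^bsub>B\<^esub>) (Wlift p n B idf j b) v"
        using Wlift_pol[OF b] by (simp add: ilv_def)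
    qed
    finally show ?thesis using True by (simp add: peval_pev)
  next
    case False
    then show ?thesis by (simp add: Wpsm_def)
  qed
qed

lemma pmu_pow_pol: "x \<in> gr B d \<Longrightarrow> pmu pB d (replicate p x) = x [^]\<^bsub>B\<^esub> p"
  using S.lprod_replicate[OF gr_carrier] by (subst pol_obj_simps(5)) (auto simp: ptuples_def)

lemma mod_on_cong:
  assumes "\<And>a b. a \<in> C \<Longrightarrow> b \<in> C \<Longrightarrow> pl a b = pl' a b"
    "\<And>l a. l \<in> carrier K \<Longrightarrow> a \<in> C \<Longrightarrow> sm l a = sm' l a"
  shows "mod_on K C z pl sm = mod_on K C z pl' sm'"
  using assms by (auto simp: mod_on_def restrict_def fun_eq_iff)

text \<open>
  For the identity embedding there is nothing to transport back, and the Witt vectors of the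
  polar algebra of \<open>B\<close> are those of \<open>B\<close>.
\<close>

lemma Wpol_pol: "Wpol p k n pB B idf = W_obj0 p k n R"
proof -
  have "mod_on (witt_ring p k) (WpolC p n pB j) (\<lambda>i\<in>{i. enat i \<le> n}. \<zero>\<^bsub>pcomp pB (j * p ^ i)\<^esub>) (Wpadd p n pB B idf j) (Wpsm p n pB B idf j)
    = mod_on (witt_ring p k) (W_carrier0 p n R j) (\<lambda>i\<in>{i. enat i \<le> n}. \<zero>\<^bsub>R\<^esub>)
       (\<lambda>a b. \<lambda>i\<in>{i. enat i \<le> n}. peval R (witt_sum p i) a b)
       (\<lambda>l a. \<lambda>i\<in>{i. enat i \<le> n}. peval R (witt_prod p i) (\<lambda>s. l s \<odot>\<^bsub>R\<^esub> \<one>\<^bsub>R\<^esub>) a)" for j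
    unfolding WpolC_pol[symmetric] pol_obj_simps(2) R_simps(3) by (rule mod_on_cong[OF Wpadd_pol Wpsm_pol])
  moreover have "(\<lambda>a\<in>WpolC p n pB j. \<lambda>i\<in>{i. enat i \<le> n}. pmu pB (j * p ^ i) (replicate p (a i)))
      = (\<lambda>a\<in>W_carrier0 p n R j. \<lambda>i\<in>{i. enat i \<le> n}. a i [^]\<^bsub>R\<^esub> p)" for j
  proof -
    have "(\<lambda>i\<in>{i. enat i \<le> n}. pmu pB (j * p ^ i) (replicate p (a i))) = (\<lambda>i\<in>{i. enat i \<le> n}. a i [^]\<^bsub>R\<^esub> p)"
      if a: "a \<in> WpolC p n pB j" for a
      using pmu_pow_pol[OF gr_R_sub, of "a _" "j * p ^ _"] a by (auto simp: WpolC_def pAcar_pol fun_eq_iff Pi_iff PiE_iff simp del: R_simps(6))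
    then show ?thesis unfolding WpolC_pol by (auto simp: restrict_def fun_eq_iff)
  qed
  moreover have "(\<lambda>a\<in>WpolC p n pB (p * j). \<lambda>i\<in>{i. enat i \<le> n}. (case i of 0 \<Rightarrow> \<zero>\<^bsub>pcomp pB j\<^esub> | Suc m \<Rightarrow> a m))
      = (\<lambda>a\<in>W_carrier0 p n R (p * j). \<lambda>i\<in>{i. enat i \<le> n}. (case i of 0 \<Rightarrow> \<zero>\<^bsub>R\<^esub> | Suc m \<Rightarrow> a m))" for j
    unfolding WpolC_pol pol_obj_simps(2) R_simps(3) by (rule refl)
  ultimately show ?thesis by (simp only: Wpol_def W_obj0_def)
qed

lemma slotcar_pol: "slotcar p pB j i = CW_entry p R j i"
  by (simp add: slotcar_def CW_entry_def pAcar_pol del: R_simps(6))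

lemma slotzero_pol: "slotzero p pB j = (\<lambda>i. \<zero>\<^bsub>R\<^esub>)"
  by (auto simp: slotzero_def)

lemma slotmap_pol: "x \<in> slotcar p pB j i \<Longrightarrow> slotmap p B idf j i x = x"
  using idf_gr[OF gr_R_sub, of x "j div p ^ i"] by (auto simp: slotcar_def slotmap_def pAcar_pol simp del: R_simps(6) split: if_splits)

lemma clift_pol: "(\<And>i. a i \<in> slotcar p pB j i) \<Longrightarrow> clift p B idf j a = a"
  unfolding clift_def using slotmap_pol by (intro ext) blast

lemma CWpol_pol:
  assumes C: "S.stable_family C"
  shows "CWpol p k C pB B idf = CW_obj0 p k C R"
proof -
  note cov = S.stable_cov[OF C]
  have sl: "a i \<in> slotcar p pB j i" if "a \<in> C j" for a i j using cov that by (auto simp: S.covset_def)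
  have "mod_on (witt_ring p k) (C j) (slotzero p pB j) (cpadd p pB B idf j) (cpsm p k pB B idf j)
    = mod_on (witt_ring p k) (C j) (\<lambda>i. \<zero>\<^bsub>R\<^esub>) (CW_add p R) (CW_smult p k R)" for j
    unfolding slotzero_pol
  proof (rule mod_on_cong)
    fix a b assume a: "a \<in> C j" and b: "b \<in> C j"
    have "cpadd p pB B idf j a b = clift p B idf j (cpadd p pB B idf j a b)"
      using clift_pol[of "cpadd p pB B idf j a b" j] S.cpadd_props(1)[OF cov a b] by simp
    also have "\<dots> = W.cwadd a b"
      using S.cpadd_props(2)[OF cov a b] clift_pol[OF sl[OF a]] clift_pol[OF sl[OF b]] by simp
    finally show "cpadd p pB B idf j a b = CW_add p R a b" by (simp add: CW_add_eq)
  next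
    fix l a assume l: "l \<in> carrier (witt_ring p k)" and a: "a \<in> C j"
    have "cpsm p k pB B idf j l a = clift p B idf j (cpsm p k pB B idf j l a)"
      using clift_pol[of "cpsm p k pB B idf j l a" j] S.cpsm_props(1)[OF cov l a] by simp
    also have "\<dots> = W.cwmul l a"
      using S.cpsm_props(2)[OF cov l a] clift_pol[OF sl[OF a]] by simp
    finally show "cpsm p k pB B idf j l a = CW_smult p k R l a" by (simp add: CW_smult_eq)
  qed
  moreover have "(\<lambda>a\<in>C j. cpF p pB j a) = (\<lambda>a\<in>C j. \<lambda>i. a i [^]\<^bsub>R\<^esub> p)" for j
  proof -
    have "cpF p pB j a i = a i [^]\<^bsub>R\<^esub> p" if "a \<in> C j" for a i
      using S.slot_F[of a j i, OF sl[OF that]] slotmap_pol[of _ j i] slotmap_pol[of _ "p * j" i] sl[OF that, of i] by simp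
    then show ?thesis by (intro restrict_ext ext)
  qed
  ultimately show ?thesis by (simp only: CWpol_def CW_obj0_def)
qed

lemma CWuC_pol: "CWuC p pB = CWu_carrier0 p R"
  by (simp add: CWuC_def CWu_carrier0_def fun_eq_iff slotcar_pol slotzero_pol del: R_simps(6))

lemma slotcar_R: "x \<in> slotcar p pB j i \<Longrightarrow> x \<in> carrier R"
  using S.slotmap_R[of x j i] slotmap_pol[of x j i] by simp

lemma nilslot_pol: "nilslot p pB j i = CW_entry p R j i \<inter> nilradical R"
proof -
  have "x \<in> nilslot p pB j i \<longleftrightarrow> x \<in> CW_entry p R j i \<inter> nilradical R" for x
    using slotmap_pol[of x j i] slotcar_R[of x j i]
    unfolding S.nilslot_iff nilradical_def slotcar_pol[symmetric] by auto
  then show ?thesis by blast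
qed

lemma CWcC_pol: "CWcC p pB = CWc_carrier0 p R"
proof
  fix j
  have fin: "finite {i. a i \<noteq> \<zero>\<^bsub>R\<^esub>}" if j: "j \<noteq> 0" and a: "\<And>i. a i \<in> CW_entry p R j i" for a
  proof -
    have "{i. a i \<noteq> \<zero>\<^bsub>R\<^esub>} \<subseteq> {..<j}"
    proof (intro subsetI, rule ccontr)
      fix i assume "i \<in> {i. a i \<noteq> \<zero>\<^bsub>R\<^esub>}" and "i \<notin> {..<j}"
      then have i: "a i \<noteq> \<zero>\<^bsub>R\<^esub>" "j \<le> i" by auto
      have "\<not> p ^ i dvd j" using dvd_imp_le[of "p ^ i" j] S.power_gt_self[of i] i(2) j by auto
      then show False using a[of i] i(1) by (simp add: CW_entry_def)
    qed
    then show ?thesis by (rule finite_subset) simp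
  qed
  show "CWcC p pB j = CWc_carrier0 p R j"
  proof (cases "j = 0")
    case True
    have "CW_entry p R 0 i = gr R 0" for i by (simp add: CW_entry_def)
    then show ?thesis using True by (simp add: CWcC_def CWc_carrier0_def nilslot_pol)
  next
    case False
    then show ?thesis using fin[OF False] by (auto simp: CWcC_def CWc_carrier0_def CWu_carrier0_def nilslot_pol simp del: R_simps)
  qed
qed

lemma Wmor_pol:
  "Wmor p n pB (\<lambda>j. restrict h (gr B j)) = (\<lambda>j. \<lambda>a\<in>W_carrier0 p n R j. \<lambda>i\<in>{i. enat i \<le> n}. h (a i))"
proof
  fix j
  have "(\<lambda>i\<in>{i. enat i \<le> n}. restrict h (gr B (j * p ^ i)) (a i)) = (\<lambda>i\<in>{i. enat i \<le> n}. h (a i))"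
    if "a \<in> WpolC p n pB j" for a
  proof (rule restrict_ext)
    fix i assume "i \<in> {i. enat i \<le> n}"
    then have "a i \<in> gr B (j * p ^ i)" using that gr_R_sub by (auto simp: WpolC_def pAcar_pol simp del: R_simps(6))
    then show "restrict h (gr B (j * p ^ i)) (a i) = h (a i)" by simp
  qed
  then show "Wmor p n pB (\<lambda>j. restrict h (gr B j)) j = (\<lambda>a\<in>W_carrier0 p n R j. \<lambda>i\<in>{i. enat i \<le> n}. h (a i))"
    unfolding Wmor_def WpolC_pol[symmetric] by (rule restrict_ext)
qed

lemma Cmor_pol:
  assumes sl: "\<And>j a i. a \<in> C j \<Longrightarrow> a i \<in> slotcar p pB j i" and h: "h \<zero>\<^bsub>B\<^esub> = \<zero>\<^bsub>pcomp A' 0\<^esub>"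
  shows "Cmor p C A' (\<lambda>j. restrict h (gr B j)) = (\<lambda>j. \<lambda>a\<in>C j. \<lambda>i. h (a i))"
proof
  fix j
  have "slotg p A' (\<lambda>j. restrict h (gr B j)) j i (a i) = h (a i)" if "a \<in> C j" for a i
    using sl[OF that, of i] gr_R_sub[of "a i" "j div p ^ i"] h
    by (auto simp: slotcar_def slotg_def pAcar_pol simp del: R_simps(6) split: if_splits)
  then show "Cmor p C A' (\<lambda>j. restrict h (gr B j)) j = (\<lambda>a\<in>C j. \<lambda>i. h (a i))"
    unfolding Cmor_def by (intro restrict_ext ext)
qed

end

context polhom begin

lemma Wmor_compose:
  "Wmor p n A (\<lambda>j. compose (carrier (pcomp A j)) (g' j) (g j)) j = compose (WpolC p n A j) (Wmor p n A' g' j) (Wmor p n A g j)"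
proof -
  have "(\<lambda>i\<in>{i. enat i \<le> n}. compose (carrier (pcomp A (j * p ^ i))) (g' (j * p ^ i)) (g (j * p ^ i)) (a i))
      = Wmor p n A' g' j (Wmor p n A g j a)" if a: "a \<in> WpolC p n A j" for a
  proof -
    have "Wmor p n A' g' j (Wmor p n A g j a) = (\<lambda>i\<in>{i. enat i \<le> n}. g' (j * p ^ i) (Wmor p n A g j a i))"
      using Wmor_in[OF a] by (simp add: Wmor_def[of p n A'])
    also have "\<dots> = (\<lambda>i\<in>{i. enat i \<le> n}. compose (carrier (pcomp A (j * p ^ i))) (g' (j * p ^ i)) (g (j * p ^ i)) (a i))"
    proof (rule restrict_ext)
      fix i assume i: "i \<in> {i. enat i \<le> n}"
      then have "a i \<in> carrier (pcomp A (j * p ^ i))" using a P.pAcar_sub by (auto simp: WpolC_def)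
      then show "g' (j * p ^ i) (Wmor p n A g j a i) = compose (carrier (pcomp A (j * p ^ i))) (g' (j * p ^ i)) (g (j * p ^ i)) (a i)"
        using a i by (simp add: Wmor_def compose_def)
    qed
    finally show ?thesis by (rule sym)
  qed
  then show ?thesis by (simp add: Wmor_def[of p n A "\<lambda>j. compose (carrier (pcomp A j)) (g' j) (g j)"] compose_def[of "WpolC p n A j"] cong: restrict_cong)
qed

lemma slotg_compose:
  "x \<in> slotcar p A j i \<Longrightarrow>
    slotg p A'' (\<lambda>j. compose (carrier (pcomp A j)) (g' j) (g j)) j i x = slotg p A'' g' j i (slotg p A' g j i x)"
  using P.pAcar_sub[of x "j div p ^ i"] by (auto simp: slotg_def slotcar_def compose_def)

lemma Cmor_compose:
  assumes "\<And>a i. a \<in> C j \<Longrightarrow> a i \<in> slotcar p A j i" "\<And>a. a \<in> C j \<Longrightarrow> (\<lambda>i. slotg p A' g j i (a i)) \<in> C' j"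
  shows "Cmor p C A'' (\<lambda>j. compose (carrier (pcomp A j)) (g' j) (g j)) j = compose (C j) (Cmor p C' A'' g' j) (Cmor p C A' g j)"
  using assms(2) slotg_compose[OF assms(1)] by (auto simp: Cmor_def compose_def restrict_def fun_eq_iff)

end

section \<open>The functors and their factorization\<close>

text \<open>
  If \<open>F\<close> agrees with the composite of two functors \<open>G\<close> and \<open>P\<close>, it is itself a functor.
\<close>

lemma factors_throughI:
  assumes G: "is_functor D E G" and P: "is_functor C D P"
    and idn: "\<And>x. x \<in> Obj C \<Longrightarrow> Idn C x \<in> Hom C x x"
    and cmp: "\<And>x y z f g. x \<in> Obj C \<Longrightarrow> y \<in> Obj C \<Longrightarrow> z \<in> Obj C \<Longrightarrow> f \<in> Hom C x y \<Longrightarrow> g \<in> Hom C y z \<Longrightarrow> Cmp C x g f \<in> Hom C x z"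
    and obj: "\<And>x. x \<in> Obj C \<Longrightarrow> fobj F x = fobj G (fobj P x)"
    and mor: "\<And>x y f. x \<in> Obj C \<Longrightarrow> y \<in> Obj C \<Longrightarrow> f \<in> Hom C x y \<Longrightarrow> fmor F x y f = fmor G (fobj P x) (fobj P y) (fmor P x y f)"
  shows "factors_through C D E F P"
proof -
  have P1: "fobj P x \<in> Obj D" if "x \<in> Obj C" for x using P that by (simp add: is_functor_def)
  have P2: "fmor P x y f \<in> Hom D (fobj P x) (fobj P y)" if "x \<in> Obj C" "y \<in> Obj C" "f \<in> Hom C x y" for x y f
    using P that by (simp add: is_functor_def)
  have P3: "fmor P x x (Idn C x) = Idn D (fobj P x)" if "x \<in> Obj C" for x using P that by (simp add: is_functor_def)
  have P4: "fmor P x z (Cmp C x g f) = Cmp D (fobj P x) (fmor P y z g) (fmor P x y f)"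
    if "x \<in> Obj C" "y \<in> Obj C" "z \<in> Obj C" "f \<in> Hom C x y" "g \<in> Hom C y z" for x y z f g
    using P that unfolding is_functor_def by blast
  have G1: "fobj G x \<in> Obj E" if "x \<in> Obj D" for x using G that by (simp add: is_functor_def)
  have G2: "fmor G x y f \<in> Hom E (fobj G x) (fobj G y)" if "x \<in> Obj D" "y \<in> Obj D" "f \<in> Hom D x y" for x y f
    using G that by (simp add: is_functor_def)
  have G3: "fmor G x x (Idn D x) = Idn E (fobj G x)" if "x \<in> Obj D" for x using G that by (simp add: is_functor_def)
  have G4: "fmor G x z (Cmp D x g f) = Cmp E (fobj G x) (fmor G y z g) (fmor G x y f)"
    if "x \<in> Obj D" "y \<in> Obj D" "z \<in> Obj D" "f \<in> Hom D x y" "g \<in> Hom D y z" for x y z f g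
    using G that unfolding is_functor_def by blast
  have "is_functor C E F"
    unfolding is_functor_def
  proof (intro conjI ballI)
    fix x assume x: "x \<in> Obj C"
    show "fobj F x \<in> Obj E" using x by (simp add: obj G1 P1)
    show "fmor F x x (Idn C x) = Idn E (fobj F x)" using x by (simp add: obj mor idn P3 G3 P1)
    fix y assume y: "y \<in> Obj C"
    show "fmor F x y f \<in> Hom E (fobj F x) (fobj F y)" if "f \<in> Hom C x y" for f
      using that x y by (simp add: obj mor G2 P1 P2)
    fix z f g assume z: "z \<in> Obj C" and f: "f \<in> Hom C x y" and g: "g \<in> Hom C y z"
    show "fmor F x z (Cmp C x g f) = Cmp E (fobj F x) (fmor F y z g) (fmor F x y f)"
      unfolding mor[OF x z cmp[OF x y z f g]] mor[OF x y f] mor[OF y z g] obj[OF x] P4[OF x y z f g]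
      by (rule G4[OF P1[OF x] P1[OF y] P1[OF z] P2[OF x y f] P2[OF y z g]])
  qed
  then show ?thesis using G P obj mor unfolding factors_through_def by blast
qed

lemma functor_full_subcat_target:
  "is_functor C D F \<Longrightarrow> (\<And>x. x \<in> Obj C \<Longrightarrow> Q (fobj F x)) \<Longrightarrow> is_functor C (full_subcat D Q) F"
  by (simp add: is_functor_def full_subcat_def)

lemma functor_full_subcat_source: "is_functor C D F \<Longrightarrow> is_functor (full_subcat C Q) D F"
  by (simp add: is_functor_def full_subcat_def)

text \<open>
  A chosen embedding of \<open>A\<close>. The constructions do not depend on the choice, but a functor has to
  be given by a definite value on each object.
\<close>

definition pol_emb :: "nat \<Rightarrow> ('k, 'r) ring_scheme \<Rightarrow> ('k, 'a) polar \<Rightarrow> ('k, 'a) galg \<times> (nat \<Rightarrow> 'a \<Rightarrow> 'a)"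
  where "pol_emb p k A = (SOME (B, f). graded_comm_algebra k B \<and> f \<in> M_hom p k A (pol_obj p k B) \<and>
    (\<forall>j. inj_on (f j) (carrier (pcomp A j))))"

locale perfect_field =
  fixes p :: nat and k :: "('k, 'r) ring_scheme"
  assumes p: "prime p" and k: "field k" and kchar: "[p] \<cdot>\<^bsub>k\<^esub> \<one>\<^bsub>k\<^esub> = \<zero>\<^bsub>k\<^esub>"
    and perf: "(\<lambda>x. x [^]\<^bsub>k\<^esub> p) ` carrier k = carrier k"
begin

lemma galgebra: "graded_comm_algebra k B \<Longrightarrow> galgebra p k B"
  using p k kchar perf by (rule galgebra.intro)

abbreviation "eB A \<equiv> fst (pol_emb p k A)"
abbreviation "ef A \<equiv> snd (pol_emb p k A)"

lemma polemb_pol_emb: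
  fixes A :: "('k, 'a) polar"
  assumes A: "is_polar_algebra p k A" shows "polemb p k (eB A) A (ef A)"
proof -
  have "\<exists>x :: ('k, 'a) galg \<times> (nat \<Rightarrow> 'a \<Rightarrow> 'a). case x of (B, f) \<Rightarrow> graded_comm_algebra k B \<and> f \<in> M_hom p k A (pol_obj p k B) \<and>
    (\<forall>j. inj_on (f j) (carrier (pcomp A j)))"
    using A unfolding is_polar_algebra_def by auto
  from someI_ex[OF this] have e: "graded_comm_algebra k (eB A)" "ef A \<in> M_hom p k A (pol_obj p k (eB A))"
    "\<And>j. inj_on (ef A j) (carrier (pcomp A j))" unfolding pol_emb_def[symmetric] by (auto split: prod.splits)
  show ?thesis
    using e A by (intro polemb.intro polemb_axioms.intro galgebra) (auto simp: is_polar_algebra_def)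
qed

lemma polhom_pol_emb:
  "is_polar_algebra p k A \<Longrightarrow> is_polar_algebra p k A' \<Longrightarrow> g \<in> M_hom p k A A' \<Longrightarrow>
    polhom p k (eB A) A (ef A) (eB A') A' (ef A') g"
  by (rule polhom.intro[OF polemb_pol_emb polemb_pol_emb polhom_axioms.intro])

lemma is_polar_pol: "graded_comm_algebra k R \<Longrightarrow> is_polar_algebra p k (pol_obj p k R)"
proof -
  assume R: "graded_comm_algebra k R"
  interpret X: galgebra p k R by (rule galgebra[OF R])
  interpret S: polemb p k R "pol_obj p k R" X.idf by (rule X.polemb_self)
  show ?thesis unfolding is_polar_algebra_def using S.A S.f S.finj R by blast
qed

lemma Alg_homD:
  assumes "f \<in> Hom (Alg k) R S"
  shows "f \<in> ring_hom R S" "f \<in> lin_maps k R S" "f \<in> extensional (carrier R)" "\<And>x. x \<in> gr R j \<Longrightarrow> f x \<in> gr S j"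
  using assms by (auto simp: Alg_def)

lemma Alg_hom_zero:
  assumes "graded_comm_algebra k R" "graded_comm_algebra k S" "f \<in> Hom (Alg k) R S"
  shows "f \<zero>\<^bsub>R\<^esub> = \<zero>\<^bsub>S\<^esub>"
proof -
  interpret X: galgebra p k R by (rule galgebra[OF assms(1)])
  interpret Y: galgebra p k S by (rule galgebra[OF assms(2)])
  show ?thesis using ring_hom_zero[OF Alg_homD(1)[OF assms(3)] X.B.ring_axioms Y.B.ring_axioms] .
qed

lemma pol_mor:
  assumes R: "graded_comm_algebra k R" and S: "graded_comm_algebra k S" and f: "f \<in> Hom (Alg k) R S"
  shows "(\<lambda>j. restrict f (gr R j)) \<in> M_hom p k (pol_obj p k R) (pol_obj p k S)"
proof -
  interpret X: galgebra p k R by (rule galgebra[OF R])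
  interpret Y: galgebra p k S by (rule galgebra[OF S])
  note fD = Alg_homD[OF f]
  have fl: "f (lprod R xs) = lprod S (map f xs)" if "set xs \<subseteq> carrier R" for xs
    using that X.lprod_carrier ring_hom_mult[OF fD(1)] ring_hom_one[OF fD(1)] by (induction xs) auto
  show ?thesis
    unfolding M_hom_def
  proof (intro CollectI allI conjI ballI)
    fix j
    have "f (x \<oplus>\<^bsub>R\<^esub> y) = f x \<oplus>\<^bsub>S\<^esub> f y" if "x \<in> gr R j" "y \<in> gr R j" for x y
      using ring_hom_add[OF fD(1)] X.gr_carrier that by blast
    moreover have "f (r \<odot>\<^bsub>R\<^esub> x) = r \<odot>\<^bsub>S\<^esub> f x" if "r \<in> carrier k" "x \<in> gr R j" for r x
      using fD(2) X.gr_carrier that by (auto simp: lin_maps_def)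
    ultimately show "restrict f (gr R j) \<in> lin_maps k (pcomp (pol_obj p k R) j) (pcomp (pol_obj p k S) j) \<inter>
        extensional (carrier (pcomp (pol_obj p k R) j))"
      using fD(4) X.gr_add X.gr_smult by (auto simp: lin_maps_def)
    fix xs assume "xs \<in> ptuples p (carrier (pcomp (pol_obj p k R) j))"
    then have xs: "xs \<in> ptuples p (gr R j)" "length xs = p" "set xs \<subseteq> gr R j" by (auto simp: ptuples_def)
    have m: "map (restrict f (gr R j)) xs = map f xs" using xs by (intro map_cong) auto
    have "map f xs \<in> ptuples p (gr S j)" using xs fD(4) by (auto simp: ptuples_def)
    moreover have "lprod R xs \<in> gr R (j * p)" using X.lprod_gr[OF xs(3)] xs(2) by simp
    moreover have "f (lprod R xs) = lprod S (map f xs)" using xs X.gr_carrier by (intro fl) blast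
    ultimately show "restrict f (gr R (j * p)) (pmu (pol_obj p k R) j xs) = pmu (pol_obj p k S) j (map (restrict f (gr R j)) xs)"
      unfolding m using xs by simp
  qed
qed

lemma Alg_idn: "Idn (Alg k) R \<in> Hom (Alg k) R R" if "R \<in> Obj (Alg k)"
proof -
  interpret X: galgebra p k R using galgebra that by (simp add: Alg_def)
  show ?thesis using X.gr_carrier by (auto simp: Alg_def ring_hom_def lin_maps_def)
qed

lemma Alg_cmp:
  assumes "f \<in> Hom (Alg k) R S" "g \<in> Hom (Alg k) S T" "R \<in> Obj (Alg k)"
  shows "Cmp (Alg k) R g f \<in> Hom (Alg k) R T"
proof -
  interpret X: galgebra p k R using galgebra assms(3) by (simp add: Alg_def)
  note fD = Alg_homD[OF assms(1)] and gD = Alg_homD[OF assms(2)]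
  have c: "f x \<in> carrier S" if "x \<in> carrier R" for x using ring_hom_closed[OF fD(1) that] .
  have "compose (carrier R) g f \<in> ring_hom R T"
  proof (rule ring_hom_memI)
    fix x y assume xy: "x \<in> carrier R" "y \<in> carrier R"
    show "compose (carrier R) g f x \<in> carrier T" using c xy ring_hom_closed[OF gD(1)] by (simp add: compose_def)
    show "compose (carrier R) g f (x \<otimes>\<^bsub>R\<^esub> y) = compose (carrier R) g f x \<otimes>\<^bsub>T\<^esub> compose (carrier R) g f y"
      using c xy by (simp add: compose_def ring_hom_mult[OF fD(1)] ring_hom_mult[OF gD(1)])
    show "compose (carrier R) g f (x \<oplus>\<^bsub>R\<^esub> y) = compose (carrier R) g f x \<oplus>\<^bsub>T\<^esub> compose (carrier R) g f y"
      using c xy by (simp add: compose_def ring_hom_add[OF fD(1)] ring_hom_add[OF gD(1)])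
  qed (simp add: compose_def ring_hom_one[OF fD(1)] ring_hom_one[OF gD(1)])
  moreover have "compose (carrier R) g f \<in> lin_maps k R T"
  proof -
    have s: "f (r \<odot>\<^bsub>R\<^esub> x) = r \<odot>\<^bsub>S\<^esub> f x" if "r \<in> carrier k" "x \<in> carrier R" for r x
      using fD(2) that by (auto simp: lin_maps_def)
    have s': "g (r \<odot>\<^bsub>S\<^esub> x) = r \<odot>\<^bsub>T\<^esub> g x" if "r \<in> carrier k" "x \<in> carrier S" for r x
      using gD(2) that by (auto simp: lin_maps_def)
    show ?thesis using c ring_hom_closed[OF gD(1)]
      by (auto simp: lin_maps_def compose_def s s' ring_hom_add[OF fD(1)] ring_hom_add[OF gD(1)])
  qed
  ultimately show ?thesis using fD(4) gD(4) X.gr_carrier by (auto simp: Alg_def compose_def)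
qed

lemma pol_is_functor: "is_functor (Alg k) (Pol p k) (pol_functor p k)"
  unfolding is_functor_def
proof (intro conjI ballI)
  fix R :: "('k, 'a) galg" assume R': "R \<in> Obj (Alg k)"
  then have R: "graded_comm_algebra k R" by (simp add: Alg_def)
  interpret X: galgebra p k R by (rule galgebra[OF R])
  show "fobj (pol_functor p k) R \<in> Obj (Pol p k)"
    using is_polar_pol[OF R] by (simp add: pol_functor_def Pol_def)
  show "fmor (pol_functor p k) R R (Idn (Alg k) R) = Idn (Pol p k) (fobj (pol_functor p k) R)"
    using X.gr_carrier by (auto simp: pol_functor_def Pol_def Alg_def restrict_def fun_eq_iff)
  fix S f assume "S \<in> Obj (Alg k)" and f: "f \<in> Hom (Alg k) R S"
  then have S: "graded_comm_algebra k S" by (simp add: Alg_def)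
  show "fmor (pol_functor p k) R S f \<in> Hom (Pol p k) (fobj (pol_functor p k) R) (fobj (pol_functor p k) S)"
    using pol_mor[OF R S f] by (simp add: pol_functor_def Pol_def)
  fix T g
  show "fmor (pol_functor p k) R T (Cmp (Alg k) R g f) =
     Cmp (Pol p k) (fobj (pol_functor p k) R) (fmor (pol_functor p k) S T g) (fmor (pol_functor p k) R S f)"
    using X.gr_carrier Alg_homD(4)[OF f]
    by (auto simp: pol_functor_def Pol_def Alg_def compose_def restrict_def fun_eq_iff)
qed

lemma pol_fin_is_functor: "is_functor (alg_fin k) (pol_fin p k) (pol_functor p k)"
  unfolding alg_fin_def pol_fin_def
proof (rule functor_full_subcat_target[OF functor_full_subcat_source[OF pol_is_functor]])
  fix R assume "R \<in> Obj (full_subcat (Alg k) (\<lambda>R. gr_finite_length k (gr_component k R)))"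
  then show "gr_finite_length k (pcomp (fobj (pol_functor p k) R))"
    by (simp add: full_subcat_def pol_functor_def pol_obj_def)
qed

definition W_on_pol :: "enat \<Rightarrow> (('k, 'a) polar, nat \<Rightarrow> 'a \<Rightarrow> 'a, ('k, nat \<Rightarrow> 'a) dmod, nat \<Rightarrow> (nat \<Rightarrow> 'a) \<Rightarrow> nat \<Rightarrow> 'a) ftor"
  where "W_on_pol n = \<lparr>fobj = (\<lambda>A. Wpol p k n A (eB A) (ef A)), fmor = (\<lambda>A A' g. Wmor p n A g)\<rparr>"

definition CWu_on_pol :: "(('k, 'a) polar, nat \<Rightarrow> 'a \<Rightarrow> 'a, ('k, nat \<Rightarrow> 'a) dmod, nat \<Rightarrow> (nat \<Rightarrow> 'a) \<Rightarrow> nat \<Rightarrow> 'a) ftor"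
  where "CWu_on_pol = \<lparr>fobj = (\<lambda>A. CWpol p k (CWuC p A) A (eB A) (ef A)), fmor = (\<lambda>A A' g. Cmor p (CWuC p A) A' g)\<rparr>"

definition CWc_on_pol :: "(('k, 'a) polar, nat \<Rightarrow> 'a \<Rightarrow> 'a, ('k, nat \<Rightarrow> 'a) tdmod, nat \<Rightarrow> (nat \<Rightarrow> 'a) \<Rightarrow> nat \<Rightarrow> 'a) ftor"
  where "CWc_on_pol = \<lparr>fobj = (\<lambda>A. CWcpol p k A (eB A) (ef A)), fmor = (\<lambda>A A' g. Cmor p (CWcC p A) A' g)\<rparr>"

lemma W_on_pol_functor: "is_functor (Pol p k) (Dmod p k) (W_on_pol n)"
  unfolding is_functor_def
proof (intro conjI ballI)
  fix A :: "('k, 'a) polar" assume "A \<in> Obj (Pol p k)"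
  then have A: "is_polar_algebra p k A" by (simp add: Pol_def)
  interpret X: polemb p k "eB A" A "ef A" by (rule polemb_pol_emb[OF A])
  show "fobj (W_on_pol n) A \<in> Obj (Dmod p k)" using X.Wpol_dieudonne[of n] by (simp add: W_on_pol_def Dmod_def)
  show "fmor (W_on_pol n) A A (Idn (Pol p k) A) = Idn (Dmod p k) (fobj (W_on_pol n) A)"
    using X.Wmor_id[of n] by (simp add: W_on_pol_def Pol_def Dmod_def Wpol_def fun_eq_iff)
  fix A' :: "('k, 'a) polar" and g assume "A' \<in> Obj (Pol p k)" and "g \<in> Hom (Pol p k) A A'"
  then have A': "is_polar_algebra p k A'" and g: "g \<in> M_hom p k A A'" by (simp_all add: Pol_def)
  interpret H: polhom p k "eB A" A "ef A" "eB A'" A' "ef A'" g by (rule polhom_pol_emb[OF A A' g])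
  show "fmor (W_on_pol n) A A' g \<in> Hom (Dmod p k) (fobj (W_on_pol n) A) (fobj (W_on_pol n) A')"
    using H.Wmor_hom[of n] by (simp add: W_on_pol_def Dmod_def)
  fix A'' :: "('k, 'a) polar" and g'
  show "fmor (W_on_pol n) A A'' (Cmp (Pol p k) A g' g) =
     Cmp (Dmod p k) (fobj (W_on_pol n) A) (fmor (W_on_pol n) A' A'' g') (fmor (W_on_pol n) A A' g)"
    using H.Wmor_compose[of n g'] by (simp add: W_on_pol_def Pol_def Dmod_def Wpol_def fun_eq_iff)
qed

lemma W_on_pol_functor_u: "is_functor (Pol p k) (Dmod_u p k) (W_on_pol (enat n))"
  unfolding Dmod_u_def
proof (rule functor_full_subcat_target[OF W_on_pol_functor])
  fix A :: "('k, 'a) polar" assume "A \<in> Obj (Pol p k)"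
  then have A: "is_polar_algebra p k A" by (simp add: Pol_def)
  interpret X: polemb p k "eB A" A "ef A" by (rule polemb_pol_emb[OF A])
  show "unipotent p (fobj (W_on_pol (enat n)) A)" using X.unipotent_Wpol by (simp add: W_on_pol_def)
qed

lemma CWu_on_pol_functor: "is_functor (Pol p k) (Dmod_u p k) CWu_on_pol"
  unfolding is_functor_def
proof (intro conjI ballI)
  fix A :: "('k, 'a) polar" assume "A \<in> Obj (Pol p k)"
  then have A: "is_polar_algebra p k A" by (simp add: Pol_def)
  interpret X: polemb p k "eB A" A "ef A" by (rule polemb_pol_emb[OF A])
  have sl: "a i \<in> slotcar p A j i" if "a \<in> CWuC p A j" for a i j using that by (simp add: CWuC_def)
  have "is_dieudonne p k (CWpol p k (CWuC p A) A (eB A) (ef A))"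
    by (rule X.CWpol_dieudonne[OF X.stable_CWuC]) (simp_all add: CWpol_def)
  then show "fobj CWu_on_pol A \<in> Obj (Dmod_u p k)"
    using X.unipotent_CWpol by (simp add: CWu_on_pol_def Dmod_u_def full_subcat_def Dmod_def)
  have "Cmor p (CWuC p A) A (\<lambda>j. \<lambda>x\<in>carrier (pcomp A j). x) j = (\<lambda>a\<in>CWuC p A j. a)" for j by (rule X.Cmor_id) (rule sl)
  then show "fmor CWu_on_pol A A (Idn (Pol p k) A) = Idn (Dmod_u p k) (fobj CWu_on_pol A)"
    by (simp add: CWu_on_pol_def Pol_def Dmod_u_def full_subcat_def Dmod_def CWpol_def fun_eq_iff)
  fix A' :: "('k, 'a) polar" and g assume "A' \<in> Obj (Pol p k)" and "g \<in> Hom (Pol p k) A A'"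
  then have A': "is_polar_algebra p k A'" and g: "g \<in> M_hom p k A A'" by (simp_all add: Pol_def)
  interpret H: polhom p k "eB A" A "ef A" "eB A'" A' "ef A'" g by (rule polhom_pol_emb[OF A A' g])
  show "fmor CWu_on_pol A A' g \<in> Hom (Dmod_u p k) (fobj CWu_on_pol A) (fobj CWu_on_pol A')"
    using H.Cmor_u_hom by (simp add: CWu_on_pol_def Dmod_u_def full_subcat_def Dmod_def)
  fix A'' :: "('k, 'a) polar" and g'
  have "Cmor p (CWuC p A) A'' (\<lambda>j. compose (carrier (pcomp A j)) (g' j) (g j)) j = compose (CWuC p A j) (Cmor p (CWuC p A') A'' g' j) (Cmor p (CWuC p A) A' g j)" for j
    by (rule H.Cmor_compose) (erule sl, erule H.slotg_CWuC)
  then show "fmor CWu_on_pol A A'' (Cmp (Pol p k) A g' g) =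
     Cmp (Dmod_u p k) (fobj CWu_on_pol A) (fmor CWu_on_pol A' A'' g') (fmor CWu_on_pol A A' g)"
    by (simp add: CWu_on_pol_def Pol_def Dmod_u_def full_subcat_def Dmod_def CWpol_def fun_eq_iff)
qed

lemma CWc_on_pol_functor: "is_functor (pol_fin p k) (Dmod_c p k) CWc_on_pol"
  unfolding is_functor_def
proof (intro conjI ballI)
  fix A :: "('k, 'a) polar" assume "A \<in> Obj (pol_fin p k)"
  then have A: "is_polar_algebra p k A" and fA: "gr_finite_length k (pcomp A)" by (simp_all add: Pol_def pol_fin_def full_subcat_def)
  interpret X: polemb_fin p k "eB A" A "ef A" by (rule polemb_fin.intro[OF polemb_pol_emb[OF A] polemb_fin_axioms.intro[OF fA]])
  have sl: "a i \<in> slotcar p A j i" if "a \<in> CWcC p A j" for a i j using that by (simp add: CWcC_def nilslot_def)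
  show "fobj CWc_on_pol A \<in> Obj (Dmod_c p k)"
    using X.CWcpol_connected by (simp add: CWc_on_pol_def Dmod_c_def)
  have "Cmor p (CWcC p A) A (\<lambda>j. \<lambda>x\<in>carrier (pcomp A j). x) j = (\<lambda>a\<in>CWcC p A j. a)" for j by (rule X.Cmor_id) (rule sl)
  then show "fmor CWc_on_pol A A (Idn (pol_fin p k) A) = Idn (Dmod_c p k) (fobj CWc_on_pol A)"
    by (simp add: CWc_on_pol_def pol_fin_def Pol_def Dmod_c_def full_subcat_def fun_eq_iff)
  fix A' :: "('k, 'a) polar" and g assume "A' \<in> Obj (pol_fin p k)" and "g \<in> Hom (pol_fin p k) A A'"
  then have A': "is_polar_algebra p k A'" and fA': "gr_finite_length k (pcomp A')" and g: "g \<in> M_hom p k A A'"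
    by (simp_all add: Pol_def pol_fin_def full_subcat_def)
  interpret H: polhom p k "eB A" A "ef A" "eB A'" A' "ef A'" g by (rule polhom_pol_emb[OF A A' g])
  show "fmor CWc_on_pol A A' g \<in> Hom (Dmod_c p k) (fobj CWc_on_pol A) (fobj CWc_on_pol A')"
    using H.Cmor_c_hom[OF fA fA'] H.Cmor_c_continuous by (simp add: CWc_on_pol_def Dmod_c_def del: CWcpol_simps)
  fix A'' :: "('k, 'a) polar" and g'
  have "Cmor p (CWcC p A) A'' (\<lambda>j. compose (carrier (pcomp A j)) (g' j) (g j)) j = compose (CWcC p A j) (Cmor p (CWcC p A') A'' g' j) (Cmor p (CWcC p A) A' g j)" for j
    by (rule H.Cmor_compose) (erule sl, erule H.slotg_CWcC)
  then show "fmor CWc_on_pol A A'' (Cmp (pol_fin p k) A g' g) =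
     Cmp (Dmod_c p k) (fobj CWc_on_pol A) (fmor CWc_on_pol A' A'' g') (fmor CWc_on_pol A A' g)"
    by (simp add: CWc_on_pol_def pol_fin_def Pol_def Dmod_c_def full_subcat_def fun_eq_iff)
qed

lemma W_obj_eq:
  assumes R: "R \<in> Obj (Alg k)"
  shows "fobj (W_functor p k n) R = fobj (W_on_pol n) (fobj (pol_functor p k) R)"
proof -
  have R: "graded_comm_algebra k R" using assms by (simp add: Alg_def)
  interpret X: galgebra p k R by (rule galgebra[OF R])
  show ?thesis
    using polemb.Wpol_indep[OF X.polemb_self polemb_pol_emb[OF is_polar_pol[OF R]], of n] X.Wpol_pol[of n]
    by (simp add: W_functor_def W_on_pol_def pol_functor_def)
qed

lemma W_mor_eq:
  assumes R: "R \<in> Obj (Alg k)"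
  shows "fmor (W_functor p k n) R S f = fmor (W_on_pol n) (fobj (pol_functor p k) R) (fobj (pol_functor p k) S) (fmor (pol_functor p k) R S f)"
proof -
  interpret X: galgebra p k R using R galgebra by (simp add: Alg_def)
  show ?thesis using X.Wmor_pol[of n f] by (simp add: W_functor_def W_on_pol_def pol_functor_def)
qed

lemma CWu_obj_eq:
  assumes R: "R \<in> Obj (Alg k)"
  shows "fobj (CWu_functor p k) R = fobj CWu_on_pol (fobj (pol_functor p k) R)"
proof -
  have R: "graded_comm_algebra k R" using assms by (simp add: Alg_def)
  interpret X: galgebra p k R by (rule galgebra[OF R])
  note S = X.polemb_self and E = polemb_pol_emb[OF is_polar_pol[OF R]]
  have "CW_obj0 p k (CWuC p X.pB) X.R = CWpol p k (CWuC p X.pB) X.pB (eB X.pB) (ef X.pB)"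
    using X.CWpol_pol[OF polemb.stable_CWuC[OF S]] polemb.CWpol_indep[OF S E polemb.stable_CWuC[OF S] polemb.stable_CWuC[OF E]] by simp
  then show ?thesis
    by (simp add: CWu_functor_def CWu_on_pol_def pol_functor_def X.CWuC_pol)
qed

lemma CWu_mor_eq:
  assumes R: "R \<in> Obj (Alg k)" and S: "S \<in> Obj (Alg k)" and f: "f \<in> Hom (Alg k) R S"
  shows "fmor (CWu_functor p k) R S f = fmor CWu_on_pol (fobj (pol_functor p k) R) (fobj (pol_functor p k) S) (fmor (pol_functor p k) R S f)"
proof -
  have RS: "graded_comm_algebra k R" "graded_comm_algebra k S" using R S by (simp_all add: Alg_def)
  interpret X: galgebra p k R by (rule galgebra[OF RS(1)])
  interpret Y: galgebra p k S by (rule galgebra[OF RS(2)])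
  have "Cmor p (CWuC p X.pB) Y.pB (\<lambda>j. restrict f (gr R j)) = (\<lambda>j. \<lambda>a\<in>CWuC p X.pB j. \<lambda>i. f (a i))"
    by (rule X.Cmor_pol) (auto simp: CWuC_def Alg_hom_zero[OF RS f])
  then show ?thesis by (simp add: CWu_functor_def CWu_on_pol_def pol_functor_def X.CWuC_pol)
qed

lemma CWc_obj_eq:
  assumes "R \<in> Obj (alg_fin k)"
  shows "fobj (CWc_functor p k) R = fobj CWc_on_pol (fobj (pol_functor p k) R)"
proof -
  have R: "graded_comm_algebra k R" and fin: "gr_finite_length k (pcomp (pol_obj p k R))"
    using assms by (simp_all add: Alg_def alg_fin_def full_subcat_def pol_obj_def)
  interpret X: galgebra p k R by (rule galgebra[OF R])
  note S = X.polemb_self and E = polemb_pol_emb[OF is_polar_pol[OF R]]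
  note SF = polemb_fin.stable_CWcC[OF polemb_fin.intro[OF S polemb_fin_axioms.intro[OF fin]]]
    and EF = polemb_fin.stable_CWcC[OF polemb_fin.intro[OF E polemb_fin_axioms.intro[OF fin]]]
  have o: "CWpol p k (CWcC p X.pB) X.pB (eB X.pB) (ef X.pB) = CW_obj0 p k (CWc_carrier0 p X.R) X.R"
    using X.CWpol_pol[OF SF] polemb.CWpol_indep[OF S E SF EF] unfolding X.CWcC_pol by simp
  have t: "(\<lambda>j. product_topology (\<lambda>i. discrete_topology (nilslot p X.pB j i)) UNIV) = CWc_top0 p X.R"
    by (simp only: CWc_top0_def[abs_def] X.nilslot_pol)
  show ?thesis
    using o t by (simp add: CWc_functor_def CWc_on_pol_def pol_functor_def CWcpol_def)
qed

lemma CWc_mor_eq: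
  assumes R: "R \<in> Obj (alg_fin k)" and S: "S \<in> Obj (alg_fin k)" and f: "f \<in> Hom (alg_fin k) R S"
  shows "fmor (CWc_functor p k) R S f = fmor CWc_on_pol (fobj (pol_functor p k) R) (fobj (pol_functor p k) S) (fmor (pol_functor p k) R S f)"
proof -
  have RS: "graded_comm_algebra k R" "graded_comm_algebra k S" using R S by (simp_all add: Alg_def alg_fin_def full_subcat_def)
  have f': "f \<in> Hom (Alg k) R S" using f by (simp add: alg_fin_def full_subcat_def)
  interpret X: galgebra p k R by (rule galgebra[OF RS(1)])
  interpret Y: galgebra p k S by (rule galgebra[OF RS(2)])
  have "Cmor p (CWcC p X.pB) Y.pB (\<lambda>j. restrict f (gr R j)) = (\<lambda>j. \<lambda>a\<in>CWcC p X.pB j. \<lambda>i. f (a i))"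
    by (rule X.Cmor_pol) (auto simp: CWcC_def nilslot_def Alg_hom_zero[OF RS f'])
  then show ?thesis by (simp add: CWc_functor_def CWc_on_pol_def pol_functor_def X.CWcC_pol)
qed

lemma alg_fin_sub: "Obj (alg_fin k) \<subseteq> Obj (Alg k)" "Hom (alg_fin k) = Hom (Alg k)"
  "Idn (alg_fin k) = Idn (Alg k)" "Cmp (alg_fin k) = Cmp (Alg k)"
  by (auto simp: alg_fin_def full_subcat_def)

end

theorem lemma1p5:
  fixes p :: nat and k :: "'k ring"
  assumes "prime p"
    and "field k"
    and "[p] \<cdot>\<^bsub>k\<^esub> \<one>\<^bsub>k\<^esub> = \<zero>\<^bsub>k\<^esub>"
    and "(\<lambda>x. x [^]\<^bsub>k\<^esub> p) ` carrier k = carrier k"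
  shows "(\<forall>n::nat. factors_through
            (Alg k :: (('k, 'a) galg, 'a \<Rightarrow> 'a) cat) (Pol p k) (Dmod_u p k)
            (W_functor p k (enat n)) (pol_functor p k))
    \<and> factors_through
            (Alg k :: (('k, 'a) galg, 'a \<Rightarrow> 'a) cat) (Pol p k) (Dmod p k)
            (W_functor p k \<infinity>) (pol_functor p k)
    \<and> factors_through
            (Alg k :: (('k, 'a) galg, 'a \<Rightarrow> 'a) cat) (Pol p k) (Dmod_u p k)
            (CWu_functor p k) (pol_functor p k)
    \<and> factors_through
            (alg_fin k :: (('k, 'a) galg, 'a \<Rightarrow> 'a) cat) (pol_fin p k) (Dmod_c p k)
            (CWc_functor p k) (pol_functor p k)"
proof -
  interpret perfect_field p k by (rule perfect_field.intro[OF assms])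
  show ?thesis
  proof (intro conjI allI)
    show "factors_through (Alg k :: (('k, 'a) galg, 'a \<Rightarrow> 'a) cat) (Pol p k) (Dmod_u p k) (W_functor p k (enat n)) (pol_functor p k)" for n
      by (rule factors_throughI[OF W_on_pol_functor_u pol_is_functor Alg_idn Alg_cmp W_obj_eq W_mor_eq])
    show "factors_through (Alg k :: (('k, 'a) galg, 'a \<Rightarrow> 'a) cat) (Pol p k) (Dmod p k) (W_functor p k \<infinity>) (pol_functor p k)"
      by (rule factors_throughI[OF W_on_pol_functor pol_is_functor Alg_idn Alg_cmp W_obj_eq W_mor_eq])
    show "factors_through (Alg k :: (('k, 'a) galg, 'a \<Rightarrow> 'a) cat) (Pol p k) (Dmod_u p k) (CWu_functor p k) (pol_functor p k)"
      by (rule factors_throughI[OF CWu_on_pol_functor pol_is_functor Alg_idn Alg_cmp CWu_obj_eq CWu_mor_eq])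
    show "factors_through (alg_fin k :: (('k, 'a) galg, 'a \<Rightarrow> 'a) cat) (pol_fin p k) (Dmod_c p k) (CWc_functor p k) (pol_functor p k)"
    proof (rule factors_throughI[OF CWc_on_pol_functor pol_fin_is_functor _ _ CWc_obj_eq CWc_mor_eq])
      fix x :: "('k, 'a) galg" assume x: "x \<in> Obj (alg_fin k)"
      show "Idn (alg_fin k) x \<in> Hom (alg_fin k) x x"
        using Alg_idn[OF subsetD[OF alg_fin_sub(1) x]] by (simp add: alg_fin_sub(2-4))
      fix y z :: "('k, 'a) galg" and f g assume "f \<in> Hom (alg_fin k) x y" "g \<in> Hom (alg_fin k) y z"
      then show "Cmp (alg_fin k) x g f \<in> Hom (alg_fin k) x z"
        using Alg_cmp[of f x y g z] subsetD[OF alg_fin_sub(1) x] by (simp add: alg_fin_sub(2-4))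
    qed
  qed
qed

end
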